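(* Let $s\in(\frac12,1)\cup(1,\frac32)$ and $\lambda>0$. Set $$\omega(s):=\frac{s^2\sin(\frac\pi s)}{s-1},\qquad\theta_s:=\begin{cases}0&\text{if }s<1\\1&\text{if }s>1.\end{cases}$$ (i) The self-adjoint extensions in $L^2(\mathbb{R})$ of the operator $\mathring{\mathsf{k}}^{(s/2)}$ form the family $(\mathsf{k}^{(s/2)}_\tau)_{\tau\in\mathbb{R}\cup\{\infty\}}$, where $\mathsf{k}^{(s/2)}_\infty=\mathsf{k}^{(s/2)}_F$ is its Friedrichs extension, and all other extensions ($\tau\in\mathbb{R}$) are given by $$\mathcal{D}(\mathsf{k}^{(s/2)}_\tau):=\Big\{g=F^\lambda+\Big(\frac{\omega(s)\lambda^{2-\frac1s}}{\tau}-\frac{\theta_s}{\mathsf{G}_{s,\lambda}(0)}\Big)F^\lambda(0)\,\mathsf{G}_{s,\lambda}\,\Big|\,F^\lambda\in H^s(\mathbb{R})\Big\},$$ $$\big(\mathsf{k}^{(s/2)}_\tau+\lambda\mathbf{1}\big)g:=((-\Delta)^{\frac s2}+\lambda)F^\lambda,$$ where for $\tau=0$ the domain is to be read as $\{F^\lambda+c\,\mathsf{G}_{s,\lambda}\mid F^\lambda\in H^s(\mathbb{R}),\ F^\lambda(0)=0,\ c\in\mathbb{C}\}$. (ii) Each extension is semi-bounded from below and $$\inf\sigma(\mathsf{k}^{(s/2)}_\tau+\lambda\mathbf{1})\geqslant0\ \Leftrightarrow\ \tau\geqslant0,\qquad\inf\sigma(\mathsf{k}^{(s/2)}_\tau+\lambda\mathbf{1})>0\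 \Leftrightarrow\ \tau>0,$$ $$(\mathsf{k}^{(s/2)}_\tau+\lambda\mathbf{1})\text{ is invertible}\ \Leftrightarrow\ \tau\neq0.$$ (iii) For each $\tau\in\mathbb{R}$ the quadratic form of the extension $\mathsf{k}^{(s/2)}_\tau$ is given by $$\mathcal{D}[\mathsf{k}^{(s/2)}_\tau]=\begin{cases}H^{s/2}(\mathbb{R})\dotplus\mathrm{span}\{\mathsf{G}_{s,\lambda}\}&\text{if }s\in(\frac12,1)\\ H^{s/2}_0(\mathbb{R}\setminus\{0\})\dotplus\mathrm{span}\{\mathsf{G}_{s,\lambda}\}&\text{if }s\in(1,\frac32)\end{cases}$$ $$\mathsf{k}^{(s/2)}_\tau[F^\lambda+\kappa_\lambda\mathsf{G}_{s,\lambda}]=\||\nabla|^{\frac s2}F^\lambda\|_{L^2}^2-\lambda\|F^\lambda+\kappa_\lambda\mathsf{G}_{s,\lambda}\|_{L^2}^2+\lambda\|F^\lambda\|_{L^2}^2+\frac{\tau}{\omega(s)\lambda^{2-\frac1s}}|\kappa_\lambda|^2$$ for any $F^\lambda\in\mathcal{D}[\mathsf{k}^{(s/2)}_F]$ and $\kappa_\lambda\in\mathbb{C}$. (iv) For $\tau\neq0$ one has the resolvent identity $$(\mathsf{k}^{(s/2)}_\tau+\lambda\mathbf{1})^{-1}=((-\Delta)^{s/2}+\lambda\mathbf{1})^{-1}+\Big(\frac{\omega(s)\lambda^{2-\frac1s}}{\tau}-\frac{\theta_s}{\mathsf{G}_{s,\lambda}(0)}\Big)|\mathsf{G}_{s,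\lambda}\rangle\langle\mathsf{G}_{s,\lambda}|.$$
   Context: Dimension $d=1$. Fourier transform: $\widehat f(p)=(2\pi)^{-1/2}\int_{\mathbb{R}}e^{-ipx}f(x)\,dx$, with inverse ${}^\vee$. $(-\Delta)^{s/2}$ is the Fourier multiplier by $|p|^s$ and $|\nabla|^{a}$ the Fourier multiplier by $|p|^a$. Scalar products are antilinear in the first entry; $|\mathsf{G}\rangle\langle\mathsf{G}|$ is the operator $h\mapsto\langle\mathsf{G},h\rangle_{L^2}\mathsf{G}$. For $\lambda>0$, $\mathsf{G}_{s,\lambda}(x):=(2\pi)^{-1/2}\big(\frac{1}{|p|^s+\lambda}\big)^\vee(x)$; it is continuous for $s>1$ and singular at $x=0$ for $s<1$. The term $\theta_s/\mathsf{G}_{s,\lambda}(0)$ is understood as $0$ when $s<1$. $\mathring{\mathsf{k}}^{(s/2)}:=\overline{(-\Delta)^{s/2}\upharpoonright C_0^\infty(\mathbb{R}\setminus\{0\})}$ (operator closure in $L^2(\mathbb{R})$). For $r\geqslant0$, $H^r_0(\mathbb{R}\setminus\{0\})$ is the closure of $C_0^\infty(\mathbb{R}\setminus\{0\})$ in the $H^r(\mathbb{R})$-norm. The Friedrichs extension $\mathsf{k}^{(s/2)}_F$ of $\mathring{\mathsf{k}}^{(s/2)}$ has form domain $\mathcal{D}[\mathsf{k}^{(s/2)}_F]=H^{s/2}(\mathbb{R})$ if $s\in(\frac12,1)$ and $H^{s/2}_0(\mathbb{R}\setminus\{0\})$ if $s\in(1,\frac32)$, with form $\langle|\nabla|^{s/2}f,|\nabla|^{s/2}g\rangle$.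 For $s\in(\frac12,1)$ it is $(-\Delta)^{s/2}$ with domain $H^s(\mathbb{R})$; for $s\in(1,\frac32)$ its domain is $\{f=\phi-\frac{\phi(0)}{\mathsf{G}_{s,\lambda}(0)}\mathsf{G}_{s,\lambda}\mid\phi\in H^s(\mathbb{R})\}$, with $(\mathsf{k}^{(s/2)}_F+\lambda\mathbf{1})f=((-\Delta)^{s/2}+\lambda)\phi$. $F^\lambda(0)$ for $F^\lambda\in H^s(\mathbb{R})$ is the value at $0$ of the continuous representative. For a lower semi-bounded self-adjoint operator $T$, $\mathcal{D}[T]$ and $T[\cdot]$ denote its (closed) quadratic form domain and quadratic form. $\dotplus$ denotes direct algebraic sum. Invertible means having an everywhere defined bounded inverse. The value $\tau=\infty$ is regarded as positive and nonzero, with $1/\tau=0$. *)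

theory Defs
  imports "HOL-Analysis.Analysis"
begin

section \<open>The Hilbert space of square-integrable functions on the real line\<close>

definition square_integrable :: "(real \<Rightarrow> complex) \<Rightarrow> bool" where
  "square_integrable f \<longleftrightarrow>
     f \<in> borel_measurable borel \<and> integrable lborel (\<lambda>x. (cmod (f x))\<^sup>2)"

lemma square_integrable_zero [simp]: "square_integrable (\<lambda>_. 0)"
  by (simp add: square_integrable_def)

lemma square_integrable_scale:
  assumes "square_integrable f" shows "square_integrable (\<lambda>x. c * f x)"
  using assms by (auto simp: square_integrable_def norm_mult power_mult_distrib)

lemma square_integrable_add:
  assumes "square_integrable f" "square_integrable g"
  shows "square_integrable (\<lambda>x. f x + g x)"
proof -
  have [measurable]: "f \<in> borel_measurable borel" "g \<in> borel_measurable borel"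
    using assms by (auto simp: square_integrable_def)
  have *: "(cmod (f x + g x))\<^sup>2 \<le> 2 * (cmod (f x))\<^sup>2 + 2 * (cmod (g x))\<^sup>2" for x
  proof -
    have "(cmod (f x + g x))\<^sup>2 \<le> (cmod (f x) + cmod (g x))\<^sup>2"
      by (intro power_mono norm_triangle_ineq) auto
    also have "\<dots> \<le> 2 * (cmod (f x))\<^sup>2 + 2 * (cmod (g x))\<^sup>2"
      using zero_le_power2[of "cmod (f x) - cmod (g x)"]
      by (simp add: power2_eq_square algebra_simps)
    finally show ?thesis .
  qed
  have "integrable lborel (\<lambda>x. (cmod (f x + g x))\<^sup>2)"
    by (rule Bochner_Integration.integrable_bound[where
          f = "\<lambda>x. 2 * (cmod (f x))\<^sup>2 + 2 * (cmod (g x))\<^sup>2"])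
       (use assms * in \<open>auto simp: square_integrable_def\<close>)
  then show ?thesis by (simp add: square_integrable_def)
qed

lemma borel_measurable_cnj_mult:
  assumes "f \<in> borel_measurable borel" "g \<in> borel_measurable borel"
  shows "(\<lambda>x::real. cnj (f x) * g x) \<in> borel_measurable borel"
  by (intro borel_measurable_times borel_measurable_continuous_on[OF _ assms(1)] assms
        continuous_intros)

lemma square_integrable_integrable_mult:
  assumes "square_integrable f" "square_integrable g"
  shows "integrable lborel (\<lambda>x. cnj (f x) * g x)"
proof -
  have [measurable]: "f \<in> borel_measurable borel" "g \<in> borel_measurable borel"
    using assms by (auto simp: square_integrable_def)
  have *: "cmod (f x) * cmod (g x) \<le> (cmod (f x))\<^sup>2 + (cmod (g x))\<^sup>2" for x
    using zero_le_power2[of "cmod (f x) - cmod (g x)"]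
      mult_nonneg_nonneg[OF norm_ge_zero[of "f x"] norm_ge_zero[of "g x"]]
    unfolding power2_diff mult.assoc by linarith
  show ?thesis
    by (rule Bochner_Integration.integrable_bound[where
          f = "\<lambda>x. (cmod (f x))\<^sup>2 + (cmod (g x))\<^sup>2"])
       (use assms * in \<open>auto simp: square_integrable_def norm_mult borel_measurable_cnj_mult\<close>)
qed

definition L2_rel :: "(real \<Rightarrow> complex) \<Rightarrow> (real \<Rightarrow> complex) \<Rightarrow> bool" where
  "L2_rel f g \<longleftrightarrow> square_integrable f \<and> square_integrable g \<and> (AE x in lborel. f x = g x)"

quotient_type L2 = "real \<Rightarrow> complex" / partial: L2_rel
proof (rule part_equivpI)
  show "\<exists>f. L2_rel f f" by (auto simp: L2_rel_def intro!: exI[of _ "\<lambda>_. 0"])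
  show "symp L2_rel" by (auto simp: symp_def L2_rel_def elim: eventually_mono)
  show "transp L2_rel"
    unfolding transp_def L2_rel_def by (auto elim: eventually_elim2)
qed

definition represents :: "(real \<Rightarrow> complex) \<Rightarrow> L2 \<Rightarrow> bool" where
  "represents \<phi> f \<longleftrightarrow> square_integrable \<phi> \<and> abs_L2 \<phi> = f"

lift_definition cinner :: "L2 \<Rightarrow> L2 \<Rightarrow> complex" is
  "\<lambda>f g. LINT x|lborel. cnj (f x) * g x"
proof -
  fix f f' g g' :: "real \<Rightarrow> complex"
  assume a: "L2_rel f f'" "L2_rel g g'"
  then have "AE x in lborel. cnj (f x) * g x = cnj (f' x) * g' x"
    by (auto simp: L2_rel_def elim: eventually_elim2)
  with a show "(LINT x|lborel. cnj (f x) * g x) = (LINT x|lborel. cnj (f' x) * g' x)"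
    by (intro integral_cong_AE)
       (auto simp: L2_rel_def square_integrable_def borel_measurable_cnj_mult)
qed

lift_definition scaleC :: "complex \<Rightarrow> L2 \<Rightarrow> L2" (infixr "*\<^sub>C" 75) is
  "\<lambda>c f x. c * f x"
  by (auto simp: L2_rel_def square_integrable_scale elim: eventually_mono)

instantiation L2 :: real_inner
begin

lift_definition zero_L2 :: L2 is "\<lambda>_. 0"
  by (simp add: L2_rel_def)

lift_definition plus_L2 :: "L2 \<Rightarrow> L2 \<Rightarrow> L2" is "\<lambda>f g x. f x + g x"
  by (auto simp: L2_rel_def square_integrable_add elim: eventually_elim2)

definition uminus_L2 :: "L2 \<Rightarrow> L2" where "uminus_L2 f = (-1) *\<^sub>C f"

definition minus_L2 :: "L2 \<Rightarrow> L2 \<Rightarrow> L2" where "minus_L2 f g = f + (- (g::L2))"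

definition scaleR_L2 :: "real \<Rightarrow> L2 \<Rightarrow> L2" where
  "scaleR_L2 r f = complex_of_real r *\<^sub>C f"

definition inner_L2 :: "L2 \<Rightarrow> L2 \<Rightarrow> real" where
  "inner_L2 f g = Re (cinner f g)"

definition norm_L2 :: "L2 \<Rightarrow> real" where
  "norm_L2 f = sqrt (inner f f)"

definition sgn_L2 :: "L2 \<Rightarrow> L2" where
  "sgn_L2 f = inverse (norm f) *\<^sub>R f"

definition dist_L2 :: "L2 \<Rightarrow> L2 \<Rightarrow> real" where
  "dist_L2 f g = norm (f - g)"

definition uniformity_L2 :: "(L2 \<times> L2) filter" where
  "uniformity_L2 = (INF e\<in>{0 <..}. principal {(x, y). dist x y < e})"

definition open_L2 :: "L2 set \<Rightarrow> bool" where
  "open_L2 U = (\<forall>x\<in>U. eventually (\<lambda>(x', y). x' = x \<longrightarrow> y \<in> U) uniformity)"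

instance
proof
  fix f g h :: L2 and a b :: real
  show "f + g + h = f + (g + h)"
    by (transfer, auto simp: L2_rel_def square_integrable_add add.assoc)
  show "f + g = g + f"
    by (transfer, auto simp: L2_rel_def square_integrable_add add.commute)
  show "0 + f = f"
    by (transfer, auto simp: L2_rel_def)
  show "- f + f = 0"
    unfolding uminus_L2_def
    by (transfer, auto simp: L2_rel_def intro!: square_integrable_add
          square_integrable_scale[of _ "-1", simplified])
  show "f - g = f + - g" by (simp add: minus_L2_def)
  show "a *\<^sub>R (f + g) = a *\<^sub>R f + a *\<^sub>R g"
    unfolding scaleR_L2_def
    by (transfer, auto simp: L2_rel_def distrib_left
          intro!: square_integrable_add square_integrable_scale)
  show "(a + b) *\<^sub>R f = a *\<^sub>R f + b *\<^sub>R f"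
    unfolding scaleR_L2_def of_real_add
    by (transfer, auto simp: L2_rel_def distrib_right
          intro!: square_integrable_add square_integrable_scale)
  show "a *\<^sub>R b *\<^sub>R f = (a * b) *\<^sub>R f"
    unfolding scaleR_L2_def of_real_mult
    by (transfer, auto simp: L2_rel_def mult.assoc intro!: square_integrable_scale)
  show "1 *\<^sub>R f = f"
    unfolding scaleR_L2_def by (transfer, auto simp: L2_rel_def)
  show "sgn f = inverse (norm f) *\<^sub>R f" by (simp add: sgn_L2_def)
  show "dist f g = norm (f - g)" by (simp add: dist_L2_def)
  show "uniformity = (INF e\<in>{0 <..}. principal {(x::L2, y). dist x y < e})"
    by (simp add: uniformity_L2_def)
  show "open U = (\<forall>x\<in>U. eventually (\<lambda>(x', y). x' = x \<longrightarrow> y \<in> U) uniformity)" for U :: "L2 set"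
    by (simp add: open_L2_def)
  show "inner f g = inner g f"
  proof -
    have "cinner f g = cnj (cinner g f)"
      by transfer (simp add: mult.commute flip: Bochner_Integration.integral_cnj)
    then show ?thesis by (simp add: inner_L2_def)
  qed
  show "inner (f + g) h = inner f h + inner g h"
  proof -
    have "cinner (f + g) h = cinner f h + cinner g h"
      by transfer (simp add: L2_rel_def distrib_right square_integrable_integrable_mult)
    then show ?thesis by (simp add: inner_L2_def)
  qed
  show "inner (a *\<^sub>R f) g = a * inner f g"
  proof -
    have "cinner (a *\<^sub>R f) g = of_real a * cinner f g"
      unfolding scaleR_L2_def by transfer (simp add: mult.assoc)
    then show ?thesis by (simp add: inner_L2_def)
  qed
  have eq: "cinner f f = complex_of_real (LINT x|lborel. (cmod (rep_L2 f x))\<^sup>2)"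
    by (simp add: cinner.rep_eq mult.commute complex_norm_square[symmetric]
          flip: integral_complex_of_real)
  then have eq': "inner f f = (LINT x|lborel. (cmod (rep_L2 f x))\<^sup>2)"
    by (simp add: inner_L2_def)
  show "0 \<le> inner f f" by (simp add: eq')
  have rel: "L2_rel (rep_L2 f) (rep_L2 f)"
    by (rule Quotient3_rep_reflp[OF Quotient3_L2])
  show "inner f f = 0 \<longleftrightarrow> f = 0"
  proof
    assume "inner f f = 0"
    then have "AE x in lborel. (cmod (rep_L2 f x))\<^sup>2 = 0"
      using rel integral_nonneg_eq_0_iff_AE[of lborel "\<lambda>x. (cmod (rep_L2 f x))\<^sup>2"]
      by (auto simp: eq' L2_rel_def square_integrable_def)
    then have "L2_rel (rep_L2 f) (\<lambda>_. 0)"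
      using rel by (auto simp: L2_rel_def)
    then have "abs_L2 (rep_L2 f) = abs_L2 (\<lambda>_. 0)"
      by (rule Quotient3_rel_abs[OF Quotient3_L2])
    then show "f = 0"
      by (simp add: zero_L2_def Quotient3_abs_rep[OF Quotient3_L2])
  next
    assume "f = 0"
    moreover have "cinner 0 0 = 0" by transfer simp
    ultimately show "inner f f = 0" by (simp add: inner_L2_def)
  qed
  show "norm f = sqrt (inner f f)" by (simp add: norm_L2_def)
qed

end

section \<open>Unbounded operators\<close>

text \<open>An operator is identified with its graph; its domain is \<^term>\<open>Domain T\<close>, and the inverse
  of an injective operator is the converse graph.\<close>

type_synonym operator = "(L2 \<times> L2) set"

definition is_operator :: "operator \<Rightarrow> bool" where
  "is_operator T \<longleftrightarrow>
     (0, 0) \<in> T \<and>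
     (\<forall>f h g k. (f, h) \<in> T \<longrightarrow> (g, k) \<in> T \<longrightarrow> (f + g, h + k) \<in> T) \<and>
     (\<forall>c f h. (f, h) \<in> T \<longrightarrow> (c *\<^sub>C f, c *\<^sub>C h) \<in> T) \<and>
     single_valued T"

definition op_apply :: "operator \<Rightarrow> L2 \<Rightarrow> L2" where
  "op_apply T f = (THE h. (f, h) \<in> T)"

definition op_graph :: "(L2 \<Rightarrow> L2) \<Rightarrow> operator" where
  "op_graph B = {(f, B f) | f. True}"

definition op_add :: "operator \<Rightarrow> operator \<Rightarrow> operator" where
  "op_add S T = {(f, h + k) | f h k. (f, h) \<in> S \<and> (f, k) \<in> T}"

definition shift :: "operator \<Rightarrow> complex \<Rightarrow> operator" where
  "shift T z = op_add T (op_graph (\<lambda>f. z *\<^sub>C f))"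

definition adjoint_op :: "operator \<Rightarrow> operator" where
  "adjoint_op T = {(g, k). \<forall>(f, h) \<in> T. cinner g h = cinner k f}"

definition selfadjoint :: "operator \<Rightarrow> bool" where
  "selfadjoint T \<longleftrightarrow> is_operator T \<and> closure (Domain T) = UNIV \<and> adjoint_op T = T"

definition semibounded :: "operator \<Rightarrow> bool" where
  "semibounded T \<longleftrightarrow> (\<exists>m::real. \<forall>(f, h) \<in> T. m * (norm f)\<^sup>2 \<le> Re (cinner f h))"

definition invertible_op :: "operator \<Rightarrow> bool" where
  "invertible_op T \<longleftrightarrow> (\<exists>B. bounded_linear B \<and> T\<inverse> = op_graph B)"

definition spectrum :: "operator \<Rightarrow> complex set" where
  "spectrum T = {z. \<not> invertible_op (shift T (- z))}"

definition inf_spectrum :: "operator \<Rightarrow> ereal" where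
  "inf_spectrum T = (INF z\<in>spectrum T. ereal (Re z))"

subsection \<open>Closed quadratic forms and the Friedrichs extension\<close>

text \<open>For a lower semi-bounded symmetric operator \<open>T\<close>, \<open>form_domain T\<close> and \<open>form T\<close> are the closure of
  the form \<open>f \<mapsto> \<langle>f, T f\<rangle>\<close> on the operator domain, and the Friedrichs extension is the
  restriction of the adjoint of \<open>T\<close> to that closed form domain. Adding a multiple of the squared norm to obtain
  a form norm is not needed, because \<open>form_conv\<close> already requires convergence in the Hilbert space.\<close>

definition op_form :: "operator \<Rightarrow> L2 \<Rightarrow> complex" where
  "op_form T f = cinner f (op_apply T f)"

definition form_conv :: "operator \<Rightarrow> (nat \<Rightarrow> L2) \<Rightarrow> L2 \<Rightarrow> bool" where
  "form_conv T u f \<longleftrightarrow>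
     (\<forall>n. u n \<in> Domain T) \<and> u \<longlonglongrightarrow> f \<and>
     ((\<lambda>(m, n). op_form T (u m - u n)) \<longlongrightarrow> 0) (sequentially \<times>\<^sub>F sequentially)"

definition form_domain :: "operator \<Rightarrow> L2 set" where
  "form_domain T = {f. \<exists>u. form_conv T u f}"

definition form :: "operator \<Rightarrow> L2 \<Rightarrow> complex" where
  "form T f = (THE c. \<forall>u. form_conv T u f \<longrightarrow> (\<lambda>n. op_form T (u n)) \<longlonglongrightarrow> c)"

definition friedrichs :: "operator \<Rightarrow> operator" where
  "friedrichs T = {(f, h) \<in> adjoint_op T. f \<in> form_domain T}"

definition is_direct_sum :: "L2 set \<Rightarrow> L2 set \<Rightarrow> L2 set \<Rightarrow> bool" where
  "is_direct_sum D V W \<longleftrightarrow> D = {v + w | v w. v \<in> V \<and> w \<in> W} \<and> V \<inter> W = {0}"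

definition cspan1 :: "L2 \<Rightarrow> L2 set" where
  "cspan1 f = range (\<lambda>c. c *\<^sub>C f)"

section \<open>Fourier transform, Sobolev spaces and fractional Laplacian\<close>

definition fourier_integral :: "(real \<Rightarrow> complex) \<Rightarrow> real \<Rightarrow> complex" where
  "fourier_integral \<phi> p =
     of_real ((2 * pi) powr (- 1/2)) * (LINT x|lborel. exp (- \<i> * of_real (p * x)) * \<phi> x)"

text \<open>The continuous extension to \<open>L\<^sup>2\<close> of the Fourier integral on \<open>L\<^sup>1 \<inter> L\<^sup>2\<close>.\<close>

definition fourier :: "L2 \<Rightarrow> L2" where
  "fourier = (THE U. continuous_on UNIV U \<and>
     (\<forall>\<phi> f. represents \<phi> f \<longrightarrow> integrable lborel \<phi> \<longrightarrow> represents (fourier_integral \<phi>) (U f)))"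

definition nabla_pow :: "real \<Rightarrow> operator" where
  "nabla_pow a = {(f, h). \<exists>\<phi>. represents \<phi> (fourier f) \<and>
     represents (\<lambda>p. of_real (\<bar>p\<bar> powr a) * \<phi> p) (fourier h)}"

definition frac_laplacian :: "real \<Rightarrow> operator" where
  "frac_laplacian r = nabla_pow (2 * r)" \<comment> \<open>\<open>(-\<Delta>)\<^bsup>r\<^esup>\<close>\<close>

definition sobolev :: "real \<Rightarrow> L2 set" where
  "sobolev r = {f. \<exists>\<phi>. represents \<phi> (fourier f) \<and>
     square_integrable (\<lambda>p. of_real ((1 + p\<^sup>2) powr (r/2)) * \<phi> p)}"

definition sobolev_norm :: "real \<Rightarrow> L2 \<Rightarrow> real" where
  "sobolev_norm r f =
     sqrt (LINT p|lborel. (1 + p\<^sup>2) powr r * (cmod (rep_L2 (fourier f) p))\<^sup>2)"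

definition smooth :: "(real \<Rightarrow> complex) \<Rightarrow> bool" where
  "smooth \<phi> \<longleftrightarrow> (\<exists>D :: nat \<Rightarrow> real \<Rightarrow> complex.
     D 0 = \<phi> \<and> (\<forall>n x. (D n has_vector_derivative D (Suc n) x) (at x)))"

definition test_functions_off_0 :: "L2 set" where
  "test_functions_off_0 = {f. \<exists>\<phi>. smooth \<phi> \<and> compact (closure {x. \<phi> x \<noteq> 0}) \<and>
     0 \<notin> closure {x. \<phi> x \<noteq> 0} \<and> represents \<phi> f}"

definition sobolev_off_0 :: "real \<Rightarrow> L2 set" where
  "sobolev_off_0 r = {f \<in> sobolev r.
     \<forall>e>0. \<exists>g\<in>test_functions_off_0. sobolev_norm r (f - g) < e}"

definition value_at_0 :: "L2 \<Rightarrow> complex" where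
  "value_at_0 f = (THE c. \<exists>\<phi>. continuous_on UNIV \<phi> \<and> represents \<phi> f \<and> \<phi> 0 = c)"

section \<open>Point perturbations of the fractional Laplacian\<close>

definition omega :: "real \<Rightarrow> real" where
  "omega s = s\<^sup>2 * sin (pi / s) / (s - 1)"

definition theta :: "real \<Rightarrow> real" where
  "theta s = (if s < 1 then 0 else 1)"

definition green :: "real \<Rightarrow> real \<Rightarrow> L2" where
  "green s l = of_real ((2 * pi) powr (- 1/2)) *\<^sub>C
     inv fourier (abs_L2 (\<lambda>p. of_real (1 / (\<bar>p\<bar> powr s + l))))"

text \<open>The operator closure is the closure of the graph in \<open>L\<^sup>2 \<times> L\<^sup>2\<close>.\<close>

definition k_min :: "real \<Rightarrow> operator" where
  "k_min s = closure {(f, h) \<in> frac_laplacian (s/2). f \<in> test_functions_off_0}"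

text \<open>The coefficient \<open>\<omega>(s) \<lambda>\<^bsup>2-1/s\<^esup> / \<tau> - \<theta>\<^sub>s / G(0)\<close> for \<open>\<tau> \<noteq> 0\<close>. In \<^typ>\<open>ereal\<close>, \<open>1 / \<infinity> = 0\<close>.
  For \<open>s < 1\<close> the last term is \<open>0\<close> since \<open>theta s = 0\<close>, whatever \<open>value_at_0\<close> returns there.\<close>

definition k_coeff :: "real \<Rightarrow> real \<Rightarrow> ereal \<Rightarrow> complex" where
  "k_coeff s l \<tau> =
     of_real (omega s * l powr (2 - 1/s) * real_of_ereal (1 / \<tau>))
     - of_real (theta s) / value_at_0 (green s l)"

text \<open>The parameter ranges over \<open>\<real> \<union> {\<infinity>}\<close>; the value at \<open>-\<infinity>\<close> is irrelevant. The pairs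
  \<open>(g, ((-\<Delta>)\<^bsup>s/2\<^esup> + \<lambda>) F)\<close> form the graph of \<open>k\<^sub>\<tau> + \<lambda>\<close>, from which \<open>\<lambda>\<close> is then subtracted.\<close>

definition k_ext :: "real \<Rightarrow> real \<Rightarrow> ereal \<Rightarrow> operator" where
  "k_ext s l \<tau> =
     (if \<tau> = \<infinity> then friedrichs (k_min s)
      else if \<tau> = 0 then
        shift {(F + c *\<^sub>C green s l, op_apply (frac_laplacian (s/2)) F + of_real l *\<^sub>C F) | F c.
                 F \<in> sobolev s \<and> value_at_0 F = 0} (- of_real l)
      else
        shift {(F + (k_coeff s l \<tau> * value_at_0 F) *\<^sub>C green s l,
                 op_apply (frac_laplacian (s/2)) F + of_real l *\<^sub>C F) | F.
                 F \<in> sobolev s} (- of_real l))"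

end

theory Submission
  imports Defs "HOL-Probability.Levy" "HOL-Real_Asymp.Real_Asymp"
begin

text \<open>
  Write \<open>G\<close> for the Green function and \<open>B\<close> for the inverse of the Friedrichs extension plus \<open>l\<close>, so that
  \<open>B k = ((-\<Delta>)\<^sup>s\<^sup>/\<^sup>2 + l)\<^sup>-\<^sup>1 k - \<theta> \<langle>G, k\<rangle> G / G(0)\<close>. Since the value at the origin of a function
  \<open>((-\<Delta>)\<^sup>s\<^sup>/\<^sup>2 + l)\<^sup>-\<^sup>1 k\<close> is \<open>\<langle>G, k\<rangle>\<close>, and test functions supported off the origin are dense among the
  functions of \<open>H\<^sup>s\<close> vanishing there, the minimal operator plus \<open>l\<close> has the graph
  \<open>{(B k, k) | \<langle>G, k\<rangle> = 0}\<close>. A symmetric extension consists of pairs \<open>(B k + \<kappa> G, k)\<close>, and self-adjointness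
  leaves exactly one linear relation between \<open>\<langle>G, k\<rangle>\<close> and \<open>\<kappa>\<close>: either \<open>\<kappa> = 0\<close> or \<open>\<langle>G, k\<rangle> = \<gamma> \<kappa>\<close> with a real
  \<open>\<gamma>\<close>, and \<open>\<gamma> = \<tau> / (\<omega>(s) l\<^sup>2\<^sup>-\<^sup>1\<^sup>/\<^sup>s)\<close>. The quadratic form of \<open>B k + \<kappa> G\<close> is that of the Friedrichs extension
  at \<open>B k\<close> plus \<open>\<gamma> \<bar>\<kappa>\<bar>\<^sup>2\<close>. It is semibounded and closed for every \<open>\<gamma>\<close> because \<open>\<bar>\<kappa>\<bar>\<^sup>2\<close> is bounded relative to the
  form with arbitrarily small constant, and after adding \<open>l\<close> it is nonnegative exactly when \<open>\<gamma> \<ge> 0\<close>.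
\<close>

section \<open>The complex Hilbert space structure of \<open>L2\<close>\<close>

text \<open>Both ranges of s are handled together on the Fourier side, where the operator plus l is
  multiplication by |p|^s + l. They differ in the integral of 1/(|p|^s + l). For s < 1 it diverges,
  and G is not in H^(s/2); for s > 1 it converges, and G is in H^(s/2) but does not vanish at the
  origin. In both cases G lies outside the Friedrichs form domain, which is what the extension
  theory needs. The admissible range of s reflects one estimate: removing a neighbourhood of the
  origin of size e from a function vanishing there to order a costs at most a multiple of
  e^(1+2a-2r) in the squared H^r norm. This is small for r < 1/2 with a = 0 and for r < 3/2 with a =
  1. The orders needed are r = s, where evaluation is continuous because s > 1/2, and r = s/2, which
  avoids the critical order 1/2 since s is not 1. The functional k -> <G, k> is not controlled by
  the form norm of \<open>B k\<close>: its value can be prescribed while \<open>B k\<close> stays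
  arbitrarily close to any given element of the form domain. Hence all extensions with real
  parameter have the same form domain, and a negative \<gamma> really makes the form
  negative.\<close>

lemma L2_rel_rep: "L2_rel (rep_L2 f) (rep_L2 f)"
  by (rule Quotient3_rep_reflp[OF Quotient3_L2])

lemma square_integrable_rep [simp]: "square_integrable (rep_L2 f)"
  using L2_rel_rep by (auto simp: L2_rel_def)

lemma square_integrable_measurable: "square_integrable f \<Longrightarrow> f \<in> borel_measurable borel"
  by (simp add: square_integrable_def)

lemma rep_measurable [measurable]: "rep_L2 f \<in> borel_measurable borel"
  by (rule square_integrable_measurable) simp

lemma abs_rep_L2 [simp]: "abs_L2 (rep_L2 f) = f"
  by (rule Quotient3_abs_rep[OF Quotient3_L2])

lemma represents_rep [simp]: "represents (rep_L2 f) f"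
  by (simp add: represents_def)

lemma represents_abs: "square_integrable \<phi> \<Longrightarrow> represents \<phi> (abs_L2 \<phi>)"
  by (simp add: represents_def)

lemma represents_square_integrable: "represents \<phi> f \<Longrightarrow> square_integrable \<phi>"
  by (simp add: represents_def)

lemma represents_unique: "represents \<phi> f \<Longrightarrow> represents \<phi> g \<Longrightarrow> f = g"
  by (simp add: represents_def)

lemma represents_L2_rel: "represents \<phi> f \<Longrightarrow> represents \<psi> f \<Longrightarrow> L2_rel \<phi> \<psi>"
  using Quotient3_rel[OF Quotient3_L2, of \<phi> \<psi>] by (auto simp: represents_def L2_rel_def)

lemma represents_AE_eq: "represents \<phi> f \<Longrightarrow> represents \<psi> f \<Longrightarrow> AE x in lborel. \<phi> x = \<psi> x"
  by (drule (1) represents_L2_rel) (simp add: L2_rel_def)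

lemma represents_eqI:
  assumes "represents \<phi> f" "represents \<psi> g" "AE x in lborel. \<phi> x = \<psi> x"
  shows "f = g"
  using assms Quotient3_rel_abs[OF Quotient3_L2, of \<phi> \<psi>] by (auto simp: represents_def L2_rel_def)

lemma represents_cong_AE:
  assumes "represents \<phi> f" "square_integrable \<psi>" "AE x in lborel. \<phi> x = \<psi> x"
  shows "represents \<psi> f"
  using represents_eqI[OF assms(1) represents_abs[OF assms(2)] assms(3)] assms(2)
  by (simp add: represents_def)

lemma square_integrable_cong_AE:
  assumes "square_integrable \<phi>" "AE x in lborel. \<phi> x = \<psi> x" "\<psi> \<in> borel_measurable borel"
  shows "square_integrable \<psi>"
proof -
  have [measurable]: "\<phi> \<in> borel_measurable borel"
    using assms by (simp add: square_integrable_def)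
  have "integrable lborel (\<lambda>x. (cmod (\<psi> x))\<^sup>2)"
    by (rule integrable_cong_AE_imp[of _ "\<lambda>x. (cmod (\<phi> x))\<^sup>2"])
       (use assms in \<open>auto simp: square_integrable_def elim: eventually_mono\<close>)
  then show ?thesis using assms by (simp add: square_integrable_def)
qed

lemma square_integrable_bound:
  assumes "square_integrable g" "f \<in> borel_measurable borel" "AE x in lborel. cmod (f x) \<le> cmod (g x)"
  shows "square_integrable f"
  unfolding square_integrable_def
proof
  have [measurable]: "g \<in> borel_measurable borel" "f \<in> borel_measurable borel"
    using assms by (auto simp: square_integrable_def)
  show "integrable lborel (\<lambda>x. (cmod (f x))\<^sup>2)"
    by (rule Bochner_Integration.integrable_bound[where f="\<lambda>x. (cmod (g x))\<^sup>2"])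
       (use assms in \<open>auto simp: square_integrable_def power_mono elim!: eventually_mono\<close>)
qed (fact assms)

lemma represents_add:
  "represents \<phi> f \<Longrightarrow> represents \<psi> g \<Longrightarrow> represents (\<lambda>x. \<phi> x + \<psi> x) (f + g)"
  unfolding represents_def
  by (auto simp: square_integrable_add plus_L2.abs_eq L2_rel_def)

lemma represents_scaleC: "represents \<phi> f \<Longrightarrow> represents (\<lambda>x. c * \<phi> x) (c *\<^sub>C f)"
  unfolding represents_def by (auto simp: square_integrable_scale scaleC.abs_eq L2_rel_def)

lemma represents_zero: "represents (\<lambda>_. 0) 0"
  by (simp add: represents_def zero_L2.abs_eq)

interpretation cvec: vector_space scaleC
proof
  fix a b :: complex and x y :: L2
  show "a *\<^sub>C (x + y) = a *\<^sub>C x + a *\<^sub>C y"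
    by transfer (auto simp: L2_rel_def distrib_left
          intro!: square_integrable_add square_integrable_scale)
  show "(a + b) *\<^sub>C x = a *\<^sub>C x + b *\<^sub>C x"
    by transfer (auto simp: L2_rel_def distrib_right
          intro!: square_integrable_add square_integrable_scale)
  show "a *\<^sub>C b *\<^sub>C x = (a * b) *\<^sub>C x"
    by transfer (auto simp: L2_rel_def mult.assoc intro!: square_integrable_scale)
  show "1 *\<^sub>C x = x"
    by transfer (auto simp: L2_rel_def)
qed

lemma scaleR_scaleC: "r *\<^sub>R f = complex_of_real r *\<^sub>C f"
  by (simp add: scaleR_L2_def)

lemma represents_diff:
  assumes "represents \<phi> f" "represents \<psi> g"
  shows "represents (\<lambda>x. \<phi> x - \<psi> x) (f - g)"
proof -
  have "represents (\<lambda>x. \<phi> x + (-1) * \<psi> x) (f + (-1) *\<^sub>C g)"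
    by (intro represents_add represents_scaleC assms)
  then show ?thesis by (simp add: cvec.scale_minus_left)
qed

lemma cinner_represents:
  assumes "represents \<phi> f" "represents \<psi> g"
  shows "cinner f g = (LINT x|lborel. cnj (\<phi> x) * \<psi> x)"
  using assms cinner.abs_eq[of \<phi> \<psi>] by (auto simp: represents_def L2_rel_def)

lemma cinner_add_right: "cinner f (g + h) = cinner f g + cinner f h"
  by transfer (simp add: L2_rel_def distrib_left square_integrable_integrable_mult)

lemma cinner_add_left: "cinner (f + g) h = cinner f h + cinner g h"
  by transfer (simp add: L2_rel_def distrib_right square_integrable_integrable_mult)

lemma cinner_scaleC_right [simp]: "cinner f (c *\<^sub>C g) = c * cinner f g"
  by transfer (simp add: mult.left_commute)

lemma cinner_scaleC_left [simp]: "cinner (c *\<^sub>C f) g = cnj c * cinner f g"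
  by transfer (simp add: mult.assoc)

lemma cinner_commute: "cinner f g = cnj (cinner g f)"
  by transfer (simp add: mult.commute flip: Bochner_Integration.integral_cnj)

lemma cinner_minus_right [simp]: "cinner f (- g) = - cinner f g"
  using cinner_scaleC_right[of f "-1" g] by simp

lemma cinner_minus_left [simp]: "cinner (- f) g = - cinner f g"
  using cinner_scaleC_left[of "-1" f g] by simp

lemma cinner_diff_right: "cinner f (g - h) = cinner f g - cinner f h"
  using cinner_add_right[of f g "- h"] by simp

lemma cinner_diff_left: "cinner (f - g) h = cinner f h - cinner g h"
  using cinner_add_left[of f "- g" h] by simp

lemma cinner_zero_right [simp]: "cinner f 0 = 0"
  using cinner_scaleC_right[of f 0 0] by simp

lemma cinner_zero_left [simp]: "cinner 0 f = 0"
  using cinner_scaleC_left[of 0 0 f] by simp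

lemma cinner_self: "cinner f f = complex_of_real ((norm f)\<^sup>2)"
proof -
  have "Im (cinner f f) = 0"
    using arg_cong[OF cinner_commute[of f f], of Im] by simp
  moreover have "Re (cinner f f) = (norm f)\<^sup>2"
    by (simp add: power2_norm_eq_inner inner_L2_def)
  ultimately show ?thesis by (simp add: complex_eq_iff)
qed

lemma norm_represents: "represents \<phi> f \<Longrightarrow> (norm f)\<^sup>2 = (LINT x|lborel. (cmod (\<phi> x))\<^sup>2)"
proof -
  assume "represents \<phi> f"
  then have "complex_of_real ((norm f)\<^sup>2) = (LINT x|lborel. cnj (\<phi> x) * \<phi> x)"
    using cinner_represents[of \<phi> f \<phi> f] by (simp add: cinner_self)
  also have "\<dots> = complex_of_real (LINT x|lborel. (cmod (\<phi> x))\<^sup>2)"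
    by (simp add: mult.commute complex_norm_square[symmetric] flip: integral_complex_of_real)
  finally show ?thesis using of_real_eq_iff by blast
qed

lemma nn_norm_represents:
  assumes "represents \<phi> f"
  shows "ennreal ((norm f)\<^sup>2) = (\<integral>\<^sup>+x. ennreal ((cmod (\<phi> x))\<^sup>2) \<partial>lborel)"
  using assms by (simp add: norm_represents represents_def square_integrable_def nn_integral_eq_integral)

lemma norm_scaleC [simp]: "norm (c *\<^sub>C f) = cmod c * norm f"
proof -
  have "complex_of_real ((norm (c *\<^sub>C f))\<^sup>2) = complex_of_real ((cmod c * norm f)\<^sup>2)"
    unfolding cinner_self[symmetric] cinner_scaleC_left cinner_scaleC_right
    by (simp add: cinner_self power_mult_distrib flip: mult.assoc)
       (simp add: complex_norm_square[symmetric])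
  then have "(norm (c *\<^sub>C f))\<^sup>2 = (cmod c * norm f)\<^sup>2"
    using of_real_eq_iff by blast
  then show ?thesis by (simp add: power2_eq_iff_nonneg)
qed

lemma cinner_bound: "cmod (cinner f g) \<le> norm f * norm g"
proof (cases "cinner f g = 0")
  case False
  \<comment> \<open>Rotating f by this phase makes the scalar product real and nonnegative, so the
    real Cauchy-Schwarz inequality applies.\<close>
  define c where "c = sgn (cinner f g)"
  have c: "cmod c = 1" using False by (simp add: c_def norm_sgn)
  have "cinner (c *\<^sub>C f) g = of_real (cmod (cinner f g))"
    using False by (simp add: c_def sgn_eq complex_norm_square[symmetric] mult.commute
        power2_eq_square field_simps)
  then have "cmod (cinner f g) = inner (c *\<^sub>C f) g" by (simp add: inner_L2_def)
  also have "\<dots> \<le> norm (c *\<^sub>C f) * norm g" by (rule norm_cauchy_schwarz)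
  finally show ?thesis by (simp add: c)
qed simp

lemma bounded_bilinear_cinner: "bounded_bilinear cinner"
  by standard (auto simp: cinner_add_left cinner_add_right scaleR_scaleC scaleR_conv_of_real
      intro!: exI[of _ 1] cinner_bound)

lemmas tendsto_cinner [tendsto_intros] = bounded_bilinear.tendsto[OF bounded_bilinear_cinner]

lemma bounded_bilinear_scaleC: "bounded_bilinear scaleC"
  by standard (auto simp: cvec.scale_left_distrib cvec.scale_right_distrib scaleR_scaleC
      scaleR_conv_of_real mult.commute intro!: exI[of _ 1])

lemmas tendsto_scaleC [tendsto_intros] = bounded_bilinear.tendsto[OF bounded_bilinear_scaleC]

lemma norm_power2_add_le: "(norm (f + g :: 'a::real_normed_vector))\<^sup>2 \<le> 2 * (norm f)\<^sup>2 + 2 * (norm g)\<^sup>2"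
proof -
  have "(norm (f + g))\<^sup>2 \<le> (norm f + norm g)\<^sup>2"
    by (intro power_mono norm_triangle_ineq) auto
  also have "\<dots> \<le> 2 * (norm f)\<^sup>2 + 2 * (norm g)\<^sup>2"
    using zero_le_power2[of "norm f - norm g"] by (simp add: power2_eq_square algebra_simps)
  finally show ?thesis .
qed

subsection \<open>Completeness\<close>

lemma integral_gaussian: "integrable lborel (\<lambda>x::real. exp (- x\<^sup>2 / 2))"
proof -
  have "integrable lborel (\<lambda>x. sqrt (2 * pi) * std_normal_density x)"
    by (intro integrable_mult_right integrable_normal_density) simp
  then show ?thesis by (simp add: std_normal_density_def field_simps)
qed

lemma square_integrable_gaussian: "square_integrable (\<lambda>x. complex_of_real (exp (- x\<^sup>2 / 2)))"
proof -
  have "integrable lborel (\<lambda>x::real. (exp (- x\<^sup>2 / 2))\<^sup>2)"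
    by (rule Bochner_Integration.integrable_bound[OF integral_gaussian])
       (auto simp: power2_eq_square simp flip: exp_add)
  then show ?thesis by (auto simp: square_integrable_def)
qed

text \<open>Cauchy-Schwarz for absolute values, in terms of nonnegative integrals so that a whole
  series of increments can be summed under the integral sign.\<close>

lemma weighted_L1_bound:
  assumes "represents \<phi> f" "represents w g"
  shows "(\<integral>\<^sup>+x. ennreal (cmod (\<phi> x) * cmod (w x)) \<partial>lborel) \<le> ennreal (norm f * norm g)"
proof -
  have [measurable]: "\<phi> \<in> borel_measurable borel" "w \<in> borel_measurable borel"
    using assms by (auto simp: represents_def square_integrable_def)
  have 1: "represents (\<lambda>x. complex_of_real (cmod (\<phi> x))) (abs_L2 (\<lambda>x. complex_of_real (cmod (\<phi> x))))"
    "represents (\<lambda>x. complex_of_real (cmod (w x))) (abs_L2 (\<lambda>x. complex_of_real (cmod (w x))))"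
    using assms by (auto intro!: represents_abs simp: represents_def square_integrable_def)
  let ?f = "abs_L2 (\<lambda>x. complex_of_real (cmod (\<phi> x)))"
  let ?g = "abs_L2 (\<lambda>x. complex_of_real (cmod (w x)))"
  have n: "norm ?f = norm f" "norm ?g = norm g"
    using norm_represents[OF 1(1)] norm_represents[OF assms(1)]
      norm_represents[OF 1(2)] norm_represents[OF assms(2)]
    by (auto intro: power2_eq_imp_eq)
  have int: "integrable lborel (\<lambda>x. cmod (\<phi> x) * cmod (w x))"
    using integrable_norm[OF square_integrable_integrable_mult[of \<phi> w]] assms
    by (simp add: represents_def norm_mult)
  have "cinner ?f ?g = complex_of_real (LINT x|lborel. cmod (\<phi> x) * cmod (w x))"
    unfolding cinner_represents[OF 1] by (simp flip: of_real_mult)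
  then have "(LINT x|lborel. cmod (\<phi> x) * cmod (w x)) \<le> norm f * norm g"
    using cinner_bound[of ?f ?g] by (simp add: n)
  then show ?thesis
    using int by (simp add: nn_integral_eq_integral ennreal_leI)
qed

lemma fast_Cauchy_subseq:
  fixes X :: "nat \<Rightarrow> 'a::metric_space"
  assumes "Cauchy X"
  obtains r :: "nat \<Rightarrow> nat" where "strict_mono r"
    "\<And>n m. m \<ge> r n \<Longrightarrow> dist (X m) (X (r n)) < (1/2)^n"
proof -
  have "\<exists>N. \<forall>m\<ge>N. \<forall>k\<ge>N. dist (X m) (X k) < (1/2)^n" for n
    using assms by (intro metric_CauchyD) auto
  then obtain N where N: "\<And>n m k. m \<ge> N n \<Longrightarrow> k \<ge> N n \<Longrightarrow> dist (X m) (X k) < (1/2)^n"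
    by metis
  \<comment> \<open>The summand n makes \<open>r\<close> strictly increasing, and the sum dominates
    each single threshold \<open>N n\<close>.\<close>
  define r where "r n = n + (\<Sum>i\<le>n. N i)" for n
  have "strict_mono r" by (rule strict_monoI_Suc) (simp add: r_def)
  moreover have "r n \<ge> N n" for n
    unfolding r_def by (rule trans_le_add2) (auto intro: member_le_sum)
  ultimately show thesis using N by (intro that[of r]) (meson order_trans order_refl)+
qed

text \<open>Along a fast Cauchy subsequence the increments are summable in \<open>L\<^sup>1\<close> with the finite weight
  \<open>exp (-x\<^sup>2/2)\<close>, hence summable almost everywhere.\<close>

instance L2 :: complete_space
proof
  fix X :: "nat \<Rightarrow> L2" assume X: "Cauchy X"
  obtain r :: "nat \<Rightarrow> nat" where r: "strict_mono r"
    and rX: "\<And>n m. m \<ge> r n \<Longrightarrow> dist (X m) (X (r n)) < (1/2)^n"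
    using fast_Cauchy_subseq[OF X] by metis
  define \<phi> where "\<phi> n = rep_L2 (X (r n))" for n
  have rep: "represents (\<phi> n) (X (r n))" for n by (simp add: \<phi>_def)
  have [measurable]: "\<phi> n \<in> borel_measurable borel" for n by (simp add: \<phi>_def)
  have fast: "norm (X (r m) - X (r n)) \<le> (1/2)^n" if "m \<ge> n" for m n
    using rX[of n "r m"] that r by (simp add: dist_norm strict_mono_less_eq)
  define w :: "real \<Rightarrow> complex" where "w x = complex_of_real (exp (- x\<^sup>2 / 2))" for x
  have [measurable]: "w \<in> borel_measurable borel" unfolding w_def by measurable
  have w: "represents w (abs_L2 w)"
    unfolding w_def by (intro represents_abs square_integrable_gaussian)
  let ?W = "norm (abs_L2 w)"
  define h where "h n x = cmod (\<phi> (Suc n) x - \<phi> n x) * cmod (w x)" for n x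
  have [measurable]: "h n \<in> borel_measurable borel" for n unfolding h_def by measurable
  have "(\<integral>\<^sup>+x. (\<Sum>n. ennreal (h n x)) \<partial>lborel) = (\<Sum>n. \<integral>\<^sup>+x. ennreal (h n x) \<partial>lborel)"
    by (intro nn_integral_suminf) auto
  also have "\<dots> \<le> (\<Sum>n. ennreal ((1/2)^n * ?W))"
  proof (intro suminf_le allI)
    fix n
    have "(\<integral>\<^sup>+x. ennreal (h n x) \<partial>lborel) \<le> ennreal (norm (X (r (Suc n)) - X (r n)) * ?W)"
      unfolding h_def by (intro weighted_L1_bound represents_diff rep w)
    also have "\<dots> \<le> ennreal ((1/2)^n * ?W)"
      by (intro ennreal_leI mult_right_mono fast) auto
    finally show "(\<integral>\<^sup>+x. ennreal (h n x) \<partial>lborel) \<le> ennreal ((1/2)^n * ?W)" .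
  qed auto
  also have "\<dots> < \<infinity>"
  proof -
    have "summable (\<lambda>n. (1/2)^n * ?W)" by (intro summable_mult2 summable_geometric) auto
    then show ?thesis by (subst suminf_ennreal2) auto
  qed
  finally have "(\<integral>\<^sup>+x. (\<Sum>n. ennreal (h n x)) \<partial>lborel) \<noteq> \<infinity>" by simp
  then have "AE x in lborel. (\<Sum>n. ennreal (h n x)) \<noteq> \<infinity>"
    by (intro nn_integral_PInf_AE) auto
  then have conv: "AE x in lborel. convergent (\<lambda>n. \<phi> n x)"
  proof (rule eventually_mono)
    fix x assume "(\<Sum>n. ennreal (h n x)) \<noteq> \<infinity>"
    then have "summable (\<lambda>n. h n x)"
      by (intro summable_suminf_not_top) (auto simp: h_def)
    \<comment> \<open>The Gaussian weight has no zeros, so it can be divided out pointwise.\<close>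
    then have "summable (\<lambda>n. h n x / cmod (w x))" by (rule summable_divide)
    then have "summable (\<lambda>n. \<phi> (Suc n) x - \<phi> n x)"
      by (intro summable_norm_cancel[where f="\<lambda>n. \<phi> (Suc n) x - \<phi> n x"]) (simp add: h_def w_def)
    then have "convergent (\<lambda>n. \<Sum>i<n. \<phi> (Suc i) x - \<phi> i x)"
      by (simp add: summable_iff_convergent)
    then have "convergent (\<lambda>n. \<phi> n x - \<phi> 0 x)"
      by (simp only: sum_lessThan_telescope[of "\<lambda>i. \<phi> i x"])
    then show "convergent (\<lambda>n. \<phi> n x)"
      using convergent_diff_const_right_iff by blast
  qed
  define \<psi> where "\<psi> x = lim (\<lambda>n. \<phi> n x)" for x
  have [measurable]: "\<psi> \<in> borel_measurable borel"
    unfolding \<psi>_def by (rule borel_measurable_lim_metric) simp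
  have lim: "AE x in lborel. (\<lambda>n. \<phi> n x) \<longlonglongrightarrow> \<psi> x"
    using conv by eventually_elim (simp add: \<psi>_def convergent_LIMSEQ_iff)
  \<comment> \<open>Fatou's lemma in m turns the Cauchy estimate into an estimate for the distance
    to the pointwise limit.\<close>
  have bound: "(\<integral>\<^sup>+x. ennreal ((cmod (\<psi> x - \<phi> n x))\<^sup>2) \<partial>lborel) \<le> ennreal (((1/2)^n)\<^sup>2)" for n
  proof -
    have "(\<integral>\<^sup>+x. ennreal ((cmod (\<psi> x - \<phi> n x))\<^sup>2) \<partial>lborel)
        = (\<integral>\<^sup>+x. liminf (\<lambda>m. ennreal ((cmod (\<phi> m x - \<phi> n x))\<^sup>2)) \<partial>lborel)"
    proof (intro nn_integral_cong_AE, use lim in eventually_elim)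
      fix x assume "(\<lambda>m. \<phi> m x) \<longlonglongrightarrow> \<psi> x"
      then have "(\<lambda>m. ennreal ((cmod (\<phi> m x - \<phi> n x))\<^sup>2)) \<longlonglongrightarrow> ennreal ((cmod (\<psi> x - \<phi> n x))\<^sup>2)"
        by (intro tendsto_intros)
      then show "ennreal ((cmod (\<psi> x - \<phi> n x))\<^sup>2) = liminf (\<lambda>m. ennreal ((cmod (\<phi> m x - \<phi> n x))\<^sup>2))"
        by (intro lim_imp_Liminf[symmetric]) auto
    qed
    also have "\<dots> \<le> liminf (\<lambda>m. \<integral>\<^sup>+x. ennreal ((cmod (\<phi> m x - \<phi> n x))\<^sup>2) \<partial>lborel)"
      by (intro nn_integral_liminf) auto
    also have "\<dots> \<le> ennreal (((1/2)^n)\<^sup>2)"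
    proof (rule Liminf_le)
      show "\<forall>\<^sub>F m in sequentially. (\<integral>\<^sup>+x. ennreal ((cmod (\<phi> m x - \<phi> n x))\<^sup>2) \<partial>lborel) \<le> ennreal (((1/2)^n)\<^sup>2)"
        using eventually_ge_at_top[of n]
      proof eventually_elim
        fix m assume "n \<le> m"
        have "(\<integral>\<^sup>+x. ennreal ((cmod (\<phi> m x - \<phi> n x))\<^sup>2) \<partial>lborel) = ennreal ((norm (X (r m) - X (r n)))\<^sup>2)"
          by (intro nn_norm_represents[symmetric] represents_diff rep)
        also have "\<dots> \<le> ennreal (((1/2)^n)\<^sup>2)"
          using fast[OF \<open>n \<le> m\<close>] by (intro ennreal_leI power_mono) auto
        finally show "(\<integral>\<^sup>+x. ennreal ((cmod (\<phi> m x - \<phi> n x))\<^sup>2) \<partial>lborel) \<le> ennreal (((1/2)^n)\<^sup>2)" .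
      qed
    qed simp
    finally show ?thesis .
  qed
  have si: "square_integrable (\<lambda>x. \<psi> x - \<phi> n x)" for n
    unfolding square_integrable_def
    using bound[of n] by (auto intro!: integrableI_bounded simp: le_less_trans[OF _ ennreal_less_top])
  have "square_integrable (\<lambda>x. (\<psi> x - \<phi> 0 x) + \<phi> 0 x)"
    by (intro square_integrable_add si) (simp add: \<phi>_def)
  then have psi: "represents \<psi> (abs_L2 \<psi>)" by (simp add: represents_abs)
  have "norm (X (r n) - abs_L2 \<psi>) \<le> (1/2)^n" for n
  proof -
    have "ennreal ((norm (abs_L2 \<psi> - X (r n)))\<^sup>2) \<le> ennreal (((1/2)^n)\<^sup>2)"
      using bound[of n] nn_norm_represents[OF represents_diff[OF psi rep[of n]]] by simp
    then have "norm (abs_L2 \<psi> - X (r n)) \<le> (1/2)^n"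
      by (subst (asm) ennreal_le_iff) (auto intro: power2_le_imp_le)
    then show ?thesis by (simp add: norm_minus_commute)
  qed
  then have "(\<lambda>n. X (r n)) \<longlonglongrightarrow> abs_L2 \<psi>"
  proof -
    assume *: "\<And>n. norm (X (r n) - abs_L2 \<psi>) \<le> (1/2)^n"
    have "(\<lambda>n. X (r n) - abs_L2 \<psi>) \<longlonglongrightarrow> 0"
      by (rule Lim_null_comparison[where g="\<lambda>n. (1/2)^n"])
         (use * in \<open>auto intro: LIMSEQ_realpow_zero\<close>)
    then show ?thesis by (rule LIM_zero_cancel)
  qed
  then have "X \<longlonglongrightarrow> abs_L2 \<psi>"
    using Cauchy_converges_subseq[OF X r] by (simp add: o_def)
  then show "convergent X" by (auto simp: convergent_def)
qed

instance L2 :: banach ..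

section \<open>Orthogonality and density of complex subspaces\<close>

definition csubspace :: "L2 set \<Rightarrow> bool" where
  "csubspace V \<longleftrightarrow> 0 \<in> V \<and> (\<forall>x\<in>V. \<forall>y\<in>V. x + y \<in> V) \<and> (\<forall>c. \<forall>x\<in>V. c *\<^sub>C x \<in> V)"

lemma csubspace_diff: "csubspace V \<Longrightarrow> x \<in> V \<Longrightarrow> y \<in> V \<Longrightarrow> x - y \<in> V"
  unfolding csubspace_def by (metis cvec.scale_left_imp_eq cvec.scale_minus_left cvec.scale_one diff_conv_add_uminus)

text \<open>A minimising sequence for the distance from a point y outside V is Cauchy by the
  parallelogram law. Its limit u is the nearest point, and the first variation of the distance at u
  makes y - u orthogonal to V.\<close>

lemma orthogonal_vector_exists:
  assumes V: "csubspace V" "closed V" and "V \<noteq> UNIV"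
  shows "\<exists>x. x \<noteq> 0 \<and> (\<forall>v\<in>V. cinner v x = 0)"
proof -
  obtain y where y: "y \<notin> V" using assms by auto
  have ne: "V \<noteq> {}" using V by (auto simp: csubspace_def)
  define d where "d = infdist y V"
  have d_le: "d \<le> norm (y - v)" if "v \<in> V" for v
    using that by (simp add: d_def infdist_le dist_norm[symmetric])
  have "\<exists>v\<in>V. norm (y - v) < d + 1 / (real n + 1)" for n :: nat
  proof (rule ccontr)
    assume "\<not> ?thesis"
    then have "d + 1 / (real n + 1) \<le> (INF v\<in>V. dist y v)"
      using ne by (intro cINF_greatest) (auto simp: not_less dist_norm)
    then have "d + 1 / (real n + 1) \<le> d"
      using ne by (simp add: d_def infdist_def)
    then show False by (simp add: field_simps)
  qed
  then have "\<forall>n::nat. \<exists>v. v \<in> V \<and> norm (y - v) < d + 1 / (real n + 1)" by blast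
  then obtain v where v: "\<And>n::nat. v n \<in> V" "\<And>n. norm (y - v n) < d + 1 / (real n + 1)"
    using choice[of "\<lambda>n v. v \<in> V \<and> norm (y - v) < d + 1 / (real n + 1)"] by blast
  have lim_d: "(\<lambda>n. (norm (y - v n))\<^sup>2) \<longlonglongrightarrow> d\<^sup>2"
  proof (rule tendsto_power, rule tendsto_sandwich[of "\<lambda>_. d" _ _ "\<lambda>n. d + 1 / (real n + 1)"])
    show "(\<lambda>n. d + 1 / (real n + 1)) \<longlonglongrightarrow> d" by real_asymp
  qed (simp_all add: d_le v(1) less_imp_le[OF v(2)])
  \<comment> \<open>The midpoint of \<open>v m\<close> and \<open>v n\<close> lies in V and so has
    distance at least d from y; the parallelogram law then bounds the difference.\<close>
  have par: "(norm (v m - v n))\<^sup>2 \<le> 2 * ((norm (y - v m))\<^sup>2 - d\<^sup>2) + 2 * ((norm (y - v n))\<^sup>2 - d\<^sup>2)" for m n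
  proof -
    define a b where "a = y - v m" and "b = y - v n"
    have "(1/2) *\<^sub>C (v m + v n) \<in> V" using V v(1) by (auto simp: csubspace_def)
    then have "d \<le> norm (y - (1/2) *\<^sub>C (v m + v n))" by (rule d_le)
    also have "y - (1/2) *\<^sub>C (v m + v n) = (1/2) *\<^sub>R (a + b)"
    proof -
      have "(1/2) *\<^sub>C (y + y) = y"
        by (simp add: cvec.scale_right_distrib flip: cvec.scale_left_distrib)
      moreover have "a + b = (y + y) - (v m + v n)" by (simp add: a_def b_def)
      ultimately show ?thesis
        by (simp only: scaleR_scaleC cvec.scale_right_diff_distrib) simp
    qed
    finally have "2 * d \<le> norm (a + b)" by simp
    then have "4 * d\<^sup>2 \<le> (norm (a + b))\<^sup>2"
      using power_mono[of "2 * d" "norm (a + b)" 2] by (simp add: power_mult_distrib d_def infdist_nonneg)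
    moreover have "(norm (a + b))\<^sup>2 + (norm (a - b))\<^sup>2 = 2 * (norm a)\<^sup>2 + 2 * (norm b)\<^sup>2"
      by (simp add: power2_norm_eq_inner inner_add_left inner_add_right inner_diff_left inner_diff_right inner_commute)
    moreover have "norm (v m - v n) = norm (a - b)"
      using norm_minus_cancel[of "a - b"] by (simp add: a_def b_def)
    ultimately show ?thesis
      unfolding a_def[symmetric] b_def[symmetric] by simp
  qed
  have "Cauchy v"
  proof (rule metric_CauchyI)
    fix e :: real assume "e > 0"
    have "(\<lambda>n. (norm (y - v n))\<^sup>2 - d\<^sup>2) \<longlonglongrightarrow> 0" using lim_d by (simp add: LIM_zero)
    then have "\<forall>\<^sub>F n in sequentially. (norm (y - v n))\<^sup>2 - d\<^sup>2 < e\<^sup>2 / 4"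
      using \<open>e > 0\<close> by (intro order_tendstoD) auto
    then obtain N where N: "\<And>n. n \<ge> N \<Longrightarrow> (norm (y - v n))\<^sup>2 - d\<^sup>2 < e\<^sup>2 / 4"
      by (auto simp: eventually_sequentially)
    show "\<exists>M. \<forall>m\<ge>M. \<forall>n\<ge>M. dist (v m) (v n) < e"
    proof (intro exI allI impI)
      fix m n assume "m \<ge> N" "n \<ge> N"
      then have "(norm (y - v m))\<^sup>2 - d\<^sup>2 < e\<^sup>2 / 4" "(norm (y - v n))\<^sup>2 - d\<^sup>2 < e\<^sup>2 / 4"
        using N by blast+
      moreover have "c < E" if "c \<le> 2 * a + 2 * b" "a < E / 4" "b < E / 4" for a b c E :: real
        using that by simp
      ultimately have "(norm (v m - v n))\<^sup>2 < e\<^sup>2" using par[of m n] by blast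
      then show "dist (v m) (v n) < e" using \<open>e > 0\<close>
        by (simp add: dist_norm power2_less_imp_less)
    qed
  qed
  then obtain u where u: "v \<longlonglongrightarrow> u" using Cauchy_convergent convergent_def by blast
  have uV: "u \<in> V" using closed_sequentially[OF V(2) _ u] v(1) by auto
  define x where "x = y - u"
  have "(\<lambda>n. (norm (y - v n))\<^sup>2) \<longlonglongrightarrow> (norm x)\<^sup>2" unfolding x_def by (intro tendsto_intros u)
  then have xd: "(norm x)\<^sup>2 = d\<^sup>2" using lim_d LIMSEQ_unique by blast
  have re0: "inner x w = 0" if w: "w \<in> V" for w
  proof -
    have *: "0 \<le> t\<^sup>2 * (norm w)\<^sup>2 - 2 * t * inner x w" for t :: real
    proof -
      have "u + t *\<^sub>R w \<in> V" using V uV w by (auto simp: csubspace_def scaleR_scaleC)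
      then have "d \<le> norm (y - (u + t *\<^sub>R w))" by (rule d_le)
      then have "d\<^sup>2 \<le> (norm (x - t *\<^sub>R w))\<^sup>2"
        by (intro power_mono) (auto simp: d_def infdist_nonneg x_def algebra_simps)
      then show ?thesis
        unfolding xd[symmetric] power2_norm_eq_inner
        by (simp add: inner_diff_left inner_diff_right inner_commute power2_eq_square algebra_simps)
    qed
    show ?thesis
    proof (cases "w = 0")
      case False
      show ?thesis
      proof -
        \<comment> \<open>The minimiser of the quadratic polynomial in t; there its value is minus
          the quotient below.\<close>
        define t where "t = inner x w / (norm w)\<^sup>2"
        have "t\<^sup>2 * (norm w)\<^sup>2 = (inner x w)\<^sup>2 / (norm w)\<^sup>2"
          "2 * t * inner x w = 2 * ((inner x w)\<^sup>2 / (norm w)\<^sup>2)"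
          using False by (simp_all add: t_def power2_eq_square)
        then have "(inner x w)\<^sup>2 / (norm w)\<^sup>2 \<le> 0"
          using *[of t] by linarith
        then show "inner x w = 0" using False by (simp add: divide_le_0_iff)
      qed
    qed simp
  qed
  show ?thesis
  proof (intro exI[of _ x] conjI ballI)
    show "x \<noteq> 0" using y uV by (auto simp: x_def)
    fix w assume w: "w \<in> V"
    have "Re (cinner x w) = 0" using re0[OF w] by (simp add: inner_L2_def)
    \<comment> \<open>Varying along w controls only the real part; the variation along i w supplies
      the imaginary part.\<close>
    moreover have "Re (cinner x (\<i> *\<^sub>C w)) = 0"
      using re0[of "\<i> *\<^sub>C w"] V w by (simp add: inner_L2_def csubspace_def)
    ultimately have "cinner x w = 0" by (simp add: complex_eq_iff)
    then show "cinner w x = 0" by (subst cinner_commute) simp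
  qed
qed

lemma csubspace_closure:
  assumes "csubspace V" shows "csubspace (closure V)"
  unfolding csubspace_def
proof (intro conjI ballI allI)
  show "0 \<in> closure V" using assms closure_subset by (auto simp: csubspace_def)
  fix x y assume "x \<in> closure V" "y \<in> closure V"
  then obtain u v where "\<And>n::nat. u n \<in> V" "u \<longlonglongrightarrow> x" "\<And>n::nat. v n \<in> V" "v \<longlonglongrightarrow> y"
    unfolding closure_sequential by blast
  then have "\<And>n. u n + v n \<in> V" "(\<lambda>n. u n + v n) \<longlonglongrightarrow> x + y"
    using assms by (auto simp: csubspace_def intro: tendsto_add)
  then show "x + y \<in> closure V"
    unfolding closure_sequential by (intro exI[of _ "\<lambda>n. u n + v n"]) simp
next
  fix c x assume "x \<in> closure V"
  then obtain u where "\<And>n::nat. u n \<in> V" "u \<longlonglongrightarrow> x"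
    unfolding closure_sequential by blast
  then have "\<And>n. c *\<^sub>C u n \<in> V" "(\<lambda>n. c *\<^sub>C u n) \<longlonglongrightarrow> c *\<^sub>C x"
    using assms by (auto simp: csubspace_def intro: tendsto_scaleC)
  then show "c *\<^sub>C x \<in> closure V"
    unfolding closure_sequential by (intro exI[of _ "\<lambda>n. c *\<^sub>C u n"]) simp
qed

lemma csubspace_dense:
  assumes "csubspace V" "\<And>x. (\<And>v. v \<in> V \<Longrightarrow> cinner v x = 0) \<Longrightarrow> x = 0"
  shows "closure V = UNIV"
proof (rule ccontr)
  assume "closure V \<noteq> UNIV"
  then obtain x where x: "x \<noteq> 0" "\<forall>v\<in>closure V. cinner v x = 0"
    using orthogonal_vector_exists[OF csubspace_closure[OF assms(1)] closed_closure]
    by auto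
  have "x = 0"
    using x(2) closure_subset[of V] by (intro assms(2)) auto
  with x(1) show False by simp
qed

section \<open>The Fourier transform on \<open>L2\<close>\<close>

subsection \<open>Fourier integrals of integrable functions\<close>

lemma borel_measurable_cnj [measurable]:
  "f \<in> borel_measurable M \<Longrightarrow> (\<lambda>x. cnj (f x)) \<in> borel_measurable M"
  by (intro borel_measurable_continuous_on[of cnj] continuous_intros)

lemma integrable_fourier_kernel:
  "integrable lborel \<phi> \<Longrightarrow> integrable lborel (\<lambda>x. exp (- \<i> * complex_of_real (p * x)) * \<phi> x)"
  by (rule Bochner_Integration.integrable_bound[where f=\<phi>])
     (auto simp: norm_mult intro!: borel_measurable_times)

lemma fourier_integral_cong_AE:
  assumes "integrable lborel \<phi>" "\<psi> \<in> borel_measurable borel" "AE x in lborel. \<phi> x = \<psi> x"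
  shows "fourier_integral \<phi> = fourier_integral \<psi>"
proof
  fix p
  have "(LINT x|lborel. exp (- \<i> * of_real (p * x)) * \<phi> x) = (LINT x|lborel. exp (- \<i> * of_real (p * x)) * \<psi> x)"
  proof (rule integral_cong_AE)
    have [measurable]: "\<phi> \<in> borel_measurable borel"
      using assms(1) by (simp add: borel_measurable_integrable[of lborel, simplified])
    note [measurable] = assms(2)
    show "(\<lambda>x. exp (- \<i> * of_real (p * x)) * \<phi> x) \<in> borel_measurable lborel" by measurable
    show "(\<lambda>x. exp (- \<i> * of_real (p * x)) * \<psi> x) \<in> borel_measurable lborel" by measurable
  qed (use assms(3) in auto)
  then show "fourier_integral \<phi> p = fourier_integral \<psi> p" by (simp add: fourier_integral_def)
qed

lemma fourier_integral_add:
  assumes "integrable lborel \<phi>" "integrable lborel \<psi>"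
  shows "fourier_integral (\<lambda>x. \<phi> x + \<psi> x) p = fourier_integral \<phi> p + fourier_integral \<psi> p"
  using Bochner_Integration.integral_add[OF integrable_fourier_kernel[OF assms(1)] integrable_fourier_kernel[OF assms(2)]]
  by (simp only: fourier_integral_def distrib_left)

lemma fourier_integral_scale:
  "fourier_integral (\<lambda>x. c * \<phi> x) p = c * fourier_integral \<phi> p"
proof -
  have "(LINT x|lborel. exp (- \<i> * of_real (p * x)) * (c * \<phi> x)) = c * (LINT x|lborel. exp (- \<i> * of_real (p * x)) * \<phi> x)"
    by (subst integral_mult_right_zero[symmetric]) (simp add: mult_ac)
  then show ?thesis by (simp add: fourier_integral_def)
qed

lemma norm_fourier_integral_le:
  assumes "integrable lborel \<phi>"
  shows "cmod (fourier_integral \<phi> p) \<le> (2 * pi) powr (- 1/2) * (LINT x|lborel. cmod (\<phi> x))"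
proof -
  have "cmod (LINT x|lborel. exp (- \<i> * of_real (p * x)) * \<phi> x) \<le> (LINT x|lborel. cmod (exp (- \<i> * of_real (p * x)) * \<phi> x))"
    by (rule integral_norm_bound)
  also have "\<dots> = (LINT x|lborel. cmod (\<phi> x))" by (simp add: norm_mult)
  finally show ?thesis by (simp add: fourier_integral_def norm_mult mult_left_mono)
qed

lemma borel_measurable_fourier_integral [measurable]:
  assumes "integrable lborel \<phi>"
  shows "fourier_integral \<phi> \<in> borel_measurable borel"
proof -
  have [measurable]: "\<phi> \<in> borel_measurable borel"
    using assms by (simp add: borel_measurable_integrable[of lborel, simplified])
  have "(\<lambda>(p, x). exp (- \<i> * complex_of_real (p * x))) \<in> borel_measurable (borel \<Otimes>\<^sub>M borel)"
    unfolding borel_prod by (intro borel_measurable_continuous_onI) (auto intro!: continuous_intros simp: case_prod_beta)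
  then have "(\<lambda>(p, x). exp (- \<i> * complex_of_real (p * x)) * \<phi> x) \<in> borel_measurable (borel \<Otimes>\<^sub>M borel)"
    unfolding case_prod_beta by measurable
  then have "(\<lambda>(p, x). exp (- \<i> * complex_of_real (p * x)) * \<phi> x) \<in> borel_measurable (borel \<Otimes>\<^sub>M lborel)"
    by (simp add: measurable_cong_sets[OF sets_pair_measure_cong[OF refl sets_lborel] refl])
  then have "(\<lambda>p. LINT x|lborel. exp (- \<i> * complex_of_real (p * x)) * \<phi> x) \<in> borel_measurable borel"
    by (rule lborel.borel_measurable_lebesgue_integral)
  then show ?thesis unfolding fourier_integral_def by measurable
qed

text \<open>Fubini, the kernel being symmetric in p and x. With a Gaussian packet as one factor this
  is the source of Plancherel's identity, of the agreement with the integral on integrable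
  functions, and of the inversion formula.\<close>

lemma fourier_multiplication_formula:
  assumes "integrable lborel \<phi>" "integrable lborel \<psi>"
  shows "(LINT p|lborel. fourier_integral \<phi> p * \<psi> p) = (LINT x|lborel. \<phi> x * fourier_integral \<psi> x)"
proof -
  have [measurable]: "\<phi> \<in> borel_measurable borel" "\<psi> \<in> borel_measurable borel"
    using assms by (simp_all add: borel_measurable_integrable[of lborel, simplified])
  define K where "K = (\<lambda>(p, x). exp (- \<i> * complex_of_real (p * x)) * \<phi> x * \<psi> p)"
  have "(\<lambda>(p, x). exp (- \<i> * complex_of_real (p * x))) \<in> borel_measurable (borel \<Otimes>\<^sub>M borel)"
    unfolding borel_prod by (intro borel_measurable_continuous_onI) (auto intro!: continuous_intros simp: case_prod_beta)
  then have "K \<in> borel_measurable (borel \<Otimes>\<^sub>M borel)"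
    unfolding K_def case_prod_beta by measurable
  then have K: "K \<in> borel_measurable (lborel \<Otimes>\<^sub>M lborel)"
    by (simp add: measurable_cong_sets[OF sets_pair_measure_cong[OF sets_lborel sets_lborel] refl])
  have "integrable (lborel \<Otimes>\<^sub>M lborel) K"
  proof (rule lborel_pair.Fubini_integrable[OF K])
    have "(LINT x|lborel. cmod (K (p, x))) = (LINT x|lborel. cmod (\<phi> x)) * cmod (\<psi> p)" for p
      by (simp add: K_def norm_mult)
    then show "integrable lborel (\<lambda>p. LINT x|lborel. cmod (K (p, x)))"
      using assms by simp
    show "AE p in lborel. integrable lborel (\<lambda>x. K (p, x))"
      using integrable_fourier_kernel[OF assms(1)] by (simp add: K_def)
  qed
  then have "(LINT x|lborel. LINT p|lborel. K (p, x)) = (LINT p|lborel. LINT x|lborel. K (p, x))"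
    by (intro lborel_pair.Fubini_integral) (simp add: case_prod_eta)
  moreover have "(LINT p|lborel. K (p, x)) = \<phi> x * (LINT p|lborel. exp (- \<i> * complex_of_real (x * p)) * \<psi> p)" for x
    unfolding K_def by (subst integral_mult_right_zero[symmetric]) (simp add: mult_ac)
  moreover have "(LINT x|lborel. K (p, x)) = (LINT x|lborel. exp (- \<i> * complex_of_real (p * x)) * \<phi> x) * \<psi> p" for p
    unfolding K_def by simp
  ultimately have "(LINT p|lborel. (LINT x|lborel. exp (- \<i> * complex_of_real (p * x)) * \<phi> x) * \<psi> p)
     = (LINT x|lborel. \<phi> x * (LINT p|lborel. exp (- \<i> * complex_of_real (x * p)) * \<psi> p))" by simp
  then show ?thesis
    unfolding fourier_integral_def
    by (simp only: mult.assoc mult.left_commute[of "\<phi> _"] integral_mult_right_zero)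
qed

text \<open>After normalisation the positive and negative parts are densities of two probability
  measures with equal characteristic functions, and Levy's uniqueness theorem identifies
  them.\<close>

lemma AE_zero_if_char_zero_real:
  fixes h :: "real \<Rightarrow> real"
  assumes h: "integrable lborel h"
    and z: "\<And>t. (LINT x|lborel. iexp (t * x) * complex_of_real (h x)) = 0"
  shows "AE x in lborel. h x = 0"
proof -
  have [measurable]: "h \<in> borel_measurable borel"
    using h by (simp add: borel_measurable_integrable[of lborel, simplified])
  define hp where "hp x = max 0 (h x)" for x
  define hm where "hm x = max 0 (- h x)" for x
  have [measurable]: "hp \<in> borel_measurable borel" "hm \<in> borel_measurable borel"
    unfolding hp_def hm_def by measurable
  have int: "integrable lborel hp" "integrable lborel hm"
    unfolding hp_def hm_def by (intro integrable_max h integrable_minus integrable_zero)+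
  have diff: "h x = hp x - hm x" for x by (auto simp: hp_def hm_def)
  have nn: "hp x \<ge> 0" "hm x \<ge> 0" for x by (auto simp: hp_def hm_def)
  have intc: "integrable lborel (\<lambda>x. iexp (t * x) * complex_of_real (hp x))"
    "integrable lborel (\<lambda>x. iexp (t * x) * complex_of_real (hm x))" for t
    by (rule Bochner_Integration.integrable_bound[OF int(1)] Bochner_Integration.integrable_bound[OF int(2)];
        simp add: norm_mult)+
  have eq: "(LINT x|lborel. iexp (t * x) * complex_of_real (hp x)) = (LINT x|lborel. iexp (t * x) * complex_of_real (hm x))" for t
    using z[of t] Bochner_Integration.integral_diff[OF intc[of t]]
    by (simp add: diff right_diff_distrib)
  define m where "m = (LINT x|lborel. hp x)"
  \<comment> \<open>Frequency 0 says that both parts have the same mass, so one constant normalises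
    both.\<close>
  have m2: "m = (LINT x|lborel. hm x)"
    using eq[of 0] by (simp add: m_def)
  have "m \<ge> 0" unfolding m_def using nn by simp
  show ?thesis
  proof (cases "m = 0")
    case True
    then have "AE x in lborel. hp x = 0" "AE x in lborel. hm x = 0"
      using integral_nonneg_eq_0_iff_AE[OF int(1)] integral_nonneg_eq_0_iff_AE[OF int(2)] nn m2 m_def by auto
    then show ?thesis by eventually_elim (simp add: diff)
  next
    case False
    then have m: "m > 0" using \<open>m \<ge> 0\<close> by simp
    have rd: "real_distribution (density lborel (\<lambda>x. ennreal (g x / m)))"
      if g: "integrable lborel g" "\<And>x. g x \<ge> 0" "m = (LINT x|lborel. g x)" for g :: "real \<Rightarrow> real"
    proof -
      have [measurable]: "g \<in> borel_measurable borel"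
        using g(1) by (simp add: borel_measurable_integrable[of lborel, simplified])
      have "(\<integral>\<^sup>+x. ennreal (g x / m) \<partial>lborel) = ennreal (LINT x|lborel. g x / m)"
        using g m by (intro nn_integral_eq_integral) auto
      also have "\<dots> = 1" using g m by simp
      finally have "prob_space (density lborel (\<lambda>x. ennreal (g x / m)))"
        by (intro prob_spaceI) (simp add: emeasure_density)
      then show ?thesis
        by (simp add: real_distribution_def real_distribution_axioms_def)
    qed
    have ch: "char (density lborel (\<lambda>x. ennreal (g x / m))) t = (LINT x|lborel. iexp (t * x) * complex_of_real (g x)) / m"
      if g: "g \<in> borel_measurable borel" "\<And>x. g x \<ge> 0" for g :: "real \<Rightarrow> real" and t
    proof -
      note [measurable] = g(1)
      have "char (density lborel (\<lambda>x. ennreal (g x / m))) t = (LINT x|lborel. (g x / m) *\<^sub>R iexp (t * x))"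
        unfolding char_def using g m by (subst integral_density) auto
      also have "\<dots> = (LINT x|lborel. iexp (t * x) * complex_of_real (g x) / complex_of_real m)"
        by (intro Bochner_Integration.integral_cong) (auto simp: scaleR_conv_of_real)
      finally show ?thesis by simp
    qed
    have "density lborel (\<lambda>x. ennreal (hp x / m)) = density lborel (\<lambda>x. ennreal (hm x / m))"
    proof (rule Levy_uniqueness)
      show "real_distribution (density lborel (\<lambda>x. ennreal (hp x / m)))"
        by (rule rd[OF int(1) nn(1) m_def])
      show "real_distribution (density lborel (\<lambda>x. ennreal (hm x / m)))"
        by (rule rd[OF int(2) nn(2) m2])
      show "char (density lborel (\<lambda>x. ennreal (hp x / m))) = char (density lborel (\<lambda>x. ennreal (hm x / m)))"
        by (rule ext) (simp add: ch nn eq del: of_real_mult)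
    qed
    then have "AE x in lborel. ennreal (hp x / m) = ennreal (hm x / m)"
      by (rule sigma_finite_measure.density_unique[OF lborel.sigma_finite_measure_axioms, rotated 2]) auto
    then show ?thesis
    proof eventually_elim
      fix x assume "ennreal (hp x / m) = ennreal (hm x / m)"
      then have "hp x / m = hm x / m"
        by (subst (asm) ennreal_inj) (use nn m in auto)
      then show "h x = 0" using m by (simp add: diff)
    qed
  qed
qed

text \<open>The transform of the conjugate at t is the conjugate of the transform at -t, so the real
  and imaginary parts also have vanishing transforms.\<close>

lemma AE_zero_if_char_zero:
  fixes h :: "real \<Rightarrow> complex"
  assumes h: "integrable lborel h"
    and z: "\<And>t. (LINT x|lborel. iexp (t * x) * h x) = 0"
  shows "AE x in lborel. h x = 0"
proof -
  have [measurable]: "h \<in> borel_measurable borel"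
    using h by (simp add: borel_measurable_integrable[of lborel, simplified])
  have re: "complex_of_real (Re z) = (z + cnj z) / 2" and im: "complex_of_real (Im z) = (z - cnj z) / (2 * \<i>)" for z
    by (simp_all add: complex_eq_iff)
  have int: "integrable lborel (\<lambda>x. iexp (t * x) * h x)" "integrable lborel (\<lambda>x. iexp (t * x) * cnj (h x))" for t
    by (rule Bochner_Integration.integrable_bound[OF h]; simp add: norm_mult)+
  have zc: "(LINT x|lborel. iexp (t * x) * cnj (h x)) = 0" for t
  proof -
    have "(LINT x|lborel. iexp (t * x) * cnj (h x)) = (LINT x|lborel. cnj (iexp ((- t) * x) * h x))"
      by (intro Bochner_Integration.integral_cong) (auto simp: exp_cnj)
    also have "\<dots> = 0" using z[of "- t"] by (simp only: Bochner_Integration.integral_cnj) simp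
    finally show ?thesis .
  qed
  have "AE x in lborel. Re (h x) = 0"
  proof (rule AE_zero_if_char_zero_real)
    show "integrable lborel (\<lambda>x. Re (h x))" using h by (rule integrable_Re)
    fix t
    have "(LINT x|lborel. iexp (t * x) * complex_of_real (Re (h x))) =
       (LINT x|lborel. (iexp (t * x) * h x + iexp (t * x) * cnj (h x)) / 2)"
      by (intro Bochner_Integration.integral_cong)
         (simp_all only: re distrib_left add_divide_distrib times_divide_eq_right)
    also have "\<dots> = 0" using z[of t] zc[of t] int[of t] by simp
    finally show "(LINT x|lborel. iexp (t * x) * complex_of_real (Re (h x))) = 0" .
  qed
  moreover have "AE x in lborel. Im (h x) = 0"
  proof (rule AE_zero_if_char_zero_real)
    show "integrable lborel (\<lambda>x. Im (h x))" using h by (rule integrable_Im)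
    fix t
    have "(LINT x|lborel. iexp (t * x) * complex_of_real (Im (h x))) =
       (LINT x|lborel. (iexp (t * x) * h x - iexp (t * x) * cnj (h x)) / (2 * \<i>))"
      by (intro Bochner_Integration.integral_cong)
         (simp_all only: im right_diff_distrib diff_divide_distrib times_divide_eq_right)
    also have "\<dots> = 0" using z[of t] zc[of t] int[of t] by simp
    finally show "(LINT x|lborel. iexp (t * x) * complex_of_real (Im (h x))) = 0" .
  qed
  ultimately show ?thesis by eventually_elim (simp add: complex_eq_iff)
qed

subsection \<open>Gaussian wave packets\<close>

text \<open>Up to a phase, the Fourier transform maps the packet at position \<open>a\<close> with momentum \<open>b\<close> to the
  packet at position \<open>b\<close> with momentum \<open>- a\<close>.\<close>

definition gwave :: "real \<Rightarrow> real \<Rightarrow> real \<Rightarrow> complex" where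
  "gwave a b x = exp (\<i> * of_real (b * x)) * of_real (exp (- (x - a)\<^sup>2 / 2))"

lemma gwave_measurable [measurable]: "gwave a b \<in> borel_measurable borel"
  unfolding gwave_def by (intro borel_measurable_continuous_onI continuous_intros) auto

lemma norm_gwave: "cmod (gwave a b x) = exp (- (x - a)\<^sup>2 / 2)"
  by (simp add: gwave_def norm_mult)

lemma gwave_nonzero [simp]: "gwave a b x \<noteq> 0"
  by (simp add: gwave_def)

lemma cnj_gwave: "cnj (gwave a b x) = gwave a (- b) x"
  by (simp add: gwave_def exp_cnj)

lemma integrable_shifted_gaussian: "integrable lborel (\<lambda>x::real. exp (- (x - a)\<^sup>2 / 2))"
  using lborel_integrable_real_affine[OF integral_gaussian, of 1 "- a"] by simp

lemma integrable_gwave: "integrable lborel (gwave a b)"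
  by (rule Bochner_Integration.integrable_bound[OF integrable_shifted_gaussian[of a]])
     (simp_all add: norm_gwave)

lemma square_integrable_gwave: "square_integrable (gwave a b)"
  unfolding square_integrable_def
proof
  show "integrable lborel (\<lambda>x. (cmod (gwave a b x))\<^sup>2)"
    by (rule Bochner_Integration.integrable_bound[OF integrable_shifted_gaussian[of a]])
       (auto simp: norm_gwave power2_eq_square simp flip: exp_add)
qed simp

lemma two_pi_powr: "(2 * pi) powr (- 1/2) * sqrt (2 * pi) = 1" "(2 * pi) powr (- 1/2) > 0"
proof -
  have "(2 * pi) powr (- 1/2) = inverse (sqrt (2 * pi))"
    by (simp add: powr_minus powr_half_sqrt flip: minus_divide_left)
  then show "(2 * pi) powr (- 1/2) * sqrt (2 * pi) = 1" "(2 * pi) powr (- 1/2) > 0" by simp_all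
qed

lemma integral_gaussian_char:
  "(LINT x|lborel. iexp (t * x) * complex_of_real (exp (- x\<^sup>2 / 2))) = complex_of_real (sqrt (2 * pi) * exp (- t\<^sup>2 / 2))"
proof -
  have "complex_of_real (exp (- t\<^sup>2 / 2)) = char std_normal_distribution t"
    by (simp add: char_std_normal_distribution)
  also have "\<dots> = (LINT x|lborel. std_normal_density x *\<^sub>R iexp (t * x))"
    unfolding char_def by (subst integral_density) auto
  also have "\<dots> = (LINT x|lborel. (iexp (t * x) * complex_of_real (exp (- x\<^sup>2 / 2))) / complex_of_real (sqrt (2 * pi)))"
    by (intro Bochner_Integration.integral_cong) (auto simp: std_normal_density_def scaleR_conv_of_real)
  finally show ?thesis by (simp add: field_simps)
qed

lemma fourier_integral_gwave: "fourier_integral (gwave a b) p = exp (\<i> * of_real (a * b)) * gwave b (- a) p"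
proof -
  have "(LINT x|lborel. exp (- \<i> * of_real (p * x)) * gwave a b x)
     = (LINT x|lborel. exp (- \<i> * of_real (p * (a + 1 * x))) * gwave a b (a + 1 * x))"
    by (subst lborel_integral_real_affine[of 1 _ a]) auto
  also have "\<dots> = (LINT x|lborel. exp (\<i> * of_real ((b - p) * a)) * (iexp ((b - p) * x) * complex_of_real (exp (- x\<^sup>2 / 2))))"
    by (intro Bochner_Integration.integral_cong) (auto simp: gwave_def algebra_simps simp flip: exp_add)
  also have "\<dots> = exp (\<i> * of_real ((b - p) * a)) * complex_of_real (sqrt (2 * pi) * exp (- (b - p)\<^sup>2 / 2))"
    by (simp only: integral_mult_right_zero integral_gaussian_char)
  finally have "fourier_integral (gwave a b) p = exp (\<i> * of_real ((b - p) * a)) *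
     complex_of_real (((2 * pi) powr (- 1/2) * sqrt (2 * pi)) * exp (- (b - p)\<^sup>2 / 2))"
    unfolding fourier_integral_def by (simp add: mult_ac)
  moreover have "exp (\<i> * of_real ((b - p) * a)) = exp (\<i> * of_real (a * b)) * exp (\<i> * of_real (- a * p))"
    by (simp add: algebra_simps flip: exp_add)
  ultimately show ?thesis
    unfolding two_pi_powr gwave_def power2_commute[of b p] by (simp only: mult_1_left mult.assoc)
qed

definition gw :: "real \<Rightarrow> real \<Rightarrow> L2" where
  "gw a b = abs_L2 (gwave a b)"

lemma represents_gw: "represents (gwave a b) (gw a b)"
  unfolding gw_def by (intro represents_abs square_integrable_gwave)

text \<open>Plancherel's identity on packets. Up to a phase, the conjugate of the packet (a, b) is
  the transform of the packet (b, a), and the multiplication formula moves this transform to the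
  other factor.\<close>

lemma cinner_gw_fourier:
  "cinner (exp (\<i> * of_real (a * b)) *\<^sub>C gw b (- a)) (exp (\<i> * of_real (c * d)) *\<^sub>C gw d (- c)) = cinner (gw a b) (gw c d)"
proof -
  have "cinner (gw a b) (gw c d) = (LINT x|lborel. gwave a (- b) x * gwave c d x)"
    by (simp add: cinner_represents[OF represents_gw represents_gw] cnj_gwave)
  also have "\<dots> = (LINT x|lborel. exp (- (\<i> * of_real (a * b))) * (fourier_integral (gwave b a) x * gwave c d x))"
    by (intro Bochner_Integration.integral_cong) (auto simp: fourier_integral_gwave exp_minus field_simps)
  also have "\<dots> = exp (- (\<i> * of_real (a * b))) * (LINT x|lborel. gwave b a x * fourier_integral (gwave c d) x)"
    by (simp only: integral_mult_right_zero fourier_multiplication_formula[OF integrable_gwave integrable_gwave])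
  also have "\<dots> = (LINT x|lborel. cnj (exp (\<i> * of_real (a * b)) * gwave b (- a) x) * (exp (\<i> * of_real (c * d)) * gwave d (- c) x))"
    unfolding integral_mult_right_zero[symmetric]
    by (intro Bochner_Integration.integral_cong) (auto simp: fourier_integral_gwave cnj_gwave exp_cnj)
  also have "\<dots> = cinner (exp (\<i> * of_real (a * b)) *\<^sub>C gw b (- a)) (exp (\<i> * of_real (c * d)) *\<^sub>C gw d (- c))"
    by (intro cinner_represents[symmetric] represents_scaleC represents_gw)
  finally show ?thesis by simp
qed

text \<open>The momentum b acts as the Fourier variable for the function times a fixed Gaussian, and
  the Gaussian has no zeros. This tests functions that need not be integrable themselves, square
  integrable or bounded ones alike.\<close>

lemma AE_eq_if_gwave_integrals_eq:
  assumes u: "\<And>b. integrable lborel (\<lambda>x. gwave 0 b x * u x)" and v: "\<And>b. integrable lborel (\<lambda>x. gwave 0 b x * v x)"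
    and eq: "\<And>b. (LINT x|lborel. gwave 0 b x * u x) = (LINT x|lborel. gwave 0 b x * v x)"
  shows "AE x in lborel. u x = v x"
proof -
  define h where "h x = gwave 0 0 x * u x - gwave 0 0 x * v x" for x
  have "AE x in lborel. h x = 0"
  proof (rule AE_zero_if_char_zero)
    show "integrable lborel h" unfolding h_def by (intro Bochner_Integration.integrable_diff u v)
    fix t
    have "(LINT x|lborel. iexp (t * x) * h x) = (LINT x|lborel. gwave 0 t x * u x - gwave 0 t x * v x)"
      by (intro Bochner_Integration.integral_cong) (auto simp: h_def gwave_def algebra_simps)
    also have "\<dots> = 0" by (simp add: u v eq)
    finally show "(LINT x|lborel. iexp (t * x) * h x) = 0" .
  qed
  then show ?thesis
    by eventually_elim (simp add: h_def flip: right_diff_distrib)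
qed

lemma integrable_gwave_mult_L2:
  "square_integrable u \<Longrightarrow> integrable lborel (\<lambda>x. gwave a b x * u x)"
  using square_integrable_integrable_mult[OF square_integrable_gwave, of u a "- b"] by (simp add: cnj_gwave)

lemma integrable_gwave_mult_bounded:
  assumes [measurable]: "v \<in> borel_measurable borel" and "\<And>x. cmod (v x) \<le> C"
  shows "integrable lborel (\<lambda>x. gwave a b x * v x)"
  by (rule Bochner_Integration.integrable_bound[OF integrable_mult_right[OF integrable_gwave[of a b], of "complex_of_real C"]])
     (use assms in \<open>auto simp: norm_mult mult.commute[of "cmod (gwave _ _ _)"]
        intro!: always_eventually mult_right_mono order_trans[OF _ abs_ge_self]\<close>)

text \<open>The linear span of the packets, generated one summand at a time so that linear
  statements follow by induction. The Fourier integral maps it into itself, because packets go to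
  multiples of packets.\<close>

inductive_set gspace :: "L2 set" where
  zero: "0 \<in> gspace"
| step: "f \<in> gspace \<Longrightarrow> c *\<^sub>C gw a b + f \<in> gspace"

lemma gspace_add: "f \<in> gspace \<Longrightarrow> g \<in> gspace \<Longrightarrow> f + g \<in> gspace"
  by (induction rule: gspace.induct) (auto simp: add.assoc intro: gspace.intros)

lemma gspace_scaleC: "f \<in> gspace \<Longrightarrow> c *\<^sub>C f \<in> gspace"
  by (induction rule: gspace.induct) (auto simp: cvec.scale_right_distrib intro: gspace.intros)

lemma gw_in_gspace: "c *\<^sub>C gw a b \<in> gspace"
  using gspace.step[OF gspace.zero, of c a b] by simp

lemma csubspace_gspace: "csubspace gspace"
  by (auto simp: csubspace_def gspace.zero gspace_add gspace_scaleC)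

lemma closure_gspace: "closure gspace = UNIV"
proof (rule csubspace_dense[OF csubspace_gspace])
  fix x assume *: "\<And>v. v \<in> gspace \<Longrightarrow> cinner v x = 0"
  have "AE y in lborel. rep_L2 x y = 0"
  proof (rule AE_eq_if_gwave_integrals_eq)
    fix b
    have "cinner (gw 0 (- b)) x = 0" using *[OF gw_in_gspace[of 1]] by simp
    then show "(LINT y|lborel. gwave 0 b y * rep_L2 x y) = (LINT y|lborel. gwave 0 b y * 0)"
      by (simp add: cinner_represents[OF represents_gw represents_rep] cnj_gwave)
  qed (auto intro: integrable_gwave_mult_L2)
  then show "x = 0" by (rule represents_eqI[OF represents_rep represents_zero])
qed

lemma gspace_dense_closed:
  assumes "closed S" "gspace \<subseteq> S" shows "x \<in> S"
  using closure_minimal[OF assms(2,1)] closure_gspace by auto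

subsection \<open>Plancherel's theorem\<close>

text \<open>Meaningful on classes with an integrable representative whose transform is square
  integrable, in particular on \<open>gspace\<close>.\<close>

definition fourier0 :: "L2 \<Rightarrow> L2" where
  "fourier0 f = abs_L2 (fourier_integral (rep_L2 f))"

lemma represents_fourier0:
  assumes "represents \<phi> f" "integrable lborel \<phi>" "square_integrable (fourier_integral \<phi>)"
  shows "represents (fourier_integral \<phi>) (fourier0 f)"
proof -
  have "fourier_integral \<phi> = fourier_integral (rep_L2 f)"
    by (rule fourier_integral_cong_AE[OF assms(2) rep_measurable represents_AE_eq[OF assms(1) represents_rep]])
  then show ?thesis using assms(3) by (simp add: fourier0_def represents_def)
qed

lemma gspace_represents:
  assumes "f \<in> gspace"
  obtains \<phi> where "represents \<phi> f" "integrable lborel \<phi>" "represents (fourier_integral \<phi>) (fourier0 f)"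
proof -
  from assms have "\<exists>\<phi>. represents \<phi> f \<and> integrable lborel \<phi> \<and> square_integrable (fourier_integral \<phi>)"
  proof (induction rule: gspace.induct)
    case zero
    then show ?case
      by (intro exI[of _ "\<lambda>_. 0"]) (simp add: represents_zero fourier_integral_def)
  next
    case (step f c a b)
    then obtain \<phi> where \<phi>: "represents \<phi> f" "integrable lborel \<phi>" "square_integrable (fourier_integral \<phi>)" by blast
    have "fourier_integral (\<lambda>x. c * gwave a b x + \<phi> x) =
        (\<lambda>p. c * (exp (\<i> * of_real (a * b)) * gwave b (- a) p) + fourier_integral \<phi> p)"
      using \<phi>(2) by (auto simp: fourier_integral_add integrable_gwave fourier_integral_scale fourier_integral_gwave)
    with \<phi> show ?case
      by (intro exI[of _ "\<lambda>x. c * gwave a b x + \<phi> x"])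
         (auto intro!: represents_add represents_scaleC represents_gw integrable_gwave
            square_integrable_add square_integrable_scale square_integrable_gwave)
  qed
  then show thesis using that represents_fourier0 by blast
qed

lemma fourier0_add:
  assumes "f \<in> gspace" "g \<in> gspace"
  shows "fourier0 (f + g) = fourier0 f + fourier0 g"
proof -
  obtain \<phi> where \<phi>: "represents \<phi> f" "integrable lborel \<phi>" "represents (fourier_integral \<phi>) (fourier0 f)"
    using gspace_represents[OF assms(1)] .
  obtain \<psi> where \<psi>: "represents \<psi> g" "integrable lborel \<psi>" "represents (fourier_integral \<psi>) (fourier0 g)"
    using gspace_represents[OF assms(2)] .
  have eq: "fourier_integral (\<lambda>x. \<phi> x + \<psi> x) = (\<lambda>p. fourier_integral \<phi> p + fourier_integral \<psi> p)"
    using fourier_integral_add[OF \<phi>(2) \<psi>(2)] by auto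
  have "represents (fourier_integral (\<lambda>x. \<phi> x + \<psi> x)) (fourier0 (f + g))"
    by (rule represents_fourier0[OF represents_add[OF \<phi>(1) \<psi>(1)]])
       (use \<phi> \<psi> in \<open>auto simp: eq intro!: square_integrable_add dest: represents_square_integrable\<close>)
  then show ?thesis
    unfolding eq using represents_add[OF \<phi>(3) \<psi>(3)] represents_unique by blast
qed

lemma fourier0_scaleC:
  assumes "f \<in> gspace"
  shows "fourier0 (c *\<^sub>C f) = c *\<^sub>C fourier0 f"
proof -
  obtain \<phi> where \<phi>: "represents \<phi> f" "integrable lborel \<phi>" "represents (fourier_integral \<phi>) (fourier0 f)"
    using gspace_represents[OF assms] .
  have eq: "fourier_integral (\<lambda>x. c * \<phi> x) = (\<lambda>p. c * fourier_integral \<phi> p)"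
    using fourier_integral_scale by auto
  have "represents (fourier_integral (\<lambda>x. c * \<phi> x)) (fourier0 (c *\<^sub>C f))"
    by (rule represents_fourier0[OF represents_scaleC[OF \<phi>(1)]])
       (use \<phi> in \<open>auto simp: eq intro!: square_integrable_scale dest: represents_square_integrable\<close>)
  then show ?thesis
    unfolding eq using represents_scaleC[OF \<phi>(3)] represents_unique by blast
qed

lemma fourier0_gw: "fourier0 (gw a b) = exp (\<i> * of_real (a * b)) *\<^sub>C gw b (- a)"
proof -
  have eq: "fourier_integral (gwave a b) = (\<lambda>p. exp (\<i> * of_real (a * b)) * gwave b (- a) p)"
    using fourier_integral_gwave by auto
  have "represents (fourier_integral (gwave a b)) (fourier0 (gw a b))"
    by (rule represents_fourier0[OF represents_gw integrable_gwave])
       (simp only: eq square_integrable_scale square_integrable_gwave)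
  then show ?thesis
    unfolding eq using represents_scaleC[OF represents_gw] represents_unique by blast
qed

lemma fourier0_zero: "fourier0 0 = 0"
  using fourier0_scaleC[OF gspace.zero, of 0] by simp

lemma cinner_fourier0:
  assumes "f \<in> gspace" "g \<in> gspace"
  shows "cinner (fourier0 f) (fourier0 g) = cinner f g"
proof -
  have gw: "gw a b \<in> gspace" for a b using gw_in_gspace[of 1] by simp
  have *: "cinner (fourier0 (gw a b)) (fourier0 g) = cinner (gw a b) g" for a b
    using assms(2)
  proof (induction rule: gspace.induct)
    case (step g c d e)
    then show ?case
      unfolding fourier0_add[OF gw_in_gspace step(1)] fourier0_scaleC[OF gw] fourier0_gw
        cinner_add_right cinner_scaleC_right[of _ c] cinner_gw_fourier by simp
  qed (simp add: fourier0_zero)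
  show ?thesis
    using assms(1)
  proof (induction rule: gspace.induct)
    case (step g c d e)
    then show ?case
      unfolding fourier0_add[OF gw_in_gspace step(1)] fourier0_scaleC[OF gw]
        cinner_add_left cinner_scaleC_left[of c] * by simp
  qed (simp add: fourier0_zero)
qed

lemma isometry_dist_fourier0:
  assumes "f \<in> gspace" "g \<in> gspace"
  shows "dist (fourier0 f) (fourier0 g) = dist f g"
proof -
  have "fourier0 f - fourier0 g = fourier0 (f - g)"
    using fourier0_add[OF csubspace_diff[OF csubspace_gspace assms] assms(2)] by simp
  moreover have "norm (fourier0 h) = norm h" if "h \<in> gspace" for h
    using arg_cong[OF cinner_fourier0[OF that that], of Re] by (simp add: cinner_self)
  ultimately show ?thesis
    using csubspace_diff[OF csubspace_gspace assms] by (simp add: dist_norm)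
qed

text \<open>U is the continuous extension of the isometry \<open>fourier0\<close> from the dense
  span. The scalar product identity is extended by continuity in one argument at a time.
  Surjectivity holds since the range of an isometry on a complete space is closed and here contains
  the span.\<close>

theorem Plancherel:
  obtains U where "continuous_on UNIV U" "\<And>f g. cinner (U f) (U g) = cinner f g" "surj U"
    "\<And>f. f \<in> gspace \<Longrightarrow> U f = fourier0 f"
proof -
  have "uniformly_continuous_on gspace fourier0"
    unfolding uniformly_continuous_on_def using isometry_dist_fourier0 by metis
  then obtain U where "uniformly_continuous_on (closure gspace) U"
    and U0: "\<And>f. f \<in> gspace \<Longrightarrow> fourier0 f = U f"
    by (rule uniformly_continuous_on_extension_on_closure) blast
  then have U: "continuous_on UNIV U" by (simp add: closure_gspace uniformly_continuous_imp_continuous)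
  have cont: "continuous_on UNIV (\<lambda>g. cinner x g)" "continuous_on UNIV (\<lambda>g. cinner g x)" for x
    by (intro bounded_bilinear.continuous_on[OF bounded_bilinear_cinner] continuous_intros)+
  have 1: "cinner (U f) (U g) = cinner f g" if "f \<in> gspace" for f g
  proof -
    have "closed {g. cinner (U f) (U g) = cinner f g}"
      by (intro closed_Collect_eq cont continuous_on_compose2[OF cont(1) U]) auto
    from gspace_dense_closed[OF this] show ?thesis
      using that by (force simp: cinner_fourier0 simp flip: U0)
  qed
  have 2: "cinner (U f) (U g) = cinner f g" for f g
  proof -
    have "closed {f. cinner (U f) (U g) = cinner f g}"
      by (intro closed_Collect_eq cont continuous_on_compose2[OF cont(2) U]) auto
    from gspace_dense_closed[OF this] show ?thesis
      using 1 by force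
  qed
  have isom: "dist (U f) (U g) = dist f g" for f g
  proof -
    have "complex_of_real ((norm (U f - U g))\<^sup>2) = complex_of_real ((norm (f - g))\<^sup>2)"
      unfolding cinner_self[symmetric] by (simp add: cinner_diff_left cinner_diff_right 2)
    then show ?thesis by (simp add: dist_norm del: of_real_power)
  qed
  have "closed (range U)"
    unfolding closed_sequential_limits
  proof (intro allI impI)
    fix y l assume y: "(\<forall>n. y n \<in> range U) \<and> y \<longlonglongrightarrow> l"
    then obtain x where x: "\<And>n. y n = U (x n)" by (auto simp: image_iff) metis
    have "Cauchy y" using y LIMSEQ_imp_Cauchy by blast
    then have "Cauchy x" by (simp add: Cauchy_def x isom)
    then obtain a where "x \<longlonglongrightarrow> a" using Cauchy_convergent convergent_def by blast
    then have "y \<longlonglongrightarrow> U a"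
      using U unfolding x continuous_on_eq_continuous_at[OF open_UNIV] by (intro isCont_tendsto_compose[of _ U]) auto
    then show "l \<in> range U" using y LIMSEQ_unique by blast
  qed
  moreover have "gspace \<subseteq> range U"
  proof
    fix f assume "f \<in> gspace"
    then have "\<exists>g\<in>gspace. f = fourier0 g"
    proof (induction rule: gspace.induct)
      case zero
      then show ?case using gspace.zero fourier0_zero by force
    next
      case (step f c a b)
      then obtain g where g: "g \<in> gspace" "f = fourier0 g" by blast
      \<comment> \<open>The preimage of the packet (a, b) is a multiple of the packet (-b, a); the
        factor cancels the phase that the transform produces.\<close>
      define k where "k = c * exp (\<i> * of_real (a * b))"
      have "fourier0 (k *\<^sub>C gw (- b) a + g) = k *\<^sub>C exp (\<i> * of_real (- b * a)) *\<^sub>C gw a b + f"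
        using fourier0_add[OF gw_in_gspace g(1), of k "- b" a] fourier0_scaleC[of "gw (- b) a" k]
          gw_in_gspace[of 1 "- b" a] by (simp add: fourier0_gw g(2))
      also have "\<dots> = c *\<^sub>C gw a b + f"
        by (simp add: k_def mult.commute exp_minus)
      finally show ?case using gspace.step[OF g(1)] by (metis)
    qed
    then show "f \<in> range U" using U0 by auto
  qed
  ultimately have "surj U" using gspace_dense_closed by blast
  then show thesis using that[of U] U 2 U0 by simp
qed

text \<open>U is only an abstract limit off the span. Its scalar products with packets are known
  from unitarity, and the multiplication formula yields the same numbers for the Fourier
  integral.\<close>

lemma fourier_on_L1:
  assumes U: "\<And>f g. cinner (U f) (U g) = cinner f g" "\<And>f. f \<in> gspace \<Longrightarrow> U f = fourier0 f"
    and f: "represents \<phi> f" "integrable lborel \<phi>"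
  shows "represents (fourier_integral \<phi>) (U f)"
proof -
  have m: "fourier_integral \<phi> \<in> borel_measurable borel" by (rule borel_measurable_fourier_integral[OF f(2)])
  have "AE x in lborel. rep_L2 (U f) x = fourier_integral \<phi> x"
  proof (rule AE_eq_if_gwave_integrals_eq)
    fix b
    show "integrable lborel (\<lambda>x. gwave 0 b x * rep_L2 (U f) x)"
      by (simp add: integrable_gwave_mult_L2)
    show "integrable lborel (\<lambda>x. gwave 0 b x * fourier_integral \<phi> x)"
      by (rule integrable_gwave_mult_bounded[OF m norm_fourier_integral_le[OF f(2)]])
    have "gw 0 (- b) = U (gw b 0)"
      using U(2)[of "gw b 0"] gw_in_gspace[of 1 b 0] by (simp add: fourier0_gw)
    then have "cinner (gw 0 (- b)) (U f) = cinner (gw b 0) f" by (simp add: U(1))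
    then have "(LINT x|lborel. gwave 0 b x * rep_L2 (U f) x) = (LINT x|lborel. gwave b 0 x * \<phi> x)"
      by (simp add: cinner_represents[OF represents_gw represents_rep[of "U f"]]
          cinner_represents[OF represents_gw f(1)] cnj_gwave)
    also have "\<dots> = (LINT x|lborel. fourier_integral (gwave 0 b) x * \<phi> x)"
      by (simp add: fourier_integral_gwave)
    also have "\<dots> = (LINT x|lborel. gwave 0 b x * fourier_integral \<phi> x)"
      by (rule fourier_multiplication_formula[OF integrable_gwave f(2)])
    finally show "(LINT x|lborel. gwave 0 b x * rep_L2 (U f) x) = (LINT x|lborel. gwave 0 b x * fourier_integral \<phi> x)" .
  qed
  then show ?thesis
    using m by (intro represents_cong_AE[OF represents_rep] square_integrable_cong_AE[OF square_integrable_rep])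
qed

text \<open>The definite description in \<open>fourier\<close> is justified because two continuous
  maps given by the Fourier integral on integrable functions agree on the dense span of
  packets.\<close>

lemma fourier_properties:
  "continuous_on UNIV fourier" (is ?cont)
  "cinner (fourier f) (fourier g) = cinner f g" (is ?isom)
  "surj fourier" (is ?surj)
  "represents \<phi> f \<Longrightarrow> integrable lborel \<phi> \<Longrightarrow> represents (fourier_integral \<phi>) (fourier f)" (is "PROP ?rep")
  "h \<in> gspace \<Longrightarrow> fourier h = fourier0 h"  (is "PROP ?gsp")
proof -
  obtain U where U: "continuous_on UNIV U" "\<And>f g. cinner (U f) (U g) = cinner f g" "surj U"
    "\<And>f. f \<in> gspace \<Longrightarrow> U f = fourier0 f"
    using Plancherel by metis
  have "fourier = U"
    unfolding fourier_def
  proof (rule the_equality)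
    show "continuous_on UNIV U \<and>
      (\<forall>\<phi> f. represents \<phi> f \<longrightarrow> integrable lborel \<phi> \<longrightarrow> represents (fourier_integral \<phi>) (U f))"
      using U fourier_on_L1[OF U(2,4)] by blast
    fix V assume V: "continuous_on UNIV V \<and>
      (\<forall>\<phi> f. represents \<phi> f \<longrightarrow> integrable lborel \<phi> \<longrightarrow> represents (fourier_integral \<phi>) (V f))"
    have "V f = U f" for f
    proof -
      have "closed {f. V f = U f}" using U V by (intro closed_Collect_eq) auto
      moreover have "gspace \<subseteq> {f. V f = U f}"
      proof
        fix f assume "f \<in> gspace"
        then obtain \<phi> where "represents \<phi> f" "integrable lborel \<phi>" by (rule gspace_represents)
        then have "represents (fourier_integral \<phi>) (U f)" "represents (fourier_integral \<phi>) (V f)"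
          using fourier_on_L1[OF U(2,4)] V by blast+
        then show "f \<in> {f. V f = U f}" using represents_unique by blast
      qed
      ultimately show ?thesis using gspace_dense_closed by blast
    qed
    then show "V = U" by blast
  qed
  with U fourier_on_L1[OF U(2,4)] show ?cont ?isom ?surj "PROP ?rep" "PROP ?gsp" by simp_all
qed

lemmas cinner_fourier = fourier_properties(2)
lemmas represents_fourier_integral = fourier_properties(4)

lemma norm_fourier: "norm (fourier f) = norm f"
  using arg_cong[OF cinner_fourier[of f f], of Re] by (simp add: cinner_self)

lemma L2_eqI_norm: "cinner (f - g) (f - g) = 0 \<Longrightarrow> f = (g :: L2)"
  by (simp add: cinner_self)

text \<open>The description of \<open>fourier\<close> says nothing about linearity. It follows from
  preservation of scalar products: the squared norm of the defect expands into scalar products that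
  may be computed before the transform.\<close>

lemma fourier_add: "fourier (f + g) = fourier f + fourier g"
  by (rule L2_eqI_norm)
     (simp add: cinner_diff_left cinner_diff_right cinner_add_left cinner_add_right cinner_fourier)

lemma fourier_scaleC: "fourier (c *\<^sub>C f) = c *\<^sub>C fourier f"
  by (rule L2_eqI_norm)
     (simp add: cinner_diff_left cinner_diff_right cinner_fourier)

lemma fourier_zero [simp]: "fourier 0 = 0"
  using norm_fourier[of 0] by simp

lemma fourier_diff: "fourier (f - g) = fourier f - fourier g"
  using fourier_add[of "f - g" g] by (simp add: algebra_simps)

lemma inj_fourier: "inj fourier"
proof (rule injI)
  fix f g assume "fourier f = fourier g"
  then have "norm (f - g) = 0" using norm_fourier[of "f - g"] by (simp add: fourier_diff)
  then show "f = g" by simp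
qed

lemma fourier_inv_fourier [simp]: "fourier (inv fourier f) = f"
  using fourier_properties(3) by (simp add: surj_f_inv_f)

lemma fourier_eq_iff: "fourier f = fourier g \<longleftrightarrow> f = g"
  using inj_fourier by (auto simp: inj_def)

text \<open>The packet test again, with the multiplication formula applied to the packet of opposite
  momentum; the reflection of the integration variable yields the argument -x.\<close>

theorem fourier_inversion:
  assumes "represents \<phi> (fourier f)" "integrable lborel \<phi>"
  shows "represents (\<lambda>x. fourier_integral \<phi> (- x)) f"
proof -
  have m [measurable]: "fourier_integral \<phi> \<in> borel_measurable borel"
    by (rule borel_measurable_fourier_integral[OF assms(2)])
  have m': "(\<lambda>x. fourier_integral \<phi> (- x)) \<in> borel_measurable borel" by measurable
  have "AE x in lborel. rep_L2 f x = fourier_integral \<phi> (- x)"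
  proof (rule AE_eq_if_gwave_integrals_eq)
    fix b
    show "integrable lborel (\<lambda>x. gwave 0 b x * rep_L2 f x)"
      by (simp add: integrable_gwave_mult_L2)
    show "integrable lborel (\<lambda>x. gwave 0 b x * fourier_integral \<phi> (- x))"
      by (rule integrable_gwave_mult_bounded[OF m' norm_fourier_integral_le[OF assms(2)]])
    have "fourier (gw 0 (- b)) = gw (- b) 0"
      using fourier_properties(5)[of "gw 0 (- b)"] gw_in_gspace[of 1 0 "- b"] by (simp add: fourier0_gw)
    then have "cinner (gw 0 (- b)) f = cinner (gw (- b) 0) (fourier f)" by (metis cinner_fourier)
    then have "(LINT x|lborel. gwave 0 b x * rep_L2 f x) = (LINT x|lborel. gwave (- b) 0 x * \<phi> x)"
      by (simp add: cinner_represents[OF represents_gw represents_rep[of f]]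
          cinner_represents[OF represents_gw assms(1)] cnj_gwave)
    also have "\<dots> = (LINT x|lborel. fourier_integral (gwave 0 (- b)) x * \<phi> x)"
      by (simp add: fourier_integral_gwave)
    also have "\<dots> = (LINT x|lborel. gwave 0 (- b) x * fourier_integral \<phi> x)"
      by (rule fourier_multiplication_formula[OF integrable_gwave assms(2)])
    also have "\<dots> = (LINT x|lborel. gwave 0 (- b) (0 + (- 1) * x) * fourier_integral \<phi> (0 + (- 1) * x))"
      by (subst lborel_integral_real_affine[of "- 1" _ 0]) auto
    also have "\<dots> = (LINT x|lborel. gwave 0 b x * fourier_integral \<phi> (- x))"
      by (simp add: gwave_def)
    finally show "(LINT x|lborel. gwave 0 b x * rep_L2 f x) = (LINT x|lborel. gwave 0 b x * fourier_integral \<phi> (- x))" .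
  qed
  then show ?thesis
    using m' by (intro represents_cong_AE[OF represents_rep] square_integrable_cong_AE[OF square_integrable_rep])
qed

section \<open>Self-adjoint operators and their spectra\<close>

lemma mem_shift: "(f, h) \<in> shift T z \<longleftrightarrow> (f, h - z *\<^sub>C f) \<in> T"
proof
  assume "(f, h - z *\<^sub>C f) \<in> T"
  then show "(f, h) \<in> shift T z"
    unfolding shift_def op_add_def op_graph_def by force
qed (auto simp: shift_def op_add_def op_graph_def)

lemma shift_shift: "shift (shift T z) w = shift T (z + w)"
  by (auto simp: mem_shift cvec.scale_left_distrib diff_diff_eq add.commute)

lemma shift_0 [simp]: "shift T 0 = T"
  by (auto simp: mem_shift)

lemma shift_minus_cancel [simp]: "shift (shift T z) (- z) = T" "shift (shift T (- z)) z = T"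
  by (simp_all add: shift_shift)

lemma shift_eq_iff: "shift T z = T' \<longleftrightarrow> T = shift T' (- z)"
  by auto

lemma shift_mono_iff: "shift T z \<subseteq> shift T' z \<longleftrightarrow> T \<subseteq> T'"
proof
  assume *: "shift T z \<subseteq> shift T' z"
  show "T \<subseteq> T'"
  proof (rule subrelI)
    fix f h assume "(f, h) \<in> T"
    then have "(f, h + z *\<^sub>C f) \<in> shift T z" by (simp add: mem_shift)
    with * have "(f, h + z *\<^sub>C f) \<in> shift T' z" by blast
    then show "(f, h) \<in> T'" by (simp add: mem_shift)
  qed
qed (auto simp: mem_shift)

lemma Domain_shift [simp]: "Domain (shift T z) = Domain T"
proof -
  have "Domain T \<subseteq> Domain (shift T z)" for T z
  proof
    fix f assume "f \<in> Domain T"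
    then obtain h where "(f, h) \<in> T" by blast
    then have "(f, h + z *\<^sub>C f) \<in> shift T z" by (simp add: mem_shift)
    then show "f \<in> Domain (shift T z)" by blast
  qed
  from this[of T z] this[of "shift T z" "- z"] show ?thesis by auto
qed

lemma single_valued_shift: "single_valued T \<Longrightarrow> single_valued (shift T z)"
  unfolding single_valued_def mem_shift by (metis diff_add_cancel)

lemma is_operator_shift: "is_operator T \<Longrightarrow> is_operator (shift T z)"
  unfolding is_operator_def
proof (elim conjE, intro conjI allI impI)
  fix f h g k
  assume "\<forall>f h g k. (f, h) \<in> T \<longrightarrow> (g, k) \<in> T \<longrightarrow> (f + g, h + k) \<in> T"
    "(f, h) \<in> shift T z" "(g, k) \<in> shift T z"
  then have "(f + g, (h - z *\<^sub>C f) + (k - z *\<^sub>C g)) \<in> T" by (auto simp: mem_shift)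
  then show "(f + g, h + k) \<in> shift T z"
    by (simp add: mem_shift cvec.scale_right_distrib algebra_simps)
next
  fix c f h
  assume "\<forall>c f h. (f, h) \<in> T \<longrightarrow> (c *\<^sub>C f, c *\<^sub>C h) \<in> T" "(f, h) \<in> shift T z"
  then have "(c *\<^sub>C f, c *\<^sub>C (h - z *\<^sub>C f)) \<in> T" by (auto simp: mem_shift)
  then show "(c *\<^sub>C f, c *\<^sub>C h) \<in> shift T z"
    by (simp add: mem_shift cvec.scale_right_diff_distrib mult.commute)
qed (simp_all add: mem_shift single_valued_shift)

lemma mem_adjoint: "(g, k) \<in> adjoint_op T \<longleftrightarrow> (\<forall>f h. (f, h) \<in> T \<longrightarrow> cinner g h = cinner k f)"
  by (auto simp: adjoint_op_def)

lemma adjoint_antimono: "S \<subseteq> T \<Longrightarrow> adjoint_op T \<subseteq> adjoint_op S"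
  by (auto simp: adjoint_op_def)

lemma adjoint_shift: "adjoint_op (shift T (of_real r)) = shift (adjoint_op T) (of_real r)"
proof -
  have "(g, k) \<in> adjoint_op (shift T (of_real r)) \<longleftrightarrow> (g, k) \<in> shift (adjoint_op T) (of_real r)" for g k
  proof
    assume *: "(g, k) \<in> adjoint_op (shift T (of_real r))"
    show "(g, k) \<in> shift (adjoint_op T) (of_real r)"
      unfolding mem_shift mem_adjoint
    proof (intro allI impI)
      fix f h assume "(f, h) \<in> T"
      then have "(f, h + of_real r *\<^sub>C f) \<in> shift T (of_real r)" by (simp add: mem_shift)
      with * have "cinner g (h + of_real r *\<^sub>C f) = cinner k f" by (simp add: mem_adjoint)
      then show "cinner g h = cinner (k - of_real r *\<^sub>C g) f"
        by (simp add: cinner_add_right cinner_diff_left algebra_simps)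
    qed
  next
    assume *: "(g, k) \<in> shift (adjoint_op T) (of_real r)"
    show "(g, k) \<in> adjoint_op (shift T (of_real r))"
      unfolding mem_adjoint
    proof (intro allI impI)
      fix f h assume "(f, h) \<in> shift T (of_real r)"
      then have "cinner g (h - of_real r *\<^sub>C f) = cinner (k - of_real r *\<^sub>C g) f"
        using * by (simp add: mem_adjoint mem_shift)
      then show "cinner g h = cinner k f"
        by (simp add: cinner_diff_right cinner_diff_left)
    qed
  qed
  then show ?thesis by auto
qed

lemma selfadjoint_shift: "selfadjoint T \<Longrightarrow> selfadjoint (shift T (of_real r))"
  by (simp add: selfadjoint_def is_operator_shift adjoint_shift)

lemma selfadjoint_maximal:
  assumes "selfadjoint T" "selfadjoint T'" "T \<subseteq> T'" shows "T = T'"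
  using adjoint_antimono[OF assms(3)] assms by (auto simp: selfadjoint_def)

lemma selfadjoint_symmetric:
  "selfadjoint T \<Longrightarrow> (f, h) \<in> T \<Longrightarrow> (g, k) \<in> T \<Longrightarrow> cinner g h = cinner k f"
  using mem_adjoint[of g k T] by (auto simp: selfadjoint_def)

lemma is_operatorD:
  assumes "is_operator T"
  shows "(0, 0) \<in> T" "(f, h) \<in> T \<Longrightarrow> (g, k) \<in> T \<Longrightarrow> (f + g, h + k) \<in> T"
    "(f, h) \<in> T \<Longrightarrow> (c *\<^sub>C f, c *\<^sub>C h) \<in> T"
    "(f, h) \<in> T \<Longrightarrow> (g, k) \<in> T \<Longrightarrow> (f - g, h - k) \<in> T"
    "(f, h) \<in> T \<Longrightarrow> (f, k) \<in> T \<Longrightarrow> h = k"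
proof -
  note * = assms[unfolded is_operator_def]
  show "(0, 0) \<in> T" and add: "\<And>f h g k. (f, h) \<in> T \<Longrightarrow> (g, k) \<in> T \<Longrightarrow> (f + g, h + k) \<in> T"
    and sc: "\<And>c f h. (f, h) \<in> T \<Longrightarrow> (c *\<^sub>C f, c *\<^sub>C h) \<in> T"
    using * by blast+
  show "(f, h) \<in> T \<Longrightarrow> (g, k) \<in> T \<Longrightarrow> (f - g, h - k) \<in> T"
    using add[OF _ sc[of g k "-1"]] by simp
  show "(f, h) \<in> T \<Longrightarrow> (f, k) \<in> T \<Longrightarrow> h = k"
    using * by (auto simp: single_valued_def)
qed

lemma op_apply_eq: "is_operator T \<Longrightarrow> (f, h) \<in> T \<Longrightarrow> op_apply T f = h"
  unfolding op_apply_def using is_operatorD(5) by (intro the_equality) auto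

lemma op_form_eq: "is_operator T \<Longrightarrow> (f, h) \<in> T \<Longrightarrow> op_form T f = cinner f h"
  by (simp add: op_form_def op_apply_eq)

section \<open>Bounded invertibility and the bottom of the spectrum\<close>

lemma invertible_op_bound:
  assumes "invertible_op T"
  obtains K where "K > 0" "\<And>f h. (f, h) \<in> T \<Longrightarrow> norm f \<le> K * norm h" "\<And>h. \<exists>f. (f, h) \<in> T"
proof -
  obtain C where C: "bounded_linear C" "T\<inverse> = op_graph C"
    using assms by (auto simp: invertible_op_def)
  have mem: "(f, h) \<in> T \<longleftrightarrow> f = C h" for f h
    using C(2) by (auto simp: op_graph_def set_eq_iff)
  obtain K where K: "K > 0" "\<And>x. norm (C x) \<le> norm x * K"
    using bounded_linear.pos_bounded[OF C(1)] by blast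
  show thesis
    by (rule that[OF K(1)]) (use K(2) in \<open>simp_all add: mem mult.commute[of K]\<close>)
qed

text \<open>The lower bound at z gives injectivity and a closed range. A vector orthogonal to the
  range lies in the kernel of the adjoint, which is the shift by the conjugate of z; hence the
  second lower bound.\<close>

lemma invertible_opI_bounded_below:
  assumes T: "selfadjoint T" and c: "c > 0"
    and lower: "\<And>f h. (f, h) \<in> shift T z \<Longrightarrow> c * norm f \<le> norm h"
      "\<And>f h. (f, h) \<in> shift T (cnj z) \<Longrightarrow> c * norm f \<le> norm h"
  shows "invertible_op (shift T z)"
proof -
  have op: "is_operator (shift T z)" using T by (simp add: selfadjoint_def is_operator_shift)
  \<comment> \<open>A self-adjoint operator is closed, because the identities defining the adjoint
    pass to limits.\<close>
  have cl: "(f, h) \<in> shift T z"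
    if lims: "\<And>n. (u n, v n) \<in> shift T z" "u \<longlonglongrightarrow> f" "v \<longlonglongrightarrow> h" for u v f h
  proof -
    have "(f, h - z *\<^sub>C f) \<in> adjoint_op T"
      unfolding mem_adjoint
    proof (intro allI impI)
      fix a b assume ab: "(a, b) \<in> T"
      have "cinner (u n) b = cinner (v n - z *\<^sub>C u n) a" for n
        using selfadjoint_symmetric[OF T ab, of "u n" "v n - z *\<^sub>C u n"] lims(1)[of n] by (simp add: mem_shift)
      moreover have "(\<lambda>n. cinner (u n) b) \<longlonglongrightarrow> cinner f b"
        by (intro tendsto_cinner lims tendsto_const)
      moreover have "(\<lambda>n. cinner (v n - z *\<^sub>C u n) a) \<longlonglongrightarrow> cinner (h - z *\<^sub>C f) a"
        by (intro tendsto_cinner tendsto_diff tendsto_scaleC lims tendsto_const)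
      ultimately show "cinner f b = cinner (h - z *\<^sub>C f) a"
        using LIMSEQ_unique by simp
    qed
    then show ?thesis using T by (simp add: mem_shift selfadjoint_def)
  qed
  have sub: "csubspace (Range (shift T z))"
    unfolding csubspace_def using is_operatorD[OF op] by blast
  have "closed (Range (shift T z))"
    unfolding closed_sequential_limits
  proof (intro allI impI)
    fix v h assume v: "(\<forall>n. v n \<in> Range (shift T z)) \<and> v \<longlonglongrightarrow> h"
    then have "\<forall>n. \<exists>f. (f, v n) \<in> shift T z" by blast
    then obtain u where u: "\<And>n. (u n, v n) \<in> shift T z" by metis
    have "Cauchy u"
    proof (rule metric_CauchyI)
      fix e :: real assume "e > 0"
      have "Cauchy v" using v LIMSEQ_imp_Cauchy by blast
      then obtain N where N: "\<And>m n. m \<ge> N \<Longrightarrow> n \<ge> N \<Longrightarrow> dist (v m) (v n) < c * e"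
        using metric_CauchyD[of v "c * e"] c \<open>e > 0\<close> by auto
      have "dist (u m) (u n) < e" if "m \<ge> N" "n \<ge> N" for m n
      proof -
        have "c * norm (u m - u n) \<le> norm (v m - v n)"
          by (intro lower(1) is_operatorD(4)[OF op] u)
        then have "c * dist (u m) (u n) < c * e" using N[OF that] by (simp add: dist_norm)
        then show ?thesis using c by simp
      qed
      then show "\<exists>N. \<forall>m\<ge>N. \<forall>n\<ge>N. dist (u m) (u n) < e" by blast
    qed
    then obtain f where "u \<longlonglongrightarrow> f" using Cauchy_convergent convergent_def by blast
    then show "h \<in> Range (shift T z)" using cl[of u v f h] u v by blast
  qed
  moreover have "closure (Range (shift T z)) = UNIV"
  proof (rule csubspace_dense[OF sub])
    fix x assume x: "\<And>v. v \<in> Range (shift T z) \<Longrightarrow> cinner v x = 0"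
    have "(x, - (cnj z *\<^sub>C x)) \<in> adjoint_op T"
      unfolding mem_adjoint
    proof (intro allI impI)
      fix f h assume "(f, h) \<in> T"
      then have "(f, h + z *\<^sub>C f) \<in> shift T z" by (simp add: mem_shift)
      then have "cinner (h + z *\<^sub>C f) x = 0" using x by blast
      then have "cinner x (h + z *\<^sub>C f) = 0" by (subst cinner_commute) simp
      then show "cinner x h = cinner (- (cnj z *\<^sub>C x)) f"
        by (simp add: cinner_add_right eq_neg_iff_add_eq_0)
    qed
    then have "(x, 0) \<in> shift T (cnj z)" using T by (simp add: mem_shift selfadjoint_def)
    then have "c * norm x \<le> 0" using lower(2) by fastforce
    then show "x = 0" using c by (simp add: mult_le_0_iff)
  qed
  ultimately have surj: "\<exists>f. (f, h) \<in> shift T z" for h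
    by (metis Range_iff UNIV_I closure_closed)
  define C where "C h = (SOME f. (f, h) \<in> shift T z)" for h
  have C: "(C h, h) \<in> shift T z" for h unfolding C_def using surj by (rule someI_ex)
  have uniq: "f = C h" if "(f, h) \<in> shift T z" for f h
    using lower(1)[OF is_operatorD(4)[OF op that C[of h]]] c by (simp add: mult_le_0_iff)
  have "bounded_linear C"
  proof (rule bounded_linear_intro[where K="1/c"])
    show "C (x + y) = C x + C y" for x y
      using uniq[OF is_operatorD(2)[OF op C C]] by simp
    show "C (r *\<^sub>R x) = r *\<^sub>R C x" for r x
      using uniq[OF is_operatorD(3)[OF op C]] by (simp add: scaleR_scaleC)
    show "norm (C x) \<le> norm x * (1 / c)" for x
      using lower(1)[OF C] c by (simp add: field_simps)
  qed
  moreover have "(shift T z)\<inverse> = op_graph C"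
    using C uniq by (auto simp: op_graph_def)
  ultimately show ?thesis by (auto simp: invertible_op_def)
qed

text \<open>Left of m the form bound and Cauchy-Schwarz bound the shifted operator from below by m -
  Re w, which is the same number for w and its conjugate.\<close>

lemma spectrum_lower_bound:
  assumes T: "selfadjoint T" and m: "\<And>f h. (f, h) \<in> T \<Longrightarrow> m * (norm f)\<^sup>2 \<le> Re (cinner f h)"
    and z: "z \<in> spectrum T"
  shows "m \<le> Re z"
proof (rule ccontr)
  assume less: "\<not> m \<le> Re z"
  have lower: "(m - Re w) * norm f \<le> norm h" if "(f, h) \<in> shift T (- w)" for w f h
  proof (cases "f = 0")
    case False
    from that have "(f, h + w *\<^sub>C f) \<in> T" by (simp add: mem_shift)
    from m[OF this] have "m * (norm f)\<^sup>2 \<le> Re (cinner f h) + Re w * (norm f)\<^sup>2"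
      by (simp add: cinner_add_right cinner_self)
    moreover have "Re (cinner f h) \<le> norm f * norm h"
      using complex_Re_le_cmod[of "cinner f h"] cinner_bound[of f h] by linarith
    ultimately have "norm f * ((m - Re w) * norm f) \<le> norm f * norm h"
      by (simp add: power2_eq_square algebra_simps)
    then show ?thesis using False by simp
  qed simp
  have "invertible_op (shift T (- z))"
    by (rule invertible_opI_bounded_below[OF T, of "m - Re z"])
       (use less lower[of _ _ z] lower[of _ _ "cnj z"] in auto)
  with z show False by (simp add: spectrum_def)
qed

text \<open>The spectral point is the largest lower bound \<open>a\<close> of the form. If \<open>T - a\<close> had a bounded inverse
  of norm \<open>K\<close>, then testing the nonnegative form of \<open>T - a\<close> on \<open>f - K\<^sup>-\<^sup>1 (T - a)\<^sup>-\<^sup>1 f\<close>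
  would improve the lower bound to \<open>a + 1/K\<close>.\<close>

lemma spectrum_below:
  assumes T: "selfadjoint T" "semibounded T" and fh: "(f0, h0) \<in> T" "Re (cinner f0 h0) < m * (norm f0)\<^sup>2"
  obtains z where "z \<in> spectrum T" "Re z < m"
proof -
  define A where "A = {m::real. \<forall>f h. (f, h) \<in> T \<longrightarrow> m * (norm f)\<^sup>2 \<le> Re (cinner f h)}"
  have ne: "A \<noteq> {}" using T(2) by (auto simp: semibounded_def A_def)
  have f0: "f0 \<noteq> 0" using fh(2) by auto
  have le_m: "x \<le> m" if "x \<in> A" for x
  proof (rule ccontr)
    assume "\<not> x \<le> m"
    then have "m * (norm f0)\<^sup>2 \<le> x * (norm f0)\<^sup>2" by (intro mult_right_mono) auto
    with that fh show False by (force simp: A_def)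
  qed
  then have bdd: "bdd_above A" by (rule bdd_aboveI)
  define a where "a = Sup A"
  have aA: "a \<in> A"
    unfolding A_def
  proof (intro CollectI allI impI)
    fix f h assume "(f, h) \<in> T"
    show "a * (norm f)\<^sup>2 \<le> Re (cinner f h)"
    proof (cases "f = 0")
      case False
      have "a \<le> Re (cinner f h) / (norm f)\<^sup>2"
        unfolding a_def using ne \<open>(f, h) \<in> T\<close> False
        by (intro cSup_least) (auto simp: A_def field_simps)
      then show ?thesis using False by (simp add: field_simps)
    qed simp
  qed
  have "a < m"
  proof (rule ccontr)
    assume "\<not> a < m"
    then have "m * (norm f0)\<^sup>2 \<le> a * (norm f0)\<^sup>2" by (intro mult_right_mono) auto
    with aA fh show False by (force simp: A_def)
  qed
  have sa: "selfadjoint (shift T (- of_real a))"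
    using selfadjoint_shift[OF T(1), of "- a"] by simp
  then have op: "is_operator (shift T (- of_real a))" by (simp add: selfadjoint_def)
  have pos: "0 \<le> Re (cinner f h)" if "(f, h) \<in> shift T (- of_real a)" for f h
  proof -
    from that have "(f, h + of_real a *\<^sub>C f) \<in> T" by (simp add: mem_shift)
    with aA have "a * (norm f)\<^sup>2 \<le> Re (cinner f (h + of_real a *\<^sub>C f))" by (simp add: A_def)
    then show ?thesis by (simp add: cinner_add_right cinner_self)
  qed
  have "of_real a \<in> spectrum T"
  proof (rule ccontr)
    assume "of_real a \<notin> spectrum T"
    then have "invertible_op (shift T (- of_real a))" by (simp add: spectrum_def)
    then obtain K where K: "K > 0" "\<And>f h. (f, h) \<in> shift T (- of_real a) \<Longrightarrow> norm f \<le> K * norm h"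
      and surj: "\<And>h. \<exists>f. (f, h) \<in> shift T (- of_real a)"
      using invertible_op_bound by metis
    have "(a + 1 / K) * (norm f)\<^sup>2 \<le> Re (cinner f h)" if fh: "(f, h) \<in> T" for f h
    proof -
      define h' where "h' = h - of_real a *\<^sub>C f"
      have fh': "(f, h') \<in> shift T (- of_real a)" using fh by (simp add: mem_shift h'_def)
      obtain g where g: "(g, f) \<in> shift T (- of_real a)" using surj by blast
      have "(f - of_real (1/K) *\<^sub>C g, h' - of_real (1/K) *\<^sub>C f) \<in> shift T (- of_real a)"
        by (intro is_operatorD(4)[OF op] is_operatorD(3)[OF op] fh' g)
      from pos[OF this]
      have "0 \<le> Re (cinner f h') - (1/K) * (norm f)\<^sup>2 - (1/K) * Re (cinner g h') + (1/K)\<^sup>2 * Re (cinner g f)"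
        by (simp add: cinner_diff_left cinner_diff_right cinner_self power2_eq_square algebra_simps)
      moreover have "cinner g h' = of_real ((norm f)\<^sup>2)"
        using selfadjoint_symmetric[OF sa fh' g] by (simp add: cinner_self)
      moreover have "(1/K)\<^sup>2 * Re (cinner g f) \<le> (1/K)\<^sup>2 * (K * (norm f)\<^sup>2)"
      proof (rule mult_left_mono)
        have "Re (cinner g f) \<le> norm g * norm f"
          using complex_Re_le_cmod[of "cinner g f"] cinner_bound[of g f] by linarith
        also have "\<dots> \<le> (K * norm f) * norm f" by (intro mult_right_mono K(2) g) auto
        finally show "Re (cinner g f) \<le> K * (norm f)\<^sup>2" by (simp add: power2_eq_square)
      qed simp
      moreover have "(1/K)\<^sup>2 * (K * (norm f)\<^sup>2) = (1/K) * (norm f)\<^sup>2"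
        using K(1) by (simp add: power2_eq_square)
      ultimately have "(1/K) * (norm f)\<^sup>2 \<le> Re (cinner f h')" by simp
      then show ?thesis by (simp add: h'_def cinner_diff_right cinner_self algebra_simps)
    qed
    then have "a + 1 / K \<in> A" by (simp add: A_def)
    then have "a + 1 / K \<le> a" unfolding a_def[symmetric] by (subst a_def) (rule cSup_upper[OF _ bdd])
    then show False using K(1) by simp
  qed
  then show thesis using that \<open>a < m\<close> by force
qed

lemma inf_spectrum_ge:
  assumes "selfadjoint T" "\<And>f h. (f, h) \<in> T \<Longrightarrow> m * (norm f)\<^sup>2 \<le> Re (cinner f h)"
  shows "ereal m \<le> inf_spectrum T"
  unfolding inf_spectrum_def using spectrum_lower_bound[OF assms] by (intro INF_greatest) auto

lemma inf_spectrum_le: "z \<in> spectrum T \<Longrightarrow> inf_spectrum T \<le> ereal (Re z)"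
  unfolding inf_spectrum_def by (rule INF_lower)

section \<open>Double sequences and shifts of lower bounds\<close>

lemma CauchyI_norm_power2:
  fixes x :: "nat \<Rightarrow> 'a::real_normed_vector"
  assumes "\<And>e. e > 0 \<Longrightarrow> \<forall>\<^sub>F (m, n) in sequentially \<times>\<^sub>F sequentially. (norm (x m - x n))\<^sup>2 < e"
  shows "Cauchy x"
proof (rule metric_CauchyI)
  fix e :: real assume "e > 0"
  then obtain N where N: "\<And>m n. m \<ge> N \<Longrightarrow> n \<ge> N \<Longrightarrow> (norm (x m - x n))\<^sup>2 < e\<^sup>2"
    using assms[of "e\<^sup>2"] by (auto simp: eventually_prod_sequentially)
  have "dist (x m) (x n) < e" if "m \<ge> N" "n \<ge> N" for m n
    using N[OF that] \<open>e > 0\<close> by (simp add: dist_norm power2_less_imp_less)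
  then show "\<exists>N. \<forall>m\<ge>N. \<forall>n\<ge>N. dist (x m) (x n) < e" by blast
qed

lemma tendsto_norm_diff_prod:
  fixes u :: "nat \<Rightarrow> 'a::real_normed_vector"
  assumes "u \<longlonglongrightarrow> f"
  shows "((\<lambda>(m, n). (norm (u m - u n))\<^sup>2) \<longlongrightarrow> 0) (sequentially \<times>\<^sub>F sequentially)"
proof -
  have "((\<lambda>p. (norm (u (fst p) - u (snd p)))\<^sup>2) \<longlongrightarrow> (norm (f - f))\<^sup>2) (sequentially \<times>\<^sub>F sequentially)"
    by (intro tendsto_intros filterlim_compose[OF assms filterlim_fst] filterlim_compose[OF assms filterlim_snd])
  then show ?thesis by (simp add: case_prod_beta')
qed

lemma semibounded_shift:
  assumes "semibounded T" shows "semibounded (shift T (of_real r))"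
proof -
  obtain m where m: "\<And>f h. (f, h) \<in> T \<Longrightarrow> m * (norm f)\<^sup>2 \<le> Re (cinner f h)"
    using assms by (auto simp: semibounded_def)
  have "(m + r) * (norm f)\<^sup>2 \<le> Re (cinner f h)" if "(f, h) \<in> shift T (of_real r)" for f h
    using m[of f "h - of_real r *\<^sub>C f"] that
    by (simp add: mem_shift cinner_diff_right cinner_self algebra_simps)
  then show ?thesis unfolding semibounded_def by blast
qed


section \<open>Extension theory with a one-dimensional defect\<close>

text \<open>The closed nonnegative form of the Friedrichs extension plus \<open>l\<close> is \<open>\<phi> \<mapsto> \<parallel>J \<phi>\<parallel>\<^sup>2\<close> on \<open>D\<close>, and \<open>B\<close> is
  the inverse of that operator. The minimal operator \<open>S\<close> is its restriction to the vectors \<open>B h\<close> with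
  \<open>h \<bottom> G\<close>, so \<open>G\<close> spans the kernel of the adjoint of \<open>S + l\<close>.\<close>

locale rank_one_extension =
  fixes D :: "L2 set" and J B :: "L2 \<Rightarrow> L2" and G :: L2 and l :: real and S :: operator
  assumes l_pos: "l > 0"
    and D: "csubspace D"
    and J_add: "\<phi> \<in> D \<Longrightarrow> \<psi> \<in> D \<Longrightarrow> J (\<phi> + \<psi>) = J \<phi> + J \<psi>"
    and J_scaleC: "\<phi> \<in> D \<Longrightarrow> J (c *\<^sub>C \<phi>) = c *\<^sub>C J \<phi>"
    and J_bound: "\<phi> \<in> D \<Longrightarrow> l * (norm \<phi>)\<^sup>2 \<le> (norm (J \<phi>))\<^sup>2"
    and J_closed: "(\<And>n. u n \<in> D) \<Longrightarrow> u \<longlonglongrightarrow> f \<Longrightarrow> (\<lambda>n. J (u n)) \<longlonglongrightarrow> g \<Longrightarrow> f \<in> D \<and> J f = g"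
    and B_in_D: "B k \<in> D"
    and B_form: "\<phi> \<in> D \<Longrightarrow> cinner (J \<phi>) (J (B k)) = cinner \<phi> k"
    and G_notin_D: "G \<notin> D"
    and S_def: "S = shift {(B h, h) | h. cinner G h = 0} (- of_real l)"
    and core: "\<phi> \<in> D \<Longrightarrow> e > 0 \<Longrightarrow> \<exists>h. cinner G h = 0 \<and> norm (J (\<phi> - B h)) < e"
    and coercive: "e > 0 \<Longrightarrow> \<exists>C. \<forall>\<phi>\<in>D. \<forall>\<kappa>. (cmod \<kappa>)\<^sup>2 \<le> e * (norm (J \<phi>))\<^sup>2 + C * (norm (\<phi> + \<kappa> *\<^sub>C G))\<^sup>2"
    and D_dense: "closure D = UNIV"
begin

lemma D_0: "0 \<in> D" and D_add: "\<phi> \<in> D \<Longrightarrow> \<psi> \<in> D \<Longrightarrow> \<phi> + \<psi> \<in> D"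
  and D_scaleC: "\<phi> \<in> D \<Longrightarrow> c *\<^sub>C \<phi> \<in> D" and D_diff: "\<phi> \<in> D \<Longrightarrow> \<psi> \<in> D \<Longrightarrow> \<phi> - \<psi> \<in> D"
  using D csubspace_diff[OF D] by (auto simp: csubspace_def)

lemma J_diff: "\<phi> \<in> D \<Longrightarrow> \<psi> \<in> D \<Longrightarrow> J (\<phi> - \<psi>) = J \<phi> - J \<psi>"
  using J_add[of \<phi> "(-1) *\<^sub>C \<psi>"] J_scaleC[of \<psi> "-1"] D_scaleC[of \<psi> "-1"] by simp

lemma norm_le_J: "\<phi> \<in> D \<Longrightarrow> norm \<phi> \<le> norm (J \<phi>) / sqrt l"
proof -
  assume "\<phi> \<in> D"
  then have "(sqrt l * norm \<phi>)\<^sup>2 \<le> (norm (J \<phi>))\<^sup>2"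
    using J_bound l_pos by (simp add: power_mult_distrib)
  then have "sqrt l * norm \<phi> \<le> norm (J \<phi>)" by (rule power2_le_imp_le) simp
  then show ?thesis using l_pos by (simp add: field_simps)
qed

lemma J_eq_0: "\<phi> \<in> D \<Longrightarrow> J \<phi> = 0 \<Longrightarrow> \<phi> = 0"
  using norm_le_J[of \<phi>] by simp

text \<open>\<open>B k\<close> is the Riesz vector of the functional given by k with respect to the
  form. Its uniqueness turns the linearity of B into a check of this defining property.\<close>

lemma B_eqI:
  assumes "\<psi> \<in> D" "\<And>\<phi>. \<phi> \<in> D \<Longrightarrow> cinner (J \<phi>) (J \<psi>) = cinner \<phi> k"
  shows "B k = \<psi>"
proof -
  have d: "B k - \<psi> \<in> D" by (intro D_diff B_in_D assms)
  have "cinner (J (B k - \<psi>)) (J (B k - \<psi>)) = 0"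
    using assms(2)[OF d] B_form[OF d, of k]
    by (simp add: J_diff[OF B_in_D assms(1)] cinner_diff_right)
  then have "J (B k - \<psi>) = 0" by (simp add: cinner_self)
  from J_eq_0[OF d this] show ?thesis by simp
qed

lemma B_add: "B (h + k) = B h + B k"
  by (rule B_eqI) (auto simp: D_add B_in_D J_add cinner_add_right B_form)

lemma B_scaleC: "B (c *\<^sub>C k) = c *\<^sub>C B k"
  by (rule B_eqI) (auto simp: D_scaleC B_in_D J_scaleC B_form)

lemma B_diff: "B (h - k) = B h - B k"
  by (rule B_eqI) (auto simp: D_diff B_in_D J_diff cinner_diff_right B_form)

lemma B_zero [simp]: "B 0 = 0"
  using B_scaleC[of 0 0] by simp

lemma B_symmetric: "cinner (B h) k = cinner h (B k)"
  by (metis B_form B_in_D cinner_commute)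

lemma cinner_B_self: "cinner (B k) k = of_real ((norm (J (B k)))\<^sup>2)"
  using B_form[OF B_in_D, of k k] by (simp add: cinner_self)

lemma norm_B_le: "norm (B k) \<le> norm k * (1 / l)"
proof (cases "B k = 0")
  case False
  have "l * (norm (B k))\<^sup>2 \<le> Re (cinner (B k) k)"
    using J_bound[OF B_in_D] by (simp add: cinner_B_self)
  also have "\<dots> \<le> norm (B k) * norm k"
    using complex_Re_le_cmod[of "cinner (B k) k"] cinner_bound[of "B k" k] by linarith
  finally have "norm (B k) * (l * norm (B k)) \<le> norm (B k) * norm k"
    by (simp add: power2_eq_square algebra_simps)
  then show ?thesis using False l_pos by (simp add: field_simps)
qed (use l_pos in simp)

lemma bounded_linear_B: "bounded_linear B"
  by (rule bounded_linear_intro[OF _ _ norm_B_le]) (simp_all add: B_add B_scaleC scaleR_scaleC)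

text \<open>If \<open>B k\<close> vanishes, then k is orthogonal to the dense set D.\<close>

lemma B_inj: "B k = 0 \<Longrightarrow> k = 0"
proof -
  assume "B k = 0"
  then have "cinner \<phi> k = 0" if "\<phi> \<in> D" for \<phi>
    using B_form[OF that, of k] J_scaleC[OF D_0, of 0] by simp
  then have "D \<subseteq> {\<phi>. cinner \<phi> k = 0}" by blast
  moreover have "closed {\<phi>. cinner \<phi> k = 0}"
    by (intro closed_Collect_eq bounded_bilinear.continuous_on[OF bounded_bilinear_cinner] continuous_intros)
  ultimately have "closure D \<subseteq> {\<phi>. cinner \<phi> k = 0}" by (rule closure_minimal)
  then have "cinner k k = 0" using D_dense by blast
  then show "k = 0" by (simp add: cinner_self)
qed

lemma G_nonzero: "G \<noteq> 0"
  using D_0 G_notin_D by blast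

lemma scale_G_in_D: "c *\<^sub>C G \<in> D \<Longrightarrow> c = 0"
  using D_scaleC[of "c *\<^sub>C G" "inverse c"] G_notin_D by (cases "c = 0") auto

lemma decomposition_unique:
  assumes "\<phi> \<in> D" "\<psi> \<in> D" "\<phi> + c *\<^sub>C G = \<psi> + d *\<^sub>C G"
  shows "\<phi> = \<psi>" "c = d"
proof -
  have "\<phi> - \<psi> = (d - c) *\<^sub>C G"
    using assms(3) by (simp add: cvec.scale_left_diff_distrib algebra_simps)
  then have "(d - c) *\<^sub>C G \<in> D" using D_diff[OF assms(1,2)] by simp
  then show "c = d" using scale_G_in_D[of "d - c"] by simp
  with assms(3) show "\<phi> = \<psi>" by simp
qed

text \<open>Adding multiples of this vector to k adjusts the scalar product of G with k to any
  prescribed value.\<close>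

definition K0 :: L2 where "K0 = of_real (1 / (norm G)\<^sup>2) *\<^sub>C G"

lemma cinner_G_K0 [simp]: "cinner G K0 = 1"
  using G_nonzero by (simp add: K0_def cinner_self)

lemma orthogonal_imp_span:
  assumes "\<And>h. cinner G h = 0 \<Longrightarrow> cinner x h = 0"
  shows "\<exists>c. x = c *\<^sub>C G"
proof -
  define h where "h = x - cinner G x *\<^sub>C K0"
  have "cinner G h = 0" by (simp add: h_def cinner_diff_right)
  then have "cinner x h = 0" "cinner K0 h = 0"
    using assms by (simp_all add: K0_def)
  then have "cinner h h = 0" by (subst h_def) (simp add: cinner_diff_left)
  then have "x = cinner G x *\<^sub>C K0" by (simp add: cinner_self h_def)
  then show ?thesis by (auto simp: K0_def intro: exI)
qed

section \<open>The minimal operator plus l and its self-adjoint extensions\<close>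

definition Smin :: operator where "Smin = {(B h, h) | h. cinner G h = 0}"
definition Tinf :: operator where "Tinf = {(B k, k) | k. True}"
text \<open>The linear relation is not solved for \<kappa>, so that \<gamma> = 0 is included: there
  k is confined to the orthogonal complement of G while \<kappa> is free.\<close>

definition Text :: "real \<Rightarrow> operator" where
  "Text \<gamma> = {(B k + \<kappa> *\<^sub>C G, k) | k \<kappa>. cinner G k = of_real \<gamma> * \<kappa>}"

lemma mem_Smin: "(f, k) \<in> Smin \<longleftrightarrow> f = B k \<and> cinner G k = 0"
  and mem_Tinf: "(f, k) \<in> Tinf \<longleftrightarrow> f = B k"
  and mem_Text: "(f, k) \<in> Text \<gamma> \<longleftrightarrow> (\<exists>\<kappa>. f = B k + \<kappa> *\<^sub>C G \<and> cinner G k = of_real \<gamma> * \<kappa>)"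
  by (auto simp: Smin_def Tinf_def Text_def)

lemma S_eq: "S = shift Smin (- of_real l)"
  by (simp add: S_def Smin_def)

lemma Smin_subset_Text: "Smin \<subseteq> Text \<gamma>"
  by (auto simp: mem_Smin mem_Text intro: exI[of _ 0])

lemma Smin_subset_Tinf: "Smin \<subseteq> Tinf"
  by (auto simp: mem_Smin mem_Tinf)

lemma Domain_Smin_dense: "closure (Domain Smin) = UNIV"
proof -
  have "D \<subseteq> closure (Domain Smin)"
  proof
    fix \<phi> assume \<phi>: "\<phi> \<in> D"
    show "\<phi> \<in> closure (Domain Smin)"
      unfolding closure_approachable
    proof (intro allI impI)
      fix e :: real assume "e > 0"
      then obtain h where h: "cinner G h = 0" "norm (J (\<phi> - B h)) < e * sqrt l"
        using core[OF \<phi>, of "e * sqrt l"] l_pos by auto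
      have "norm (\<phi> - B h) \<le> norm (J (\<phi> - B h)) / sqrt l" by (intro norm_le_J D_diff \<phi> B_in_D)
      also have "\<dots> < e" using h(2) l_pos by (simp add: field_simps)
      finally have "dist (B h) \<phi> < e" by (simp add: dist_norm norm_minus_commute)
      moreover have "(B h, h) \<in> Smin" using h(1) by (simp add: mem_Smin)
      ultimately show "\<exists>y\<in>Domain Smin. dist y \<phi> < e" by blast
    qed
  qed
  then show ?thesis using closure_minimal[of D "closure (Domain Smin)"] D_dense by auto
qed

lemma dense_Domain: "Smin \<subseteq> T \<Longrightarrow> closure (Domain T) = UNIV"
  using closure_mono[OF Domain_mono, of Smin T] Domain_Smin_dense by auto

text \<open>Testing with the pairs (\<open>B h\<close>, h) shows that g - \<open>B k\<close> is
  orthogonal to everything orthogonal to G, hence a multiple of G. The adjoint therefore exceeds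
  \<open>Tinf\<close> by the single direction G in its domain.\<close>

lemma mem_adjoint_Smin: "(g, k) \<in> adjoint_op Smin \<longleftrightarrow> (\<exists>c. g = B k + c *\<^sub>C G)"
proof
  assume *: "(g, k) \<in> adjoint_op Smin"
  have "cinner (g - B k) h = 0" if "cinner G h = 0" for h
  proof -
    have "(B h, h) \<in> Smin" using that by (simp add: mem_Smin)
    with * have "cinner g h = cinner k (B h)" by (simp add: mem_adjoint)
    then show ?thesis by (simp add: cinner_diff_left B_symmetric)
  qed
  from orthogonal_imp_span[OF this] show "\<exists>c. g = B k + c *\<^sub>C G"
    by (metis add.commute diff_add_cancel)
next
  assume "\<exists>c. g = B k + c *\<^sub>C G"
  then show "(g, k) \<in> adjoint_op Smin"
    by (auto simp: mem_adjoint mem_Smin cinner_add_left B_symmetric)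
qed

lemma is_operator_Tinf: "is_operator Tinf"
  unfolding is_operator_def single_valued_def
proof (intro conjI allI impI)
  show "k = k'" if "(f, k) \<in> Tinf" "(f, k') \<in> Tinf" for f k k'
    using that B_inj[of "k - k'"] by (simp add: mem_Tinf B_diff)
qed (auto simp: mem_Tinf B_add B_scaleC)

lemma is_operator_Text: "is_operator (Text \<gamma>)"
  unfolding is_operator_def single_valued_def
proof (intro conjI allI impI)
  show "(0, 0) \<in> Text \<gamma>" by (auto simp: mem_Text intro: exI[of _ 0])
  show "(f + g, h + k) \<in> Text \<gamma>" if "(f, h) \<in> Text \<gamma>" "(g, k) \<in> Text \<gamma>" for f h g k
  proof -
    from that obtain \<kappa> \<kappa>' where "f = B h + \<kappa> *\<^sub>C G" "cinner G h = of_real \<gamma> * \<kappa>"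
      "g = B k + \<kappa>' *\<^sub>C G" "cinner G k = of_real \<gamma> * \<kappa>'" by (auto simp: mem_Text)
    then show ?thesis unfolding mem_Text
      by (intro exI[of _ "\<kappa> + \<kappa>'"]) (auto simp: B_add cvec.scale_left_distrib cinner_add_right algebra_simps)
  qed
  show "(c *\<^sub>C f, c *\<^sub>C h) \<in> Text \<gamma>" if "(f, h) \<in> Text \<gamma>" for c f h
  proof -
    from that obtain \<kappa> where "f = B h + \<kappa> *\<^sub>C G" "cinner G h = of_real \<gamma> * \<kappa>"
      by (auto simp: mem_Text)
    then show ?thesis unfolding mem_Text
      by (intro exI[of _ "c * \<kappa>"]) (auto simp: B_scaleC cvec.scale_right_distrib algebra_simps)
  qed
  show "k = k'" if k: "(f, k) \<in> Text \<gamma>" "(f, k') \<in> Text \<gamma>" for f k k'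
  proof -
    obtain \<kappa> where 1: "f = B k + \<kappa> *\<^sub>C G" using k(1) unfolding mem_Text by blast
    obtain \<kappa>' where 2: "f = B k' + \<kappa>' *\<^sub>C G" using k(2) unfolding mem_Text by blast
    have "B k + \<kappa> *\<^sub>C G = B k' + \<kappa>' *\<^sub>C G" using 1 2 by simp
    then have "B k = B k'" by (rule decomposition_unique(1)[OF B_in_D B_in_D])
    then show ?thesis using B_inj[of "k - k'"] by (simp add: B_diff)
  qed
qed

lemma selfadjoint_Tinf: "selfadjoint Tinf"
proof -
  have "adjoint_op Tinf = Tinf"
  proof (intro equalityI subrelI)
    fix g k assume *: "(g, k) \<in> adjoint_op Tinf"
    then have "cinner g h = cinner (B k) h" for h
      by (simp add: mem_adjoint mem_Tinf B_symmetric)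
    then have "cinner (g - B k) (g - B k) = 0" by (simp add: cinner_diff_left)
    then show "(g, k) \<in> Tinf" by (simp add: cinner_self mem_Tinf)
  qed (auto simp: mem_adjoint mem_Tinf B_symmetric)
  then show ?thesis
    using is_operator_Tinf dense_Domain[OF Smin_subset_Tinf] by (simp add: selfadjoint_def)
qed

text \<open>An element of the adjoint already has the form B k + c G, because the extension contains
  \<open>Smin\<close>; a single further test pair fixes the relation between c and k.\<close>

lemma selfadjoint_Text: "selfadjoint (Text \<gamma>)"
proof -
  have "adjoint_op (Text \<gamma>) = Text \<gamma>"
  proof (intro equalityI subrelI)
    fix g k assume *: "(g, k) \<in> adjoint_op (Text \<gamma>)"
    then have "(g, k) \<in> adjoint_op Smin" using adjoint_antimono[OF Smin_subset_Text] by blast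
    then obtain c where c: "g = B k + c *\<^sub>C G" by (auto simp: mem_adjoint_Smin)
    \<comment> \<open>The test pair has coefficient 1 in front of G, and k is the multiple of
      \<open>K0\<close> that the relation then demands.\<close>
    have mem: "(B (of_real \<gamma> *\<^sub>C K0) + 1 *\<^sub>C G, of_real \<gamma> *\<^sub>C K0) \<in> Text \<gamma>"
      unfolding mem_Text by (intro exI[of _ 1]) simp
    have "cinner g (of_real \<gamma> *\<^sub>C K0) = cinner k (B (of_real \<gamma> *\<^sub>C K0) + 1 *\<^sub>C G)"
      by (rule *[unfolded mem_adjoint, rule_format, OF mem])
    then have "of_real \<gamma> * cnj c = cinner k G"
      unfolding c by (simp add: cinner_add_left cinner_add_right B_symmetric B_scaleC distrib_left)
    then have "cnj (of_real \<gamma> * cnj c) = cnj (cinner k G)" by simp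
    then have "cinner G k = of_real \<gamma> * c" by (simp add: cinner_commute[of G k])
    with c show "(g, k) \<in> Text \<gamma>" by (auto simp: mem_Text)
  next
    fix g k assume "(g, k) \<in> Text \<gamma>"
    then obtain c where c: "g = B k + c *\<^sub>C G" "cinner G k = of_real \<gamma> * c" by (auto simp: mem_Text)
    then have k: "cinner k G = of_real \<gamma> * cnj c" using cinner_commute[of k G] by simp
    show "(g, k) \<in> adjoint_op (Text \<gamma>)"
      unfolding mem_adjoint
    proof (intro allI impI)
      fix f h assume "(f, h) \<in> Text \<gamma>"
      then obtain d where "f = B h + d *\<^sub>C G" "cinner G h = of_real \<gamma> * d" by (auto simp: mem_Text)
      then show "cinner g h = cinner k f"
        using c k by (simp add: cinner_add_left cinner_add_right B_symmetric)
    qed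
  qed
  then show ?thesis
    using is_operator_Text dense_Domain[OF Smin_subset_Text] by (simp add: selfadjoint_def)
qed

text \<open>For two pairs symmetry reads cnj c <G, k'> = cnj <G, k> c'. A single pair with nonzero
  coefficient thus fixes the relation for all others, and the pair tested with itself shows that the
  ratio \<gamma> is real. Since self-adjoint operators are maximal, the inclusion obtained is an
  equality.\<close>

theorem selfadjoint_extension_cases:
  assumes T: "selfadjoint T" "Smin \<subseteq> T"
  shows "T = Tinf \<or> (\<exists>\<gamma>. T = Text \<gamma>)"
proof -
  have "T \<subseteq> adjoint_op Smin"
    using adjoint_antimono[OF T(2)] T(1) by (simp add: selfadjoint_def)
  then have ex: "\<exists>c. f = B k + c *\<^sub>C G" if "(f, k) \<in> T" for f k
    using that mem_adjoint_Smin by blast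
  have sym: "cnj c * cinner G k' = cnj (cinner G k) * c'"
    if "(B k + c *\<^sub>C G, k) \<in> T" "(B k' + c' *\<^sub>C G, k') \<in> T" for k c k' c'
    using selfadjoint_symmetric[OF T(1) that(2,1)] cinner_commute[of k G]
    by (simp add: cinner_add_left cinner_add_right B_symmetric mult.commute)
  show ?thesis
  proof (cases "\<forall>k c. (B k + c *\<^sub>C G, k) \<in> T \<longrightarrow> c = 0")
    case True
    have "T \<subseteq> Tinf"
    proof (rule subrelI)
      fix f k assume fk: "(f, k) \<in> T"
      then obtain c where "f = B k + c *\<^sub>C G" using ex by blast
      with True fk show "(f, k) \<in> Tinf" by (auto simp: mem_Tinf)
    qed
    then show ?thesis using selfadjoint_maximal[OF T(1) selfadjoint_Tinf] by blast
  next
    case False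
    then obtain k0 c0 where k0: "(B k0 + c0 *\<^sub>C G, k0) \<in> T" "c0 \<noteq> 0" by blast
    have "cnj (cinner G k0 / c0) = cinner G k0 / c0"
      using sym[OF k0(1) k0(1)] k0(2) by (simp add: field_simps)
    then have "cinner G k0 / c0 \<in> \<real>" by (simp add: Reals_cnj_iff)
    then obtain \<gamma> where \<gamma>: "cinner G k0 / c0 = of_real \<gamma>" by (auto elim: Reals_cases)
    have "T \<subseteq> Text \<gamma>"
    proof (rule subrelI)
      fix f k assume fk: "(f, k) \<in> T"
      then obtain c where c: "f = B k + c *\<^sub>C G" using ex by blast
      have "cnj c0 * cinner G k = cnj (of_real \<gamma> * c0) * c"
        using sym[OF k0(1), of k c] fk c \<gamma> k0(2) by (simp add: field_simps)
      then have "cinner G k = of_real \<gamma> * c" using k0(2) by simp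
      with c show "(f, k) \<in> Text \<gamma>" by (auto simp: mem_Text)
    qed
    then show ?thesis using selfadjoint_maximal[OF T(1) selfadjoint_Text] by blast
  qed
qed

section \<open>Lower bounds, spectrum and inverses of the extensions\<close>

lemma cinner_Text:
  assumes "cinner G k = of_real \<gamma> * \<kappa>"
  shows "cinner (B k + \<kappa> *\<^sub>C G) k = of_real ((norm (J (B k)))\<^sup>2 + \<gamma> * (cmod \<kappa>)\<^sup>2)"
  using assms complex_norm_square[of \<kappa>] by (simp add: cinner_add_left cinner_B_self mult_ac)

lemma semibounded_Text: "semibounded (Text \<gamma>)"
proof -
  \<comment> \<open>Chosen so that \<bar>\<gamma>\<bar> e is at most 1: the form of
    \<open>B k\<close> then absorbs its share of the point term even when \<gamma> is
    negative.\<close>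
  define e where "e = 1 / (\<bar>\<gamma>\<bar> + 1)"
  have e: "e > 0" "\<bar>\<gamma>\<bar> * e \<le> 1" by (auto simp: e_def field_simps)
  obtain C where C: "\<And>\<phi> \<kappa>. \<phi> \<in> D \<Longrightarrow> (cmod \<kappa>)\<^sup>2 \<le> e * (norm (J \<phi>))\<^sup>2 + C * (norm (\<phi> + \<kappa> *\<^sub>C G))\<^sup>2"
    using coercive[OF e(1)] by blast
  have "- \<bar>\<gamma>\<bar> * C * (norm f)\<^sup>2 \<le> Re (cinner f k)" if "(f, k) \<in> Text \<gamma>" for f k
  proof -
    from that
    obtain \<kappa> where f: "f = B k + \<kappa> *\<^sub>C G" "cinner G k = of_real \<gamma> * \<kappa>" by (auto simp: mem_Text)
    have "\<bar>\<gamma>\<bar> * (cmod \<kappa>)\<^sup>2 \<le> \<bar>\<gamma>\<bar> * (e * (norm (J (B k)))\<^sup>2 + C * (norm f)\<^sup>2)"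
      unfolding f(1) by (intro mult_left_mono C B_in_D) auto
    also have "\<dots> = (\<bar>\<gamma>\<bar> * e) * (norm (J (B k)))\<^sup>2 + \<bar>\<gamma>\<bar> * C * (norm f)\<^sup>2"
      by (simp add: algebra_simps)
    also have "\<dots> \<le> 1 * (norm (J (B k)))\<^sup>2 + \<bar>\<gamma>\<bar> * C * (norm f)\<^sup>2"
      by (intro add_right_mono mult_right_mono e) auto
    finally have "\<bar>\<gamma>\<bar> * (cmod \<kappa>)\<^sup>2 \<le> (norm (J (B k)))\<^sup>2 + \<bar>\<gamma>\<bar> * C * (norm f)\<^sup>2" by simp
    moreover have "- (\<bar>\<gamma>\<bar> * (cmod \<kappa>)\<^sup>2) \<le> \<gamma> * (cmod \<kappa>)\<^sup>2"
      using mult_right_mono[of "- \<bar>\<gamma>\<bar>" \<gamma> "(cmod \<kappa>)\<^sup>2"] by auto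
    moreover have "Re (cinner f k) = (norm (J (B k)))\<^sup>2 + \<gamma> * (cmod \<kappa>)\<^sup>2"
      unfolding f(1) cinner_Text[OF f(2)] by simp
    ultimately show ?thesis by simp
  qed
  then show ?thesis unfolding semibounded_def by blast
qed

lemma Tinf_lower_bound: "(f, k) \<in> Tinf \<Longrightarrow> l * (norm f)\<^sup>2 \<le> Re (cinner f k)"
  using J_bound[OF B_in_D, of k] by (auto simp: mem_Tinf cinner_B_self)

lemma semibounded_Tinf: "semibounded Tinf"
  using Tinf_lower_bound unfolding semibounded_def by blast

lemma Text_nonneg: "0 \<le> \<gamma> \<Longrightarrow> (f, k) \<in> Text \<gamma> \<Longrightarrow> 0 * (norm f)\<^sup>2 \<le> Re (cinner f k)"
proof -
  assume "0 \<le> \<gamma>" "(f, k) \<in> Text \<gamma>"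
  then obtain \<kappa> where f: "f = B k + \<kappa> *\<^sub>C G" "cinner G k = of_real \<gamma> * \<kappa>" by (auto simp: mem_Text)
  show ?thesis
    unfolding f(1) cinner_Text[OF f(2)] using \<open>0 \<le> \<gamma>\<close> by simp
qed

lemma Text_pos:
  assumes "\<gamma> > 0"
  shows "\<exists>m>0. \<forall>f k. (f, k) \<in> Text \<gamma> \<longrightarrow> m * (norm f)\<^sup>2 \<le> Re (cinner f k)"
proof -
  \<comment> \<open>Half of each constant, because the squared norm of
    \<open>B k + \<kappa> *\<^sub>C G\<close> is at most twice the sum of the two squared
    norms.\<close>
  define m where "m = min (l / 2) (\<gamma> / (2 * (norm G)\<^sup>2))"
  have m: "m > 0" "2 * m \<le> l" "2 * m * (norm G)\<^sup>2 \<le> \<gamma>"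
    using assms l_pos G_nonzero by (auto simp: m_def min_def field_simps)
  show ?thesis
  proof (intro exI[of _ m] conjI allI impI m(1))
    fix f k assume "(f, k) \<in> Text \<gamma>"
    then obtain \<kappa> where f: "f = B k + \<kappa> *\<^sub>C G" "cinner G k = of_real \<gamma> * \<kappa>" by (auto simp: mem_Text)
    have "m * (norm f)\<^sup>2 \<le> m * (2 * (norm (B k))\<^sup>2 + 2 * (norm (\<kappa> *\<^sub>C G))\<^sup>2)"
      unfolding f(1) using m(1) by (intro mult_left_mono norm_power2_add_le) auto
    also have "\<dots> = (2 * m) * (norm (B k))\<^sup>2 + (2 * m * (norm G)\<^sup>2) * (cmod \<kappa>)\<^sup>2"
      by (simp add: power_mult_distrib algebra_simps)
    also have "\<dots> \<le> l * (norm (B k))\<^sup>2 + \<gamma> * (cmod \<kappa>)\<^sup>2"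
      by (intro add_mono mult_right_mono m) auto
    also have "\<dots> \<le> (norm (J (B k)))\<^sup>2 + \<gamma> * (cmod \<kappa>)\<^sup>2"
      using J_bound[OF B_in_D, of k] by simp
    also have "\<dots> = Re (cinner f k)"
      unfolding f(1) cinner_Text[OF f(2)] by simp
    finally show "m * (norm f)\<^sup>2 \<le> Re (cinner f k)" .
  qed
qed

text \<open>Split off b \<open>B K0\<close>, approximate the rest within the core and add b
  \<open>K0\<close> back. The scalar product of G with k can thus be prescribed at arbitrarily small
  cost in the form norm.\<close>

lemma core_affine:
  assumes "\<phi> \<in> D" "e > 0"
  shows "\<exists>k. cinner G k = b \<and> norm (J (\<phi> - B k)) < e"
proof -
  have "\<phi> - b *\<^sub>C B K0 \<in> D" by (intro D_diff D_scaleC B_in_D assms)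
  from core[OF this assms(2)] obtain h where h: "cinner G h = 0" "norm (J (\<phi> - b *\<^sub>C B K0 - B h)) < e"
    by blast
  have eq: "\<phi> - B (h + b *\<^sub>C K0) = \<phi> - b *\<^sub>C B K0 - B h" by (simp add: B_add B_scaleC)
  show ?thesis
    using h by (intro exI[of _ "h + b *\<^sub>C K0"]) (simp only: eq, simp add: cinner_add_right)
qed

text \<open>With coefficient 1 in front of G and \<open>B k\<close> nearly 0 in the form norm, the
  value of the form is nearly \<gamma>.\<close>

lemma Text_negative:
  assumes "\<gamma> < 0"
  shows "\<exists>f k. (f, k) \<in> Text \<gamma> \<and> Re (cinner f k) < 0 * (norm f)\<^sup>2"
proof -
  obtain k where k: "cinner G k = of_real \<gamma> * 1" "norm (J (0 - B k)) < sqrt (- \<gamma>)"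
    using core_affine[OF D_0, of "sqrt (- \<gamma>)" "of_real \<gamma> * 1"] assms by auto
  have "J (0 - B k) = - J (B k)"
    using J_scaleC[OF B_in_D[of k], of "-1"] by simp
  then have "(norm (J (B k)))\<^sup>2 < (sqrt (- \<gamma>))\<^sup>2"
    using k(2) by (intro power_strict_mono) auto
  then have "Re (cinner (B k + 1 *\<^sub>C G) k) < 0"
    unfolding cinner_Text[OF k(1)] using assms by simp
  moreover have "(B k + 1 *\<^sub>C G, k) \<in> Text \<gamma>" using k(1) by (auto simp: mem_Text intro: exI[of _ 1])
  ultimately show ?thesis by (intro exI[of _ "B k + 1 *\<^sub>C G"] exI[of _ k]) simp
qed

lemma converse_Tinf: "Tinf\<inverse> = op_graph B"
  by (auto simp: op_graph_def mem_Tinf)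

lemma invertible_Tinf: "invertible_op Tinf"
  unfolding invertible_op_def using bounded_linear_B converse_Tinf by blast

lemma converse_Text:
  assumes "\<gamma> \<noteq> 0"
  shows "(Text \<gamma>)\<inverse> = op_graph (\<lambda>k. B k + (of_real (1 / \<gamma>) * cinner G k) *\<^sub>C G)"
proof -
  have "(f, k) \<in> Text \<gamma> \<longleftrightarrow> f = B k + (of_real (1 / \<gamma>) * cinner G k) *\<^sub>C G" for f k
  proof -
    have "cinner G k = of_real \<gamma> * \<kappa> \<longleftrightarrow> \<kappa> = of_real (1 / \<gamma>) * cinner G k" for \<kappa>
      using assms by (auto simp: field_simps)
    then show ?thesis by (simp only: mem_Text) blast
  qed
  then show ?thesis by (auto simp: op_graph_def)
qed

lemma invertible_Text_iff: "invertible_op (Text \<gamma>) \<longleftrightarrow> \<gamma> \<noteq> 0"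
proof
  assume "\<gamma> \<noteq> 0"
  moreover have "bounded_linear (\<lambda>k. B k + (of_real (1 / \<gamma>) * cinner G k) *\<^sub>C G)"
    by (intro bounded_linear_add bounded_linear_B
        bounded_linear_compose[OF bounded_bilinear.bounded_linear_left[OF bounded_bilinear_scaleC]]
        bounded_linear_const_mult bounded_bilinear.bounded_linear_right[OF bounded_bilinear_cinner])
  ultimately show "invertible_op (Text \<gamma>)"
    unfolding invertible_op_def using converse_Text by blast
next
  assume inv: "invertible_op (Text \<gamma>)"
  show "\<gamma> \<noteq> 0"
  proof
    assume "\<gamma> = 0"
    \<comment> \<open>With k = 0 and coefficient 1: G is in the kernel.\<close>
    then have "(G, 0) \<in> Text \<gamma>" by (auto simp: mem_Text intro: exI[of _ 1])
    with invertible_op_bound[OF inv] have "norm G \<le> 0" by (metis mult_zero_right norm_zero)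
    then show False using G_nonzero by simp
  qed
qed

lemma inf_spectrum_Tinf: "inf_spectrum Tinf > 0"
proof -
  have "(0::ereal) < ereal l" using l_pos by simp
  also have "\<dots> \<le> inf_spectrum Tinf" by (rule inf_spectrum_ge[OF selfadjoint_Tinf Tinf_lower_bound])
  finally show ?thesis .
qed

lemma inf_spectrum_Text_ge: "inf_spectrum (Text \<gamma>) \<ge> 0 \<longleftrightarrow> \<gamma> \<ge> 0"
  and inf_spectrum_Text_gt: "inf_spectrum (Text \<gamma>) > 0 \<longleftrightarrow> \<gamma> > 0"
proof -
  have neg: "inf_spectrum (Text \<gamma>) < 0" if neg: "\<gamma> < 0"
  proof -
    obtain f k where fk: "(f, k) \<in> Text \<gamma>" "Re (cinner f k) < 0 * (norm f)\<^sup>2"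
      using Text_negative[OF neg] by blast
    obtain z where "z \<in> spectrum (Text \<gamma>)" "Re z < 0"
      using spectrum_below[OF selfadjoint_Text semibounded_Text fk] .
    then have "inf_spectrum (Text \<gamma>) \<le> ereal (Re z)" "ereal (Re z) < 0"
      using inf_spectrum_le[of z "Text \<gamma>"] by auto
    then show ?thesis by (rule le_less_trans)
  qed
  have zero: "inf_spectrum (Text 0) \<le> 0"
  proof -
    have "0 \<in> spectrum (Text 0)" using invertible_Text_iff[of 0] by (simp add: spectrum_def)
    from inf_spectrum_le[OF this] show ?thesis by (simp only: zero_complex.sel zero_ereal_def)
  qed
  have nonneg: "inf_spectrum (Text \<gamma>) \<ge> 0" if "\<gamma> \<ge> 0"
  proof -
    have "ereal 0 \<le> inf_spectrum (Text \<gamma>)"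
      by (rule inf_spectrum_ge[OF selfadjoint_Text Text_nonneg[OF that]])
    then show ?thesis by (simp only: zero_ereal_def)
  qed
  have pos: "inf_spectrum (Text \<gamma>) > 0" if pos: "\<gamma> > 0"
  proof -
    obtain m where m: "m > 0" "\<And>f k. (f, k) \<in> Text \<gamma> \<Longrightarrow> m * (norm f)\<^sup>2 \<le> Re (cinner f k)"
      using Text_pos[OF pos] by blast
    have "(0::ereal) < ereal m" using m(1) by simp
    also have "\<dots> \<le> inf_spectrum (Text \<gamma>)" by (rule inf_spectrum_ge[OF selfadjoint_Text m(2)])
    finally show ?thesis .
  qed
  show "inf_spectrum (Text \<gamma>) \<ge> 0 \<longleftrightarrow> \<gamma> \<ge> 0"
    using neg nonneg by (cases "\<gamma> \<ge> 0") (auto simp: not_le)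
  show "inf_spectrum (Text \<gamma>) > 0 \<longleftrightarrow> \<gamma> > 0"
    using neg pos zero by (cases \<gamma> "0::real" rule: linorder_cases) (auto simp: not_less)
qed

subsection \<open>Quadratic forms of the extensions\<close>

text \<open>The total form need not be positive, so its Cauchy property must first be split into
  those of \<open>J (\<phi> n)\<close> and \<open>\<kappa> n\<close>. Relative boundedness absorbs
  the point term into half of the J-part up to the L2 distances, which tend to 0. Completeness and
  closedness of J then give the limits.\<close>

lemma form_limit:
  assumes \<phi>: "\<And>n. \<phi> n \<in> D" and lim: "(\<lambda>n. \<phi> n + \<kappa> n *\<^sub>C G) \<longlonglongrightarrow> f"
    and E: "((\<lambda>(m, n). (norm (J (\<phi> m - \<phi> n)))\<^sup>2 + \<gamma> * (cmod (\<kappa> m - \<kappa> n))\<^sup>2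
       - l * (norm ((\<phi> m + \<kappa> m *\<^sub>C G) - (\<phi> n + \<kappa> n *\<^sub>C G)))\<^sup>2) \<longlongrightarrow> 0) (sequentially \<times>\<^sub>F sequentially)"
  obtains \<psi> c where "\<psi> \<in> D" "f = \<psi> + c *\<^sub>C G" "(\<lambda>n. J (\<phi> n)) \<longlonglongrightarrow> J \<psi>" "\<kappa> \<longlonglongrightarrow> c"
proof -
  define u where "u n = \<phi> n + \<kappa> n *\<^sub>C G" for n
  define X where "X p = (norm (J (\<phi> (fst p)) - J (\<phi> (snd p))))\<^sup>2" for p
  define Y where "Y p = (cmod (\<kappa> (fst p) - \<kappa> (snd p)))\<^sup>2" for p
  define Z where "Z p = (norm (u (fst p) - u (snd p)))\<^sup>2" for p
  \<comment> \<open>Makes \<bar>\<gamma>\<bar> e at most 1/2, so that half of X survives the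
    absorption of the point term.\<close>
  define e where "e = 1 / (2 * (\<bar>\<gamma>\<bar> + 1))"
  have e: "e > 0" "\<bar>\<gamma>\<bar> * e \<le> 1 / 2" by (auto simp: e_def field_simps)
  obtain C where C: "\<And>\<phi> \<kappa>. \<phi> \<in> D \<Longrightarrow> (cmod \<kappa>)\<^sup>2 \<le> e * (norm (J \<phi>))\<^sup>2 + C * (norm (\<phi> + \<kappa> *\<^sub>C G))\<^sup>2"
    using coercive[OF e(1)] by blast
  have Z0: "(Z \<longlongrightarrow> 0) (sequentially \<times>\<^sub>F sequentially)"
    using tendsto_norm_diff_prod[OF lim] unfolding Z_def[abs_def] u_def by (simp only: case_prod_beta')
  have YC: "Y p \<le> e * X p + C * Z p" for p
  proof -
    have "(\<phi> (fst p) - \<phi> (snd p)) + (\<kappa> (fst p) - \<kappa> (snd p)) *\<^sub>C G = u (fst p) - u (snd p)"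
      by (simp add: u_def cvec.scale_left_diff_distrib)
    then show ?thesis
      using C[OF D_diff[OF \<phi> \<phi>], of "\<kappa> (fst p) - \<kappa> (snd p)" "fst p" "snd p"]
      by (simp add: X_def Y_def Z_def J_diff[OF \<phi> \<phi>])
  qed
  have E': "((\<lambda>p. X p + \<gamma> * Y p - l * Z p) \<longlongrightarrow> 0) (sequentially \<times>\<^sub>F sequentially)"
    using E by (simp add: X_def Y_def Z_def u_def case_prod_beta' J_diff[OF \<phi> \<phi>])
  have X_le: "X p \<le> 2 * ((X p + \<gamma> * Y p - l * Z p) + (l + \<bar>\<gamma>\<bar> * C) * Z p)" for p
  proof -
    have "- (\<gamma> * Y p) \<le> \<bar>\<gamma>\<bar> * Y p"
      using mult_right_mono[of "- \<gamma>" "\<bar>\<gamma>\<bar>" "Y p"] by (simp add: Y_def)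
    also have "\<dots> \<le> \<bar>\<gamma>\<bar> * (e * X p + C * Z p)" by (intro mult_left_mono YC) auto
    also have "\<dots> = (\<bar>\<gamma>\<bar> * e) * X p + \<bar>\<gamma>\<bar> * C * Z p" by (simp add: algebra_simps)
    also have "\<dots> \<le> (1/2) * X p + \<bar>\<gamma>\<bar> * C * Z p"
      by (intro add_right_mono mult_right_mono e) (simp add: X_def)
    finally show ?thesis by (simp add: algebra_simps)
  qed
  have X0: "(X \<longlongrightarrow> 0) (sequentially \<times>\<^sub>F sequentially)"
  proof (rule tendsto_sandwich[OF always_eventually always_eventually tendsto_const])
    show "\<forall>p. 0 \<le> X p" by (simp add: X_def)
    show "\<forall>p. X p \<le> 2 * ((X p + \<gamma> * Y p - l * Z p) + (l + \<bar>\<gamma>\<bar> * C) * Z p)" using X_le by blast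
    show "((\<lambda>p. 2 * ((X p + \<gamma> * Y p - l * Z p) + (l + \<bar>\<gamma>\<bar> * C) * Z p)) \<longlongrightarrow> 0) (sequentially \<times>\<^sub>F sequentially)"
      using tendsto_mult[OF tendsto_const[of 2] tendsto_add[OF E' tendsto_mult[OF tendsto_const[of "l + \<bar>\<gamma>\<bar> * C"] Z0]]]
      by simp
  qed
  have Y0: "(Y \<longlongrightarrow> 0) (sequentially \<times>\<^sub>F sequentially)"
  proof (rule tendsto_sandwich[OF always_eventually always_eventually tendsto_const])
    show "\<forall>p. 0 \<le> Y p" by (simp add: Y_def)
    show "\<forall>p. Y p \<le> e * X p + C * Z p" using YC by blast
    show "((\<lambda>p. e * X p + C * Z p) \<longlongrightarrow> 0) (sequentially \<times>\<^sub>F sequentially)"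
      using tendsto_add[OF tendsto_mult[OF tendsto_const[of e] X0] tendsto_mult[OF tendsto_const[of C] Z0]] by simp
  qed
  have "Cauchy (\<lambda>n. J (\<phi> n))"
    by (rule CauchyI_norm_power2) (use order_tendstoD(2)[OF X0] in \<open>simp add: X_def case_prod_beta'\<close>)
  then obtain g where g: "(\<lambda>n. J (\<phi> n)) \<longlonglongrightarrow> g" using Cauchy_convergent convergent_def by blast
  have "Cauchy \<kappa>"
    by (rule CauchyI_norm_power2) (use order_tendstoD(2)[OF Y0] in \<open>simp add: Y_def case_prod_beta'\<close>)
  then obtain c where c: "\<kappa> \<longlonglongrightarrow> c" using Cauchy_convergent convergent_def by blast
  have "(\<lambda>n. (\<phi> n + \<kappa> n *\<^sub>C G) - \<kappa> n *\<^sub>C G) \<longlonglongrightarrow> f - c *\<^sub>C G"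
    by (intro tendsto_diff lim tendsto_scaleC c tendsto_const)
  then have "\<phi> \<longlonglongrightarrow> f - c *\<^sub>C G" by simp
  from J_closed[OF \<phi> this g] show thesis
    using that[of "f - c *\<^sub>C G" c] g c by auto
qed

lemma core_sequence:
  assumes "\<phi> \<in> D"
  obtains k where "\<And>n::nat. cinner G (k n) = b" "(\<lambda>n. J (B (k n))) \<longlonglongrightarrow> J \<phi>" "(\<lambda>n. B (k n)) \<longlonglongrightarrow> \<phi>"
proof -
  have "\<forall>n::nat. \<exists>k. cinner G k = b \<and> norm (J (\<phi> - B k)) < 1 / (real n + 1)"
    by (intro allI core_affine[OF assms]) simp
  from choice[OF this] obtain k
    where k: "\<And>n. cinner G (k n) = b" "\<And>n::nat. norm (J (\<phi> - B (k n))) < 1 / (real n + 1)"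
    by blast
  have lim0: "(\<lambda>n::nat. 1 / (real n + 1)) \<longlonglongrightarrow> 0" by real_asymp
  have "(\<lambda>n. J (\<phi> - B (k n))) \<longlonglongrightarrow> 0"
    by (rule Lim_null_comparison[OF always_eventually lim0]) (use k(2) less_imp_le in blast)
  then have "(\<lambda>n. J \<phi> - J (B (k n))) \<longlonglongrightarrow> 0" by (simp add: J_diff assms B_in_D)
  from tendsto_diff[OF tendsto_const[of "J \<phi>"] this] have 1: "(\<lambda>n. J (B (k n))) \<longlonglongrightarrow> J \<phi>" by simp
  have lim1: "(\<lambda>n::nat. 1 / (real n + 1) / sqrt l) \<longlonglongrightarrow> 0"
    using tendsto_divide[OF lim0 tendsto_const[of "sqrt l"]] l_pos by simp
  have "(\<lambda>n. \<phi> - B (k n)) \<longlonglongrightarrow> 0"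
  proof (rule Lim_null_comparison[OF always_eventually lim1], rule allI)
    fix n
    have "norm (\<phi> - B (k n)) \<le> norm (J (\<phi> - B (k n))) / sqrt l" by (intro norm_le_J D_diff assms B_in_D)
    also have "\<dots> \<le> 1 / (real n + 1) / sqrt l"
      using k(2)[of n] l_pos by (intro divide_right_mono) auto
    finally show "norm (\<phi> - B (k n)) \<le> 1 / (real n + 1) / sqrt l" .
  qed
  from tendsto_diff[OF tendsto_const[of \<phi>] this] have 2: "(\<lambda>n. B (k n)) \<longlonglongrightarrow> \<phi>" by simp
  show thesis by (rule that[OF k(1) 1 2])
qed

text \<open>Covers all extensions at once: \<open>T\<close> is \<open>S\<close>, the Friedrichs extension (both with \<open>\<kappa> = 0\<close>) or
  the extension with parameter \<open>\<gamma>\<close>.\<close>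

lemma op_form_representation:
  assumes op: "is_operator T" and T: "\<And>f k. (f, k) \<in> shift T (of_real l) \<Longrightarrow>
      \<exists>\<kappa>. f = B k + \<kappa> *\<^sub>C G \<and> cinner (\<kappa> *\<^sub>C G) k = of_real \<gamma> * of_real ((cmod \<kappa>)\<^sup>2) \<and> P \<kappa>"
    and u: "\<And>n::nat. u n \<in> Domain T"
  shows "\<exists>k \<kappa>. (\<forall>n. u n = B (k n) + \<kappa> n *\<^sub>C G) \<and> (\<forall>n. P (\<kappa> n)) \<and>
    (\<forall>n. op_form T (u n) = of_real ((norm (J (B (k n))))\<^sup>2 + \<gamma> * (cmod (\<kappa> n))\<^sup>2 - l * (norm (u n))\<^sup>2)) \<and>
    (\<forall>m n. op_form T (u m - u n) = of_real ((norm (J (B (k m) - B (k n))))\<^sup>2 + \<gamma> * (cmod (\<kappa> m - \<kappa> n))\<^sup>2 - l * (norm (u m - u n))\<^sup>2))"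
proof -
  have "\<forall>n. \<exists>h. (u n, h) \<in> T" using u by blast
  from choice[OF this] obtain h where h: "\<And>n. (u n, h n) \<in> T" by blast
  define k where "k n = h n + of_real l *\<^sub>C u n" for n
  have uk: "(u n, k n) \<in> shift T (of_real l)" for n using h by (simp add: mem_shift k_def)
  have "\<forall>n. \<exists>\<kappa>. u n = B (k n) + \<kappa> *\<^sub>C G \<and> P \<kappa>" using T[OF uk] by blast
  from choice[OF this] obtain \<kappa> where \<kappa>: "\<And>n. u n = B (k n) + \<kappa> n *\<^sub>C G"  "\<And>n. P (\<kappa> n)" by blast
  have val: "op_form T f = of_real ((norm (J (B k)))\<^sup>2 + \<gamma> * (cmod \<kappa>)\<^sup>2 - l * (norm f)\<^sup>2)"
    if fk: "(f, k) \<in> shift T (of_real l)" and f: "f = B k + \<kappa> *\<^sub>C G" for f k \<kappa>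
  proof -
    obtain \<kappa>' where \<kappa>': "f = B k + \<kappa>' *\<^sub>C G" "cinner (\<kappa>' *\<^sub>C G) k = of_real \<gamma> * of_real ((cmod \<kappa>')\<^sup>2)"
      using T[OF fk] by blast
    \<comment> \<open>The hypothesis on T only provides some coefficient; uniqueness of the
      decomposition identifies it with the given one.\<close>
    have "\<kappa>' = \<kappa>"
      by (rule decomposition_unique(2)[OF B_in_D B_in_D \<kappa>'(1)[symmetric, unfolded f]])
    with \<kappa>' have c: "cinner (\<kappa> *\<^sub>C G) k = of_real \<gamma> * of_real ((cmod \<kappa>)\<^sup>2)" by simp
    have "op_form T f = cinner f (k - of_real l *\<^sub>C f)"
      using fk by (intro op_form_eq[OF op]) (simp add: mem_shift)
    also have "\<dots> = cinner f k - of_real (l * (norm f)\<^sup>2)" by (simp add: cinner_diff_right cinner_self)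
    also have "cinner f k = of_real ((norm (J (B k)))\<^sup>2 + \<gamma> * (cmod \<kappa>)\<^sup>2)"
      unfolding f cinner_add_left c by (simp add: cinner_B_self)
    finally show ?thesis by simp
  qed
  show ?thesis
  proof (intro exI[of _ k] exI[of _ \<kappa>] conjI allI \<kappa>)
    show "op_form T (u n) = of_real ((norm (J (B (k n))))\<^sup>2 + \<gamma> * (cmod (\<kappa> n))\<^sup>2 - l * (norm (u n))\<^sup>2)" for n
      by (rule val[OF uk \<kappa>(1)])
    show "op_form T (u m - u n) = of_real ((norm (J (B (k m) - B (k n))))\<^sup>2 + \<gamma> * (cmod (\<kappa> m - \<kappa> n))\<^sup>2 - l * (norm (u m - u n))\<^sup>2)" for m n
    proof -
      have "(u m - u n, k m - k n) \<in> shift T (of_real l)"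
        by (intro is_operatorD(4)[OF is_operator_shift[OF op]] uk)
      moreover have "u m - u n = B (k m - k n) + (\<kappa> m - \<kappa> n) *\<^sub>C G"
        by (subst \<kappa>(1)[of m], subst \<kappa>(1)[of n]) (simp add: B_diff cvec.scale_left_diff_distrib)
      ultimately have "op_form T (u m - u n) = of_real ((norm (J (B (k m - k n))))\<^sup>2 + \<gamma> * (cmod (\<kappa> m - \<kappa> n))\<^sup>2 - l * (norm (u m - u n))\<^sup>2)"
        by (rule val)
      then show ?thesis by (simp only: B_diff)
    qed
  qed
qed

text \<open>The limit depends on f only through its decomposition, which makes the form independent
  of the approximating sequence. The flag Z records that all coefficients vanish, as they do for the
  minimal operator and the Friedrichs extension; the limit coefficient then vanishes too.\<close>

lemma form_conv_limit:
  assumes op: "is_operator T" and T: "\<And>f k. (f, k) \<in> shift T (of_real l) \<Longrightarrow>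
      \<exists>\<kappa>. f = B k + \<kappa> *\<^sub>C G \<and> cinner (\<kappa> *\<^sub>C G) k = of_real \<gamma> * of_real ((cmod \<kappa>)\<^sup>2) \<and> (Z \<longrightarrow> \<kappa> = 0)"
    and u: "form_conv T u f"
  shows "\<exists>\<psi> c. \<psi> \<in> D \<and> f = \<psi> + c *\<^sub>C G \<and> (Z \<longrightarrow> c = 0) \<and>
    (\<lambda>n. op_form T (u n)) \<longlonglongrightarrow> of_real ((norm (J \<psi>))\<^sup>2 + \<gamma> * (cmod c)\<^sup>2 - l * (norm f)\<^sup>2)"
proof -
  from u have u': "\<And>n. u n \<in> Domain T" "u \<longlonglongrightarrow> f"
    "((\<lambda>(m, n). op_form T (u m - u n)) \<longlongrightarrow> 0) (sequentially \<times>\<^sub>F sequentially)"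
    by (auto simp: form_conv_def)
  obtain k \<kappa> where k: "\<And>n. u n = B (k n) + \<kappa> n *\<^sub>C G" "\<And>n. Z \<longrightarrow> \<kappa> n = 0"
    "\<And>n. op_form T (u n) = of_real ((norm (J (B (k n))))\<^sup>2 + \<gamma> * (cmod (\<kappa> n))\<^sup>2 - l * (norm (u n))\<^sup>2)"
    "\<And>m n. op_form T (u m - u n) = of_real ((norm (J (B (k m) - B (k n))))\<^sup>2 + \<gamma> * (cmod (\<kappa> m - \<kappa> n))\<^sup>2 - l * (norm (u m - u n))\<^sup>2)"
    using op_form_representation[where P="\<lambda>\<kappa>. Z \<longrightarrow> \<kappa> = 0" and u=u, OF op T u'(1)] by blast
  have ueq: "u = (\<lambda>n. B (k n) + \<kappa> n *\<^sub>C G)" using k(1) by auto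
  have E: "((\<lambda>(m, n). (norm (J (B (k m) - B (k n))))\<^sup>2 + \<gamma> * (cmod (\<kappa> m - \<kappa> n))\<^sup>2
       - l * (norm ((B (k m) + \<kappa> m *\<^sub>C G) - (B (k n) + \<kappa> n *\<^sub>C G)))\<^sup>2) \<longlongrightarrow> 0) (sequentially \<times>\<^sub>F sequentially)"
    using tendsto_Re[OF u'(3)] unfolding k(4) by (simp add: case_prod_beta' k(1))
  obtain \<psi> c where \<psi>: "\<psi> \<in> D" "f = \<psi> + c *\<^sub>C G" "(\<lambda>n. J (B (k n))) \<longlonglongrightarrow> J \<psi>" "\<kappa> \<longlonglongrightarrow> c"
    using form_limit[OF B_in_D u'(2)[unfolded ueq] E] .
  have "c = 0" if Z
  proof -
    have "\<kappa> = (\<lambda>_. 0)" using k(2) that by auto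
    with \<psi>(4) have "(\<lambda>_::nat. 0::complex) \<longlonglongrightarrow> c" by simp
    then show ?thesis by (simp add: LIMSEQ_const_iff)
  qed
  moreover have "(\<lambda>n. op_form T (u n)) \<longlonglongrightarrow> of_real ((norm (J \<psi>))\<^sup>2 + \<gamma> * (cmod c)\<^sup>2 - l * (norm f)\<^sup>2)"
    unfolding k(3) by (intro tendsto_intros \<psi> u')
  ultimately show ?thesis using \<psi> by blast
qed

text \<open>The coefficient \<kappa> is kept constant along the sequence and only \<open>B k\<close>
  approximates \<phi>, with the scalar product of G and k fixed by the relation. Differences then
  lie in D and the point term drops out of the Cauchy condition.\<close>

lemma form_conv_exists:
  assumes op: "is_operator T" and T: "\<And>k. cinner G k = of_real \<gamma> * \<kappa> \<Longrightarrow> (B k + \<kappa> *\<^sub>C G, k) \<in> shift T (of_real l)"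
    and \<phi>: "\<phi> \<in> D" and S0: "Smin \<subseteq> shift T (of_real l)"
  shows "\<exists>u. form_conv T u (\<phi> + \<kappa> *\<^sub>C G)"
proof -
  obtain k where k: "\<And>n::nat. cinner G (k n) = of_real \<gamma> * \<kappa>" "(\<lambda>n. J (B (k n))) \<longlonglongrightarrow> J \<phi>" "(\<lambda>n. B (k n)) \<longlonglongrightarrow> \<phi>"
    using core_sequence[OF \<phi>] by metis
  define u where "u n = B (k n) + \<kappa> *\<^sub>C G" for n
  have uk: "(u n, k n) \<in> shift T (of_real l)" for n unfolding u_def by (intro T k)
  then have "u n \<in> Domain T" for n using Domain_shift[of T "of_real l"] by blast
  moreover have lim: "u \<longlonglongrightarrow> \<phi> + \<kappa> *\<^sub>C G"
    unfolding u_def by (intro tendsto_intros k)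
  moreover have "((\<lambda>(m, n). op_form T (u m - u n)) \<longlongrightarrow> 0) (sequentially \<times>\<^sub>F sequentially)"
  proof -
    have "op_form T (u m - u n) = of_real ((norm (J (B (k m)) - J (B (k n))))\<^sup>2 - l * (norm (u m - u n))\<^sup>2)" for m n
    proof -
      have d: "u m - u n = B (k m - k n)" by (simp add: u_def B_diff)
      have "(u m - u n, k m - k n) \<in> shift T (of_real l)"
        by (intro is_operatorD(4)[OF is_operator_shift[OF op]] uk)
      then have "op_form T (u m - u n) = cinner (u m - u n) ((k m - k n) - of_real l *\<^sub>C (u m - u n))"
        by (intro op_form_eq[OF op]) (simp add: mem_shift)
      also have "\<dots> = cinner (u m - u n) (k m - k n) - of_real (l * (norm (u m - u n))\<^sup>2)"
        unfolding cinner_diff_right[of "u m - u n" "k m - k n"] by (simp add: cinner_self)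
      also have "cinner (u m - u n) (k m - k n) = of_real ((norm (J (B (k m)) - J (B (k n))))\<^sup>2)"
        unfolding d cinner_B_self by (simp add: B_diff J_diff B_in_D)
      finally show ?thesis by simp
    qed
    moreover have "((\<lambda>(m, n). complex_of_real ((norm (J (B (k m)) - J (B (k n))))\<^sup>2 - l * (norm (u m - u n))\<^sup>2)) \<longlongrightarrow> of_real (0 - l * 0)) (sequentially \<times>\<^sub>F sequentially)"
      unfolding case_prod_beta'
      by (intro tendsto_of_real tendsto_diff tendsto_mult tendsto_const
          tendsto_norm_diff_prod[OF k(2), unfolded case_prod_beta'] tendsto_norm_diff_prod[OF lim, unfolded case_prod_beta'])
    ultimately show ?thesis by simp
  qed
  ultimately show ?thesis unfolding form_conv_def by blast
qed

definition Sext :: "real \<Rightarrow> operator" where "Sext \<gamma> = shift (Text \<gamma>) (- of_real l)"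

lemma shift_Sext [simp]: "shift (Sext \<gamma>) (of_real l) = Text \<gamma>"
  and shift_S [simp]: "shift S (of_real l) = Smin"
  by (simp_all add: Sext_def S_eq)

lemma Sext_representation:
  assumes "(f, k) \<in> shift (Sext \<gamma>) (of_real l)"
  shows "\<exists>\<kappa>. f = B k + \<kappa> *\<^sub>C G \<and> cinner (\<kappa> *\<^sub>C G) k = of_real \<gamma> * of_real ((cmod \<kappa>)\<^sup>2) \<and> (False \<longrightarrow> \<kappa> = 0)"
proof -
  from assms obtain \<kappa> where "f = B k + \<kappa> *\<^sub>C G" "cinner G k = of_real \<gamma> * \<kappa>" by (auto simp: mem_Text)
  then show ?thesis
    using complex_norm_square[of \<kappa>] by (intro exI[of _ \<kappa>]) (simp add: mult_ac)
qed

theorem form_domain_Sext: "form_domain (Sext \<gamma>) = {\<phi> + c *\<^sub>C G | \<phi> c. \<phi> \<in> D}"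
proof -
  have op: "is_operator (Sext \<gamma>)" unfolding Sext_def by (rule is_operator_shift[OF is_operator_Text])
  show ?thesis
  proof (intro equalityI subsetI)
    fix f assume "f \<in> form_domain (Sext \<gamma>)"
    then obtain u where "form_conv (Sext \<gamma>) u f" by (auto simp: form_domain_def)
    from form_conv_limit[OF op Sext_representation this]
    show "f \<in> {\<phi> + c *\<^sub>C G | \<phi> c. \<phi> \<in> D}" by blast
  next
    fix f assume "f \<in> {\<phi> + c *\<^sub>C G | \<phi> c. \<phi> \<in> D}"
    then obtain \<phi> c where "f = \<phi> + c *\<^sub>C G" "\<phi> \<in> D" by blast
    then show "f \<in> form_domain (Sext \<gamma>)"
      using form_conv_exists[OF op _ \<open>\<phi> \<in> D\<close>, of \<gamma> c] Smin_subset_Text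
      by (auto simp: form_domain_def mem_Text)
  qed
qed

theorem form_Sext:
  assumes \<phi>: "\<phi> \<in> D"
  shows "form (Sext \<gamma>) (\<phi> + c *\<^sub>C G) = of_real ((norm (J \<phi>))\<^sup>2 + \<gamma> * (cmod c)\<^sup>2 - l * (norm (\<phi> + c *\<^sub>C G))\<^sup>2)"
proof -
  have op: "is_operator (Sext \<gamma>)" unfolding Sext_def by (rule is_operator_shift[OF is_operator_Text])
  have lim: "(\<lambda>n. op_form (Sext \<gamma>) (u n)) \<longlonglongrightarrow> of_real ((norm (J \<phi>))\<^sup>2 + \<gamma> * (cmod c)\<^sup>2 - l * (norm (\<phi> + c *\<^sub>C G))\<^sup>2)"
    if u: "form_conv (Sext \<gamma>) u (\<phi> + c *\<^sub>C G)" for u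
  proof -
    obtain \<psi> d where \<psi>: "\<psi> \<in> D" "\<phi> + c *\<^sub>C G = \<psi> + d *\<^sub>C G"
      and lim: "(\<lambda>n. op_form (Sext \<gamma>) (u n)) \<longlonglongrightarrow> of_real ((norm (J \<psi>))\<^sup>2 + \<gamma> * (cmod d)\<^sup>2 - l * (norm (\<phi> + c *\<^sub>C G))\<^sup>2)"
      using form_conv_limit[OF op Sext_representation u] by blast
    then show ?thesis using decomposition_unique[OF \<phi> \<psi>] by simp
  qed
  obtain u where u: "form_conv (Sext \<gamma>) u (\<phi> + c *\<^sub>C G)"
    using form_conv_exists[OF op _ \<phi>, of \<gamma> c] Smin_subset_Text by (auto simp: mem_Text)
  show ?thesis
    unfolding form_def
  proof (rule the_equality)
    show "\<forall>u. form_conv (Sext \<gamma>) u (\<phi> + c *\<^sub>C G) \<longrightarrow>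
      (\<lambda>n. op_form (Sext \<gamma>) (u n)) \<longlonglongrightarrow> of_real ((norm (J \<phi>))\<^sup>2 + \<gamma> * (cmod c)\<^sup>2 - l * (norm (\<phi> + c *\<^sub>C G))\<^sup>2)"
      using lim by blast
    show "d = of_real ((norm (J \<phi>))\<^sup>2 + \<gamma> * (cmod c)\<^sup>2 - l * (norm (\<phi> + c *\<^sub>C G))\<^sup>2)"
      if "\<forall>u. form_conv (Sext \<gamma>) u (\<phi> + c *\<^sub>C G) \<longrightarrow> (\<lambda>n. op_form (Sext \<gamma>) (u n)) \<longlonglongrightarrow> d" for d
      using that u lim LIMSEQ_unique by blast
  qed
qed

section \<open>The Friedrichs extension and the full list of extensions\<close>

lemma form_domain_subset_Tinf:
  assumes op: "is_operator T" and T: "shift T (of_real l) \<subseteq> Tinf" and f: "f \<in> form_domain T"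
  shows "f \<in> D"
proof -
  have T': "\<exists>\<kappa>. f = B k + \<kappa> *\<^sub>C G \<and> cinner (\<kappa> *\<^sub>C G) k = of_real 0 * of_real ((cmod \<kappa>)\<^sup>2) \<and> (True \<longrightarrow> \<kappa> = 0)"
    if "(f, k) \<in> shift T (of_real l)" for f k
    using that T by (intro exI[of _ 0]) (auto simp: mem_Tinf)
  obtain u where u: "form_conv T u f" using f by (auto simp: form_domain_def)
  show ?thesis using form_conv_limit[OF op T' u] by auto
qed

text \<open>Elements of the adjoint of S have the form B k + c G, and membership in the form domain
  D forces c = 0 because G is not in D.\<close>

theorem friedrichs_S: "friedrichs S = shift Tinf (- of_real l)"
proof -
  have op: "is_operator S"
    unfolding S_eq
  proof (rule is_operator_shift)
    show "is_operator Smin"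
      unfolding is_operator_def single_valued_def
    proof (intro conjI allI impI)
      show "k = k'" if "(f, k) \<in> Smin" "(f, k') \<in> Smin" for f k k'
        using that B_inj[of "k - k'"] by (simp add: mem_Smin B_diff)
    qed (auto simp: mem_Smin B_add B_scaleC cinner_add_right)
  qed
  have fd: "form_domain S = D"
  proof (intro equalityI subsetI)
    show "f \<in> D" if "f \<in> form_domain S" for f
      by (rule form_domain_subset_Tinf[OF op _ that]) (simp add: Smin_subset_Tinf)
    show "f \<in> form_domain S" if "f \<in> D" for f
      using form_conv_exists[OF op _ that, of 0 0] by (auto simp: form_domain_def mem_Smin)
  qed
  have "adjoint_op S = shift (adjoint_op Smin) (- of_real l)"
    unfolding S_eq using adjoint_shift[of Smin "- l"] by simp
  then have adj: "(f, h) \<in> adjoint_op S \<longleftrightarrow> (\<exists>c. f = B (h + of_real l *\<^sub>C f) + c *\<^sub>C G)" for f h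
    by (simp add: mem_shift mem_adjoint_Smin)
  have "(f, h) \<in> friedrichs S \<longleftrightarrow> (f, h) \<in> shift Tinf (- of_real l)" for f h
  proof
    assume "(f, h) \<in> friedrichs S"
    then obtain c where c: "f = B (h + of_real l *\<^sub>C f) + c *\<^sub>C G" "f \<in> D"
      using adj fd by (auto simp: friedrichs_def)
    then have "f - B (h + of_real l *\<^sub>C f) \<in> D" by (intro D_diff B_in_D)
    moreover have "f - B (h + of_real l *\<^sub>C f) = c *\<^sub>C G"
      using c(1) by (metis add_diff_cancel_left')
    ultimately have "c = 0" using scale_G_in_D by simp
    then show "(f, h) \<in> shift Tinf (- of_real l)" using c(1) by (simp add: mem_shift mem_Tinf)
  next
    assume "(f, h) \<in> shift Tinf (- of_real l)"
    then have f: "f = B (h + of_real l *\<^sub>C f)" by (simp add: mem_shift mem_Tinf)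
    then have "f \<in> D" using B_in_D by metis
    moreover have "f = B (h + of_real l *\<^sub>C f) + 0 *\<^sub>C G" using f by simp
    ultimately show "(f, h) \<in> friedrichs S"
      using adj fd by (auto simp: friedrichs_def simp del: cvec.scale_zero_left)
  qed
  then show ?thesis by auto
qed

lemma form_domain_friedrichs: "form_domain (friedrichs S) \<subseteq> D"
  unfolding friedrichs_S
  by (intro subsetI form_domain_subset_Tinf[OF is_operator_shift[OF is_operator_Tinf]]) simp_all

theorem selfadjoint_extensions:
  "{T. selfadjoint T \<and> S \<subseteq> T} = insert (friedrichs S) (range Sext)"
proof (intro equalityI subsetI)
  fix T assume T: "T \<in> {T. selfadjoint T \<and> S \<subseteq> T}"
  then have "selfadjoint (shift T (of_real l))" "Smin \<subseteq> shift T (of_real l)"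
    using selfadjoint_shift[of T l] shift_mono_iff[of S "of_real l" T] by auto
  then consider "shift T (of_real l) = Tinf" | \<gamma> where "shift T (of_real l) = Text \<gamma>"
    using selfadjoint_extension_cases by blast
  then show "T \<in> insert (friedrichs S) (range Sext)"
    by cases (simp_all add: friedrichs_S Sext_def shift_eq_iff)
next
  fix T assume "T \<in> insert (friedrichs S) (range Sext)"
  then consider "T = shift Tinf (of_real (- l))" | \<gamma> where "T = shift (Text \<gamma>) (of_real (- l))"
    by (auto simp: friedrichs_S Sext_def)
  then show "T \<in> {T. selfadjoint T \<and> S \<subseteq> T}"
    by cases (simp_all only: S_eq selfadjoint_shift selfadjoint_Tinf selfadjoint_Text mem_Collect_eq
        of_real_minus shift_mono_iff Smin_subset_Tinf Smin_subset_Text simp_thms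
        selfadjoint_shift[of _ "- l", unfolded of_real_minus])
qed

end

section \<open>Fourier multipliers\<close>

abbreviation fhat :: "L2 \<Rightarrow> real \<Rightarrow> complex" where
  "fhat f \<equiv> rep_L2 (fourier f)"

definition fdom :: "(real \<Rightarrow> real) \<Rightarrow> L2 set" where
  "fdom w = {f. square_integrable (\<lambda>p. of_real (w p) * fhat f p)}"

definition fmult :: "(real \<Rightarrow> real) \<Rightarrow> L2 \<Rightarrow> L2" where
  "fmult w f = inv fourier (abs_L2 (\<lambda>p. of_real (w p) * fhat f p))"

lemma fourier_eqI:
  assumes "represents \<phi> (fourier f)" "represents \<psi> (fourier g)" "AE p in lborel. \<phi> p = \<psi> p"
  shows "f = g"
  using represents_eqI[OF assms] by (simp add: fourier_eq_iff)

lemma fhat_fmult_represents: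
  assumes "f \<in> fdom w"
  shows "represents (\<lambda>p. of_real (w p) * fhat f p) (fourier (fmult w f))"
  using assms by (simp add: fmult_def fdom_def represents_abs)

lemma fdom_iff:
  assumes w: "w \<in> borel_measurable borel" and \<phi>: "represents \<phi> (fourier f)"
  shows "f \<in> fdom w \<longleftrightarrow> square_integrable (\<lambda>p. of_real (w p) * \<phi> p)"
proof -
  note [measurable] = w
  have [measurable]: "\<phi> \<in> borel_measurable borel"
    using \<phi> by (simp add: represents_def square_integrable_def)
  have "AE p in lborel. \<phi> p = fhat f p" by (rule represents_AE_eq[OF \<phi> represents_rep])
  then have ae: "AE p in lborel. of_real (w p) * \<phi> p = of_real (w p) * fhat f p"
    "AE p in lborel. of_real (w p) * fhat f p = of_real (w p) * \<phi> p" by auto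
  have m: "(\<lambda>p. of_real (w p) * \<phi> p) \<in> borel_measurable borel"
    "(\<lambda>p. of_real (w p) * fhat f p) \<in> borel_measurable borel" by measurable
  show ?thesis unfolding fdom_def
    using square_integrable_cong_AE[OF _ ae(1) m(2)] square_integrable_cong_AE[OF _ ae(2) m(1)] by blast
qed

lemma fmult_eqI:
  assumes w: "w \<in> borel_measurable borel" and f: "represents \<phi> (fourier f)"
    and g: "represents (\<lambda>p. of_real (w p) * \<phi> p) (fourier g)"
  shows "f \<in> fdom w" "fmult w f = g"
proof -
  show dom: "f \<in> fdom w" using fdom_iff[OF w f] represents_square_integrable[OF g] by simp
  have "AE p in lborel. of_real (w p) * fhat f p = of_real (w p) * \<phi> p"
    using represents_AE_eq[OF represents_rep f] by auto
  then show "fmult w f = g" by (rule fourier_eqI[OF fhat_fmult_represents[OF dom] g])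
qed

lemma fmult_represents:
  assumes w: "w \<in> borel_measurable borel" and f: "f \<in> fdom w" "represents \<phi> (fourier f)"
  shows "represents (\<lambda>p. of_real (w p) * \<phi> p) (fourier (fmult w f))"
proof (rule represents_cong_AE[OF fhat_fmult_represents[OF f(1)]])
  show "square_integrable (\<lambda>p. of_real (w p) * \<phi> p)" using fdom_iff[OF w f(2)] f(1) by simp
  show "AE p in lborel. of_real (w p) * fhat f p = of_real (w p) * \<phi> p"
    using represents_AE_eq[OF represents_rep f(2)] by auto
qed

lemma
  assumes w: "w \<in> borel_measurable borel" and f: "f \<in> fdom w" and g: "g \<in> fdom w"
  shows fdom_add: "f + g \<in> fdom w" and fmult_add: "fmult w (f + g) = fmult w f + fmult w g"
proof -
  have 1: "represents (\<lambda>p. fhat f p + fhat g p) (fourier (f + g))"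
    unfolding fourier_add by (intro represents_add represents_rep)
  have 2: "represents (\<lambda>p. of_real (w p) * (fhat f p + fhat g p)) (fourier (fmult w f + fmult w g))"
    unfolding fourier_add distrib_left by (intro represents_add fhat_fmult_represents f g)
  show "f + g \<in> fdom w" "fmult w (f + g) = fmult w f + fmult w g" using fmult_eqI[OF w 1 2] by auto
qed

lemma
  assumes w: "w \<in> borel_measurable borel" and f: "f \<in> fdom w"
  shows fdom_scaleC: "c *\<^sub>C f \<in> fdom w" and fmult_scaleC: "fmult w (c *\<^sub>C f) = c *\<^sub>C fmult w f"
proof -
  have 1: "represents (\<lambda>p. c * fhat f p) (fourier (c *\<^sub>C f))"
    unfolding fourier_scaleC by (intro represents_scaleC represents_rep)
  have 2: "represents (\<lambda>p. of_real (w p) * (c * fhat f p)) (fourier (c *\<^sub>C fmult w f))"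
    unfolding fourier_scaleC mult.left_commute[of _ c] by (intro represents_scaleC fhat_fmult_represents f)
  show "c *\<^sub>C f \<in> fdom w" "fmult w (c *\<^sub>C f) = c *\<^sub>C fmult w f" using fmult_eqI[OF w 1 2] by auto
qed

lemma zero_in_fdom: "w \<in> borel_measurable borel \<Longrightarrow> 0 \<in> fdom w"
  using fdom_iff[of w "\<lambda>_. 0" 0] represents_zero by simp

lemma csubspace_fdom: "w \<in> borel_measurable borel \<Longrightarrow> csubspace (fdom w)"
  by (simp add: csubspace_def zero_in_fdom fdom_add fdom_scaleC)

lemma fmult_diff:
  assumes w: "w \<in> borel_measurable borel" and f: "f \<in> fdom w" and g: "g \<in> fdom w"
  shows "fmult w (f - g) = fmult w f - fmult w g"
  using fmult_add[OF w f fdom_scaleC[OF w g, of "-1"]] fmult_scaleC[OF w g, of "-1"] by simp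

lemmas fdom_diff = csubspace_diff[OF csubspace_fdom]

lemma norm_fmult: "f \<in> fdom w \<Longrightarrow> (norm (fmult w f))\<^sup>2 = (LINT p|lborel. (w p)\<^sup>2 * (cmod (fhat f p))\<^sup>2)"
  using norm_represents[OF fhat_fmult_represents, of f w]
  by (simp add: norm_fourier norm_mult power_mult_distrib)

lemma norm_fhat: "(norm f)\<^sup>2 = (LINT p|lborel. (cmod (fhat f p))\<^sup>2)"
  using norm_represents[OF represents_rep, of "fourier f"] by (simp add: norm_fourier)

lemma fdom_bounded:
  assumes v: "v \<in> borel_measurable borel" and w: "w \<in> borel_measurable borel"
    and f: "f \<in> fdom v" and le: "\<And>p. \<bar>w p\<bar> \<le> C * \<bar>v p\<bar>"
  shows "f \<in> fdom w" "(norm (fmult w f))\<^sup>2 \<le> C\<^sup>2 * (norm (fmult v f))\<^sup>2"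
proof -
  note [measurable] = v w
  have bound: "cmod (of_real (w p) * fhat f p) \<le> cmod (of_real (C * v p) * fhat f p)" for p
  proof -
    have "\<bar>w p\<bar> \<le> \<bar>C * v p\<bar>"
      using le[of p] abs_ge_self[of C] mult_right_mono[of C "\<bar>C\<bar>" "\<bar>v p\<bar>"] by (simp add: abs_mult)
    then show ?thesis unfolding norm_mult norm_of_real by (rule mult_right_mono) simp
  qed
  have si: "square_integrable (\<lambda>p. of_real (C * v p) * fhat f p)"
    using square_integrable_scale[of "\<lambda>p. of_real (v p) * fhat f p" "of_real C"] f by (simp add: fdom_def mult.assoc)
  show dom: "f \<in> fdom w"
    unfolding fdom_def mem_Collect_eq by (rule square_integrable_bound[OF si]) (use bound in auto)
  have "(norm (fmult w f))\<^sup>2 \<le> (LINT p|lborel. (cmod (of_real (C * v p) * fhat f p))\<^sup>2)"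
    unfolding norm_represents[OF fhat_fmult_represents[OF dom], unfolded norm_fourier]
    using dom si by (intro integral_mono power_mono bound) (auto simp: fdom_def square_integrable_def)
  also have "\<dots> = C\<^sup>2 * (norm (fmult v f))\<^sup>2"
    unfolding norm_fmult[OF f] by (simp add: norm_mult power_mult_distrib mult.assoc)
  finally show "(norm (fmult w f))\<^sup>2 \<le> C\<^sup>2 * (norm (fmult v f))\<^sup>2" .
qed

lemma fmult_one: "fdom (\<lambda>_. 1) = UNIV" "fmult (\<lambda>_. 1) f = f"
proof -
  show "fdom (\<lambda>_. 1) = UNIV" by (auto simp: fdom_def)
  then show "fmult (\<lambda>_. 1) f = f" by (simp add: fmult_def inv_f_f inj_fourier)
qed

lemma fdom_bounded_UNIV:
  assumes "w \<in> borel_measurable borel" "\<And>p. \<bar>w p\<bar> \<le> C"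
  shows "f \<in> fdom w" "(norm (fmult w f))\<^sup>2 \<le> C\<^sup>2 * (norm f)\<^sup>2"
  using fdom_bounded[of "\<lambda>_. 1" w f C] assms fmult_one by auto

lemma fmult_compose:
  assumes v: "v \<in> borel_measurable borel" and w: "w \<in> borel_measurable borel" and f: "f \<in> fdom w"
  shows "fmult w f \<in> fdom v \<longleftrightarrow> f \<in> fdom (\<lambda>p. v p * w p)"
    "f \<in> fdom (\<lambda>p. v p * w p) \<Longrightarrow> fmult v (fmult w f) = fmult (\<lambda>p. v p * w p) f"
proof -
  show *: "fmult w f \<in> fdom v \<longleftrightarrow> f \<in> fdom (\<lambda>p. v p * w p)"
    unfolding fdom_iff[OF v fhat_fmult_represents[OF f]] by (simp add: fdom_def mult.assoc)
  show "fmult v (fmult w f) = fmult (\<lambda>p. v p * w p) f" if f2: "f \<in> fdom (\<lambda>p. v p * w p)"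
    by (rule fmult_eqI(2)[OF v fhat_fmult_represents[OF f]])
       (use fhat_fmult_represents[OF f2] in \<open>simp add: mult.assoc\<close>)
qed

text \<open>Only the product of the two symbols enters. It serves to move both factors of a square
  root symbol to one side of the scalar product.\<close>

lemma cinner_fmult:
  assumes f: "f \<in> fdom v" "f \<in> fdom v'" and g: "g \<in> fdom w" "g \<in> fdom w'"
    and eq: "\<And>p. v p * w p = v' p * w' p"
  shows "cinner (fmult v f) (fmult w g) = cinner (fmult v' f) (fmult w' g)"
proof -
  have "cinner (fmult v f) (fmult w g) = (LINT p|lborel. cnj (of_real (v p) * fhat f p) * (of_real (w p) * fhat g p))"
    using cinner_represents[OF fhat_fmult_represents[OF f(1)] fhat_fmult_represents[OF g(1)]] by (simp add: cinner_fourier)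
  also have "\<dots> = (LINT p|lborel. of_real (v p * w p) * (cnj (fhat f p) * fhat g p))"
    by (intro Bochner_Integration.integral_cong) auto
  also have "\<dots> = (LINT p|lborel. cnj (of_real (v' p) * fhat f p) * (of_real (w' p) * fhat g p))"
    unfolding eq by (intro Bochner_Integration.integral_cong) auto
  also have "\<dots> = cinner (fmult v' f) (fmult w' g)"
    using cinner_represents[OF fhat_fmult_represents[OF f(2)] fhat_fmult_represents[OF g(2)]] by (simp add: cinner_fourier)
  finally show ?thesis .
qed

section \<open>Frequency truncation and closedness of multipliers\<close>

abbreviation cut :: "nat \<Rightarrow> real \<Rightarrow> real" where
  "cut N p \<equiv> indicator {- real N..real N} p"

lemma cut_dom: "f \<in> fdom (cut N)"
  by (rule fdom_bounded_UNIV(1)[of _ 1]) (auto simp: indicator_def)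

text \<open>Dominated convergence: at each fixed frequency the truncation error is eventually
  zero.\<close>

lemma cut_tendsto: "(\<lambda>N. fmult (cut N) f) \<longlonglongrightarrow> f"
proof -
  have "(\<lambda>N. LINT p|lborel. (cmod (fhat (f - fmult (cut N) f) p))\<^sup>2) \<longlonglongrightarrow> integral\<^sup>L lborel (\<lambda>_::real. 0)"
  proof (rule integral_dominated_convergence[where w="\<lambda>p. (cmod (fhat f p))\<^sup>2"])
    show "integrable lborel (\<lambda>p. (cmod (fhat f p))\<^sup>2)"
      using square_integrable_rep by (simp add: square_integrable_def)
    have eq: "AE p in lborel. fhat (f - fmult (cut N) f) p = of_real (1 - cut N p) * fhat f p" for N
      by (rule represents_AE_eq[OF represents_rep])
         (use represents_diff[OF represents_rep[of "fourier f"] fhat_fmult_represents[OF cut_dom[of f N]]]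
          in \<open>simp add: fourier_diff left_diff_distrib\<close>)
    then have "AE p in lborel. \<forall>N. fhat (f - fmult (cut N) f) p = of_real (1 - cut N p) * fhat f p"
      by (simp add: AE_all_countable)
    then show "AE p in lborel. (\<lambda>N. (cmod (fhat (f - fmult (cut N) f) p))\<^sup>2) \<longlonglongrightarrow> 0"
    proof eventually_elim
      fix p assume *: "\<forall>N. fhat (f - fmult (cut N) f) p = of_real (1 - cut N p) * fhat f p"
      obtain M :: nat where M: "\<bar>p\<bar> \<le> real M" using real_arch_simple by blast
      have "\<forall>\<^sub>F N in sequentially. (cmod (fhat (f - fmult (cut N) f) p))\<^sup>2 = 0"
        using eventually_ge_at_top[of M]
      proof eventually_elim
        fix N assume "M \<le> N"
        then have "cut N p = 1" using M by (auto simp: indicator_def)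
        then show "(cmod (fhat (f - fmult (cut N) f) p))\<^sup>2 = 0" using * by simp
      qed
      then show "(\<lambda>N. (cmod (fhat (f - fmult (cut N) f) p))\<^sup>2) \<longlonglongrightarrow> 0" by (rule tendsto_eventually)
    qed
    show "AE p in lborel. norm ((cmod (fhat (f - fmult (cut N) f) p))\<^sup>2) \<le> (cmod (fhat f p))\<^sup>2" for N
      using eq[of N] by eventually_elim (auto simp: indicator_def)
  qed auto
  then have "(\<lambda>N. (norm (f - fmult (cut N) f))\<^sup>2) \<longlonglongrightarrow> 0" by (simp add: norm_fhat)
  then have "(\<lambda>N. sqrt ((norm (f - fmult (cut N) f))\<^sup>2)) \<longlonglongrightarrow> sqrt 0" by (intro tendsto_intros)
  then have "(\<lambda>N. norm (f - fmult (cut N) f)) \<longlonglongrightarrow> 0" by simp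
  then have "(\<lambda>N. f - fmult (cut N) f) \<longlonglongrightarrow> 0" by (simp add: tendsto_norm_zero_iff)
  from tendsto_diff[OF tendsto_const[of f] this] show ?thesis by simp
qed

lemma bounded_linear_fmult:
  assumes "w \<in> borel_measurable borel" "\<And>p. \<bar>w p\<bar> \<le> C"
  shows "bounded_linear (fmult w)"
proof (rule bounded_linear_intro[where K="\<bar>C\<bar>"])
  note dom = fdom_bounded_UNIV(1)[OF assms]
  show "fmult w (x + y) = fmult w x + fmult w y" for x y by (rule fmult_add[OF assms(1) dom dom])
  show "fmult w (r *\<^sub>R x) = r *\<^sub>R fmult w x" for r x
    unfolding scaleR_scaleC by (rule fmult_scaleC[OF assms(1) dom])
  show "norm (fmult w x) \<le> norm x * \<bar>C\<bar>" for x
    by (rule power2_le_imp_le)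
       (use fdom_bounded_UNIV(2)[OF assms, of x] in \<open>simp_all add: power_mult_distrib mult.commute\<close>)
qed

text \<open>Unbounded multipliers are closed operators: after truncation to \<open>\<bar>w\<bar> \<le> N\<close> they are bounded, so
  limits may be taken there.\<close>

lemma fmult_closed:
  assumes w[measurable]: "w \<in> borel_measurable borel" and u: "\<And>n. u n \<in> fdom w"
    and lim: "u \<longlonglongrightarrow> f" "(\<lambda>n. fmult w (u n)) \<longlonglongrightarrow> g"
  shows "f \<in> fdom w" "fmult w f = g"
proof -
  define \<eta> where "\<eta> N p = (if \<bar>w p\<bar> \<le> real N then 1 else 0 :: real)" for N p
  have [measurable]: "\<eta> N \<in> borel_measurable borel" for N unfolding \<eta>_def by measurable
  have \<eta>1: "\<bar>\<eta> N p\<bar> \<le> 1" for N p by (simp add: \<eta>_def)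
  have \<eta>w: "\<bar>\<eta> N p * w p\<bar> \<le> real N" for N p by (simp add: \<eta>_def)
  have \<eta>w_m: "(\<lambda>p. \<eta> N p * w p) \<in> borel_measurable borel" for N by measurable
  have \<eta>m: "\<eta> N \<in> borel_measurable borel" for N by measurable
  have eq: "fmult (\<lambda>p. \<eta> N p * w p) f = fmult (\<eta> N) g" for N
  proof (rule LIMSEQ_unique)
    show "(\<lambda>n. fmult (\<lambda>p. \<eta> N p * w p) (u n)) \<longlonglongrightarrow> fmult (\<lambda>p. \<eta> N p * w p) f"
      by (rule bounded_linear.tendsto[OF bounded_linear_fmult[OF \<eta>w_m \<eta>w] lim(1)])
    have "fmult (\<lambda>p. \<eta> N p * w p) (u n) = fmult (\<eta> N) (fmult w (u n))" for n
      by (rule fmult_compose(2)[symmetric, OF \<eta>m w u fdom_bounded_UNIV(1)[OF \<eta>w_m \<eta>w]])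
    then show "(\<lambda>n. fmult (\<lambda>p. \<eta> N p * w p) (u n)) \<longlonglongrightarrow> fmult (\<eta> N) g"
      using bounded_linear.tendsto[OF bounded_linear_fmult[OF \<eta>m \<eta>1] lim(2)] by simp
  qed
  have "AE p in lborel. \<forall>N. of_real (\<eta> N p * w p) * fhat f p = of_real (\<eta> N p) * fhat g p"
    unfolding AE_all_countable
  proof
    fix N
    have "represents (\<lambda>p. of_real (\<eta> N p * w p) * fhat f p) (fourier (fmult (\<eta> N) g))"
      using fhat_fmult_represents[OF fdom_bounded_UNIV(1)[OF \<eta>w_m[of N] \<eta>w[of N]], of f] by (simp only: eq)
    from represents_AE_eq[OF this fhat_fmult_represents[OF fdom_bounded_UNIV(1)[OF \<eta>m[of N] \<eta>1[of N]]]]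
    show "AE p in lborel. of_real (\<eta> N p * w p) * fhat f p = of_real (\<eta> N p) * fhat g p" .
  qed
  then have ae: "AE p in lborel. fhat g p = of_real (w p) * fhat f p"
  proof eventually_elim
    fix p assume *: "\<forall>N. of_real (\<eta> N p * w p) * fhat f p = of_real (\<eta> N p) * fhat g p"
    obtain N :: nat where "\<bar>w p\<bar> \<le> real N" using real_arch_simple by blast
    then have "\<eta> N p = 1" by (simp add: \<eta>_def)
    then show "fhat g p = of_real (w p) * fhat f p" using *[rule_format, of N] by simp
  qed
  have si: "square_integrable (\<lambda>p. of_real (w p) * fhat f p)"
    by (rule square_integrable_cong_AE[OF square_integrable_rep ae]) measurable
  have "represents (\<lambda>p. of_real (w p) * fhat f p) (fourier g)"
    by (rule represents_cong_AE[OF represents_rep si ae])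
  from fmult_eqI[OF w represents_rep this] show "f \<in> fdom w" "fmult w f = g" by auto
qed

section \<open>Sobolev spaces and fractional Laplacians\<close>

definition sobw :: "real \<Rightarrow> real \<Rightarrow> real" where
  "sobw r p = (1 + p\<^sup>2) powr (r / 2)"

lemma sobw_measurable [measurable]: "sobw r \<in> borel_measurable borel"
  unfolding sobw_def by measurable

lemma one_plus_square_pos [simp]: "(0::real) < 1 + p\<^sup>2"
  by (simp add: add_pos_nonneg)

lemma sobw_pos [simp]: "sobw r p > 0"
  unfolding sobw_def by (metis one_plus_square_pos powr_gt_zero less_irrefl)

lemma sobw_power2: "(sobw r p)\<^sup>2 = (1 + p\<^sup>2) powr r"
  unfolding sobw_def by (simp add: power2_eq_square flip: powr_add)

lemma sobw_ge_1: "r \<ge> 0 \<Longrightarrow> sobw r p \<ge> 1"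
  unfolding sobw_def by (rule ge_one_powr_ge_zero) auto

lemma sobw_mono: "r \<le> t \<Longrightarrow> sobw r p \<le> sobw t p"
  unfolding sobw_def by (rule powr_mono) auto

lemma sobolev_eq: "sobolev r = fdom (sobw r)"
  unfolding sobolev_def
  using fdom_iff[OF sobw_measurable[of r]] represents_rep unfolding sobw_def by blast

lemma sobolev_norm_eq: "f \<in> sobolev r \<Longrightarrow> sobolev_norm r f = norm (fmult (sobw r) f)"
proof -
  assume "f \<in> sobolev r"
  then have *: "(norm (fmult (sobw r) f))\<^sup>2 = (LINT p|lborel. (1 + p\<^sup>2) powr r * (cmod (fhat f p))\<^sup>2)"
    using norm_fmult[of f "sobw r"] by (simp add: sobw_power2 sobolev_eq)
  then show ?thesis unfolding sobolev_norm_def *[symmetric] by simp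
qed

lemma powr_abs_measurable [measurable]: "(\<lambda>p::real. \<bar>p\<bar> powr a) \<in> borel_measurable borel"
  by measurable

lemma mem_nabla_pow: "(f, h) \<in> nabla_pow a \<longleftrightarrow> f \<in> fdom (\<lambda>p. \<bar>p\<bar> powr a) \<and> h = fmult (\<lambda>p. \<bar>p\<bar> powr a) f"
proof
  assume "(f, h) \<in> nabla_pow a"
  then obtain \<phi> where "represents \<phi> (fourier f)" "represents (\<lambda>p. of_real (\<bar>p\<bar> powr a) * \<phi> p) (fourier h)"
    by (auto simp: nabla_pow_def)
  from fmult_eqI[OF powr_abs_measurable this] show "f \<in> fdom (\<lambda>p. \<bar>p\<bar> powr a) \<and> h = fmult (\<lambda>p. \<bar>p\<bar> powr a) f" by auto
next
  assume "f \<in> fdom (\<lambda>p. \<bar>p\<bar> powr a) \<and> h = fmult (\<lambda>p. \<bar>p\<bar> powr a) f"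
  then show "(f, h) \<in> nabla_pow a"
    unfolding nabla_pow_def by (auto intro!: exI[of _ "fhat f"] fhat_fmult_represents)
qed

lemma op_apply_nabla_pow:
  "f \<in> fdom (\<lambda>p. \<bar>p\<bar> powr a) \<Longrightarrow> op_apply (nabla_pow a) f = fmult (\<lambda>p. \<bar>p\<bar> powr a) f"
  unfolding op_apply_def mem_nabla_pow by (rule the_equality) auto

lemma powr_abs_le_sobw:
  assumes "a \<ge> 0" shows "\<bar>p\<bar> powr a \<le> sobw a p"
proof -
  have "\<bar>p\<bar> \<le> sqrt (1 + p\<^sup>2)" by (rule real_le_rsqrt) simp
  then have "\<bar>p\<bar> powr a \<le> sqrt (1 + p\<^sup>2) powr a" using assms by (intro powr_mono2) auto
  also have "\<dots> = sobw a p"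
    using one_plus_square_pos[of p] unfolding sobw_def by (simp add: powr_half_sqrt[symmetric] powr_powr del: one_plus_square_pos)
  finally show ?thesis .
qed

lemma sobw_le_powr_abs:
  assumes "a \<ge> 0" shows "sobw a p \<le> 2 powr a * (1 + \<bar>p\<bar> powr a)"
proof -
  have "1 + p\<^sup>2 \<le> (2 * max 1 \<bar>p\<bar>)\<^sup>2"
  proof (cases "\<bar>p\<bar> \<le> 1")
    case True
    then have "p\<^sup>2 \<le> 1" by (simp add: abs_square_le_1)
    then show ?thesis using True by (simp add: max_def)
  next
    case False
    then have "1 \<le> \<bar>p\<bar>\<^sup>2" by (intro one_le_power) simp
    then show ?thesis using False by (simp add: max_def power_mult_distrib)
  qed
  then have "sqrt (1 + p\<^sup>2) \<le> 2 * max 1 \<bar>p\<bar>"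
    by (intro real_le_lsqrt) auto
  then have "sqrt (1 + p\<^sup>2) powr a \<le> (2 * max 1 \<bar>p\<bar>) powr a" using assms by (intro powr_mono2) auto
  also have "\<dots> = 2 powr a * (max 1 \<bar>p\<bar>) powr a" by (rule powr_mult) 
  also have "(max 1 \<bar>p\<bar>) powr a \<le> 1 + \<bar>p\<bar> powr a" by (auto simp: max_def)
  also have "sqrt (1 + p\<^sup>2) powr a = sobw a p"
    using one_plus_square_pos[of p] unfolding sobw_def by (simp add: powr_half_sqrt[symmetric] powr_powr del: one_plus_square_pos)
  finally show ?thesis by simp
qed

subsection \<open>Point evaluation at the origin\<close>

text \<open>Fourier inversion at x = 0. The integral replaces the continuous representative in
  \<open>value_at_0\<close> and agrees with it as soon as the transform is integrable.\<close>

definition ev0 :: "L2 \<Rightarrow> complex" where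
  "ev0 f = of_real ((2 * pi) powr (- 1/2)) * (LINT p|lborel. fhat f p)"

lemma continuous_fourier_integral:
  assumes "integrable lborel \<phi>"
  shows "continuous_on UNIV (fourier_integral \<phi>)"
proof -
  have [measurable]: "\<phi> \<in> borel_measurable borel"
    using assms by (simp add: borel_measurable_integrable[of lborel, simplified])
  have "isCont (\<lambda>p. LINT x|lborel. exp (- \<i> * of_real (p * x)) * \<phi> x) p" for p
  proof (rule continuous_at_sequentiallyI)
    fix u assume u: "u \<longlonglongrightarrow> p"
    show "(\<lambda>n. LINT x|lborel. exp (- \<i> * of_real (u n * x)) * \<phi> x) \<longlonglongrightarrow> (LINT x|lborel. exp (- \<i> * of_real (p * x)) * \<phi> x)"
    proof (rule integral_dominated_convergence[where w="\<lambda>x. cmod (\<phi> x)"])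
      show "AE x in lborel. (\<lambda>n. exp (- \<i> * of_real (u n * x)) * \<phi> x) \<longlonglongrightarrow> exp (- \<i> * of_real (p * x)) * \<phi> x"
        by (intro always_eventually allI tendsto_intros u)
    qed (use assms in \<open>auto simp: norm_mult\<close>)
  qed
  then show ?thesis
    unfolding fourier_integral_def continuous_on_eq_continuous_at[OF open_UNIV] by (auto intro!: continuous_intros)
qed

lemma continuous_AE_eq_imp_eq:
  fixes f g :: "real \<Rightarrow> complex"
  assumes "continuous_on UNIV f" "continuous_on UNIV g" "AE x in lborel. f x = g x"
  shows "f x = g x"
proof (rule ccontr)
  assume ne: "f x \<noteq> g x"
  have op: "open {x. f x \<noteq> g x}" using assms by (intro open_Collect_neq) auto
  then have "{x. f x \<noteq> g x} \<in> sets borel" by simp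
  then have "{x. f x \<noteq> g x} \<in> null_sets lborel"
    using assms(3) by (subst AE_iff_null_sets) auto
  then have "negligible {x. f x \<noteq> g x}"
    by (simp add: negligible_iff_null_sets null_sets_completionI)
  then show False using open_not_negligible[OF op] ne by auto
qed

lemma value_at_0_eqI:
  assumes "continuous_on UNIV \<phi>" "represents \<phi> f"
  shows "value_at_0 f = \<phi> 0"
  unfolding value_at_0_def
proof (rule the_equality)
  show "\<exists>\<psi>. continuous_on UNIV \<psi> \<and> represents \<psi> f \<and> \<psi> 0 = \<phi> 0" using assms by blast
  fix c assume "\<exists>\<psi>. continuous_on UNIV \<psi> \<and> represents \<psi> f \<and> \<psi> 0 = c"
  then obtain \<psi> where \<psi>: "continuous_on UNIV \<psi>" "represents \<psi> f" "\<psi> 0 = c" by blast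
  from continuous_AE_eq_imp_eq[OF \<psi>(1) assms(1) represents_AE_eq[OF \<psi>(2) assms(2)]] \<psi>(3) show "c = \<phi> 0" by simp
qed

lemma ev0_represents:
  assumes "represents \<phi> (fourier f)"
  shows "ev0 f = of_real ((2 * pi) powr (- 1/2)) * (LINT p|lborel. \<phi> p)"
proof -
  have "(LINT p|lborel. fhat f p) = (LINT p|lborel. \<phi> p)"
    by (rule integral_cong_AE)
       (use represents_AE_eq[OF represents_rep assms] assms in \<open>auto simp: represents_def square_integrable_def\<close>)
  then show ?thesis by (simp add: ev0_def)
qed

lemma value_at_0_eq_ev0:
  assumes "integrable lborel (fhat f)"
  shows "value_at_0 f = ev0 f"
proof -
  have "continuous_on UNIV (\<lambda>x. fourier_integral (fhat f) (- x))"
    by (intro continuous_on_compose2[OF continuous_fourier_integral[OF assms]] continuous_intros) auto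
  from value_at_0_eqI[OF this fourier_inversion[OF represents_rep assms]]
  show ?thesis by (simp add: ev0_def fourier_integral_def)
qed

lemma represents_value_0:
  assumes "integrable lborel (fhat f)" "continuous_on UNIV \<phi>" "represents \<phi> f"
  shows "ev0 f = \<phi> 0"
  using value_at_0_eqI[OF assms(2,3)] value_at_0_eq_ev0[OF assms(1)] by simp

section \<open>Integrable weights and evaluation as a scalar product\<close>

lemma integrable_powr_one_plus_abs:
  assumes "a > 1"
  shows "integrable lborel (\<lambda>p::real. (1 + \<bar>p\<bar>) powr (- a))"
proof -
  \<comment> \<open>An antiderivative on the half line; it tends to 0 at infinity because a >
    1.\<close>
  define F where "F p = - ((1 + p) powr (1 - a)) / (a - 1)" for p :: real
  have "(\<integral>\<^sup>+p. ennreal ((1 + \<bar>p\<bar>) powr (- a)) * indicator {0..} p \<partial>lborel) = ennreal (0 - F 0)"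
  proof (rule nn_integral_FTC_atLeast)
    fix p :: real assume p: "0 \<le> p"
    have "(F has_real_derivative - ((1 - a) * (1 + p) powr (1 - a - 1)) / (a - 1)) (at p)"
      unfolding F_def using p assms by (auto intro!: derivative_eq_intros)
    moreover have "- ((1 - a) * (1 + p) powr (1 - a - 1)) / (a - 1) = (1 + \<bar>p\<bar>) powr (- a)"
      using p assms by (simp add: divide_simps) (simp add: algebra_simps)
    ultimately show "(F has_real_derivative (1 + \<bar>p\<bar>) powr (- a)) (at p)" by simp
  next
    show "(F \<longlongrightarrow> 0) at_top"
      unfolding F_def using assms by real_asymp
  qed auto
  then have fin: "(\<integral>\<^sup>+p. ennreal ((1 + \<bar>p\<bar>) powr (- a)) * indicator {0..} p \<partial>lborel) < \<infinity>" by simp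
  have "(\<integral>\<^sup>+p. ennreal ((1 + \<bar>p\<bar>) powr (- a)) * indicator {..0} p \<partial>lborel)
      = (\<integral>\<^sup>+p. ennreal ((1 + \<bar>0 + (-1) * p\<bar>) powr (- a)) * indicator {..0} (0 + (-1) * p) \<partial>lborel)"
    by (subst nn_integral_real_affine[of _ "-1" 0]) auto
  also have "\<dots> = (\<integral>\<^sup>+p. ennreal ((1 + \<bar>p\<bar>) powr (- a)) * indicator {0..} p \<partial>lborel)"
    by (intro nn_integral_cong) (auto simp: indicator_def)
  finally have fin2: "(\<integral>\<^sup>+p. ennreal ((1 + \<bar>p\<bar>) powr (- a)) * indicator {..0} p \<partial>lborel) < \<infinity>" using fin by simp
  have "(\<integral>\<^sup>+p. ennreal ((1 + \<bar>p\<bar>) powr (- a)) \<partial>lborel)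
      \<le> (\<integral>\<^sup>+p. ennreal ((1 + \<bar>p\<bar>) powr (- a)) * indicator {0..} p + ennreal ((1 + \<bar>p\<bar>) powr (- a)) * indicator {..0} p \<partial>lborel)"
    by (intro nn_integral_mono) (auto simp: indicator_def)
  also have "\<dots> = (\<integral>\<^sup>+p. ennreal ((1 + \<bar>p\<bar>) powr (- a)) * indicator {0..} p \<partial>lborel)
      + (\<integral>\<^sup>+p. ennreal ((1 + \<bar>p\<bar>) powr (- a)) * indicator {..0} p \<partial>lborel)"
    by (intro nn_integral_add) auto
  also have "\<dots> < \<infinity>" using fin fin2 by simp
  finally show ?thesis by (intro integrableI_nonneg) auto
qed

lemma integrable_if_powr_bound:
  fixes w :: "real \<Rightarrow> real"
  assumes [measurable]: "w \<in> borel_measurable borel" and "a > 1" and "\<And>p. \<bar>w p\<bar> \<le> C * (1 + \<bar>p\<bar>) powr (- a)"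
  shows "integrable lborel w"
  by (rule Bochner_Integration.integrable_bound[OF integrable_mult_right[OF integrable_powr_one_plus_abs[OF assms(2)], of C]])
     (use assms(3) in \<open>auto intro!: always_eventually order_trans[OF assms(3) abs_ge_self]\<close>)

text \<open>The threshold of the Sobolev embedding: the squared reciprocal weight decays like
  |p|^(-2r), and 2r > 1. Evaluation at the origin is therefore bounded on H^r.\<close>

lemma sobw_inverse_square_integrable:
  assumes "r > 1/2"
  shows "integrable lborel (\<lambda>p. (1 / sobw r p)\<^sup>2)"
proof (rule integrable_if_powr_bound[where a="2 * r" and C="2 powr r"])
  show "(\<lambda>p. (1 / sobw r p)\<^sup>2) \<in> borel_measurable borel" by measurable
  show "2 * r > 1" using assms by simp
  fix p :: real
  have "((1 + \<bar>p\<bar>)\<^sup>2) powr r \<le> (2 * (1 + p\<^sup>2)) powr r"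
    using zero_le_power2[of "1 - \<bar>p\<bar>"] assms
    by (intro powr_mono2) (auto simp: power2_eq_square algebra_simps)
  also have "\<dots> = 2 powr r * (1 + p\<^sup>2) powr r" by (rule powr_mult)
  also have "((1 + \<bar>p\<bar>)\<^sup>2) powr r = (1 + \<bar>p\<bar>) powr (2 * r)"
    by (simp add: powr_powr[symmetric])
  finally show "\<bar>(1 / sobw r p)\<^sup>2\<bar> \<le> 2 powr r * (1 + \<bar>p\<bar>) powr (- (2 * r))"
    using powr_gt_zero[of "1 + p\<^sup>2" r] one_plus_square_pos[of p] powr_gt_zero[of "1 + \<bar>p\<bar>" "2 * r"]
    by (simp add: power_divide sobw_power2 powr_minus pos_divide_le_eq divide_inverse[symmetric]
        pos_le_divide_eq mult.commute del: powr_gt_zero)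
qed

text \<open>For any weight \<open>w\<close> with square integrable reciprocal, evaluation is the scalar product with the
  function \<open>e w\<close> after multiplication by \<open>w\<close>.\<close>

definition evrep :: "(real \<Rightarrow> real) \<Rightarrow> L2" where
  "evrep w = inv fourier (abs_L2 (\<lambda>p. of_real ((2 * pi) powr (- 1/2) / w p)))"

lemma evrep_represents:
  assumes [measurable]: "w \<in> borel_measurable borel" and "integrable lborel (\<lambda>p. (1 / w p)\<^sup>2)"
  shows "represents (\<lambda>p. of_real ((2 * pi) powr (- 1/2) / w p)) (fourier (evrep w))"
proof -
  have "square_integrable (\<lambda>p. of_real ((2 * pi) powr (- 1/2)) * complex_of_real (1 / w p))"
    using assms(2) by (intro square_integrable_scale) (auto simp: square_integrable_def norm_divide power_divide)
  then show ?thesis by (simp add: evrep_def represents_abs)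
qed

text \<open>The transform is the product of 1/w and of w times the transform, two square integrable
  factors; hence it is integrable, and its integral is a scalar product.\<close>

lemma
  assumes w: "w \<in> borel_measurable borel" "\<And>p. w p \<noteq> 0" "integrable lborel (\<lambda>p. (1 / w p)\<^sup>2)" and f: "f \<in> fdom w"
  shows integrable_fhat: "integrable lborel (fhat f)"
    and ev0_eq_cinner: "ev0 f = cinner (evrep w) (fmult w f)"
proof -
  have *: "cnj (of_real ((2 * pi) powr (- 1/2) / w p)) * (of_real (w p) * fhat f p) = of_real ((2 * pi) powr (- 1/2)) * fhat f p" for p
    using w(2)[of p] by simp
  have "integrable lborel (\<lambda>p. cnj (of_real ((2 * pi) powr (- 1/2) / w p)) * (of_real (w p) * fhat f p))"
    by (rule square_integrable_integrable_mult)
       (use evrep_represents[OF w(1,3)] fhat_fmult_represents[OF f] in \<open>auto dest: represents_square_integrable\<close>)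
  then have "integrable lborel (\<lambda>p. of_real (inverse ((2 * pi) powr (- 1/2))) * (of_real ((2 * pi) powr (- 1/2)) * fhat f p))"
    unfolding * by (rule integrable_mult_right)
  moreover have "of_real (inverse ((2 * pi) powr (- 1/2))) * (of_real ((2 * pi) powr (- 1/2)) * z) = z" for z :: complex
    unfolding mult.assoc[symmetric] of_real_mult[symmetric] using two_pi_powr(2) by simp
  ultimately show "integrable lborel (fhat f)" by (simp only:)
  have "cinner (evrep w) (fmult w f) = (LINT p|lborel. cnj (of_real ((2 * pi) powr (- 1/2) / w p)) * (of_real (w p) * fhat f p))"
    using cinner_represents[OF evrep_represents[OF w(1,3)] fhat_fmult_represents[OF f]] by (simp add: cinner_fourier)
  then show "ev0 f = cinner (evrep w) (fmult w f)" unfolding * by (simp add: ev0_def)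
qed

lemma ev0_add:
  assumes "integrable lborel (fhat f)" "integrable lborel (fhat g)"
  shows "ev0 (f + g) = ev0 f + ev0 g"
proof -
  have "represents (\<lambda>p. fhat f p + fhat g p) (fourier (f + g))"
    unfolding fourier_add by (intro represents_add represents_rep)
  from ev0_represents[OF this] show ?thesis using assms by (simp add: ev0_def distrib_left)
qed

lemma ev0_scaleC: "ev0 (c *\<^sub>C f) = c * ev0 f"
proof -
  have "represents (\<lambda>p. c * fhat f p) (fourier (c *\<^sub>C f))"
    unfolding fourier_scaleC by (intro represents_scaleC represents_rep)
  from ev0_represents[OF this] show ?thesis by (simp add: ev0_def)
qed

lemma integrable_fhat_sobolev: "r > 1/2 \<Longrightarrow> f \<in> sobolev r \<Longrightarrow> integrable lborel (fhat f)"
  unfolding sobolev_eq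
  by (rule integrable_fhat[OF sobw_measurable _ sobw_inverse_square_integrable]) (auto simp: less_imp_neq[OF sobw_pos, symmetric])

lemma ev0_sobolev: "r > 1/2 \<Longrightarrow> f \<in> sobolev r \<Longrightarrow> ev0 f = cinner (evrep (sobw r)) (fmult (sobw r) f)"
  unfolding sobolev_eq
  by (rule ev0_eq_cinner[OF sobw_measurable _ sobw_inverse_square_integrable]) (auto simp: less_imp_neq[OF sobw_pos, symmetric])

section \<open>Smooth functions and cut-offs\<close>

lemma smoothI:
  "D 0 = \<phi> \<Longrightarrow> (\<And>n x. (D n has_vector_derivative D (Suc n) x) (at x)) \<Longrightarrow> smooth \<phi>"
  unfolding smooth_def by blast

lemma smooth_derivative:
  assumes "smooth \<phi>"
  shows "\<exists>\<psi>. smooth \<psi> \<and> (\<forall>x. (\<phi> has_vector_derivative \<psi> x) (at x))"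
proof -
  obtain D where D: "D 0 = \<phi>" "\<And>n x. (D n has_vector_derivative D (Suc n) x) (at x)"
    using assms by (auto simp: smooth_def)
  have "smooth (D 1)" by (rule smoothI[of "\<lambda>n. D (Suc n)"]) (simp_all add: D)
  then show ?thesis using D(2)[of 0] D(1) by (intro exI[of _ "D 1"]) simp
qed

lemma smooth_primitive:
  assumes "\<And>x. (F has_vector_derivative f x) (at x)" "smooth f"
  shows "smooth F"
proof -
  obtain D where D: "D 0 = f" "\<And>n x. (D n has_vector_derivative D (Suc n) x) (at x)"
    using assms(2) by (auto simp: smooth_def)
  show ?thesis
  proof (rule smoothI[of "case_nat F D"])
    show "(case_nat F D n has_vector_derivative case_nat F D (Suc n) x) (at x)" for n x
      by (cases n) (simp_all add: D assms(1))
  qed simp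
qed

lemma smooth_const [simp]: "smooth (\<lambda>_. c)"
  by (rule smoothI[of "\<lambda>n _. if n = 0 then c else 0"]) auto

lemma smooth_affine:
  assumes "smooth f" shows "smooth (\<lambda>x. f (a * x + b))"
proof -
  obtain D where D: "D 0 = f" "\<And>n x. (D n has_vector_derivative D (Suc n) x) (at x)"
    using assms by (auto simp: smooth_def)
  show ?thesis
  proof (rule smoothI[of "\<lambda>n x. (a ^ n) *\<^sub>R D n (a * x + b)"])
    fix n x
    have "((\<lambda>x. a * x + b) has_vector_derivative a) (at x)"
      by (auto intro!: derivative_eq_intros simp flip: has_real_derivative_iff_has_vector_derivative)
    from vector_diff_chain_at[OF this D(2)]
    have "((\<lambda>x. D n (a * x + b)) has_vector_derivative a *\<^sub>R D (Suc n) (a * x + b)) (at x)"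
      by (simp add: o_def)
    from has_vector_derivative_scaleR[OF DERIV_const this, of "a ^ n"]
    show "((\<lambda>x. (a ^ n) *\<^sub>R D n (a * x + b)) has_vector_derivative (a ^ Suc n) *\<^sub>R D (Suc n) (a * x + b)) (at x)"
      by (simp add: mult.commute)
  qed (simp add: D)
qed

lemma smooth_add:
  assumes "smooth f" "smooth g" shows "smooth (\<lambda>x. f x + g x)"
proof -
  obtain D where D: "D 0 = f" "\<And>n x. (D n has_vector_derivative D (Suc n) x) (at x)"
    using assms by (auto simp: smooth_def)
  obtain E where E: "E 0 = g" "\<And>n x. (E n has_vector_derivative E (Suc n) x) (at x)"
    using assms by (auto simp: smooth_def)
  show ?thesis
    by (rule smoothI[of "\<lambda>n x. D n x + E n x"]) (auto simp: D E intro!: has_vector_derivative_add D(2) E(2))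
qed

lemma smooth_mult:
  assumes "smooth f" "smooth g" shows "smooth (\<lambda>x. f x * g x)"
proof -
  obtain D where D: "D 0 = f" "\<And>n x. (D n has_vector_derivative D (Suc n) x) (at x)"
    using assms by (auto simp: smooth_def)
  obtain E where E: "E 0 = g" "\<And>n x. (E n has_vector_derivative E (Suc n) x) (at x)"
    using assms by (auto simp: smooth_def)
  show ?thesis
  proof (rule smoothI[of "\<lambda>n x. \<Sum>k\<le>n. of_nat (n choose k) * (D k x * E (n - k) x)"])
    fix n x
    have "((\<lambda>x. \<Sum>k\<le>n. of_nat (n choose k) * (D k x * E (n - k) x)) has_vector_derivative
       (\<Sum>k\<le>n. of_nat (n choose k) * (D k x * E (Suc (n - k)) x + D (Suc k) x * E (n - k) x))) (at x)"
      by (intro has_vector_derivative_sum has_vector_derivative_mult_right has_vector_derivative_mult D(2) E(2))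
    moreover have "(\<Sum>k\<le>n. of_nat (n choose k) * (D k x * E (Suc (n - k)) x + D (Suc k) x * E (n - k) x))
        = (\<Sum>k\<le>Suc n. of_nat (Suc n choose k) * (D k x * E (Suc n - k) x))"
    proof -
      \<comment> \<open>The added top term has binomial coefficient 0. Shifting the index then
        allows Pascal's rule to merge the two sums.\<close>
      have "(\<Sum>k\<le>n. of_nat (n choose k) * (D k x * E (Suc (n - k)) x))
          = (\<Sum>k\<le>Suc n. of_nat (n choose k) * (D k x * E (Suc n - k) x))"
        by (simp add: Suc_diff_le)
      also have "\<dots> = D 0 x * E (Suc n) x + (\<Sum>k\<le>n. of_nat (n choose Suc k) * (D (Suc k) x * E (n - k) x))"
        by (subst sum.atMost_Suc_shift) simp
      finally have "(\<Sum>k\<le>n. of_nat (n choose k) * (D k x * E (Suc (n - k)) x + D (Suc k) x * E (n - k) x))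
          = D 0 x * E (Suc n) x + (\<Sum>k\<le>n. of_nat (Suc n choose Suc k) * (D (Suc k) x * E (n - k) x))"
        by (simp add: distrib_left distrib_right sum.distrib algebra_simps)
      also have "\<dots> = (\<Sum>k\<le>Suc n. of_nat (Suc n choose k) * (D k x * E (Suc n - k) x))"
        unfolding sum.atMost_Suc_shift[of _ n] by simp
      finally show ?thesis .
    qed
    ultimately show "((\<lambda>x. \<Sum>k\<le>n. of_nat (n choose k) * (D k x * E (n - k) x)) has_vector_derivative
       (\<Sum>k\<le>Suc n. of_nat (Suc n choose k) * (D k x * E (Suc n - k) x))) (at x)" by simp
  qed (simp add: D E)
qed

lemma continuous_if_has_vector_derivative:
  "(\<And>x. (f has_vector_derivative f' x) (at x)) \<Longrightarrow> continuous_on S f"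
  by (meson continuous_at_imp_continuous_on has_vector_derivative_continuous)

lemma smooth_continuous: "smooth \<phi> \<Longrightarrow> continuous_on S \<phi>"
  using smooth_derivative continuous_if_has_vector_derivative by blast

subsection \<open>A smooth cut-off function\<close>

lemma poly_exp_tendsto_0: "((\<lambda>y::real. poly p y * exp (- y)) \<longlongrightarrow> 0) at_top"
proof -
  have "((\<lambda>y::real. \<Sum>i\<le>degree p. coeff p i * (y ^ i / exp y)) \<longlongrightarrow> (\<Sum>i\<le>degree p. coeff p i * 0)) at_top"
    by (intro tendsto_sum tendsto_mult tendsto_const tendsto_power_div_exp_0)
  moreover have "(\<lambda>y::real. \<Sum>i\<le>degree p. coeff p i * (y ^ i / exp y)) = (\<lambda>y. poly p y * exp (- y))"
    by (auto simp: poly_altdef sum_distrib_right exp_minus divide_inverse mult.assoc)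
  ultimately show ?thesis by simp
qed

text \<open>The \<open>n\<close>-th derivative of \<open>exp (- 1/x)\<close> is \<open>poly (flat_poly n) (1/x) * exp (- 1/x)\<close>.\<close>

primrec flat_poly :: "nat \<Rightarrow> real poly" where
  "flat_poly 0 = 1"
| "flat_poly (Suc n) = [:0, 0, 1:] * (flat_poly n - pderiv (flat_poly n))"

definition flat :: "nat \<Rightarrow> real \<Rightarrow> real" where
  "flat n x = (if x > 0 then poly (flat_poly n) (1 / x) * exp (- (1 / x)) else 0)"

lemma flat_derivative: "(flat n has_real_derivative flat (Suc n) x) (at x)"
proof (cases x "0::real" rule: linorder_cases)
  case greater
  have "((\<lambda>x. poly (flat_poly n) (1 / x) * exp (- (1 / x))) has_real_derivative
      poly (flat_poly n) (1 / x) * (exp (- (1 / x)) * (1 / x\<^sup>2)) + (poly (pderiv (flat_poly n)) (1 / x) * (- (1 / x\<^sup>2))) * exp (- (1 / x))) (at x)"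
    using greater by (auto intro!: derivative_eq_intros DERIV_chain2[OF poly_DERIV] simp: power2_eq_square)
  moreover have "poly (flat_poly n) (1 / x) * (exp (- (1 / x)) * (1 / x\<^sup>2)) + (poly (pderiv (flat_poly n)) (1 / x) * (- (1 / x\<^sup>2))) * exp (- (1 / x)) = flat (Suc n) x"
    using greater by (simp add: flat_def power2_eq_square field_simps)
  ultimately have "((\<lambda>x. poly (flat_poly n) (1 / x) * exp (- (1 / x))) has_real_derivative flat (Suc n) x) (at x)" by simp
  then show ?thesis
    by (rule has_field_derivative_transform_within_open[where S="{0<..}"]) (use greater in \<open>auto simp: flat_def\<close>)
next
  case less
  have "((\<lambda>_. 0) has_real_derivative flat (Suc n) x) (at x)"
    using less by (simp add: flat_def)
  then show ?thesis
    by (rule has_field_derivative_transform_within_open[where S="{..<0}"]) (use less in \<open>auto simp: flat_def\<close>)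
next
  case equal
  have "((\<lambda>h. flat n h / h) \<longlongrightarrow> 0) (at 0)"
  proof (rule filterlim_split_at)
    show "((\<lambda>h. flat n h / h) \<longlongrightarrow> 0) (at_left 0)"
      by (rule tendsto_eventually) (auto simp: flat_def eventually_at_filter)
    \<comment> \<open>\<open>pCons 0\<close> supplies the factor 1/h of the difference quotient, so
      the limit is again that of a polynomial times an exponential.\<close>
    have "((\<lambda>h. poly (pCons 0 (flat_poly n)) (inverse h) * exp (- inverse h)) \<longlongrightarrow> 0) (at_right 0)"
      by (rule filterlim_compose[OF poly_exp_tendsto_0 filterlim_inverse_at_top_right])
    then show "((\<lambda>h. flat n h / h) \<longlongrightarrow> 0) (at_right 0)"
      by (rule Lim_transform_eventually) (auto simp: flat_def eventually_at_filter divide_inverse)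
  qed
  then show ?thesis
    unfolding has_field_derivative_iff using equal by (simp add: flat_def)
qed

lemma smooth_flat: "smooth (\<lambda>x. complex_of_real (flat 0 x))"
  by (rule smoothI[of "\<lambda>n x. complex_of_real (flat n x)"])
     (auto intro: has_vector_derivative_of_real flat_derivative)

lemma flat_0: "flat 0 x \<ge> 0" "flat 0 x = 0 \<longleftrightarrow> x \<le> 0"
  by (auto simp: flat_def)

text \<open>The normalised primitive of the bump flat(t - 1) flat(2 - t), which vanishes outside the
  interval from 1 to 2.\<close>

lemma smooth_step_exists:
  "\<exists>B::real \<Rightarrow> complex. smooth B \<and> (\<forall>x\<le>1. B x = 0) \<and> (\<forall>x\<ge>2. B x = 1)"
proof -
  define b where "b t = flat 0 (t - 1) * flat 0 (2 - t)" for t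
  have b_smooth: "smooth (\<lambda>t. complex_of_real (b t))"
    using smooth_mult[OF smooth_affine[OF smooth_flat, of 1 "-1"] smooth_affine[OF smooth_flat, of "-1" 2]]
    by (simp add: b_def)
  have flat_cont: "continuous_on UNIV (flat 0)"
    by (meson continuous_at_imp_continuous_on DERIV_isCont flat_derivative)
  have b_cont: "continuous_on S b" for S
    unfolding b_def by (intro continuous_intros continuous_on_compose2[OF flat_cont]) auto
  have b0: "b t = 0" if "t \<le> 1 \<or> t \<ge> 2" for t
    using that flat_0(2)[of "t - 1"] flat_0(2)[of "2 - t"] by (auto simp: b_def)
  define c where "c x = integral {0..x} b" for x
  have c_deriv: "(c has_real_derivative b x) (at x)" for x
  proof (cases "x > 0")
    case True
    have "((\<lambda>u. integral {0..u} b) has_vector_derivative b x) (at x within {0..x+1})"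
      by (rule integral_has_vector_derivative[OF b_cont]) (use True in auto)
    then have "((\<lambda>u. integral {0..u} b) has_vector_derivative b x) (at x)"
      using at_within_interior[of x "{0..x+1}"] True by simp
    then show ?thesis
      unfolding c_def[abs_def] has_real_derivative_iff_has_vector_derivative .
  next
    case False
    have d: "((\<lambda>_. 0) has_real_derivative b x) (at x)" using b0[of x] False by simp
    have "0 = c y" if "y \<in> {..<1}" for y
    proof -
      have "integral {0..y} b = integral {0..y} (\<lambda>_. 0)"
        using that by (intro Henstock_Kurzweil_Integration.integral_cong b0) auto
      then show ?thesis by (simp add: c_def)
    qed
    then show ?thesis
      by (intro has_field_derivative_transform_within_open[OF d, where S="{..<1}"]) (use False in auto)
  qed
  have c_le1: "c x = 0" if "x \<le> 1" for x
  proof -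
    have "integral {0..x} b = integral {0..x} (\<lambda>_. 0)"
      using that by (intro Henstock_Kurzweil_Integration.integral_cong b0) auto
    then show ?thesis by (simp add: c_def)
  qed
  have c_ge2: "c x = c 2" if "x \<ge> 2" for x
  proof (cases "x = 2")
    case False
    show ?thesis
    proof (rule DERIV_isconst_end[of 2 x c])
      show "2 < x" using that False by simp
      show "continuous_on {2..x} c"
        by (meson continuous_at_imp_continuous_on DERIV_isCont c_deriv)
      show "(c has_real_derivative 0) (at y)" if "2 < y" "y < x" for y
        using c_deriv[of y] b0[of y] that by simp
    qed
  qed simp
  \<comment> \<open>A continuous nonnegative function with integral 0 would vanish, but the bump is
    positive at its centre 3/2.\<close>
  have c2: "c 2 \<noteq> 0"
  proof
    assume "c 2 = 0"
    moreover have "(b has_integral c 2) (cbox 0 2)"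
      unfolding c_def cbox_interval by (intro integrable_integral integrable_continuous_interval b_cont)
    ultimately have "(b has_integral 0) (cbox 0 2)" by simp
    then have "b (3/2) = 0"
      by (rule has_integral_0_cbox_imp_0[OF b_cont, rotated]) (auto simp: b_def flat_0(1))
    then show False using flat_0(2)[of "1/2"] by (simp add: b_def)
  qed
  define B where "B x = complex_of_real (c x / c 2)" for x
  have "smooth B"
  proof (rule smooth_primitive)
    show "(B has_vector_derivative complex_of_real (1 / c 2) * complex_of_real (b x)) (at x)" for x
      unfolding B_def[abs_def] using has_vector_derivative_of_real[OF DERIV_cdivide[OF c_deriv[of x], of "c 2"], where 'a=complex] by simp
    show "smooth (\<lambda>x. complex_of_real (1 / c 2) * complex_of_real (b x))"
      by (intro smooth_mult smooth_const b_smooth)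
  qed
  moreover have "B x = 0" if "x \<le> 1" for x using c_le1[OF that] by (simp add: B_def)
  moreover have "B x = 1" if "x \<ge> 2" for x using c_ge2[OF that] c2 by (simp add: B_def)
  ultimately show ?thesis by blast
qed

lemma smooth_cutoff_exists:
  "\<exists>\<eta>::real \<Rightarrow> complex. smooth \<eta> \<and> (\<forall>x. \<bar>x\<bar> \<le> 1 \<longrightarrow> \<eta> x = 1) \<and> (\<forall>x. \<bar>x\<bar> \<ge> 2 \<longrightarrow> \<eta> x = 0)"
proof -
  obtain B :: "real \<Rightarrow> complex" where B: "smooth B" "\<And>x. x \<le> 1 \<Longrightarrow> B x = 0" "\<And>x. x \<ge> 2 \<Longrightarrow> B x = 1"
    using smooth_step_exists by blast
  \<comment> \<open>This is 1 - B(x) - B(-x), spelled out in the sums, products and affine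
    substitutions that preserve smoothness.\<close>
  define \<eta> where "\<eta> x = 1 + ((-1) * B (1 * x + 0) + (-1) * B ((-1) * x + 0))" for x
  have "smooth \<eta>"
    unfolding \<eta>_def by (intro smooth_add smooth_mult smooth_const smooth_affine B(1))
  moreover have "\<eta> x = 1" if "\<bar>x\<bar> \<le> 1" for x using that B(2)[of x] B(2)[of "- x"] by (simp add: \<eta>_def)
  moreover have "\<eta> x = 0" if "\<bar>x\<bar> \<ge> 2" for x
    using that B(2)[of x] B(2)[of "- x"] B(3)[of x] B(3)[of "- x"] by (cases "x \<ge> 0") (auto simp: \<eta>_def)
  ultimately show ?thesis by blast
qed

section \<open>Density of test functions\<close>

lemma compact_support_bounded:
  fixes f :: "real \<Rightarrow> complex"
  assumes "continuous_on UNIV f" "\<And>x. \<bar>x\<bar> > M \<Longrightarrow> f x = 0"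
  shows "\<exists>C\<ge>0. \<forall>x. cmod (f x) \<le> C"
proof -
  have "compact (f ` {-M..M})"
    using assms(1) by (intro compact_continuous_image) (auto intro: continuous_on_subset)
  then obtain C where C: "\<And>x. x \<in> {-M..M} \<Longrightarrow> cmod (f x) \<le> C"
    using compact_imp_bounded bounded_iff by (metis imageI)
  have "cmod (f x) \<le> max C 0" for x
  proof (cases "\<bar>x\<bar> \<le> M")
    case True
    then have "cmod (f x) \<le> C" by (intro C) auto
    then show ?thesis by simp
  qed (simp add: assms(2))
  then show ?thesis by (intro exI[of _ "max C 0"]) auto
qed

lemma
  fixes f :: "real \<Rightarrow> complex"
  assumes [measurable]: "f \<in> borel_measurable borel" and bound: "\<And>x. cmod (f x) \<le> C * indicator {-M..M} x"
  shows integrable_bounded_support: "integrable lborel f"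
    and square_integrable_bounded_support: "square_integrable f"
    and integral_bounded_support: "M \<ge> 0 \<Longrightarrow> (LINT x|lborel. (cmod (f x))\<^sup>2) \<le> C\<^sup>2 * (2 * M)"
proof -
  have int: "integrable lborel (\<lambda>x. D * indicator {-M..M} x :: real)" for D
    by (intro integrable_mult_right integrable_real_indicator) (auto simp: emeasure_lborel_Icc_eq)
  show "integrable lborel f"
    by (rule Bochner_Integration.integrable_bound[OF int[of C]])
       (use bound in \<open>auto intro!: always_eventually order_trans[OF bound abs_ge_self]\<close>)
  have bound2: "(cmod (f x))\<^sup>2 \<le> C\<^sup>2 * indicator {-M..M} x" for x
    using power_mono[OF bound[of x], of 2] by (auto simp: indicator_def)
  show si: "square_integrable f"
    unfolding square_integrable_def
  proof
    show "integrable lborel (\<lambda>x. (cmod (f x))\<^sup>2)"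
      by (rule Bochner_Integration.integrable_bound[OF int[of "C\<^sup>2"]])
         (use bound2 in \<open>auto intro!: always_eventually order_trans[OF bound2 abs_ge_self]\<close>)
  qed fact
  show "(LINT x|lborel. (cmod (f x))\<^sup>2) \<le> C\<^sup>2 * (2 * M)" if "M \<ge> 0"
  proof -
    have "(LINT x|lborel. (cmod (f x))\<^sup>2) \<le> (LINT x|lborel. C\<^sup>2 * indicator {-M..M} x)"
      using si by (intro integral_mono bound2 int) (simp add: square_integrable_def)
    also have "\<dots> = C\<^sup>2 * (2 * M)" using that by simp
    finally show ?thesis .
  qed
qed

lemma compact_support_bound_indicator:
  fixes f :: "real \<Rightarrow> complex"
  assumes "continuous_on UNIV f" "\<And>x. \<bar>x\<bar> > M \<Longrightarrow> f x = 0"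
  shows "\<exists>C\<ge>0. \<forall>x. cmod (f x) \<le> C * indicator {-M..M} x"
proof -
  obtain C where "C \<ge> 0" "\<And>x. cmod (f x) \<le> C" using compact_support_bounded[OF assms] by blast
  then show ?thesis using assms(2) by (intro exI[of _ C]) (auto simp: indicator_def abs_if)
qed

lemma
  fixes f :: "real \<Rightarrow> complex"
  assumes "continuous_on UNIV f" "\<And>x. \<bar>x\<bar> > M \<Longrightarrow> f x = 0"
  shows integrable_compact_support: "integrable lborel f"
    and square_integrable_compact_support: "square_integrable f"
proof -
  have m: "f \<in> borel_measurable borel" using assms(1) by (rule borel_measurable_continuous_onI)
  obtain C where "\<And>x. cmod (f x) \<le> C * indicator {-M..M} x"
    using compact_support_bound_indicator[OF assms] by blast
  from integrable_bounded_support[OF m this] square_integrable_bounded_support[OF m this]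
  show "integrable lborel f" "square_integrable f" by auto
qed

lemma derivative_zero_off_support:
  fixes f :: "real \<Rightarrow> complex"
  assumes "(f has_vector_derivative f') (at x)" "\<And>y. \<bar>y\<bar> > M \<Longrightarrow> f y = 0" "\<bar>x\<bar> > M"
  shows "f' = 0"
proof -
  have "open {y::real. \<bar>y\<bar> > M}" by (intro open_Collect_less continuous_intros)
  then have "((\<lambda>_. 0) has_vector_derivative f') (at x)"
    by (rule has_vector_derivative_transform_within_open[OF assms(1)]) (use assms in auto)
  then show ?thesis using has_vector_derivative_const vector_derivative_unique_at by blast
qed

section \<open>Derivatives on the Fourier side and Sobolev bounds\<close>

lemma fourier_integral_derivative:
  assumes f': "\<And>x. (f has_vector_derivative f' x) (at x)" and cont: "continuous_on UNIV f'"
    and supp: "\<And>x. \<bar>x\<bar> > M \<Longrightarrow> f x = 0"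
  shows "fourier_integral f' p = \<i> * of_real p * fourier_integral f p"
proof -
  define e where "e x = exp (- \<i> * complex_of_real (p * x))" for x
  have e': "(e has_vector_derivative (- \<i> * of_real p) * e x) (at x)" for x
  proof -
    have "((\<lambda>z. exp (- \<i> * (of_real p * z))) has_field_derivative (- \<i> * of_real p) * exp (- \<i> * (of_real p * of_real x))) (at (of_real x))"
      by (auto intro!: derivative_eq_intros)
    from has_vector_derivative_real_field[OF this] show ?thesis by (simp add: e_def[abs_def])
  qed
  have contf: "continuous_on UNIV f" by (rule continuous_if_has_vector_derivative[OF f'])
  have conte: "continuous_on UNIV e" by (rule continuous_if_has_vector_derivative[OF e'])
  have supp': "f' x = 0" if "\<bar>x\<bar> > M" for x
    by (rule derivative_zero_off_support[OF f' supp that])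
  define W where "W x = e x * f' x + (- \<i> * of_real p) * e x * f x" for x
  have W': "((\<lambda>x. e x * f x) has_vector_derivative W x) (at x)" for x
    unfolding W_def by (intro has_vector_derivative_mult e' f')
  have contW: "continuous_on UNIV W" unfolding W_def by (intro continuous_intros conte contf cont)
  \<comment> \<open>Strictly beyond M, so that both boundary terms of the integration by parts
    vanish.\<close>
  define N where "N = \<bar>M\<bar> + 1"
  have N: "\<bar>M\<bar> < N" "- N \<le> N" by (auto simp: N_def)
  have "(LINT x|lborel. indicator {-N..N} x *\<^sub>R W x) = e N * f N - e (- N) * f (- N)"
    by (rule integral_FTC_Icc[OF N(2)])
       (auto intro: has_vector_derivative_at_within W' continuous_on_subset[OF contW])
  also have "\<dots> = 0" using supp[of N] supp[of "- N"] N by simp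
  also have "(LINT x|lborel. indicator {-N..N} x *\<^sub>R W x) = (LINT x|lborel. W x)"
  proof (intro Bochner_Integration.integral_cong refl)
    fix x
    show "indicator {-N..N} x *\<^sub>R W x = W x"
    proof (cases "x \<in> {-N..N}")
      case False
      then have "\<bar>x\<bar> > M" using N by auto
      then show ?thesis using False supp supp' by (simp add: W_def)
    qed simp
  qed
  also have "\<dots> = (LINT x|lborel. e x * f' x) + (- \<i> * of_real p) * (LINT x|lborel. e x * f x)"
  proof -
    have "integrable lborel (\<lambda>x. e x * f' x)" "integrable lborel (\<lambda>x. e x * f x)"
      unfolding e_def by (intro integrable_fourier_kernel integrable_compact_support[OF cont supp'] integrable_compact_support[OF contf supp]; simp)+
    then show ?thesis unfolding W_def mult.assoc by simp
  qed
  finally have "(LINT x|lborel. e x * f' x) = \<i> * of_real p * (LINT x|lborel. e x * f x)"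
    by (simp add: eq_neg_iff_add_eq_0 algebra_simps)
  then show ?thesis by (simp add: fourier_integral_def e_def)
qed

text \<open>\<open>lap u v\<close> says that \<open>v\<close> is the second derivative of \<open>u\<close> in \<open>L2\<close>.\<close>

definition lap :: "L2 \<Rightarrow> L2 \<Rightarrow> bool" where
  "lap u v \<longleftrightarrow> (\<exists>\<phi>. represents \<phi> (fourier u) \<and> represents (\<lambda>p. of_real (- p\<^sup>2) * \<phi> p) (fourier v))"

lemma lap_diff:
  assumes "lap u v" "lap u' v'" shows "lap (u - u') (v - v')"
proof -
  obtain \<phi> where \<phi>: "represents \<phi> (fourier u)" "represents (\<lambda>p. of_real (- p\<^sup>2) * \<phi> p) (fourier v)"
    using assms(1) unfolding lap_def by blast
  obtain \<psi> where \<psi>: "represents \<psi> (fourier u')" "represents (\<lambda>p. of_real (- p\<^sup>2) * \<psi> p) (fourier v')"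
    using assms(2) unfolding lap_def by blast
  have "represents (\<lambda>p. \<phi> p - \<psi> p) (fourier (u - u'))"
    unfolding fourier_diff by (rule represents_diff[OF \<phi>(1) \<psi>(1)])
  moreover have "represents (\<lambda>p. of_real (- p\<^sup>2) * (\<phi> p - \<psi> p)) (fourier (v - v'))"
    unfolding fourier_diff right_diff_distrib by (rule represents_diff[OF \<phi>(2) \<psi>(2)])
  ultimately show ?thesis unfolding lap_def by blast
qed

lemma lap_compact_support:
  assumes f': "\<And>x. (f has_vector_derivative f' x) (at x)" and f'': "\<And>x. (f' has_vector_derivative f'' x) (at x)"
    and cont: "continuous_on UNIV f''" and supp: "\<And>x. \<bar>x\<bar> > M \<Longrightarrow> f x = 0"
  shows "lap (abs_L2 f) (abs_L2 f'')"
proof -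
  have supp': "f' x = 0" if "\<bar>x\<bar> > M" for x by (rule derivative_zero_off_support[OF f' supp that])
  have supp'': "f'' x = 0" if "\<bar>x\<bar> > M" for x by (rule derivative_zero_off_support[OF f'' supp' that])
  have c: "continuous_on UNIV f" "continuous_on UNIV f'"
    by (rule continuous_if_has_vector_derivative[OF f'] continuous_if_has_vector_derivative[OF f''])+
  have eq: "fourier_integral f'' = (\<lambda>p. of_real (- p\<^sup>2) * fourier_integral f p)"
  proof
    fix p
    have "fourier_integral f'' p = \<i> * of_real p * fourier_integral f' p"
      by (rule fourier_integral_derivative[OF f'' cont]) (rule supp')
    also have "fourier_integral f' p = \<i> * of_real p * fourier_integral f p"
      by (rule fourier_integral_derivative[OF f' c(2)]) (rule supp)
    finally show "fourier_integral f'' p = of_real (- p\<^sup>2) * fourier_integral f p"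
      by (simp add: power2_eq_square algebra_simps)
  qed
  have 1: "represents (fourier_integral f) (fourier (abs_L2 f))"
    by (intro represents_fourier_integral represents_abs square_integrable_compact_support[OF c(1) supp]
        integrable_compact_support[OF c(1) supp])
  have 2: "represents (fourier_integral f'') (fourier (abs_L2 f''))"
    by (intro represents_fourier_integral represents_abs square_integrable_compact_support[OF cont supp'']
        integrable_compact_support[OF cont supp''])
  show ?thesis
    unfolding lap_def using 1 2[unfolded eq] by blast
qed

text \<open>The scale \<open>e\<close> is that of the support of \<open>u\<close>; with it the estimate scales like the
  \<open>H\<^sup>r\<close> norm.\<close>

lemma lap_sobolev:
  assumes lap: "lap u v" and r: "0 \<le> r" "r \<le> 2" and e: "0 < e" "e \<le> 1"
  shows "u \<in> sobolev r"
    "(norm (fmult (sobw r) u))\<^sup>2 \<le> 2 * e powr (- 2 * r) * ((norm u)\<^sup>2 + e ^ 4 * (norm v)\<^sup>2)"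
proof -
  obtain \<phi> where \<phi>: "represents \<phi> (fourier u)" "represents (\<lambda>p. of_real (- p\<^sup>2) * \<phi> p) (fourier v)"
    using lap by (auto simp: lap_def)
  have [measurable]: "\<phi> \<in> borel_measurable borel" using \<phi>(1) by (simp add: represents_def square_integrable_def)
  \<comment> \<open>Since e is at most 1, 1 + p^2 is at most e^(-2) (1 + e^2 p^2). In the second
    factor the exponent r may be raised to 2, and the square of a sum is at most twice the sum of
    squares.\<close>
  have pw: "(sobw r p)\<^sup>2 \<le> 2 * e powr (- 2 * r) * (1 + e ^ 4 * p ^ 4)" for p
  proof -
    have "1 + p\<^sup>2 \<le> (1 / e\<^sup>2) * (1 + e\<^sup>2 * p\<^sup>2)"
      using e by (simp add: field_simps power_le_one)
    then have "(1 + p\<^sup>2) powr r \<le> ((1 / e\<^sup>2) * (1 + e\<^sup>2 * p\<^sup>2)) powr r"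
      using r(1) by (intro powr_mono2) auto
    also have "\<dots> = (1 / e\<^sup>2) powr r * (1 + e\<^sup>2 * p\<^sup>2) powr r" by (rule powr_mult)
    also have "(1 / e\<^sup>2) powr r = e powr (- 2 * r)"
    proof -
      have "1 / e\<^sup>2 = e powr (- 2)" using e by (simp add: powr_minus powr_numeral divide_inverse)
      then show ?thesis by (simp add: powr_powr)
    qed
    finally have 1: "(1 + p\<^sup>2) powr r \<le> e powr (- 2 * r) * (1 + e\<^sup>2 * p\<^sup>2) powr r" .
    have "(1 + e\<^sup>2 * p\<^sup>2) powr r \<le> (1 + e\<^sup>2 * p\<^sup>2) powr 2"
      using r by (intro powr_mono) auto
    also have "(1 + e\<^sup>2 * p\<^sup>2) powr 2 = (1 + e\<^sup>2 * p\<^sup>2)\<^sup>2"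
      by (rule powr_numeral) (simp add: add_nonneg_nonneg)
    also have "\<dots> \<le> 2 * (1 + e ^ 4 * p ^ 4)"
      using zero_le_power2[of "1 - e\<^sup>2 * p\<^sup>2"] by (simp add: power2_eq_square power4_eq_xxxx algebra_simps)
    finally have 2: "(1 + e\<^sup>2 * p\<^sup>2) powr r \<le> 2 * (1 + e ^ 4 * p ^ 4)" .
    have "(1 + p\<^sup>2) powr r \<le> e powr (- 2 * r) * (2 * (1 + e ^ 4 * p ^ 4))"
      by (rule order_trans[OF 1 mult_left_mono[OF 2]]) simp
    then show ?thesis unfolding sobw_power2 by (simp only: mult.assoc mult.left_commute)
  qed
  define Q where "Q p = 2 * e powr (- 2 * r) * ((cmod (\<phi> p))\<^sup>2 + e ^ 4 * (cmod (of_real (- p\<^sup>2) * \<phi> p))\<^sup>2)" for p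
  have Q: "(cmod (of_real (sobw r p) * \<phi> p))\<^sup>2 \<le> Q p" for p
  proof -
    have "(cmod (of_real (sobw r p) * \<phi> p))\<^sup>2 = (sobw r p)\<^sup>2 * (cmod (\<phi> p))\<^sup>2"
      by (simp add: norm_mult power_mult_distrib)
    also have "\<dots> \<le> (2 * e powr (- 2 * r) * (1 + e ^ 4 * p ^ 4)) * (cmod (\<phi> p))\<^sup>2"
      by (intro mult_right_mono pw) auto
    also have "\<dots> = Q p"
      by (simp add: Q_def norm_mult norm_power power_mult_distrib algebra_simps flip: power_mult)
    finally show ?thesis .
  qed
  have intQ: "integrable lborel Q"
    unfolding Q_def using \<phi>
    by (intro integrable_mult_right Bochner_Integration.integrable_add) (auto simp: represents_def square_integrable_def)
  have si: "square_integrable (\<lambda>p. of_real (sobw r p) * \<phi> p)"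
    unfolding square_integrable_def
  proof
    show "integrable lborel (\<lambda>p. (cmod (of_real (sobw r p) * \<phi> p))\<^sup>2)"
      by (rule Bochner_Integration.integrable_bound[OF intQ])
         (use Q in \<open>auto intro!: always_eventually order_trans[OF Q abs_ge_self]\<close>)
  qed measurable
  then show dom: "u \<in> sobolev r"
    unfolding sobolev_eq using fdom_iff[OF sobw_measurable \<phi>(1)] by simp
  have "(norm (fmult (sobw r) u))\<^sup>2 = (LINT p|lborel. (cmod (of_real (sobw r p) * \<phi> p))\<^sup>2)"
    using norm_represents[OF fmult_represents[OF sobw_measurable dom[unfolded sobolev_eq] \<phi>(1)]]
    by (simp add: norm_fourier)
  also have "\<dots> \<le> (LINT p|lborel. Q p)"
    using si by (intro integral_mono Q intQ) (simp add: square_integrable_def)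
  also have "\<dots> = 2 * e powr (- 2 * r) * ((norm u)\<^sup>2 + e ^ 4 * (norm v)\<^sup>2)"
    unfolding Q_def using \<phi> norm_represents[OF \<phi>(1)] norm_represents[OF \<phi>(2)]
    by (subst integral_mult_right_zero, subst Bochner_Integration.integral_add)
       (auto simp: represents_def square_integrable_def norm_fourier)
  finally show "(norm (fmult (sobw r) u))\<^sup>2 \<le> 2 * e powr (- 2 * r) * ((norm u)\<^sup>2 + e ^ 4 * (norm v)\<^sup>2)" .
qed

lemma cutoff_product_derivatives:
  fixes f f' f'' \<eta> \<eta>' \<eta>'' :: "real \<Rightarrow> complex"
  assumes f: "\<And>x. (f has_vector_derivative f' x) (at x)" "\<And>x. (f' has_vector_derivative f'' x) (at x)"
    and \<eta>: "\<And>x. (\<eta> has_vector_derivative \<eta>' x) (at x)" "\<And>x. (\<eta>' has_vector_derivative \<eta>'' x) (at x)"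
    and t: "t \<noteq> 0"
  shows "((\<lambda>x. f x * \<eta> (x / t)) has_vector_derivative (f x * (of_real (1 / t) * \<eta>' (x / t)) + f' x * \<eta> (x / t))) (at x)"
    and "((\<lambda>x. f x * (of_real (1 / t) * \<eta>' (x / t)) + f' x * \<eta> (x / t)) has_vector_derivative
      (f x * (of_real (1 / t\<^sup>2) * \<eta>'' (x / t)) + 2 * f' x * (of_real (1 / t) * \<eta>' (x / t)) + f'' x * \<eta> (x / t))) (at x)"
proof -
  have sc: "((\<lambda>x. g (x / t)) has_vector_derivative of_real (1 / t) * g' (x / t)) (at x)"
    if "\<And>x. (g has_vector_derivative g' x) (at x)" for g g' :: "real \<Rightarrow> complex" and x
  proof -
    have "((\<lambda>x. x / t) has_vector_derivative 1 / t) (at x)"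
      using t by (auto intro!: derivative_eq_intros simp flip: has_real_derivative_iff_has_vector_derivative)
    from vector_diff_chain_at[OF this that] show ?thesis by (simp add: o_def scaleR_conv_of_real)
  qed
  show "((\<lambda>x. f x * \<eta> (x / t)) has_vector_derivative (f x * (of_real (1 / t) * \<eta>' (x / t)) + f' x * \<eta> (x / t))) (at x)"
    by (intro has_vector_derivative_mult f sc \<eta>)
  have "((\<lambda>x. f x * (of_real (1 / t) * \<eta>' (x / t)) + f' x * \<eta> (x / t)) has_vector_derivative
     ((f x * (of_real (1 / t) * (of_real (1 / t) * \<eta>'' (x / t))) + f' x * (of_real (1 / t) * \<eta>' (x / t)))
      + (f' x * (of_real (1 / t) * \<eta>' (x / t)) + f'' x * \<eta> (x / t)))) (at x)"
    by (intro has_vector_derivative_add has_vector_derivative_mult has_vector_derivative_mult_right f sc \<eta>)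
  then show "((\<lambda>x. f x * (of_real (1 / t) * \<eta>' (x / t)) + f' x * \<eta> (x / t)) has_vector_derivative
      (f x * (of_real (1 / t\<^sup>2) * \<eta>'' (x / t)) + 2 * f' x * (of_real (1 / t) * \<eta>' (x / t)) + f'' x * \<eta> (x / t))) (at x)"
    by (simp add: power2_eq_square algebra_simps)
qed

text \<open>The first order Taylor remainder of the exponential is quadratic, so the error of the
  difference quotient is at most |y - x| times a multiple of the absolute second moment of \<phi>.
  This is where the third integrability hypothesis enters.\<close>

lemma fourier_integral_has_derivative:
  assumes int: "integrable lborel \<phi>" "integrable lborel (\<lambda>p. of_real p * \<phi> p)" "integrable lborel (\<lambda>p. of_real (p\<^sup>2) * \<phi> p)"
  shows "((\<lambda>x. fourier_integral \<phi> (- x)) has_vector_derivative fourier_integral (\<lambda>p. \<i> * of_real p * \<phi> p) (- x)) (at x)"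
proof -
  define c :: complex where "c = of_real ((2 * pi) powr (- 1/2))"
  define K where "K = cmod c * (1/2) * (LINT p|lborel. cmod (of_real (p\<^sup>2) * \<phi> p))"
  have ker: "integrable lborel (\<lambda>p. exp (\<i> * of_real (x * p)) * \<psi> p)" if "integrable lborel \<psi>" for \<psi> x
    using integrable_fourier_kernel[OF that, of "- x"] by simp
  have fi: "fourier_integral \<psi> (- x) = c * (LINT p|lborel. exp (\<i> * of_real (x * p)) * \<psi> p)" for \<psi> x
    by (simp add: fourier_integral_def c_def)
  have int2: "integrable lborel (\<lambda>p. \<i> * of_real p * \<phi> p)"
    using integrable_mult_right[OF int(2), of \<i>] by (simp add: mult.assoc)
  have bound: "norm (fourier_integral \<phi> (- y) - fourier_integral \<phi> (- x) - (y - x) *\<^sub>R fourier_integral (\<lambda>p. \<i> * of_real p * \<phi> p) (- x)) \<le> K * (y - x)\<^sup>2" for y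
  proof -
    define h where "h p = exp (\<i> * of_real (y * p)) * \<phi> p - exp (\<i> * of_real (x * p)) * \<phi> p - of_real (y - x) * (exp (\<i> * of_real (x * p)) * (\<i> * of_real p * \<phi> p))" for p
    have "fourier_integral \<phi> (- y) - fourier_integral \<phi> (- x) - (y - x) *\<^sub>R fourier_integral (\<lambda>p. \<i> * of_real p * \<phi> p) (- x)
        = c * (LINT p|lborel. h p)"
      unfolding h_def fi scaleR_conv_of_real
      using ker[OF int(1), of y] ker[OF int(1), of x] ker[OF int2, of x]
      by (simp add: right_diff_distrib mult.left_commute[of c])
    moreover have "cmod (LINT p|lborel. h p) \<le> (LINT p|lborel. (1/2) * (y - x)\<^sup>2 * cmod (of_real (p\<^sup>2) * \<phi> p))"
    proof (rule order_trans[OF integral_norm_bound integral_mono])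
      show "integrable lborel (\<lambda>p. norm (h p))"
        unfolding h_def by (intro integrable_norm Bochner_Integration.integrable_diff ker int integrable_mult_right int2)
      show "integrable lborel (\<lambda>p. (1/2) * (y - x)\<^sup>2 * cmod (of_real (p\<^sup>2) * \<phi> p))"
        by (intro integrable_mult_right integrable_norm int)
      fix p
      have "h p = exp (\<i> * of_real (x * p)) * \<phi> p * (iexp ((y - x) * p) - (\<Sum>k\<le>1. (\<i> * of_real ((y - x) * p)) ^ k / fact k))"
      proof -
        have "exp (\<i> * of_real (y * p)) = exp (\<i> * of_real (x * p)) * iexp ((y - x) * p)"
          by (simp add: algebra_simps flip: exp_add)
        then show ?thesis unfolding h_def by (simp add: algebra_simps)
      qed
      then have "norm (h p) = cmod (\<phi> p) * cmod (iexp ((y - x) * p) - (\<Sum>k\<le>1. (\<i> * of_real ((y - x) * p)) ^ k / fact k))"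
        by (simp only: norm_mult norm_exp_i_times mult_1_left)
      also have "\<dots> \<le> cmod (\<phi> p) * (\<bar>(y - x) * p\<bar> ^ Suc 1 / fact (Suc 1))"
        by (intro mult_left_mono iexp_approx1) auto
      also have "\<bar>(y - x) * p\<bar> ^ Suc 1 = (y - x)\<^sup>2 * p\<^sup>2"
        unfolding Suc_1 power2_abs power_mult_distrib by (rule refl)
      also have "cmod (\<phi> p) * ((y - x)\<^sup>2 * p\<^sup>2 / fact (Suc 1)) = (1/2) * (y - x)\<^sup>2 * cmod (of_real (p\<^sup>2) * \<phi> p)"
        by (simp add: norm_mult norm_power)
      finally show "norm (h p) \<le> (1/2) * (y - x)\<^sup>2 * cmod (of_real (p\<^sup>2) * \<phi> p)" .
    qed
    moreover have "(LINT p|lborel. (1/2) * (y - x)\<^sup>2 * cmod (of_real (p\<^sup>2) * \<phi> p)) = (1/2) * (y - x)\<^sup>2 * (LINT p|lborel. cmod (of_real (p\<^sup>2) * \<phi> p))"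
      by (rule integral_mult_right_zero)
    ultimately have "norm (fourier_integral \<phi> (- y) - fourier_integral \<phi> (- x) - (y - x) *\<^sub>R fourier_integral (\<lambda>p. \<i> * of_real p * \<phi> p) (- x))
        \<le> cmod c * ((1/2) * (y - x)\<^sup>2 * (LINT p|lborel. cmod (of_real (p\<^sup>2) * \<phi> p)))"
      by (simp only: norm_mult mult_left_mono norm_ge_zero)
    then show ?thesis by (simp only: K_def mult_ac)
  qed
  show ?thesis
    unfolding has_vector_derivative_def
  proof (rule has_derivativeI_sandwich[where e=1 and H="\<lambda>y. K * \<bar>y - x\<bar>"])
    show "bounded_linear (\<lambda>h. h *\<^sub>R fourier_integral (\<lambda>p. \<i> * of_real p * \<phi> p) (- x))"
      by (rule bounded_linear_scaleR_left)
    show "norm (fourier_integral \<phi> (- y) - fourier_integral \<phi> (- x) - (y - x) *\<^sub>R fourier_integral (\<lambda>p. \<i> * of_real p * \<phi> p) (- x)) / norm (y - x) \<le> K * \<bar>y - x\<bar>"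
      if "y \<noteq> x" for y
      using bound[of y] that by (simp add: divide_le_eq power2_eq_square mult.assoc abs_mult_self_eq)
    have "((\<lambda>y. K * \<bar>y - x\<bar>) \<longlongrightarrow> K * \<bar>x - x\<bar>) (at x)" by (intro tendsto_intros)
    then show "((\<lambda>y. K * \<bar>y - x\<bar>) \<longlongrightarrow> 0) (at x)" by simp
  qed auto
qed

section \<open>Band-limited functions and cut-off at infinity\<close>

definition bandlimited :: "L2 \<Rightarrow> bool" where
  "bandlimited F \<longleftrightarrow> (\<exists>\<phi> N. represents \<phi> (fourier F) \<and> (\<forall>p. \<bar>p\<bar> > N \<longrightarrow> \<phi> p = 0))"

text \<open>All powers of i p times a transform with bounded support are integrable, so the
  inversion integral can be differentiated any number of times; \<open>f k\<close> is the derivative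
  of order k.\<close>

lemma bandlimited_smooth:
  assumes "bandlimited F"
  shows "\<exists>f0 f1 f2. smooth f0 \<and> (\<forall>x. (f0 has_vector_derivative f1 x) (at x)) \<and> (\<forall>x. (f1 has_vector_derivative f2 x) (at x))
    \<and> continuous_on UNIV f2 \<and> represents f0 F \<and> square_integrable f1 \<and> square_integrable f2
    \<and> lap F (abs_L2 f2) \<and> f0 0 = ev0 F"
proof -
  obtain \<phi> N where \<phi>: "represents \<phi> (fourier F)" and supp: "\<And>p. \<bar>p\<bar> > N \<Longrightarrow> \<phi> p = 0"
    using assms unfolding bandlimited_def by blast
  have [measurable]: "\<phi> \<in> borel_measurable borel" using \<phi> by (simp add: represents_def square_integrable_def)
  define m where "m k p = (\<i> * of_real p) ^ k * \<phi> p" for k p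
  have m_meas [measurable]: "m k \<in> borel_measurable borel" for k unfolding m_def by measurable
  have m_bound: "cmod (m k p) \<le> \<bar>N\<bar> ^ k * cmod (\<phi> p)" for k p
  proof (cases "\<bar>p\<bar> > N")
    case False
    then have "\<bar>p\<bar> ^ k \<le> \<bar>N\<bar> ^ k" by (intro power_mono) auto
    then show ?thesis by (simp add: m_def norm_mult norm_power mult_right_mono)
  qed (simp add: m_def supp)
  have m_supp: "m k p = 0" if "\<bar>p\<bar> > N" for k p using supp[OF that] by (simp add: m_def)
  have m_si: "square_integrable (m k)" for k
    by (rule square_integrable_bound[OF square_integrable_scale[of \<phi> "of_real (\<bar>N\<bar> ^ k)"]])
       (use \<phi> m_bound in \<open>auto simp: represents_def norm_mult norm_power intro!: always_eventually\<close>)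
  \<comment> \<open>On the band a modulus is at most its square plus 1, and the band has finite
    length.\<close>
  have m_int: "integrable lborel (m k)" for k
  proof (rule Bochner_Integration.integrable_bound)
    have "integrable lborel (\<lambda>x. indicator {-N..N} x :: real)"
      by (intro integrable_real_indicator) (auto simp: emeasure_lborel_Icc_eq)
    then show "integrable lborel (\<lambda>p. (cmod (m k p))\<^sup>2 + indicator {-N..N} p)"
      using m_si[of k] by (intro Bochner_Integration.integrable_add) (auto simp: square_integrable_def)
    show "AE p in lborel. norm (m k p) \<le> norm ((cmod (m k p))\<^sup>2 + indicator {-N..N} p)"
    proof (intro always_eventually allI)
      fix p
      show "norm (m k p) \<le> norm ((cmod (m k p))\<^sup>2 + indicator {-N..N} p)"
      proof (cases "\<bar>p\<bar> > N")
        case False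
        have "2 * cmod (m k p) \<le> (cmod (m k p))\<^sup>2 + 1"
          using zero_le_power2[of "cmod (m k p) - 1"] by (simp add: power2_eq_square algebra_simps)
        then have "cmod (m k p) \<le> (cmod (m k p))\<^sup>2 + 1"
          using norm_ge_zero[of "m k p"] by linarith
        moreover have "p \<in> {-N..N}" using False by auto
        ultimately show ?thesis by simp
      qed (simp add: m_supp)
    qed
  qed measurable
  define f where "f k x = fourier_integral (m k) (- x)" for k x
  have f': "(f k has_vector_derivative f (Suc k) x) (at x)" for k x
  proof -
    have 1: "(\<lambda>p. of_real p * m k p) = (\<lambda>p. (- \<i>) * m (Suc k) p)"
      by (auto simp: m_def mult_ac)
    have 2: "(\<lambda>p. of_real (p\<^sup>2) * m k p) = (\<lambda>p. (-1) * m (Suc (Suc k)) p)"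
      by (auto simp: m_def power2_eq_square mult_ac)
    have "((\<lambda>x. fourier_integral (m k) (- x)) has_vector_derivative fourier_integral (\<lambda>p. \<i> * of_real p * m k p) (- x)) (at x)"
      by (rule fourier_integral_has_derivative) (simp_all only: 1 2 integrable_mult_right m_int)
    moreover have "(\<lambda>p. \<i> * of_real p * m k p) = m (Suc k)" by (auto simp: m_def)
    ultimately show ?thesis unfolding f_def[abs_def] by simp
  qed
  define g where "g k = inv fourier (abs_L2 (m k))" for k
  have g: "represents (m k) (fourier (g k))" for k by (simp add: g_def represents_abs m_si)
  have fg: "represents (f k) (g k)" for k
    unfolding f_def[abs_def] by (rule fourier_inversion[OF g m_int])
  have m0: "m 0 = \<phi>" by (auto simp: m_def)
  have "F = g 0" using represents_unique[OF \<phi> g[of 0, unfolded m0]] by (simp add: fourier_eq_iff)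
  have m2: "m 2 = (\<lambda>p. of_real (- p\<^sup>2) * \<phi> p)" by (intro ext) (simp add: m_def power_mult_distrib)
  have g2: "g 2 = abs_L2 (f 2)" using fg[of 2] by (simp add: represents_def)
  have "lap F (abs_L2 (f 2))"
    unfolding lap_def using \<phi> g[of 2] by (auto simp: m2 g2)
  moreover have "f 0 0 = ev0 F"
    using ev0_represents[OF \<phi>] by (simp add: f_def m0 fourier_integral_def)
  moreover have "continuous_on UNIV (f 2)" by (rule continuous_if_has_vector_derivative[OF f'])
  moreover have "smooth (f 0)" by (rule smoothI[of f]) (use f' in auto)
  moreover have "\<forall>x. (f 1 has_vector_derivative f 2 x) (at x)" using f'[of 1] by (simp add: numeral_2_eq_2)
  moreover have "\<forall>x. (f 0 has_vector_derivative f 1 x) (at x)" using f'[of 0] by simp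
  ultimately show ?thesis
    using fg[of 0] represents_square_integrable[OF fg] \<open>F = g 0\<close> by blast
qed

lemma L2_dominated_convergence:
  assumes rep: "\<And>n::nat. represents (h n) (H n)" and W: "integrable lborel W"
    and bound: "\<And>n x. (cmod (h n x))\<^sup>2 \<le> W x" and lim: "\<And>x. (\<lambda>n. h n x) \<longlonglongrightarrow> 0"
  shows "(\<lambda>n. (norm (H n))\<^sup>2) \<longlonglongrightarrow> 0"
proof -
  have [measurable]: "h n \<in> borel_measurable borel" for n
    using rep by (simp add: represents_def square_integrable_def)
  have "(\<lambda>n. LINT x|lborel. (cmod (h n x))\<^sup>2) \<longlonglongrightarrow> integral\<^sup>L lborel (\<lambda>_::real. 0)"
  proof (rule integral_dominated_convergence[OF _ _ W])
    show "AE x in lborel. (\<lambda>n. (cmod (h n x))\<^sup>2) \<longlonglongrightarrow> 0"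
    proof (intro always_eventually allI)
      show "(\<lambda>n. (cmod (h n x))\<^sup>2) \<longlonglongrightarrow> 0" for x
        using tendsto_power[OF tendsto_norm[OF lim[of x]], of 2] by simp
    qed
  qed (use bound in auto)
  then show ?thesis by (simp add: norm_represents[OF rep])
qed

text \<open>The cut-off is stretched by a factor tending to infinity. Function and second derivative
  then converge in L2, since every derivative falling on the cut-off brings a factor 1/t. The bound
  \<open>lap_sobolev\<close> at scale 1 converts this into convergence in H^r. The value at the
  origin is kept because the cut-off equals 1 there.\<close>

lemma bandlimited_approx:
  assumes F: "bandlimited F" and r: "0 \<le> r" "r \<le> 2" and d: "\<delta> > 0"
  shows "\<exists>f M. smooth f \<and> (\<forall>x. \<bar>x\<bar> > M \<longrightarrow> f x = 0) \<and> f 0 = ev0 F \<and> F - abs_L2 f \<in> sobolev r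
    \<and> norm (fmult (sobw r) (F - abs_L2 f)) < \<delta>"
proof -
  obtain f0 f1 f2 where f0: "smooth f0" "\<And>x. (f0 has_vector_derivative f1 x) (at x)" "\<And>x. (f1 has_vector_derivative f2 x) (at x)"
    "continuous_on UNIV f2" "represents f0 F" "square_integrable f1" "square_integrable f2"
    "lap F (abs_L2 f2)" "f0 0 = ev0 F"
    using bandlimited_smooth[OF F] by blast
  obtain \<eta> :: "real \<Rightarrow> complex" where \<eta>: "smooth \<eta>" "\<And>x. \<bar>x\<bar> \<le> 1 \<Longrightarrow> \<eta> x = 1" "\<And>x. \<bar>x\<bar> \<ge> 2 \<Longrightarrow> \<eta> x = 0"
    using smooth_cutoff_exists by blast
  obtain \<eta>1 where \<eta>1: "smooth \<eta>1" "\<And>x. (\<eta> has_vector_derivative \<eta>1 x) (at x)" using smooth_derivative[OF \<eta>(1)] by blast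
  obtain \<eta>2 where \<eta>2: "smooth \<eta>2" "\<And>x. (\<eta>1 has_vector_derivative \<eta>2 x) (at x)" using smooth_derivative[OF \<eta>1(1)] by blast
  have s0: "\<eta> x = 0" if "\<bar>x\<bar> > 2" for x using \<eta>(3)[of x] that by simp
  have s1: "\<eta>1 x = 0" if "\<bar>x\<bar> > 2" for x by (rule derivative_zero_off_support[OF \<eta>1(2) s0 that])
  have s2: "\<eta>2 x = 0" if "\<bar>x\<bar> > 2" for x by (rule derivative_zero_off_support[OF \<eta>2(2) s1 that])
  have c: "continuous_on UNIV \<eta>" "continuous_on UNIV \<eta>1" "continuous_on UNIV \<eta>2"
    by (intro smooth_continuous \<eta> \<eta>1 \<eta>2)+
  have c0: "continuous_on UNIV f0" "continuous_on UNIV f1"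
    by (rule continuous_if_has_vector_derivative[OF f0(2)] continuous_if_has_vector_derivative[OF f0(3)])+
  obtain C0 where C0: "C0 \<ge> 0" "\<And>x. cmod (\<eta> x) \<le> C0" using compact_support_bounded[OF c(1), of 2] s0 by blast
  obtain C1 where C1: "C1 \<ge> 0" "\<And>x. cmod (\<eta>1 x) \<le> C1" using compact_support_bounded[OF c(2), of 2] s1 by blast
  obtain C2 where C2: "C2 \<ge> 0" "\<And>x. cmod (\<eta>2 x) \<le> C2" using compact_support_bounded[OF c(3), of 2] s2 by blast
  \<comment> \<open>Bounds every coefficient of \<open>f0\<close>, \<open>f1\<close> and
    \<open>f2\<close> in the two errors: 1 + \<open>C0\<close> for the factor 1 - \<eta>, twice
    \<open>C1\<close> from the product rule, and \<open>C2\<close>.\<close>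
  define C where "C = 1 + C0 + 2 * C1 + C2"
  define t where "t n = real (Suc n)" for n
  have t: "t n \<ge> 1" "t n \<noteq> 0" for n by (simp_all add: t_def)
  have t_lim: "(\<lambda>n. 1 / t n) \<longlonglongrightarrow> 0" unfolding t_def using LIMSEQ_inverse_real_of_nat by (simp add: inverse_eq_divide)
  define g0 where "g0 n x = f0 x * \<eta> (x / t n)" for n x
  define g2 where "g2 n x = f0 x * (of_real (1 / (t n)\<^sup>2) * \<eta>2 (x / t n)) + 2 * f1 x * (of_real (1 / t n) * \<eta>1 (x / t n)) + f2 x * \<eta> (x / t n)" for n x
  have g_smooth: "smooth (g0 n)" for n
    using smooth_mult[OF f0(1) smooth_affine[OF \<eta>(1), of "1 / t n" 0]] by (simp add: g0_def[abs_def])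
  have g_supp: "g0 n x = 0" if "\<bar>x\<bar> > 2 * t n" for n x
  proof -
    have "\<bar>x / t n\<bar> > 2" using that t(1)[of n] by (simp add: field_simps abs_divide)
    then show ?thesis by (simp add: g0_def s0)
  qed
  note der = cutoff_product_derivatives[of f0 f1 f2 \<eta> \<eta>1 \<eta>2, OF f0(2,3) \<eta>1(2) \<eta>2(2) t(2)]
  have der1: "(g0 n has_vector_derivative (f0 x * (of_real (1 / t n) * \<eta>1 (x / t n)) + f1 x * \<eta> (x / t n))) (at x)" for n x
    unfolding g0_def[abs_def] by (rule der(1))
  have der2: "((\<lambda>x. f0 x * (of_real (1 / t n) * \<eta>1 (x / t n)) + f1 x * \<eta> (x / t n)) has_vector_derivative g2 n x) (at x)" for n x
    unfolding g2_def by (rule der(2))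
  have cont_sc: "continuous_on UNIV (\<lambda>x. h (x / t n))" if "continuous_on UNIV h" for h :: "real \<Rightarrow> complex" and n
    by (rule continuous_on_compose2[OF that]) (use t(2) in \<open>auto intro!: continuous_intros\<close>)
  have g2_cont: "continuous_on UNIV (g2 n)" for n
    unfolding g2_def by (intro continuous_intros c0 f0(4) cont_sc c)
  have lap_g: "lap (abs_L2 (g0 n)) (abs_L2 (g2 n))" for n
    by (rule lap_compact_support[OF der1 der2 g2_cont]) (rule g_supp)
  have si0: "square_integrable f0" by (rule represents_square_integrable[OF f0(5)])
  have g2_si: "square_integrable (g2 n)" for n
  proof (rule square_integrable_compact_support[OF g2_cont])
    fix x assume "\<bar>x\<bar> > 2 * t n"
    then have "\<bar>x / t n\<bar> > 2" using t(1)[of n] by (simp add: field_simps abs_divide)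
    then show "g2 n x = 0" by (simp add: g2_def s0 s1 s2)
  qed
  have g0_si: "square_integrable (g0 n)" for n
    by (rule square_integrable_compact_support[OF smooth_continuous[OF g_smooth] g_supp])
  have \<eta>_lim: "(\<lambda>n. h (x / t n)) \<longlonglongrightarrow> h 0" if "continuous_on UNIV h" for h :: "real \<Rightarrow> complex" and x
  proof -
    have "(\<lambda>n. x * (1 / t n)) \<longlonglongrightarrow> x * 0" by (intro tendsto_mult tendsto_const t_lim)
    then show ?thesis
      using that continuous_on_tendsto_compose[OF that, of "\<lambda>n. x / t n" 0] by simp
  qed
  define W where "W x = 3 * C\<^sup>2 * ((cmod (f0 x))\<^sup>2 + (cmod (f1 x))\<^sup>2 + (cmod (f2 x))\<^sup>2)" for x
  have intW: "integrable lborel W"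
    unfolding W_def using si0 f0(6,7)
    by (intro integrable_mult_right Bochner_Integration.integrable_add) (auto simp: square_integrable_def)
  have sq3: "(C * (a + b + d))\<^sup>2 \<le> 3 * C\<^sup>2 * (a\<^sup>2 + b\<^sup>2 + d\<^sup>2)" for a b d :: real
  proof -
    have "(a + b + d)\<^sup>2 \<le> 3 * (a\<^sup>2 + b\<^sup>2 + d\<^sup>2)"
      using zero_le_power2[of "a - b"] zero_le_power2[of "b - d"] zero_le_power2[of "a - d"]
      by (simp add: power2_eq_square algebra_simps)
    from mult_left_mono[OF this zero_le_power2[of C]] show ?thesis
      unfolding power_mult_distrib by (simp only: mult.assoc mult.left_commute)
  qed
  have t_inv: "1 / t n \<le> 1" "1 / (t n)\<^sup>2 \<le> 1" "0 \<le> 1 / t n" for n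
    using t(1)[of n] by (auto simp: one_le_power)
  have C: "0 \<le> C" "1 + C0 \<le> C" "2 * C1 \<le> C" "C2 \<le> C" using C0(1) C1(1) C2(1) by (auto simp: C_def)
  have 1: "(\<lambda>n. (norm (F - abs_L2 (g0 n)))\<^sup>2) \<longlonglongrightarrow> 0"
  proof (rule L2_dominated_convergence[OF _ intW])
    show "represents (\<lambda>x. f0 x - g0 n x) (F - abs_L2 (g0 n))" for n
      by (intro represents_diff f0(5) represents_abs g0_si)
    show "(cmod (f0 x - g0 n x))\<^sup>2 \<le> W x" for n x
    proof -
      have "f0 x - g0 n x = f0 x * (1 - \<eta> (x / t n))" by (simp add: g0_def algebra_simps)
      then have "cmod (f0 x - g0 n x) = cmod (f0 x) * cmod (1 - \<eta> (x / t n))" by (simp add: norm_mult)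
      also have "\<dots> \<le> cmod (f0 x) * C"
        using norm_triangle_ineq4[of 1 "\<eta> (x / t n)"] C0(2)[of "x / t n"] C(2) by (intro mult_left_mono) auto
      also have "\<dots> \<le> C * (cmod (f0 x) + cmod (f1 x) + cmod (f2 x))"
        using C(1) by (simp add: algebra_simps)
      finally have "(cmod (f0 x - g0 n x))\<^sup>2 \<le> (C * (cmod (f0 x) + cmod (f1 x) + cmod (f2 x)))\<^sup>2"
        by (rule power_mono) simp
      also have "\<dots> \<le> W x" unfolding W_def by (rule sq3)
      finally show ?thesis .
    qed
    show "(\<lambda>n. f0 x - g0 n x) \<longlonglongrightarrow> 0" for x
    proof -
      have "(\<lambda>n. f0 x - f0 x * \<eta> (x / t n)) \<longlonglongrightarrow> f0 x - f0 x * \<eta> 0"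
        by (intro tendsto_diff tendsto_mult tendsto_const \<eta>_lim c)
      then show ?thesis by (simp add: g0_def \<eta>(2))
    qed
  qed
  have 2: "(\<lambda>n. (norm (abs_L2 f2 - abs_L2 (g2 n)))\<^sup>2) \<longlonglongrightarrow> 0"
  proof (rule L2_dominated_convergence[OF _ intW])
    show "represents (\<lambda>x. f2 x - g2 n x) (abs_L2 f2 - abs_L2 (g2 n))" for n
      by (intro represents_diff represents_abs g2_si f0(7))
    show "(cmod (f2 x - g2 n x))\<^sup>2 \<le> W x" for n x
    proof -
      have "f2 x - g2 n x = f2 x * (1 - \<eta> (x / t n)) - f0 x * (of_real (1 / (t n)\<^sup>2) * \<eta>2 (x / t n)) - 2 * f1 x * (of_real (1 / t n) * \<eta>1 (x / t n))"
        by (simp add: g2_def algebra_simps)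
      also have "cmod \<dots> \<le> cmod (f2 x * (1 - \<eta> (x / t n))) + cmod (f0 x * (of_real (1 / (t n)\<^sup>2) * \<eta>2 (x / t n))) + cmod (2 * f1 x * (of_real (1 / t n) * \<eta>1 (x / t n)))"
        by (rule order_trans[OF norm_triangle_ineq4 add_right_mono[OF norm_triangle_ineq4]])
      also have "\<dots> \<le> cmod (f2 x) * C + cmod (f0 x) * C + cmod (f1 x) * C"
      proof (intro add_mono)
        show "cmod (f2 x * (1 - \<eta> (x / t n))) \<le> cmod (f2 x) * C"
          unfolding norm_mult using norm_triangle_ineq4[of 1 "\<eta> (x / t n)"] C0(2)[of "x / t n"] C(2)
          by (intro mult_left_mono) auto
        have "cmod (of_real (1 / (t n)\<^sup>2) * \<eta>2 (x / t n)) \<le> 1 * C2"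
          unfolding norm_mult norm_of_real using t_inv(2)[of n] C2 by (intro mult_mono) auto
        then show "cmod (f0 x * (of_real (1 / (t n)\<^sup>2) * \<eta>2 (x / t n))) \<le> cmod (f0 x) * C"
          unfolding norm_mult[of "f0 x"] using C(4) by (intro mult_left_mono) auto
        have "cmod (of_real (1 / t n) * \<eta>1 (x / t n)) \<le> 1 * C1"
          unfolding norm_mult norm_of_real using t_inv(1,3)[of n] C1 by (intro mult_mono) auto
        then have "cmod (f1 x) * (2 * cmod (of_real (1 / t n) * \<eta>1 (x / t n))) \<le> cmod (f1 x) * C"
          using C(3) by (intro mult_left_mono) auto
        then show "cmod (2 * f1 x * (of_real (1 / t n) * \<eta>1 (x / t n))) \<le> cmod (f1 x) * C"
          by (simp only: norm_mult norm_numeral mult_ac)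
      qed
      also have "\<dots> = C * (cmod (f0 x) + cmod (f1 x) + cmod (f2 x))" by (simp add: algebra_simps)
      finally have "(cmod (f2 x - g2 n x))\<^sup>2 \<le> (C * (cmod (f0 x) + cmod (f1 x) + cmod (f2 x)))\<^sup>2"
        by (rule power_mono) simp
      also have "\<dots> \<le> W x" unfolding W_def by (rule sq3)
      finally show ?thesis .
    qed
    show "(\<lambda>n. f2 x - g2 n x) \<longlonglongrightarrow> 0" for x
    proof -
      have "(\<lambda>n. f2 x - (f0 x * (of_real (1 / t n) * of_real (1 / t n) * \<eta>2 (x / t n)) + 2 * f1 x * (of_real (1 / t n) * \<eta>1 (x / t n)) + f2 x * \<eta> (x / t n)))
         \<longlonglongrightarrow> f2 x - (f0 x * (of_real 0 * of_real 0 * \<eta>2 0) + 2 * f1 x * (of_real 0 * \<eta>1 0) + f2 x * \<eta> 0)"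
        by (intro tendsto_diff tendsto_add tendsto_mult tendsto_const tendsto_of_real t_lim \<eta>_lim c)
      then show ?thesis by (simp add: g2_def \<eta>(2) power2_eq_square)
    qed
  qed
  have lapd: "lap (F - abs_L2 (g0 n)) (abs_L2 f2 - abs_L2 (g2 n))" for n by (rule lap_diff[OF f0(8) lap_g])
  have le: "(norm (fmult (sobw r) (F - abs_L2 (g0 n))))\<^sup>2 \<le> 2 * ((norm (F - abs_L2 (g0 n)))\<^sup>2 + (norm (abs_L2 f2 - abs_L2 (g2 n)))\<^sup>2)" for n
    using lap_sobolev(2)[OF lapd[of n] r, of 1] by simp
  have "(\<lambda>n. 2 * ((norm (F - abs_L2 (g0 n)))\<^sup>2 + (norm (abs_L2 f2 - abs_L2 (g2 n)))\<^sup>2)) \<longlonglongrightarrow> 2 * (0 + 0)"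
    by (intro tendsto_mult tendsto_add tendsto_const 1 2)
  then have "\<forall>\<^sub>F n in sequentially. 2 * ((norm (F - abs_L2 (g0 n)))\<^sup>2 + (norm (abs_L2 f2 - abs_L2 (g2 n)))\<^sup>2) < \<delta>\<^sup>2"
    using d by (intro order_tendstoD(2)) auto
  then obtain n where n: "2 * ((norm (F - abs_L2 (g0 n)))\<^sup>2 + (norm (abs_L2 f2 - abs_L2 (g2 n)))\<^sup>2) < \<delta>\<^sup>2"
    by (auto simp: eventually_sequentially)
  have "norm (fmult (sobw r) (F - abs_L2 (g0 n))) < \<delta>"
    by (rule power2_less_imp_less) (use le[of n] n d in auto)
  moreover have "F - abs_L2 (g0 n) \<in> sobolev r" using lap_sobolev(1)[OF lapd r, of 1] by simp
  moreover have "g0 n 0 = ev0 F" by (simp add: g0_def \<eta>(2) f0(9))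
  ultimately show ?thesis using g_smooth[of n] g_supp[of n] by blast
qed

section \<open>Cut-off at the origin\<close>

lemma powr_small:
  fixes K \<alpha> \<delta> :: real
  assumes "\<alpha> > 0" "K \<ge> 0" "\<delta> > 0"
  shows "\<exists>e. 0 < e \<and> e \<le> 1 \<and> K * e powr \<alpha> < \<delta>"
proof -
  define e where "e = min 1 ((\<delta> / (K + 1)) powr (1 / \<alpha>))"
  have pos: "\<delta> / (K + 1) > 0" using assms by simp
  then have e: "0 < e" "e \<le> 1" by (auto simp: e_def)
  have "e powr \<alpha> \<le> ((\<delta> / (K + 1)) powr (1 / \<alpha>)) powr \<alpha>"
    using e assms by (intro powr_mono2) (auto simp: e_def)
  also have "\<dots> = \<delta> / (K + 1)" using pos assms by (simp add: powr_powr)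
  finally have "K * e powr \<alpha> \<le> K * (\<delta> / (K + 1))" using assms by (intro mult_left_mono)
  also have "\<dots> < \<delta>" using assms by (simp add: field_simps)
  finally show ?thesis using e by blast
qed

lemma norm_le_derivative_bound:
  fixes f :: "real \<Rightarrow> complex"
  assumes "\<And>x. (f has_vector_derivative f' x) (at x)" "\<And>x. cmod (f' x) \<le> C" "f 0 = 0"
  shows "cmod (f x) \<le> C * \<bar>x\<bar>"
proof -
  have C: "C \<ge> 0" using assms(2)[of 0] norm_ge_zero[of "f' 0"] by linarith
  have "norm (f x - f 0) \<le> C * norm (x - 0)"
  proof (rule differentiable_bound[of UNIV f "\<lambda>x h. h *\<^sub>R f' x"])
    show "(f has_derivative (\<lambda>h. h *\<^sub>R f' x)) (at x within UNIV)" for x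
      using assms(1)[of x] by (simp add: has_vector_derivative_def)
    show "onorm (\<lambda>h. h *\<^sub>R f' x) \<le> C" for x
    proof (rule onorm_bound[OF C])
      show "norm (h *\<^sub>R f' x) \<le> C * norm h" for h
        using mult_right_mono[OF assms(2)[of x], of "\<bar>h\<bar>"] by (simp add: mult.commute)
    qed
  qed auto
  then show ?thesis by (simp add: assms(3))
qed

text \<open>Cutting off a neighbourhood of the origin of size \<open>e\<close> costs \<open>e powr (1 + 2 * a - 2 * r)\<close> in the
  square of the \<open>H\<^sup>r\<close> norm, where \<open>a\<close> is the order of vanishing at the origin.\<close>

lemma cutoff_at_origin:
  assumes f: "smooth f" "\<And>x. \<bar>x\<bar> > M \<Longrightarrow> f x = 0" and r: "0 \<le> r" "r < 1/2 \<or> r < 3/2 \<and> f 0 = 0" and d: "\<delta> > 0"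
  shows "\<exists>g\<in>test_functions_off_0. abs_L2 f - g \<in> sobolev r \<and> norm (fmult (sobw r) (abs_L2 f - g)) < \<delta>"
proof -
  obtain f1 where f1: "smooth f1" "\<And>x. (f has_vector_derivative f1 x) (at x)" using smooth_derivative[OF f(1)] by blast
  obtain f2 where f2: "smooth f2" "\<And>x. (f1 has_vector_derivative f2 x) (at x)" using smooth_derivative[OF f1(1)] by blast
  have f1s: "f1 x = 0" if "\<bar>x\<bar> > M" for x by (rule derivative_zero_off_support[OF f1(2) f(2) that])
  have f2s: "f2 x = 0" if "\<bar>x\<bar> > M" for x by (rule derivative_zero_off_support[OF f2(2) f1s that])
  obtain \<eta> :: "real \<Rightarrow> complex" where \<eta>: "smooth \<eta>" "\<And>x. \<bar>x\<bar> \<le> 1 \<Longrightarrow> \<eta> x = 1" "\<And>x. \<bar>x\<bar> \<ge> 2 \<Longrightarrow> \<eta> x = 0"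
    using smooth_cutoff_exists by blast
  obtain \<eta>1 where \<eta>1: "smooth \<eta>1" "\<And>x. (\<eta> has_vector_derivative \<eta>1 x) (at x)" using smooth_derivative[OF \<eta>(1)] by blast
  obtain \<eta>2 where \<eta>2: "smooth \<eta>2" "\<And>x. (\<eta>1 has_vector_derivative \<eta>2 x) (at x)" using smooth_derivative[OF \<eta>1(1)] by blast
  have s0: "\<eta> x = 0" if "\<bar>x\<bar> > 2" for x using \<eta>(3)[of x] that by simp
  have s1: "\<eta>1 x = 0" if "\<bar>x\<bar> > 2" for x by (rule derivative_zero_off_support[OF \<eta>1(2) s0 that])
  have s2: "\<eta>2 x = 0" if "\<bar>x\<bar> > 2" for x by (rule derivative_zero_off_support[OF \<eta>2(2) s1 that])
  obtain C0 where C0: "C0 \<ge> 0" "\<And>x. cmod (\<eta> x) \<le> C0" using compact_support_bounded[OF smooth_continuous[OF \<eta>(1)], of 2] s0 by blast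
  obtain C1 where C1: "C1 \<ge> 0" "\<And>x. cmod (\<eta>1 x) \<le> C1" using compact_support_bounded[OF smooth_continuous[OF \<eta>1(1)], of 2] s1 by blast
  obtain C2 where C2: "C2 \<ge> 0" "\<And>x. cmod (\<eta>2 x) \<le> C2" using compact_support_bounded[OF smooth_continuous[OF \<eta>2(1)], of 2] s2 by blast
  obtain D0 where D0: "D0 \<ge> 0" "\<And>x. cmod (f x) \<le> D0" using compact_support_bounded[OF smooth_continuous[OF f(1)], of M] f(2) by blast
  obtain D1 where D1: "D1 \<ge> 0" "\<And>x. cmod (f1 x) \<le> D1" using compact_support_bounded[OF smooth_continuous[OF f1(1)], of M] f1s by blast
  obtain D2 where D2: "D2 \<ge> 0" "\<And>x. cmod (f2 x) \<le> D2" using compact_support_bounded[OF smooth_continuous[OF f2(1)], of M] f2s by blast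
  define C where "C = C0 + C1 + C2 + D0 + D1 + D2"
  have C: "0 \<le> C" "\<And>x. cmod (\<eta> x) \<le> C" "\<And>x. cmod (\<eta>1 x) \<le> C" "\<And>x. cmod (\<eta>2 x) \<le> C"
    "\<And>x. cmod (f1 x) \<le> C" "\<And>x. cmod (f2 x) \<le> C" "D0 \<le> C"
  proof -
    have ge: "0 \<le> C" "C0 \<le> C" "C1 \<le> C" "C2 \<le> C" "D0 \<le> C" "D1 \<le> C" "D2 \<le> C"
      using C0(1) C1(1) C2(1) D0(1) D1(1) D2(1) by (simp_all add: C_def)
    show "0 \<le> C" "D0 \<le> C" by (fact ge)+
    show "cmod (\<eta> x) \<le> C" "cmod (\<eta>1 x) \<le> C" "cmod (\<eta>2 x) \<le> C" "cmod (f1 x) \<le> C" "cmod (f2 x) \<le> C" for x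
      using order_trans[OF C0(2) ge(2)] order_trans[OF C1(2) ge(3)] order_trans[OF C2(2) ge(4)]
        order_trans[OF D1(2) ge(6)] order_trans[OF D2(2) ge(7)] by blast+
  qed
  define a :: nat where "a = (if f 0 = 0 then 1 else 0)"
  have ar: "0 < 1 + 2 * real a - 2 * r" using r(2) by (auto simp: a_def)
  \<comment> \<open>On the support of the rescaled cut-off f is of size e if it vanishes at the
    origin, by the mean value inequality, and merely bounded otherwise; a records which case
    holds.\<close>
  have f_small: "cmod (f x) \<le> 2 * C * e ^ a" if "\<bar>x\<bar> \<le> 2 * e" for x e
  proof (cases "f 0 = 0")
    case True
    have "cmod (f x) \<le> C * \<bar>x\<bar>" by (rule norm_le_derivative_bound[OF f1(2) C(5) True])
    also have "\<dots> \<le> C * (2 * e)" by (intro mult_left_mono that C(1))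
    finally show ?thesis using True by (simp add: a_def mult_ac)
  next
    case False
    have "cmod (f x) \<le> C" by (rule order_trans[OF D0(2) C(7)])
    then show ?thesis using False C(1) by (simp add: a_def)
  qed
  \<comment> \<open>The constant is 2 (16 + 100): the factor 2 of \<open>lap_sobolev\<close>, and 4
    times the squares of the sup bounds 2 and 5 for \<open>h\<close> and \<open>h2\<close>, the 4
    coming from the length 4e of the support.\<close>
  obtain e where e: "0 < e" "e \<le> 1" and small: "232 * C ^ 4 * e powr (1 + 2 * real a - 2 * r) < \<delta>\<^sup>2"
    using powr_small[OF ar, of "232 * C ^ 4" "\<delta>\<^sup>2"] C(1) d by auto
  define h where "h x = f x * \<eta> (x / e)" for x
  define h2 where "h2 x = f x * (of_real (1 / e\<^sup>2) * \<eta>2 (x / e)) + 2 * f1 x * (of_real (1 / e) * \<eta>1 (x / e)) + f2 x * \<eta> (x / e)" for x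
  have e0: "e \<noteq> 0" using e by simp
  note der = cutoff_product_derivatives[OF f1(2) f2(2) \<eta>1(2) \<eta>2(2) e0]
  have h_smooth: "smooth h"
    using smooth_mult[OF f(1) smooth_affine[OF \<eta>(1), of "1 / e" 0]] by (simp add: h_def[abs_def])
  have off: "\<bar>x / e\<bar> > 2" if "\<bar>x\<bar> > 2 * e" for x using that e by (simp add: field_simps abs_divide)
  have cont_sc: "continuous_on UNIV (\<lambda>x. g (x / e))" if "continuous_on UNIV g" for g :: "real \<Rightarrow> complex"
    by (rule continuous_on_compose2[OF that]) (use e0 in \<open>auto intro!: continuous_intros\<close>)
  have h2_cont: "continuous_on UNIV h2"
    unfolding h2_def by (intro continuous_intros cont_sc smooth_continuous f f1 f2 \<eta> \<eta>1 \<eta>2)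
  have h_supp: "h x = 0" "h2 x = 0" if "\<bar>x\<bar> > 2 * e" for x
    using off[OF that] by (simp_all add: h_def h2_def s0 s1 s2)
  have lap_h: "lap (abs_L2 h) (abs_L2 h2)"
  proof (rule lap_compact_support[OF _ _ h2_cont])
    show "(h has_vector_derivative (f x * (of_real (1 / e) * \<eta>1 (x / e)) + f1 x * \<eta> (x / e))) (at x)" for x
      unfolding h_def[abs_def] by (rule der(1))
    show "((\<lambda>x. f x * (of_real (1 / e) * \<eta>1 (x / e)) + f1 x * \<eta> (x / e)) has_vector_derivative h2 x) (at x)" for x
      unfolding h2_def by (rule der(2))
  qed (rule h_supp(1))
  have hm: "h \<in> borel_measurable borel" "h2 \<in> borel_measurable borel"
    by (intro borel_measurable_continuous_onI smooth_continuous h_smooth h2_cont)+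
  \<comment> \<open>As e and a are at most 1, the term in which both derivatives fall on the cut-off
    dominates the other two.\<close>
  have ea: "1 \<le> e ^ a / e\<^sup>2" "1 / e \<le> e ^ a / e\<^sup>2" "0 \<le> e ^ a"
    using e by (auto simp: a_def power2_eq_square field_simps mult_le_one)
  have hb: "cmod (h x) \<le> (2 * C\<^sup>2 * e ^ a) * indicator {-(2 * e)..2 * e} x" for x
  proof (cases "\<bar>x\<bar> > 2 * e")
    case False
    have "cmod (h x) \<le> (2 * C * e ^ a) * C"
      unfolding h_def norm_mult using False C(1) ea(3) by (intro mult_mono f_small C(2)) auto
    moreover have "indicator {-(2 * e)..2 * e} x = (1::real)" using False by (auto simp: indicator_def)
    ultimately show ?thesis by (simp add: power2_eq_square mult_ac)
  next
    case True
    show ?thesis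
      unfolding h_supp(1)[OF True] norm_zero by (intro mult_nonneg_nonneg ea(3)) (auto simp: indicator_def)
  qed
  have h2b: "cmod (h2 x) \<le> (5 * C\<^sup>2 * (e ^ a / e\<^sup>2)) * indicator {-(2 * e)..2 * e} x" for x
  proof (cases "\<bar>x\<bar> > 2 * e")
    case False
    have "cmod (h2 x) \<le> cmod (f x * (of_real (1 / e\<^sup>2) * \<eta>2 (x / e))) + cmod (2 * f1 x * (of_real (1 / e) * \<eta>1 (x / e))) + cmod (f2 x * \<eta> (x / e))"
      unfolding h2_def by (rule order_trans[OF norm_triangle_ineq add_right_mono[OF norm_triangle_ineq]])
    also have "\<dots> \<le> (2 * C * e ^ a) * ((1 / e\<^sup>2) * C) + (2 * C) * ((1 / e) * C) + C * C"
      unfolding norm_mult norm_of_real norm_numeral using False C e ea(3)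
      by (intro add_mono mult_mono f_small) auto
    also have "\<dots> = C\<^sup>2 * (2 * (e ^ a / e\<^sup>2) + 2 * (1 / e) + 1)"
      by (simp add: power2_eq_square algebra_simps)
    also have "\<dots> \<le> C\<^sup>2 * (2 * (e ^ a / e\<^sup>2) + 2 * (e ^ a / e\<^sup>2) + e ^ a / e\<^sup>2)"
      using ea by (intro mult_left_mono add_mono) auto
    finally have "cmod (h2 x) \<le> 5 * C\<^sup>2 * (e ^ a / e\<^sup>2)" by (simp add: algebra_simps)
    moreover have "indicator {-(2 * e)..2 * e} x = (1::real)" using False by (auto simp: indicator_def)
    ultimately show ?thesis by (simp only: mult_1_right)
  next
    case True
    show ?thesis
      unfolding h_supp(2)[OF True] norm_zero by (intro mult_nonneg_nonneg divide_nonneg_nonneg ea(3)) (auto simp: indicator_def)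
  qed
  have hsi: "square_integrable h" "square_integrable h2"
    by (rule square_integrable_bounded_support[OF hm(1) hb] square_integrable_bounded_support[OF hm(2) h2b])+
  have n1: "(norm (abs_L2 h))\<^sup>2 \<le> (2 * C\<^sup>2 * e ^ a)\<^sup>2 * (2 * (2 * e))"
    unfolding norm_represents[OF represents_abs[OF hsi(1)]]
    by (rule integral_bounded_support[OF hm(1) hb]) (use e in simp)
  have n2: "(norm (abs_L2 h2))\<^sup>2 \<le> (5 * C\<^sup>2 * (e ^ a / e\<^sup>2))\<^sup>2 * (2 * (2 * e))"
    unfolding norm_represents[OF represents_abs[OF hsi(2)]]
    by (rule integral_bounded_support[OF hm(2) h2b]) (use e in simp)
  have r2: "r \<le> 2" using r(2) by auto
  have "(norm (fmult (sobw r) (abs_L2 h)))\<^sup>2 \<le> 2 * e powr (- 2 * r) * ((norm (abs_L2 h))\<^sup>2 + e ^ 4 * (norm (abs_L2 h2))\<^sup>2)"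
    by (rule lap_sobolev(2)[OF lap_h r(1) r2 e])
  also have "\<dots> \<le> 2 * e powr (- 2 * r) * ((2 * C\<^sup>2 * e ^ a)\<^sup>2 * (2 * (2 * e)) + e ^ 4 * ((5 * C\<^sup>2 * (e ^ a / e\<^sup>2))\<^sup>2 * (2 * (2 * e))))"
    using e by (intro mult_left_mono add_mono n1 n2) auto
  also have "\<dots> = 232 * C ^ 4 * (e powr (- 2 * r) * (e * (e ^ a)\<^sup>2))"
    using e by (simp add: power_mult_distrib power_divide power2_eq_square power4_eq_xxxx field_simps)
  also have "e powr (- 2 * r) * (e * (e ^ a)\<^sup>2) = e powr (1 + 2 * real a - 2 * r)"
  proof -
    have "(e ^ a)\<^sup>2 = e powr (2 * real a)"
      using e by (simp add: powr_realpow[symmetric] power2_eq_square flip: powr_add)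
    then have "e powr (- 2 * r) * (e * (e ^ a)\<^sup>2) = e powr (- 2 * r) * (e powr 1 * e powr (2 * real a))" using e by simp
    also have "\<dots> = e powr (1 + 2 * real a - 2 * r)" by (simp only: powr_add[symmetric]) (simp add: algebra_simps)
    finally show ?thesis .
  qed
  also note small
  finally have nh: "norm (fmult (sobw r) (abs_L2 h)) < \<delta>"
    by (rule power2_less_imp_less) (use d in simp)
  \<comment> \<open>f times 1 - \<eta>(x/e), which vanishes for |x| at most e; the error of the
    approximation is exactly h.\<close>
  define g where "g x = f x + (-1) * h x" for x
  have g_smooth: "smooth g" unfolding g_def by (intro smooth_add smooth_mult smooth_const f h_smooth)
  define N where "N = max \<bar>M\<bar> (2 * e)"
  have g_supp: "{x. g x \<noteq> 0} \<subseteq> {-N..N} \<inter> {x. e \<le> \<bar>x\<bar>}"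
  proof
    fix x assume "x \<in> {x. g x \<noteq> 0}"
    then have gx: "g x \<noteq> 0" by simp
    have "\<not> \<bar>x\<bar> > N"
    proof
      assume "\<bar>x\<bar> > N"
      then have "\<bar>x\<bar> > M" "\<bar>x\<bar> > 2 * e" by (auto simp: N_def)
      then have "g x = 0" using f(2) h_supp(1) by (simp add: g_def)
      with gx show False by simp
    qed
    moreover have "\<not> \<bar>x\<bar> < e"
    proof
      assume "\<bar>x\<bar> < e"
      then have "\<bar>x / e\<bar> \<le> 1" using e by (simp add: abs_divide)
      then have "g x = 0" by (simp add: g_def h_def \<eta>(2))
      with gx show False by simp
    qed
    ultimately show "x \<in> {-N..N} \<inter> {x. e \<le> \<bar>x\<bar>}" by (auto simp: abs_le_iff)
  qed
  have "closed ({-N..N} \<inter> {x. e \<le> \<bar>x\<bar>})"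
    by (intro closed_Int closed_atLeastAtMost closed_Collect_le continuous_intros)
  then have cl: "closure {x. g x \<noteq> 0} \<subseteq> {-N..N} \<inter> {x. e \<le> \<bar>x\<bar>}" by (rule closure_minimal[OF g_supp])
  have comp: "compact (closure {x. g x \<noteq> 0})"
    using cl by (intro compact_eq_bounded_closed[THEN iffD2] conjI closed_closure bounded_subset[OF bounded_closed_interval[of "-N" N]]) auto
  have "0 \<notin> closure {x. g x \<noteq> 0}" using cl e by force
  have g_si: "square_integrable g"
    using g_supp by (intro square_integrable_compact_support[of _ N] smooth_continuous[OF g_smooth]) (force simp: abs_le_iff)
  have "abs_L2 g \<in> test_functions_off_0"
    unfolding test_functions_off_0_def using g_smooth comp \<open>0 \<notin> _\<close> represents_abs[OF g_si] by blast
  moreover have "abs_L2 f - abs_L2 g = abs_L2 h"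
  proof (rule represents_eqI[OF represents_diff[OF represents_abs represents_abs[OF g_si]] represents_abs[OF hsi(1)]])
    show "square_integrable f" by (rule square_integrable_compact_support[OF smooth_continuous[OF f(1)] f(2)])
  qed (simp add: g_def)
  ultimately show ?thesis using nh lap_sobolev(1)[OF lap_h r(1) r2 e] by (intro bexI[of _ "abs_L2 g"]) auto
qed

lemma test_function_properties:
  assumes "g \<in> test_functions_off_0"
  shows "0 \<le> r \<Longrightarrow> r \<le> 2 \<Longrightarrow> g \<in> sobolev r" "ev0 g = 0"
proof -
  obtain \<phi> where \<phi>: "smooth \<phi>" "compact (closure {x. \<phi> x \<noteq> 0})" "0 \<notin> closure {x. \<phi> x \<noteq> 0}" "represents \<phi> g"
    using assms by (auto simp: test_functions_off_0_def)
  obtain \<phi>1 where \<phi>1: "smooth \<phi>1" "\<And>x. (\<phi> has_vector_derivative \<phi>1 x) (at x)" using smooth_derivative[OF \<phi>(1)] by blast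
  obtain \<phi>2 where \<phi>2: "smooth \<phi>2" "\<And>x. (\<phi>1 has_vector_derivative \<phi>2 x) (at x)" using smooth_derivative[OF \<phi>1(1)] by blast
  obtain M where M: "\<And>x. x \<in> closure {x. \<phi> x \<noteq> 0} \<Longrightarrow> \<bar>x\<bar> \<le> M"
    using compact_imp_bounded[OF \<phi>(2)] unfolding bounded_iff by auto
  have supp: "\<phi> x = 0" if "\<bar>x\<bar> > M" for x
    using M[of x] that closure_subset[of "{x. \<phi> x \<noteq> 0}"] by force
  have lap: "lap (abs_L2 \<phi>) (abs_L2 \<phi>2)"
    by (rule lap_compact_support[OF \<phi>1(2) \<phi>2(2) smooth_continuous[OF \<phi>2(1)] supp])
  have g: "g = abs_L2 \<phi>" using \<phi>(4) by (simp add: represents_def)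
  show sob: "g \<in> sobolev r" if "0 \<le> r" "r \<le> 2" for r using lap_sobolev(1)[OF lap that, of 1] g by simp
  have "\<phi> 0 = 0" using \<phi>(3) closure_subset[of "{x. \<phi> x \<noteq> 0}"] by auto
  then show "ev0 g = 0"
    using represents_value_0[OF integrable_fhat_sobolev[of 1] smooth_continuous[OF \<phi>(1)] \<phi>(4)] sob[of 1] by simp
qed

section \<open>Approximating Sobolev functions by test functions off the origin\<close>

lemma bandlimited_cut: "bandlimited (fmult (cut N) F)"
  unfolding bandlimited_def
  by (intro exI[of _ "\<lambda>p. of_real (cut N p) * fhat F p"] exI[of _ "real N"] conjI fhat_fmult_represents cut_dom)
     (auto simp: indicator_def)

lemma bandlimited_diff:
  assumes "bandlimited F" "bandlimited G" shows "bandlimited (F - c *\<^sub>C G)"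
proof -
  obtain \<phi> N \<psi> M where "represents \<phi> (fourier F)" "\<And>p. \<bar>p\<bar> > N \<Longrightarrow> \<phi> p = 0" "represents \<psi> (fourier G)" "\<And>p. \<bar>p\<bar> > M \<Longrightarrow> \<psi> p = 0"
    using assms unfolding bandlimited_def by blast
  then show ?thesis
    unfolding bandlimited_def fourier_diff fourier_scaleC
    by (intro exI[of _ "\<lambda>p. \<phi> p - c * \<psi> p"] exI[of _ "max N M"] conjI represents_diff represents_scaleC) auto
qed

lemma cut_sobolev:
  assumes "F \<in> sobolev r"
  shows "fmult (cut N) F \<in> sobolev r" "fmult (sobw r) (fmult (cut N) F) = fmult (cut N) (fmult (sobw r) F)"
proof -
  have F: "F \<in> fdom (sobw r)" using assms by (simp add: sobolev_eq)
  have m: "cut N \<in> borel_measurable borel" by measurable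
  have eq: "(\<lambda>p. cut N p * sobw r p) = (\<lambda>p. sobw r p * cut N p)" by (auto simp: mult.commute)
  have "F \<in> fdom (\<lambda>p. cut N p * sobw r p)" using fmult_compose(1)[OF m sobw_measurable F] cut_dom by blast
  then have F': "F \<in> fdom (\<lambda>p. sobw r p * cut N p)" by (simp only: eq)
  show "fmult (cut N) F \<in> sobolev r"
    unfolding sobolev_eq using fmult_compose(1)[OF sobw_measurable m cut_dom] F' by blast
  show "fmult (sobw r) (fmult (cut N) F) = fmult (cut N) (fmult (sobw r) F)"
    using fmult_compose(2)[OF sobw_measurable m cut_dom F'] fmult_compose(2)[OF m sobw_measurable F] F'
    by (simp add: eq)
qed

text \<open>Frequency truncation converges in H^r but does not preserve a zero at the origin. For r
  > 1/2 a multiple of a fixed band-limited function restores the zero; its coefficient tends to 0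
  because evaluation is continuous.\<close>

lemma bandlimited_dense:
  assumes F: "F \<in> sobolev r" and r: "r \<ge> 0" and d: "\<delta> > 0"
  shows "\<exists>F1. bandlimited F1 \<and> F1 \<in> sobolev r \<and> norm (fmult (sobw r) (F - F1)) < \<delta> \<and> (r > 1/2 \<longrightarrow> ev0 F = 0 \<longrightarrow> ev0 F1 = 0)"
proof -
  note sub = csubspace_fdom[OF sobw_measurable, of r]
  have lim: "(\<lambda>N. fmult (sobw r) (fmult (cut N) F)) \<longlonglongrightarrow> fmult (sobw r) F"
    unfolding cut_sobolev(2)[OF F] by (rule cut_tendsto)
  have approx: "\<exists>N. norm (fmult (sobw r) (F - U N)) < \<delta>"
    if U: "\<And>N. U N \<in> sobolev r" "(\<lambda>N. fmult (sobw r) (U N)) \<longlonglongrightarrow> fmult (sobw r) F" for U :: "nat \<Rightarrow> L2"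
  proof -
    obtain N where "dist (fmult (sobw r) (U N)) (fmult (sobw r) F) < \<delta>"
      using metric_LIMSEQ_D[OF U(2) d] by blast
    then show ?thesis
      using fmult_diff[OF sobw_measurable, of F r "U N"] F U(1)[of N]
      by (intro exI[of _ N]) (simp add: sobolev_eq dist_norm norm_minus_commute)
  qed
  show ?thesis
  proof (cases "r > 1/2 \<and> ev0 F = 0")
    case False
    then show ?thesis
      using approx[OF cut_sobolev(1)[OF F] lim] bandlimited_cut[of _ F] cut_sobolev(1)[OF F] by blast
  next
    case True
    \<comment> \<open>The transform of the correcting function is the indicator of the interval from
      -1 to 1; its integral 2 makes the value at the origin nonzero.\<close>
    define \<iota> :: "real \<Rightarrow> complex" where "\<iota> p = of_real (cut 1 p)" for p
    have \<iota>m: "\<iota> \<in> borel_measurable borel" unfolding \<iota>_def by measurable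
    have si: "square_integrable \<iota>"
      by (rule square_integrable_bounded_support[OF \<iota>m, of 1 1]) (auto simp: \<iota>_def indicator_def)
    define E where "E = inv fourier (abs_L2 \<iota>)"
    have E: "represents \<iota> (fourier E)" by (simp add: E_def represents_abs si)
    have "bandlimited E" unfolding bandlimited_def
      by (intro exI[of _ \<iota>] exI[of _ 1] conjI E) (auto simp: \<iota>_def indicator_def)
    have E_sob: "E \<in> sobolev r"
      unfolding sobolev_eq fdom_iff[OF sobw_measurable E]
    proof (rule square_integrable_bounded_support[where C="sobw r 1" and M=1])
      show "(\<lambda>p. complex_of_real (sobw r p) * \<iota> p) \<in> borel_measurable borel"
        using \<iota>m by measurable
      show "cmod (of_real (sobw r p) * \<iota> p) \<le> sobw r 1 * indicator {- 1..1} p" for p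
      proof (cases "p \<in> {-1..1}")
        case True
        then have "p\<^sup>2 \<le> 1" by (simp add: abs_square_le_1 abs_le_iff)
        then have "sobw r p \<le> sobw r 1" unfolding sobw_def using r by (intro powr_mono2) auto
        then show ?thesis using True by (simp add: \<iota>_def less_imp_le norm_mult abs_of_pos)
      qed (simp add: \<iota>_def)
    qed
    have ev0E: "ev0 E \<noteq> 0"
    proof -
      have "(LINT p|lborel. \<iota> p) = of_real (LINT p|lborel. cut 1 p)"
        unfolding \<iota>_def by (rule integral_complex_of_real)
      also have "(LINT p|lborel. cut 1 p) = 2" by simp
      finally show ?thesis unfolding ev0_represents[OF E] using two_pi_powr(2) by simp
    qed
    define c where "c N = ev0 (fmult (cut N) F) / ev0 E" for N
    define U where "U N = fmult (cut N) F - c N *\<^sub>C E" for N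
    have evN: "ev0 (fmult (cut N) F) = cinner (evrep (sobw r)) (fmult (sobw r) (fmult (cut N) F))" for N
      using ev0_sobolev cut_sobolev(1)[OF F] True by blast
    have "(\<lambda>N. ev0 (fmult (cut N) F)) \<longlonglongrightarrow> cinner (evrep (sobw r)) (fmult (sobw r) F)"
      unfolding evN by (intro tendsto_cinner tendsto_const lim)
    then have "(\<lambda>N. ev0 (fmult (cut N) F)) \<longlonglongrightarrow> 0" using ev0_sobolev[of r F] F True by simp
    then have c_lim: "c \<longlonglongrightarrow> 0 / ev0 E" unfolding c_def by (intro tendsto_divide tendsto_const ev0E)
    have cE: "c N *\<^sub>C E \<in> sobolev r" for N using E_sob unfolding sobolev_eq by (rule fdom_scaleC[OF sobw_measurable])
    have U_sob: "U N \<in> sobolev r" for N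
      unfolding U_def using csubspace_diff[OF sub] cut_sobolev(1)[OF F] cE unfolding sobolev_eq by blast
    have "fmult (sobw r) (U N) = fmult (sobw r) (fmult (cut N) F) - c N *\<^sub>C fmult (sobw r) E" for N
      unfolding U_def using fmult_diff[OF sobw_measurable] cut_sobolev(1)[OF F] cE fmult_scaleC[OF sobw_measurable] E_sob
      by (simp add: sobolev_eq)
    moreover have "(\<lambda>N. fmult (sobw r) (fmult (cut N) F) - c N *\<^sub>C fmult (sobw r) E) \<longlonglongrightarrow> fmult (sobw r) F - (0 / ev0 E) *\<^sub>C fmult (sobw r) E"
      by (intro tendsto_diff lim tendsto_scaleC c_lim tendsto_const)
    ultimately have "(\<lambda>N. fmult (sobw r) (U N)) \<longlonglongrightarrow> fmult (sobw r) F" by simp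
    from approx[OF U_sob this] obtain N where N: "norm (fmult (sobw r) (F - U N)) < \<delta>" by blast
    have int: "integrable lborel (fhat G)" if "G \<in> sobolev r" for G
      using integrable_fhat_sobolev[of r G] True that by blast
    have "ev0 (U N) = ev0 (fmult (cut N) F) + ev0 ((- c N) *\<^sub>C E)"
      unfolding U_def using ev0_add[OF int[OF cut_sobolev(1)[OF F]] int, of "(- c N) *\<^sub>C E" N]
        fdom_scaleC[OF sobw_measurable E_sob[unfolded sobolev_eq], of "- c N"] by (simp add: sobolev_eq)
    also have "\<dots> = 0" unfolding ev0_scaleC c_def using ev0E by simp
    finally have "ev0 (U N) = 0" .
    moreover have "bandlimited (U N)" unfolding U_def by (intro bandlimited_diff bandlimited_cut \<open>bandlimited E\<close>)
    ultimately show ?thesis using N U_sob by blast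
  qed
qed

text \<open>Three errors of at most a third each: band limitation, cut-off at infinity and cut-off
  at the origin. For r > 1/2 each of the first two steps keeps the value 0 at the origin, which the
  third one requires.\<close>

theorem test_functions_dense:
  assumes F: "F \<in> sobolev r" and r: "0 \<le> r" "r < 1/2 \<or> 1/2 < r \<and> r < 3/2 \<and> ev0 F = 0" and d: "\<delta> > 0"
  shows "\<exists>g\<in>test_functions_off_0. norm (fmult (sobw r) (F - g)) < \<delta>"
proof -
  note m = sobw_measurable
  obtain F1 where F1: "bandlimited F1" "F1 \<in> sobolev r" "norm (fmult (sobw r) (F - F1)) < \<delta> / 3"
    "r > 1/2 \<longrightarrow> ev0 F = 0 \<longrightarrow> ev0 F1 = 0"
    using bandlimited_dense[OF F r(1), of "\<delta> / 3"] d by auto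
  have r2: "r \<le> 2" using r by auto
  obtain f M where f: "smooth f" "\<And>x. \<bar>x\<bar> > M \<Longrightarrow> f x = 0" "f 0 = ev0 F1" "F1 - abs_L2 f \<in> sobolev r"
    "norm (fmult (sobw r) (F1 - abs_L2 f)) < \<delta> / 3"
    using bandlimited_approx[OF F1(1) r(1) r2, of "\<delta> / 3"] d by auto
  have "r < 1/2 \<or> r < 3/2 \<and> f 0 = 0" using r(2) F1(4) f(3) by auto
  then have "\<exists>g\<in>test_functions_off_0. abs_L2 f - g \<in> sobolev r \<and> norm (fmult (sobw r) (abs_L2 f - g)) < \<delta> / 3"
    using d by (intro cutoff_at_origin[of f M] f(1,2) r(1)) auto
  then obtain g where g: "g \<in> test_functions_off_0" "abs_L2 f - g \<in> sobolev r" "norm (fmult (sobw r) (abs_L2 f - g)) < \<delta> / 3"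
    by blast
  have d1: "F - F1 \<in> fdom (sobw r)" using fdom_diff[OF m] F F1(2) by (simp add: sobolev_eq)
  have d2: "F1 - abs_L2 f \<in> fdom (sobw r)" "abs_L2 f - g \<in> fdom (sobw r)" using f(4) g(2) by (simp_all add: sobolev_eq)
  have "F - g = (F - F1) + ((F1 - abs_L2 f) + (abs_L2 f - g))" by simp
  then have "fmult (sobw r) (F - g) = fmult (sobw r) (F - F1) + (fmult (sobw r) (F1 - abs_L2 f) + fmult (sobw r) (abs_L2 f - g))"
    using fmult_add[OF m d1 fdom_add[OF m d2]] fmult_add[OF m d2] by (simp only:)
  then have "norm (fmult (sobw r) (F - g)) \<le> norm (fmult (sobw r) (F - F1)) + (norm (fmult (sobw r) (F1 - abs_L2 f)) + norm (fmult (sobw r) (abs_L2 f - g)))"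
    by (simp only:) (rule order_trans[OF norm_triangle_ineq add_left_mono[OF norm_triangle_ineq]])
  also have "\<dots> < \<delta>" using F1(3) f(5) g(3) by simp
  finally show ?thesis using g(1) by blast
qed

section \<open>Point perturbations of the fractional Laplacian\<close>

text \<open>For s < 1 the angle pi/s lies between pi and 2 pi, so the sine and s - 1 are both
  negative; for s > 1 both are positive.\<close>

lemma omega_pos:
  assumes "s \<in> {1/2<..<1} \<union> {1<..<3/2}" shows "omega s > 0"
proof (cases "s < 1")
  case True
  then have s: "1/2 < s" "s < 1" using assms by auto
  have "pi < pi / s" "pi / s < 2 * pi" using s by (auto simp: field_simps)
  then have "sin (pi / s) < 0" by (rule sin_lt_zero)
  then show ?thesis using s by (simp add: omega_def divide_neg_neg mult_pos_neg)
next
  case False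
  then have s: "1 < s" using assms by auto
  then have "sin (pi / s) > 0" by (intro sin_gt_zero) (auto simp: field_simps)
  then show ?thesis using s by (simp add: omega_def)
qed

lemma op_add_graph: "op_add (op_graph A) (op_graph C) = op_graph (\<lambda>h. A h + C h)"
  by (auto simp: op_add_def op_graph_def)

lemma ereal_cases_above: "{-\<infinity><..} = insert \<infinity> (range ereal)"
proof -
  have "x \<in> {-\<infinity><..} \<longleftrightarrow> x \<in> insert \<infinity> (range ereal)" for x :: ereal by (cases x) auto
  then show ?thesis by blast
qed

section \<open>Symbols of the operator and of its form, and the free resolvent\<close>

locale point_perturbation =
  fixes s l :: real
  assumes s: "s \<in> {1/2<..<1} \<union> {1<..<3/2}" and l: "l > 0"
begin

lemma s_bounds: "1/2 < s" "s < 3/2" "s \<noteq> 1" "0 \<le> s" "0 \<le> s / 2"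
  using s by auto

text \<open>The symbol of the free operator plus l. Its square root V carries the quadratic form,
  and the two weights are equivalent to those of H^s and H^(s/2).\<close>

definition W :: "real \<Rightarrow> real" where "W p = \<bar>p\<bar> powr s + l"
definition V :: "real \<Rightarrow> real" where "V p = sqrt (W p)"
definition c0 :: real where "c0 = (2 * pi) powr (- 1/2)"

lemma W_measurable [measurable]: "W \<in> borel_measurable borel"
  and V_measurable [measurable]: "V \<in> borel_measurable borel"
  unfolding V_def[abs_def] W_def[abs_def] by measurable

lemma c0_pos: "c0 > 0"
  unfolding c0_def by (rule two_pi_powr)

lemma W_ge: "W p \<ge> l" and W_pos: "W p > 0" and W_nz: "W p \<noteq> 0"
proof -
  show "W p \<ge> l" by (simp add: W_def)
  then show "W p > 0" "W p \<noteq> 0" using l by linarith+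
qed

lemma V_pos: "V p > 0" and V_nz: "V p \<noteq> 0" and V_square: "V p * V p = W p" and V_power2: "(V p)\<^sup>2 = W p"
  using W_pos[of p] by (auto simp: V_def)

definition K1 :: real where "K1 = 2 powr s * (1 + 1 / l)"

lemma W_le_sobw: "W p \<le> (1 + l) * sobw s p"
proof -
  have "l * 1 \<le> l * sobw s p" using sobw_ge_1[OF s_bounds(4), of p] l by (intro mult_left_mono) auto
  then show ?thesis using powr_abs_le_sobw[OF s_bounds(4), of p] by (simp add: W_def algebra_simps)
qed

lemma sobw_le_W: "sobw s p \<le> K1 * W p"
proof -
  have "1 + \<bar>p\<bar> powr s \<le> (1 + 1 / l) * W p"
    using l by (simp add: W_def algebra_simps)
  then have "2 powr s * (1 + \<bar>p\<bar> powr s) \<le> 2 powr s * ((1 + 1 / l) * W p)"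
    by (rule mult_left_mono) simp
  with sobw_le_powr_abs[OF s_bounds(4), of p] show ?thesis unfolding K1_def mult.assoc by (rule order_trans)
qed

lemma sobw_half: "(sobw (s / 2) p)\<^sup>2 = sobw s p"
  unfolding sobw_power2 by (simp add: sobw_def)

lemma V_le_sobw: "V p \<le> sqrt (1 + l) * sobw (s / 2) p"
proof -
  have "V p \<le> sqrt ((1 + l) * (sobw (s / 2) p)\<^sup>2)"
    unfolding V_def sobw_half by (rule real_sqrt_le_mono[OF W_le_sobw])
  then show ?thesis by (simp add: real_sqrt_mult less_imp_le)
qed

lemma sobw_le_V: "sobw (s / 2) p \<le> sqrt K1 * V p"
proof -
  have "sqrt ((sobw (s / 2) p)\<^sup>2) \<le> sqrt (K1 * W p)"
    unfolding sobw_half by (rule real_sqrt_le_mono[OF sobw_le_W])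
  then show ?thesis by (simp add: real_sqrt_mult V_def less_imp_le)
qed

lemma sobolev_W: "sobolev s = fdom W"
proof -
  have "fdom (sobw s) \<subseteq> fdom W" "fdom W \<subseteq> fdom (sobw s)"
    using fdom_bounded(1)[of "sobw s" W _ "1 + l"] fdom_bounded(1)[of W "sobw s" _ K1] W_le_sobw sobw_le_W W_pos
    by (auto simp: abs_of_pos)
  then show ?thesis by (auto simp: sobolev_eq)
qed

lemma sobolev_V: "sobolev (s / 2) = fdom V"
proof -
  have "fdom (sobw (s / 2)) \<subseteq> fdom V" "fdom V \<subseteq> fdom (sobw (s / 2))"
    using fdom_bounded(1)[of "sobw (s / 2)" V _ "sqrt (1 + l)"] fdom_bounded(1)[of V "sobw (s / 2)" _ "sqrt K1"]
      V_le_sobw sobw_le_V V_pos by (auto simp: abs_of_pos)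
  then show ?thesis by (auto simp: sobolev_eq)
qed

lemma sobolev_powr: "f \<in> sobolev s \<Longrightarrow> f \<in> fdom (\<lambda>p. \<bar>p\<bar> powr s)"
  unfolding sobolev_W by (rule fdom_bounded(1)[of W _ _ 1]) (use l in \<open>auto simp: W_def\<close>)

lemma powr_sobolev:
  assumes "f \<in> fdom (\<lambda>p. \<bar>p\<bar> powr s)" shows "f \<in> sobolev s" "fmult W f = fmult (\<lambda>p. \<bar>p\<bar> powr s) f + of_real l *\<^sub>C f"
proof -
  have "represents (\<lambda>p. of_real (\<bar>p\<bar> powr s) * fhat f p + of_real l * fhat f p) (fourier (fmult (\<lambda>p. \<bar>p\<bar> powr s) f + of_real l *\<^sub>C f))"
    unfolding fourier_add fourier_scaleC
    by (intro represents_add represents_scaleC represents_rep fhat_fmult_represents assms)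
  then have "represents (\<lambda>p. of_real (W p) * fhat f p) (fourier (fmult (\<lambda>p. \<bar>p\<bar> powr s) f + of_real l *\<^sub>C f))"
    by (simp add: W_def distrib_right)
  from fmult_eqI[OF W_measurable represents_rep this]
  show "f \<in> sobolev s" "fmult W f = fmult (\<lambda>p. \<bar>p\<bar> powr s) f + of_real l *\<^sub>C f" by (auto simp: sobolev_W)
qed

lemma mem_frac_laplacian: "(f, h) \<in> frac_laplacian (s / 2) \<longleftrightarrow> f \<in> sobolev s \<and> h + of_real l *\<^sub>C f = fmult W f"
  unfolding frac_laplacian_def using powr_sobolev[of f] sobolev_powr[of f] by (auto simp: mem_nabla_pow)

lemma op_apply_frac_laplacian: "f \<in> sobolev s \<Longrightarrow> op_apply (frac_laplacian (s / 2)) f + of_real l *\<^sub>C f = fmult W f"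
  unfolding frac_laplacian_def using op_apply_nabla_pow[OF sobolev_powr, of f] powr_sobolev(2)[OF sobolev_powr, of f] by simp

definition R :: "L2 \<Rightarrow> L2" where "R = fmult (\<lambda>p. 1 / W p)"

lemma inverse_W: "(\<lambda>p. 1 / W p) \<in> borel_measurable borel" "\<bar>1 / W p\<bar> \<le> 1 / l"
  using W_pos[of p] W_ge[of p] l by (auto simp: frac_le)

lemma R_props: "R h \<in> sobolev s" "fmult W (R h) = h" "f \<in> sobolev s \<Longrightarrow> R (fmult W f) = f"
proof -
  note dom = fdom_bounded_UNIV(1)[OF inverse_W]
  have eq: "(\<lambda>p. W p * (1 / W p)) = (\<lambda>_. 1)" "(\<lambda>p. 1 / W p * W p) = (\<lambda>_. 1)" using W_nz by auto
  show "R h \<in> sobolev s"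
    unfolding R_def sobolev_W fmult_compose(1)[OF W_measurable inverse_W(1) dom] eq fmult_one by simp
  show "fmult W (R h) = h"
    unfolding R_def using fmult_compose(2)[OF W_measurable inverse_W(1) dom[of h]] by (simp only: eq fmult_one UNIV_I)
  show "R (fmult W f) = f" if "f \<in> sobolev s"
    unfolding R_def using fmult_compose(2)[OF inverse_W(1) W_measurable that[unfolded sobolev_W]] by (simp only: eq fmult_one UNIV_I)
qed

abbreviation G :: L2 where "G \<equiv> green s l"

lemma inverse_W_square_integrable: "integrable lborel (\<lambda>p. (1 / W p)\<^sup>2)"
proof (rule Bochner_Integration.integrable_bound[OF integrable_mult_right[OF sobw_inverse_square_integrable[OF s_bounds(1)], of "K1\<^sup>2"]])
  have "(1 / W p)\<^sup>2 \<le> K1\<^sup>2 * (1 / sobw s p)\<^sup>2" for p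
  proof -
    have "1 / W p \<le> K1 * (1 / sobw s p)" using sobw_le_W[of p] W_pos[of p] by (simp add: field_simps)
    then have "(1 / W p)\<^sup>2 \<le> (K1 * (1 / sobw s p))\<^sup>2" using W_pos[of p] by (intro power_mono) auto
    then show ?thesis by (simp only: power_mult_distrib)
  qed
  then show "AE p in lborel. norm ((1 / W p)\<^sup>2) \<le> norm (K1\<^sup>2 * (1 / sobw s p)\<^sup>2)" by simp
qed measurable

lemma G_represents: "represents (\<lambda>p. of_real (c0 / W p)) (fourier G)"
proof -
  have "square_integrable (\<lambda>p. complex_of_real (1 / W p))"
    using inverse_W_square_integrable inverse_W(1)
    by (auto simp: square_integrable_def norm_divide power_divide)
  then have "represents (\<lambda>p. of_real c0 * complex_of_real (1 / W p)) (fourier G)"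
    unfolding green_def fourier_scaleC fourier_inv_fourier c0_def W_def
    by (intro represents_scaleC represents_abs)
  then show ?thesis by simp
qed

text \<open>The Green function represents evaluation at the origin relative to W; this is why the
  value of \<open>R h\<close> at the origin is the scalar product of G with h.\<close>

lemma G_eq_evrep: "G = evrep W"
proof -
  have "fourier G = fourier (evrep W)"
    by (rule represents_unique[OF G_represents])
       (unfold c0_def, rule evrep_represents[OF W_measurable inverse_W_square_integrable])
  then show ?thesis by (simp add: fourier_eq_iff)
qed

lemma ev0_eq: "f \<in> sobolev s \<Longrightarrow> ev0 f = cinner G (fmult W f)"
  and integrable_fhat_s: "f \<in> sobolev s \<Longrightarrow> integrable lborel (fhat f)"
  using ev0_eq_cinner[OF W_measurable W_nz inverse_W_square_integrable]
    integrable_fhat[OF W_measurable W_nz inverse_W_square_integrable]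
  by (auto simp: sobolev_W G_eq_evrep)

lemma value_at_0_sobolev: "f \<in> sobolev s \<Longrightarrow> value_at_0 f = ev0 f"
  by (rule value_at_0_eq_ev0[OF integrable_fhat_s])

lemma ev0_R: "ev0 (R h) = cinner G h"
  using ev0_eq[OF R_props(1)] R_props(2) by simp

subsection \<open>Regularity of the Green function\<close>

text \<open>Times \<open>c0\<^sup>2\<close>, this is the value at the origin of the part of G with
  frequencies up to N; its divergence for s < 1 is the singularity of G.\<close>

definition I :: "nat \<Rightarrow> real" where "I N = (LINT p|lborel. cut N p / W p)"

lemma integrable_cut_W: "integrable lborel (\<lambda>p. cut N p / W p)"
proof (rule Bochner_Integration.integrable_bound)
  show "integrable lborel (\<lambda>p. (1 / l) * cut N p)"
    by (intro integrable_mult_right integrable_real_indicator) auto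
  show "AE p in lborel. norm (cut N p / W p) \<le> norm ((1 / l) * cut N p)"
    using W_ge W_pos l by (auto simp: indicator_def abs_of_pos frac_le intro!: always_eventually)
qed measurable

lemma I_ge: "2 * real N / (real N powr s + l) \<le> I N"
proof -
  have "(LINT p|lborel. (1 / (real N powr s + l)) * cut N p) \<le> I N"
    unfolding I_def
  proof (rule integral_mono[OF _ integrable_cut_W])
    show "integrable lborel (\<lambda>p. (1 / (real N powr s + l)) * cut N p)"
      by (intro integrable_mult_right integrable_real_indicator) auto
    fix p
    show "(1 / (real N powr s + l)) * cut N p \<le> cut N p / W p"
    proof (cases "p \<in> {- real N..real N}")
      case True
      then have "\<bar>p\<bar> powr s \<le> real N powr s" using s_bounds by (intro powr_mono2) auto
      then have "W p \<le> real N powr s + l" by (simp add: W_def)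
      then show ?thesis using True W_pos[of p] by (simp add: frac_le)
    qed simp
  qed
  then show ?thesis by simp
qed

lemma I_pos: "N \<ge> 1 \<Longrightarrow> I N > 0"
  using I_ge[of N] l by (intro less_le_trans[OF _ I_ge]) (auto simp: add_nonneg_pos)

lemma I_mono: "M \<le> N \<Longrightarrow> I M \<le> I N"
  unfolding I_def using W_pos
  by (intro integral_mono integrable_cut_W) (auto simp: indicator_def less_imp_le)

lemma I_unbounded:
  assumes "s < 1" shows "\<exists>N\<ge>1. I N > C"
proof -
  \<comment> \<open>Once N^(1-s) exceeds D, the quotient N / (N^s (1 + l)) exceeds |C|, and the
    lower bound for \<open>I N\<close> is at least twice this quotient.\<close>
  define D where "D = max 1 (\<bar>C\<bar> * (1 + l))"
  obtain N :: nat where N: "real N \<ge> D powr (1 / (1 - s))" using real_arch_simple by blast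
  have D: "D \<ge> 1" by (simp add: D_def)
  then have "D powr (1 / (1 - s)) \<ge> 1" using assms by (intro ge_one_powr_ge_zero) auto
  then have N1: "real N \<ge> 1" using N by linarith
  have "D = (D powr (1 / (1 - s))) powr (1 - s)" using D assms by (simp add: powr_powr)
  also have "\<dots> \<le> real N powr (1 - s)" using N assms by (intro powr_mono2) auto
  finally have ND: "D \<le> real N powr (1 - s)" .
  have Ns: "real N powr s \<ge> 1" using N1 s_bounds by (intro ge_one_powr_ge_zero) auto
  have "\<bar>C\<bar> \<le> D / (1 + l)" using l by (simp add: D_def pos_le_divide_eq)
  also have "\<dots> \<le> real N powr (1 - s) / (1 + l)" using ND l by (intro divide_right_mono) auto
  also have "\<dots> = real N / (real N powr s * (1 + l))"
    using N1 by (simp add: powr_diff)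
  also have "\<dots> < 2 * (real N / (real N powr s * (1 + l)))"
  proof -
    have "0 < real N / (real N powr s * (1 + l))"
      by (intro divide_pos_pos mult_pos_pos) (use N1 Ns l in auto)
    then show ?thesis by linarith
  qed
  also have "\<dots> \<le> 2 * (real N / (real N powr s + l))"
  proof (intro mult_left_mono divide_left_mono)
    show "real N powr s + l \<le> real N powr s * (1 + l)"
      using mult_right_mono[OF Ns, of l] l by (simp add: algebra_simps)
    show "0 < (real N powr s * (1 + l)) * (real N powr s + l)" using N1 Ns l by (intro mult_pos_pos) auto
  qed (use N1 in auto)
  also have "\<dots> \<le> I N" using I_ge[of N] by simp
  finally show ?thesis using N1 by (intro exI[of _ N]) auto
qed

lemma not_integrable_W:
  assumes "s < 1" shows "\<not> integrable lborel (\<lambda>p. 1 / W p)"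
proof
  assume int: "integrable lborel (\<lambda>p. 1 / W p)"
  have "I N \<le> (LINT p|lborel. 1 / W p)" for N
    unfolding I_def using W_pos
    by (intro integral_mono integrable_cut_W int) (auto simp: indicator_def less_imp_le)
  then show False using I_unbounded[OF assms, of "LINT p|lborel. 1 / W p"] by (auto simp: not_less[symmetric])
qed

lemma integrable_W:
  assumes "s > 1" shows "integrable lborel (\<lambda>p. 1 / W p)" "integrable lborel (\<lambda>p. (1 / V p)\<^sup>2)"
proof -
  have h: "s / 2 > 1 / 2" using assms by simp
  show "integrable lborel (\<lambda>p. 1 / W p)"
  proof (rule Bochner_Integration.integrable_bound[OF integrable_mult_right[OF sobw_inverse_square_integrable[OF h], of K1]])
    have "1 / W p \<le> K1 * (1 / sobw (s / 2) p)\<^sup>2" for p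
      unfolding power_divide sobw_half using sobw_le_W[of p] W_pos[of p] by (simp add: field_simps)
    moreover have "0 \<le> 1 / W p" for p using W_pos[of p] by simp
    ultimately show "AE p in lborel. norm (1 / W p) \<le> norm (K1 * (1 / sobw (s / 2) p)\<^sup>2)"
      by (intro always_eventually allI) (metis abs_ge_self abs_of_nonneg order_trans real_norm_def)
  qed (use inverse_W in simp)
  then show "integrable lborel (\<lambda>p. (1 / V p)\<^sup>2)" by (simp add: power_divide V_power2)
qed

text \<open>The squared norm of V times the transform of G is \<open>c0\<^sup>2\<close> times the
  integral of 1/W, which converges only for s > 1.\<close>

lemma G_in_V_iff: "G \<in> sobolev (s / 2) \<longleftrightarrow> s > 1"
proof -
  have eq: "complex_of_real (V p) * of_real (c0 / W p) = of_real (c0 * (1 / V p))" for p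
    unfolding V_square[symmetric] using V_nz[of p] by simp
  have "G \<in> sobolev (s / 2) \<longleftrightarrow> square_integrable (\<lambda>p. of_real (c0 * (1 / V p)))"
    unfolding sobolev_V fdom_iff[OF V_measurable G_represents] eq ..
  also have "\<dots> \<longleftrightarrow> integrable lborel (\<lambda>p. c0\<^sup>2 * (1 / W p))"
  proof -
    have "(cmod (of_real (c0 * (1 / V p))))\<^sup>2 = c0\<^sup>2 * (1 / W p)" for p
      unfolding norm_of_real power2_abs power_mult_distrib power_divide V_power2 by simp
    moreover have "(\<lambda>p. complex_of_real (c0 * (1 / V p))) \<in> borel_measurable lborel"
      using V_measurable by measurable
    ultimately show ?thesis unfolding square_integrable_def by simp
  qed
  also have "\<dots> \<longleftrightarrow> integrable lborel (\<lambda>p. 1 / W p)"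
  proof
    assume "integrable lborel (\<lambda>p. c0\<^sup>2 * (1 / W p))"
    from integrable_mult_right[OF this, of "1 / c0\<^sup>2"] show "integrable lborel (\<lambda>p. 1 / W p)"
      using c0_pos by simp
  next
    assume "integrable lborel (\<lambda>p. 1 / W p)"
    from integrable_mult_right[OF this] show "integrable lborel (\<lambda>p. c0\<^sup>2 * (1 / W p))" .
  qed
  also have "\<dots> \<longleftrightarrow> s > 1" using integrable_W(1) not_integrable_W s_bounds(3) by (metis linorder_neqE_linordered_idom)
  finally show ?thesis .
qed

lemma fmult_V_G:
  assumes "s > 1" shows "fmult V G = evrep V"
proof -
  have "represents (\<lambda>p. of_real (c0 / V p)) (fourier (evrep V))"
    unfolding c0_def by (rule evrep_represents[OF V_measurable integrable_W(2)[OF assms]])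
  moreover have "of_real (c0 / V p) = complex_of_real (V p) * of_real (c0 / W p)" for p
    unfolding V_square[symmetric] using V_nz[of p] by simp
  ultimately show ?thesis using fmult_eqI(2)[OF V_measurable G_represents, of "evrep V"] by simp
qed

lemma
  assumes "s > 1" "f \<in> sobolev (s / 2)"
  shows ev0_V: "ev0 f = cinner (evrep V) (fmult V f)" and integrable_fhat_V: "integrable lborel (fhat f)"
  using ev0_eq_cinner[OF V_measurable V_nz integrable_W(2)[OF assms(1)]]
    integrable_fhat[OF V_measurable V_nz integrable_W(2)[OF assms(1)]] assms(2)
  by (auto simp: sobolev_V)

text \<open>In the form scalar product G represents evaluation, so G(0) is its squared form norm. If
  it were 0, evaluation would vanish on H^(s/2), hence on every \<open>R h\<close>; then G would be
  orthogonal to all h, itself included.\<close>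

lemma value_at_0_G:
  assumes "s > 1" shows "value_at_0 G = ev0 G" "ev0 G \<noteq> 0"
proof -
  have G: "G \<in> sobolev (s / 2)" using G_in_V_iff assms by simp
  show "value_at_0 G = ev0 G" by (rule value_at_0_eq_ev0[OF integrable_fhat_V[OF assms G]])
  have "ev0 G = of_real ((norm (fmult V G))\<^sup>2)"
    using ev0_V[OF assms G] by (simp add: fmult_V_G[OF assms] cinner_self)
  moreover have "fmult V G \<noteq> 0"
  proof
    assume *: "fmult V G = 0"
    then have "evrep V = 0" using fmult_V_G[OF assms] by simp
    then have "ev0 f = 0" if "f \<in> sobolev (s / 2)" for f using ev0_V[OF assms that] by simp
    then have "ev0 (R h) = 0" for h
      using R_props(1)[of h] sobw_mono[of "s / 2" s] s_bounds
        fdom_bounded(1)[OF sobw_measurable[of s] sobw_measurable[of "s / 2"], of "R h" 1]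
      by (simp add: sobolev_eq abs_of_pos)
    then have "cinner G G = 0" by (simp add: ev0_R)
    then have "G = 0" by (simp add: cinner_self)
    then have "represents (\<lambda>p. of_real (c0 / W p)) 0" using G_represents by simp
    from represents_AE_eq[OF this represents_zero] have "AE p::real in lborel. (0::real) = 1"
      by eventually_elim (use c0_pos W_nz in simp)
    then show False
      using continuous_AE_eq_imp_eq[of "\<lambda>_. 0::real" "\<lambda>_. 1" 0] by simp
  qed
  ultimately show "ev0 G \<noteq> 0" by simp
qed

subsection \<open>The minimal operator and the Friedrichs resolvent\<close>

text \<open>Lets one formula for B serve both ranges: it is 0 for s < 1 and 1/G(0) for s >
  1.\<close>

definition q :: complex where "q = of_real (theta s) / value_at_0 G"

lemma q_eq: "q = (if s < 1 then 0 else 1 / ev0 G)"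
  using value_at_0_G(1) s_bounds(3) by (auto simp: q_def theta_def)

definition B :: "L2 \<Rightarrow> L2" where "B k = R k - (q * cinner G k) *\<^sub>C G"

definition D :: "L2 set" where "D = {f \<in> sobolev (s / 2). s > 1 \<longrightarrow> ev0 f = 0}"

lemma B_orth: "cinner G h = 0 \<Longrightarrow> B h = R h"
  by (simp add: B_def)

lemma sobolev_s_half: "f \<in> sobolev s \<Longrightarrow> f \<in> sobolev (s / 2)"
  unfolding sobolev_eq
  by (rule fdom_bounded(1)[OF sobw_measurable sobw_measurable, of _ s _ 1]) (use sobw_mono[of "s / 2" s] s_bounds in \<open>auto simp: abs_of_pos\<close>)

lemma test_functions_D: "g \<in> test_functions_off_0 \<Longrightarrow> g \<in> D"
  using test_function_properties[of g] s_bounds by (auto simp: D_def)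

lemma test_functions_dense_D:
  assumes "f \<in> D" "e > 0"
  shows "\<exists>g\<in>test_functions_off_0. norm (fmult (sobw (s / 2)) (f - g)) < e"
  by (rule test_functions_dense) (use assms s in \<open>auto simp: D_def\<close>)

lemma csubspace_D: "csubspace D"
proof -
  have sub: "csubspace (sobolev (s / 2))" unfolding sobolev_eq by (rule csubspace_fdom) measurable
  have "ev0 0 = 0" using ev0_scaleC[of 0 0] by simp
  then show ?thesis
    using sub ev0_add[OF integrable_fhat_V integrable_fhat_V] unfolding csubspace_def D_def
    by (auto simp: ev0_scaleC)
qed

text \<open>For s > 1 evaluation is continuous on H^(s/2), so limits of test functions still vanish
  at the origin; the converse is the density theorem at order s/2.\<close>

lemma sobolev_off_0_eq:
  assumes "s > 1" shows "sobolev_off_0 (s / 2) = D"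
proof (intro equalityI subsetI)
  have h: "s / 2 > 1 / 2" using assms by simp
  have diff: "f - g \<in> sobolev (s / 2)" if "f \<in> sobolev (s / 2)" "g \<in> test_functions_off_0" for f g
    using fdom_diff[OF sobw_measurable] that test_functions_D[OF that(2)] by (simp add: sobolev_eq D_def)
  fix f assume f: "f \<in> sobolev_off_0 (s / 2)"
  then have fs: "f \<in> sobolev (s / 2)" by (simp add: sobolev_off_0_def)
  define C where "C = norm (evrep (sobw (s / 2))) + 1"
  have C: "C > 0" by (simp add: C_def add_nonneg_pos)
  have key: "cmod (ev0 f) \<le> C * e" if e: "e > 0" for e
  proof -
    obtain g where g: "g \<in> test_functions_off_0" "sobolev_norm (s / 2) (f - g) < e"
      using f e by (auto simp: sobolev_off_0_def)
    have gs: "g \<in> sobolev (s / 2)" using test_functions_D[OF g(1)] by (simp add: D_def)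
    have "ev0 f = ev0 ((f - g) + g)" by simp
    also have "\<dots> = ev0 (f - g) + ev0 g"
      by (intro ev0_add integrable_fhat_V assms diff fs g gs)
    also have "ev0 g = 0" by (rule test_function_properties(2)[OF g(1)])
    finally have "cmod (ev0 f) = cmod (cinner (evrep (sobw (s / 2))) (fmult (sobw (s / 2)) (f - g)))"
      using ev0_sobolev[OF h diff[OF fs g(1)]] by simp
    also have "\<dots> \<le> norm (evrep (sobw (s / 2))) * norm (fmult (sobw (s / 2)) (f - g))" by (rule cinner_bound)
    also have "\<dots> \<le> C * e"
      using g(2) sobolev_norm_eq[OF diff[OF fs g(1)]] by (intro mult_mono) (auto simp: C_def)
    finally show ?thesis .
  qed
  have "cmod (ev0 f) \<le> 0 + e" if "e > 0" for e
    using key[of "e / C"] that C by simp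
  then have "cmod (ev0 f) \<le> 0" by (rule field_le_epsilon)
  then show "f \<in> D" using fs by (simp add: D_def)
next
  fix f assume f: "f \<in> D"
  then have fs: "f \<in> sobolev (s / 2)" by (simp add: D_def)
  have "\<exists>g\<in>test_functions_off_0. sobolev_norm (s / 2) (f - g) < e" if "e > 0" for e
  proof -
    obtain g where g: "g \<in> test_functions_off_0" "norm (fmult (sobw (s / 2)) (f - g)) < e"
      using test_functions_dense_D[OF f \<open>e > 0\<close>] by blast
    moreover have "f - g \<in> sobolev (s / 2)"
      using csubspace_diff[OF csubspace_D f test_functions_D[OF g(1)]] by (simp add: D_def)
    ultimately show ?thesis using sobolev_norm_eq by force
  qed
  then show "f \<in> sobolev_off_0 (s / 2)" using fs by (auto simp: sobolev_off_0_def)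
qed

text \<open>The zero at the origin survives graph limits because evaluation is the scalar product of
  G with W times the transform, and multiplication by W is closed. Conversely, approximation in H^s
  controls both components of the graph.\<close>

lemma k_min_eq: "(f, h) \<in> k_min s \<longleftrightarrow> f \<in> sobolev s \<and> ev0 f = 0 \<and> h + of_real l *\<^sub>C f = fmult W f"
proof
  let ?X = "{(f, h) \<in> frac_laplacian (s/2). f \<in> test_functions_off_0}"
  assume "(f, h) \<in> k_min s"
  then obtain x where x: "\<And>n. x n \<in> ?X" "x \<longlonglongrightarrow> (f, h)"
    unfolding k_min_def closure_sequential by blast
  define u v where "u n = fst (x n)" and "v n = snd (x n)" for n
  have uv: "u n \<in> sobolev s" "v n + of_real l *\<^sub>C u n = fmult W (u n)" "ev0 (u n) = 0" for n
    using x(1)[of n] mem_frac_laplacian[of "u n" "v n"] test_function_properties(2)[of "u n"]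
    by (auto simp: u_def v_def case_prod_beta)
  have lims: "u \<longlonglongrightarrow> f" "v \<longlonglongrightarrow> h"
    unfolding u_def v_def using tendsto_fst[OF x(2)] tendsto_snd[OF x(2)] by simp_all
  have lim2: "(\<lambda>n. fmult W (u n)) \<longlonglongrightarrow> h + of_real l *\<^sub>C f"
    unfolding uv(2)[symmetric] by (intro tendsto_add tendsto_scaleC tendsto_const lims)
  have f: "f \<in> sobolev s" "fmult W f = h + of_real l *\<^sub>C f"
    using fmult_closed[OF W_measurable _ lims(1) lim2] uv(1) by (auto simp: sobolev_W)
  have "(\<lambda>n. cinner G (fmult W (u n))) \<longlonglongrightarrow> cinner G (h + of_real l *\<^sub>C f)"
    by (intro tendsto_cinner tendsto_const lim2)
  moreover have "cinner G (fmult W (u n)) = 0" for n using ev0_eq[OF uv(1)] uv(3) by simp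
  ultimately have "cinner G (h + of_real l *\<^sub>C f) = 0" by (simp add: LIMSEQ_const_iff)
  then show "f \<in> sobolev s \<and> ev0 f = 0 \<and> h + of_real l *\<^sub>C f = fmult W f"
    using f ev0_eq[OF f(1)] by simp
next
  let ?X = "{(f, h) \<in> frac_laplacian (s/2). f \<in> test_functions_off_0}"
  assume f: "f \<in> sobolev s \<and> ev0 f = 0 \<and> h + of_real l *\<^sub>C f = fmult W f"
  have "\<exists>g\<in>test_functions_off_0. norm (fmult (sobw s) (f - g)) < 1 / (real n + 1)" for n :: nat
    by (rule test_functions_dense) (use f s_bounds in auto)
  then have "\<forall>n. \<exists>g. g \<in> test_functions_off_0 \<and> norm (fmult (sobw s) (f - g)) < 1 / (real n + 1)" by blast
  from choice[OF this] obtain g where g: "\<And>n::nat. g n \<in> test_functions_off_0" "\<And>n. norm (fmult (sobw s) (f - g n)) < 1 / (real n + 1)"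
    by blast
  have gs: "g n \<in> sobolev s" for n by (rule test_function_properties(1)[OF g(1)]) (use s_bounds in auto)
  have d: "f - g n \<in> fdom (sobw s)" for n
    using fdom_diff[OF sobw_measurable] f gs by (simp add: sobolev_eq)
  have lim0: "(\<lambda>n. C * (1 / (real n + 1))) \<longlonglongrightarrow> 0" for C by real_asymp
  have lim: "(\<lambda>n. fmult w (f - g n)) \<longlonglongrightarrow> 0"
    if w: "w \<in> borel_measurable borel" "\<And>p. \<bar>w p\<bar> \<le> C * \<bar>sobw s p\<bar>" for w C
  proof (rule Lim_null_comparison[OF always_eventually lim0[of "\<bar>C\<bar>"]], rule allI)
    fix n
    have "norm (fmult w (f - g n)) \<le> \<bar>C\<bar> * norm (fmult (sobw s) (f - g n))"
      by (rule power2_le_imp_le) (use fdom_bounded(2)[OF sobw_measurable w(1) d w(2)] in \<open>simp_all add: power_mult_distrib\<close>)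
    also have "\<dots> \<le> \<bar>C\<bar> * (1 / (real n + 1))" using g(2)[of n] by (intro mult_left_mono) auto
    finally show "norm (fmult w (f - g n)) \<le> \<bar>C\<bar> * (1 / (real n + 1))" .
  qed
  have "(\<lambda>n. fmult (\<lambda>_. 1) (f - g n)) \<longlonglongrightarrow> 0"
    by (rule lim[where C=1]) (use sobw_ge_1[OF s_bounds(4)] in \<open>auto simp: abs_of_pos\<close>)
  then have "(\<lambda>n. f - g n) \<longlonglongrightarrow> 0" by (simp add: fmult_one)
  from tendsto_diff[OF tendsto_const[of f] this] have lg: "g \<longlonglongrightarrow> f" by simp
  have "(\<lambda>n. fmult W (f - g n)) \<longlonglongrightarrow> 0"
    by (rule lim[where C="1 + l"]) (use W_le_sobw W_pos in \<open>auto simp: abs_of_pos\<close>)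
  then have "(\<lambda>n. fmult W f - fmult W (g n)) \<longlonglongrightarrow> 0"
    using fmult_diff[OF W_measurable, of f] f gs by (simp add: sobolev_W)
  from tendsto_diff[OF tendsto_const[of "fmult W f"] this] have "(\<lambda>n. fmult W (g n)) \<longlonglongrightarrow> fmult W f" by simp
  then have "(\<lambda>n. fmult W (g n) - of_real l *\<^sub>C g n) \<longlonglongrightarrow> fmult W f - of_real l *\<^sub>C f"
    by (intro tendsto_diff tendsto_scaleC tendsto_const lg)
  moreover have "fmult W f - of_real l *\<^sub>C f = h" using f by (metis add_diff_cancel_right')
  ultimately have lv: "(\<lambda>n. fmult W (g n) - of_real l *\<^sub>C g n) \<longlonglongrightarrow> h" by simp
  have "(\<lambda>n. (g n, fmult W (g n) - of_real l *\<^sub>C g n)) \<longlonglongrightarrow> (f, h)" by (rule tendsto_Pair[OF lg lv])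
  moreover have "(g n, fmult W (g n) - of_real l *\<^sub>C g n) \<in> ?X" for n
    using g(1) gs by (simp add: mem_frac_laplacian)
  ultimately show "(f, h) \<in> k_min s" unfolding k_min_def closure_sequential
    by (intro exI[of _ "\<lambda>n. (g n, fmult W (g n) - of_real l *\<^sub>C g n)"]) auto
qed

lemma k_min_shift: "k_min s = shift {(B h, h) | h. cinner G h = 0} (- of_real l)"
proof -
  have "(f, k) \<in> shift (k_min s) (of_real l) \<longleftrightarrow> f = B k \<and> cinner G k = 0" for f k
  proof -
    have "(f, k) \<in> shift (k_min s) (of_real l) \<longleftrightarrow> f \<in> sobolev s \<and> ev0 f = 0 \<and> k = fmult W f"
      by (simp add: mem_shift k_min_eq)
    also have "\<dots> \<longleftrightarrow> f = R k \<and> cinner G k = 0"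
      using R_props[of k] R_props(3)[of f] ev0_R by metis
    also have "\<dots> \<longleftrightarrow> f = B k \<and> cinner G k = 0" using B_orth by metis
    finally show ?thesis .
  qed
  then have "shift (k_min s) (of_real l) = {(B h, h) | h. cinner G h = 0}" by auto
  then have "shift (shift (k_min s) (of_real l)) (- of_real l) = shift {(B h, h) | h. cinner G h = 0} (- of_real l)"
    by simp
  then show ?thesis by (simp only: shift_minus_cancel)
qed

lemma B_in_D: "B k \<in> D"
proof (cases "s < 1")
  case True
  then show ?thesis using sobolev_s_half[OF R_props(1)[of k]] by (simp add: B_def q_eq D_def)
next
  case False
  then have s1: "s > 1" using s_bounds(3) by simp
  have R: "R k \<in> sobolev (s / 2)" by (rule sobolev_s_half[OF R_props(1)])
  have G: "(- (q * cinner G k)) *\<^sub>C G \<in> sobolev (s / 2)"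
    unfolding sobolev_V by (rule fdom_scaleC[OF V_measurable]) (use G_in_V_iff s1 in \<open>simp add: sobolev_V\<close>)
  have eq: "B k = R k + (- (q * cinner G k)) *\<^sub>C G" by (simp add: B_def)
  have "B k \<in> sobolev (s / 2)"
    unfolding eq sobolev_V by (rule fdom_add[OF V_measurable]) (use R G in \<open>simp_all add: sobolev_V\<close>)
  moreover have "ev0 (B k) = ev0 (R k) + ev0 ((- (q * cinner G k)) *\<^sub>C G)"
    unfolding eq by (intro ev0_add integrable_fhat_V s1 R G)
  \<comment> \<open>The value of \<open>R k\<close> at the origin is the scalar product of G with k,
    and q = 1/G(0) removes exactly this amount.\<close>
  then have "ev0 (B k) = 0" unfolding ev0_scaleC ev0_R q_eq using s1 value_at_0_G(2)[OF s1] by simp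
  ultimately show ?thesis by (simp add: D_def)
qed

text \<open>For \<open>R k\<close> this is V V = W. The correction along G contributes nothing for s
  > 1, since its form scalar product with \<phi> is the value of \<phi> at the origin up to
  conjugation and a factor.\<close>

lemma B_form:
  assumes "\<phi> \<in> D" shows "cinner (fmult V \<phi>) (fmult V (B k)) = cinner \<phi> k"
proof -
  have \<phi>: "\<phi> \<in> fdom V" using assms by (simp add: D_def sobolev_V)
  have Rk: "R k \<in> fdom V" using sobolev_s_half[OF R_props(1)] by (simp add: sobolev_V)
  have RW: "R k \<in> fdom W" using R_props(1) by (simp add: sobolev_W)
  have 1: "cinner (fmult V \<phi>) (fmult V (R k)) = cinner \<phi> k"
    using cinner_fmult[OF \<phi> _ Rk RW, of "\<lambda>_. 1"] R_props(2) by (simp add: fmult_one V_square)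
  show ?thesis
  proof (cases "s < 1")
    case True
    then show ?thesis using 1 by (simp add: B_def q_eq)
  next
    case False
    then have s1: "s > 1" using s_bounds(3) by simp
    have G: "G \<in> fdom V" using G_in_V_iff s1 by (simp add: sobolev_V)
    have "ev0 \<phi> = 0" "\<phi> \<in> sobolev (s / 2)" using assms s1 by (auto simp: D_def)
    then have "cinner (fmult V G) (fmult V \<phi>) = 0" using ev0_V[OF s1, of \<phi>] by (simp add: fmult_V_G[OF s1])
    then have 2: "cinner (fmult V \<phi>) (fmult V G) = 0" by (subst cinner_commute) simp
    have "fmult V (B k) = fmult V (R k) - (q * cinner G k) *\<^sub>C fmult V G"
      unfolding B_def using fmult_diff[OF V_measurable Rk fdom_scaleC[OF V_measurable G]] fmult_scaleC[OF V_measurable G] by simp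
    then show ?thesis using 1 2 by (simp add: cinner_diff_right)
  qed
qed

section \<open>Core, density and relative smallness of the point term\<close>

lemma V_bound_sobw:
  assumes "f \<in> sobolev (s / 2)"
  shows "norm (fmult V f) \<le> sqrt (1 + l) * norm (fmult (sobw (s / 2)) f)"
  by (rule power2_le_imp_le)
     (use fdom_bounded(2)[OF sobw_measurable V_measurable assms[unfolded sobolev_eq], of "sqrt (1 + l)"] V_le_sobw V_pos l
       in \<open>simp_all add: power_mult_distrib abs_of_pos\<close>)

text \<open>A test function g vanishes at the origin, so it equals B applied to W g with W g
  orthogonal to G; density of test functions in the form norm gives the core.\<close>

lemma core:
  assumes "\<phi> \<in> D" "e > 0"
  shows "\<exists>h. cinner G h = 0 \<and> norm (fmult V (\<phi> - B h)) < e"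
proof -
  have l1: "sqrt (1 + l) > 0" using l by simp
  obtain g where g: "g \<in> test_functions_off_0" "norm (fmult (sobw (s / 2)) (\<phi> - g)) < e / sqrt (1 + l)"
    using test_functions_dense_D[OF assms(1), of "e / sqrt (1 + l)"] assms(2) l1 by auto
  have gs: "g \<in> sobolev s" by (rule test_function_properties(1)[OF g(1)]) (use s_bounds in auto)
  have G: "cinner G (fmult W g) = 0" using ev0_eq[OF gs] test_function_properties(2)[OF g(1)] by simp
  have Bg: "B (fmult W g) = g" using B_orth[OF G] R_props(3)[OF gs] by simp
  have "\<phi> - g \<in> sobolev (s / 2)"
    using csubspace_diff[OF csubspace_D assms(1) test_functions_D[OF g(1)]] by (simp add: D_def)
  then have "norm (fmult V (\<phi> - g)) \<le> sqrt (1 + l) * norm (fmult (sobw (s / 2)) (\<phi> - g))" by (rule V_bound_sobw)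
  also have "\<dots> < e" using g(2) l1 by (simp add: field_simps)
  finally show ?thesis using G Bg by (intro exI[of _ "fmult W g"]) simp
qed

text \<open>The density theorem at order 0, where the Sobolev weight is 1.\<close>

lemma D_dense: "closure D = UNIV"
proof -
  have "f \<in> closure D" for f
    unfolding closure_approachable
  proof (intro allI impI)
    fix e :: real assume e: "e > 0"
    have sob0: "sobw 0 = (\<lambda>_. 1)" by (intro ext) (simp add: sobw_def less_imp_neq[OF one_plus_square_pos, symmetric])
    have "f \<in> sobolev 0" by (simp add: sobolev_eq sob0 fmult_one)
    then obtain g where g: "g \<in> test_functions_off_0" "norm (fmult (sobw 0) (f - g)) < e"
      using test_functions_dense[of f 0, OF _ _ _ e] by auto
    then have "dist g f < e" by (simp add: sob0 fmult_one dist_norm norm_minus_commute)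
    then show "\<exists>y\<in>D. dist y f < e" using test_functions_D[OF g(1)] by blast
  qed
  then show ?thesis by blast
qed

text \<open>The coefficient \<open>\<kappa>\<close> is read off from the low frequency part of \<open>\<phi> + \<kappa> G\<close> at the origin. The contribution
  of \<open>\<phi>\<close> is negligible: for \<open>s < 1\<close> because that of \<open>G\<close> diverges, for \<open>s > 1\<close> because \<open>\<phi>\<close> vanishes at the origin.\<close>

lemma coercive:
  assumes "e > 0"
  shows "\<exists>C. \<forall>\<phi>\<in>D. \<forall>\<kappa>. (cmod \<kappa>)\<^sup>2 \<le> e * (norm (fmult V \<phi>))\<^sup>2 + C * (norm (\<phi> + \<kappa> *\<^sub>C G))\<^sup>2"
proof -
  have cut_si: "square_integrable (\<lambda>p. complex_of_real (c0 * cut N p))" for N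
    by (rule square_integrable_bounded_support[where C=c0 and M="real N"]) (use c0_pos in \<open>auto simp: indicator_def\<close>)
  have cutV_si: "square_integrable (\<lambda>p. complex_of_real (c0 * cut N p / V p))" for N
  proof (rule square_integrable_bounded_support[where C="c0 / sqrt l" and M="real N"])
    show "(\<lambda>p. complex_of_real (c0 * cut N p / V p)) \<in> borel_measurable borel" by measurable
    show "cmod (complex_of_real (c0 * cut N p / V p)) \<le> c0 / sqrt l * cut N p" for p
      using c0_pos V_pos[of p] W_ge[of p] l by (auto simp: indicator_def V_def abs_of_pos norm_divide intro!: frac_le)
  qed
  \<comment> \<open>The scalar product with \<open>P N\<close> is the value at the origin of the
    part with frequencies up to N. \<open>X N\<close> is the same functional divided by V, to be
    applied to V \<phi>.\<close>
  define P where "P N = inv fourier (abs_L2 (\<lambda>p. complex_of_real (c0 * cut N p)))" for N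
  define X where "X N = inv fourier (abs_L2 (\<lambda>p. complex_of_real (c0 * cut N p / V p)))" for N
  have P: "represents (\<lambda>p. complex_of_real (c0 * cut N p)) (fourier (P N))" for N
    by (simp add: P_def represents_abs cut_si del: of_real_mult)
  have X: "represents (\<lambda>p. complex_of_real (c0 * cut N p / V p)) (fourier (X N))" for N
    by (simp add: X_def represents_abs cutV_si del: of_real_mult of_real_divide)
  have PX: "cinner (P N) \<phi> = cinner (X N) (fmult V \<phi>)" if "\<phi> \<in> D" for N \<phi>
  proof -
    have \<phi>: "\<phi> \<in> fdom V" using that by (simp add: D_def sobolev_V)
    have "cinner (X N) (fmult V \<phi>) = (LINT p|lborel. cnj (complex_of_real (c0 * cut N p / V p)) * (of_real (V p) * fhat \<phi> p))"
      using cinner_represents[OF X fhat_fmult_represents[OF \<phi>]] by (simp only: cinner_fourier)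
    also have "\<dots> = (LINT p|lborel. cnj (complex_of_real (c0 * cut N p)) * fhat \<phi> p)"
      by (intro Bochner_Integration.integral_cong) (auto simp: V_nz)
    also have "\<dots> = cinner (P N) \<phi>"
      using cinner_represents[OF P represents_rep, of N "fourier \<phi>"] by (simp only: cinner_fourier)
    finally show ?thesis by simp
  qed
  have PG: "cinner (P N) G = of_real (c0\<^sup>2 * I N)" for N
  proof -
    have "cinner (P N) G = (LINT p|lborel. cnj (complex_of_real (c0 * cut N p)) * of_real (c0 / W p))"
      using cinner_represents[OF P G_represents] by (simp only: cinner_fourier)
    also have "\<dots> = (LINT p|lborel. complex_of_real (c0\<^sup>2 * (cut N p / W p)))"
      by (intro Bochner_Integration.integral_cong) (auto simp: power2_eq_square)
    also have "\<dots> = of_real (c0\<^sup>2 * I N)" by (simp only: integral_complex_of_real I_def integral_mult_right_zero)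
    finally show ?thesis .
  qed
  have normX: "(norm (X N))\<^sup>2 = c0\<^sup>2 * I N" for N
  proof -
    have "(norm (X N))\<^sup>2 = (LINT p|lborel. (cmod (complex_of_real (c0 * cut N p / V p)))\<^sup>2)"
      using norm_represents[OF X] by (simp only: norm_fourier)
    also have "\<dots> = (LINT p|lborel. c0\<^sup>2 * (cut N p / W p))"
      by (intro Bochner_Integration.integral_cong) (auto simp: norm_divide norm_mult power_divide power_mult_distrib V_power2 indicator_def)
    finally show ?thesis by (simp only: I_def integral_mult_right_zero)
  qed
  \<comment> \<open>Here y bounds the contribution of \<phi>, while \<kappa> contributes
    \<open>c0\<^sup>2 * I N\<close> times itself. The condition on y is what remains after squaring
    and dividing by the square of that factor.\<close>
  have main: ?thesis if N: "N \<ge> 1" and Y: "\<And>\<phi>. \<phi> \<in> D \<Longrightarrow> cmod (cinner (P N) \<phi>) \<le> y * norm (fmult V \<phi>)"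
    and y: "2 * y\<^sup>2 \<le> e * (c0\<^sup>2 * I N)\<^sup>2" for N y
  proof -
    define g where "g = c0\<^sup>2 * I N"
    have g: "g > 0" using I_pos[OF N] c0_pos by (simp add: g_def)
    show ?thesis
    proof (intro exI[of _ "2 * (norm (P N))\<^sup>2 / g\<^sup>2"] ballI allI)
      fix \<phi> \<kappa> assume \<phi>: "\<phi> \<in> D"
      define u where "u = \<phi> + \<kappa> *\<^sub>C G"
      have "cinner (P N) u = cinner (P N) \<phi> + \<kappa> * of_real g"
        by (simp add: u_def cinner_add_right PG g_def)
      then have "cmod \<kappa> * g = cmod (cinner (P N) u - cinner (P N) \<phi>)" using g by (simp add: norm_mult)
      also have "\<dots> \<le> norm (P N) * norm u + y * norm (fmult V \<phi>)"
        using norm_triangle_ineq4[of "cinner (P N) u" "cinner (P N) \<phi>"] cinner_bound[of "P N" u] Y[OF \<phi>] by linarith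
      finally have "(cmod \<kappa> * g)\<^sup>2 \<le> (norm (P N) * norm u + y * norm (fmult V \<phi>))\<^sup>2"
        using g by (intro power_mono) auto
      also have "\<dots> \<le> 2 * (norm (P N) * norm u)\<^sup>2 + 2 * (y * norm (fmult V \<phi>))\<^sup>2"
        using zero_le_power2[of "norm (P N) * norm u - y * norm (fmult V \<phi>)"] by (simp add: power2_eq_square algebra_simps)
      also have "\<dots> = 2 * (norm (P N))\<^sup>2 * (norm u)\<^sup>2 + (2 * y\<^sup>2) * (norm (fmult V \<phi>))\<^sup>2"
        by (simp add: power_mult_distrib)
      also have "\<dots> \<le> 2 * (norm (P N))\<^sup>2 * (norm u)\<^sup>2 + (e * g\<^sup>2) * (norm (fmult V \<phi>))\<^sup>2"
        using y unfolding g_def by (intro add_left_mono mult_right_mono) auto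
      finally have "(cmod \<kappa>)\<^sup>2 * g\<^sup>2 \<le> (e * (norm (fmult V \<phi>))\<^sup>2 + 2 * (norm (P N))\<^sup>2 / g\<^sup>2 * (norm u)\<^sup>2) * g\<^sup>2"
        using g by (simp add: power_mult_distrib algebra_simps)
      then show "(cmod \<kappa>)\<^sup>2 \<le> e * (norm (fmult V \<phi>))\<^sup>2 + 2 * (norm (P N))\<^sup>2 / g\<^sup>2 * (norm (\<phi> + \<kappa> *\<^sub>C G))\<^sup>2"
        unfolding u_def using g by (simp only: mult_le_cancel_right) simp
    qed
  qed
  show ?thesis
  proof (cases "s < 1")
    case True
    \<comment> \<open>With y the norm of \<open>X N\<close>, y^2 is linear in \<open>I N\<close>
      while the requirement is quadratic in it, so a large \<open>I N\<close> suffices.\<close>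
    obtain N where N: "N \<ge> 1" "I N > 2 / (e * c0\<^sup>2)" using I_unbounded[OF True] by blast
    show ?thesis
    proof (rule main[OF N(1)])
      show "cmod (cinner (P N) \<phi>) \<le> norm (X N) * norm (fmult V \<phi>)" if "\<phi> \<in> D" for \<phi>
        unfolding PX[OF that] by (rule cinner_bound)
      have "2 \<le> e * (c0\<^sup>2 * I N)" using N(2) assms c0_pos by (simp add: field_simps)
      then have "2 * (c0\<^sup>2 * I N) \<le> e * (c0\<^sup>2 * I N) * (c0\<^sup>2 * I N)"
        using I_pos[OF N(1)] by (intro mult_right_mono) auto
      then show "2 * (norm (X N))\<^sup>2 \<le> e * (c0\<^sup>2 * I N)\<^sup>2"
        unfolding normX power2_eq_square[of "c0\<^sup>2 * I N"] by (simp only: mult.assoc)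
    qed
  next
    case False
    then have s1: "s > 1" using s_bounds(3) by simp
    have eV: "represents (\<lambda>p. of_real (c0 / V p)) (fourier (evrep V))"
      unfolding c0_def by (rule evrep_represents[OF V_measurable integrable_W(2)[OF s1]])
    \<comment> \<open>\<open>X N\<close> tends to \<open>evrep V\<close>, which is orthogonal to V
      \<phi> for \<phi> in D. Only the difference counts; it becomes small while \<open>I N\<close>
      stays above \<open>I 1\<close>.\<close>
    have "X N = fmult (cut N) (evrep V)" for N
      by (rule fmult_eqI(2)[symmetric, OF _ eV]) (use X[of N] in \<open>simp_all add: mult.commute\<close>)
    then have "X = (\<lambda>N. fmult (cut N) (evrep V))" by auto
    then have "X \<longlonglongrightarrow> evrep V" using cut_tendsto[of "evrep V"] by simp
    then have "(\<lambda>N. 2 * (norm (evrep V - X N))\<^sup>2) \<longlonglongrightarrow> 2 * (norm (evrep V - evrep V))\<^sup>2"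
      by (intro tendsto_intros)
    moreover have "0 < e * (c0\<^sup>2 * I 1)\<^sup>2" using assms c0_pos I_pos[of 1] by simp
    ultimately have "\<forall>\<^sub>F N in sequentially. 2 * (norm (evrep V - X N))\<^sup>2 < e * (c0\<^sup>2 * I 1)\<^sup>2"
      by (intro order_tendstoD(2)) auto
    then obtain M where "\<And>N. N \<ge> M \<Longrightarrow> 2 * (norm (evrep V - X N))\<^sup>2 < e * (c0\<^sup>2 * I 1)\<^sup>2"
      unfolding eventually_sequentially by auto
    from this[of "max M 1"] obtain N where N: "N \<ge> 1" "2 * (norm (evrep V - X N))\<^sup>2 < e * (c0\<^sup>2 * I 1)\<^sup>2"
      using max.cobounded1 max.cobounded2 by blast
    show ?thesis
    proof (rule main[OF N(1)])
      show "cmod (cinner (P N) \<phi>) \<le> norm (evrep V - X N) * norm (fmult V \<phi>)" if \<phi>: "\<phi> \<in> D" for \<phi>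
      proof -
        have "cinner (evrep V) (fmult V \<phi>) = 0" using ev0_V[OF s1, of \<phi>] \<phi> s1 by (simp add: D_def)
        then have "cinner (P N) \<phi> = - cinner (evrep V - X N) (fmult V \<phi>)"
          unfolding PX[OF \<phi>] by (simp add: cinner_diff_left)
        then show ?thesis using cinner_bound[of "evrep V - X N" "fmult V \<phi>"] by simp
      qed
      have "(c0\<^sup>2 * I 1)\<^sup>2 \<le> (c0\<^sup>2 * I N)\<^sup>2"
        using I_mono[OF N(1)] I_pos[of 1] by (intro power_mono mult_left_mono) auto
      then have "e * (c0\<^sup>2 * I 1)\<^sup>2 \<le> e * (c0\<^sup>2 * I N)\<^sup>2" using assms by (intro mult_left_mono) auto
      then show "2 * (norm (evrep V - X N))\<^sup>2 \<le> e * (c0\<^sup>2 * I N)\<^sup>2" using N(2) by linarith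
    qed
  qed
qed

sublocale rank_one_extension D "fmult V" B G l "k_min s"
proof
  have DV: "\<phi> \<in> fdom V" if "\<phi> \<in> D" for \<phi> using that by (simp add: D_def sobolev_V)
  show "l > 0" by (rule l)
  show "csubspace D" by (rule csubspace_D)
  show "fmult V (\<phi> + \<psi>) = fmult V \<phi> + fmult V \<psi>" if "\<phi> \<in> D" "\<psi> \<in> D" for \<phi> \<psi>
    by (intro fmult_add V_measurable DV that)
  show "fmult V (c *\<^sub>C \<phi>) = c *\<^sub>C fmult V \<phi>" if "\<phi> \<in> D" for c \<phi>
    by (intro fmult_scaleC V_measurable DV that)
  show "l * (norm \<phi>)\<^sup>2 \<le> (norm (fmult V \<phi>))\<^sup>2" if "\<phi> \<in> D" for \<phi>
  proof -
    have le: "\<bar>1\<bar> \<le> (1 / sqrt l) * \<bar>V p\<bar>" for p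
      using W_ge[of p] l V_pos[of p] by (simp add: V_def field_simps abs_of_pos)
    have "(norm \<phi>)\<^sup>2 \<le> (1 / sqrt l)\<^sup>2 * (norm (fmult V \<phi>))\<^sup>2"
      using fdom_bounded(2)[OF V_measurable _ DV[OF that] le] by (simp add: fmult_one)
    then show ?thesis using l by (simp add: power_divide field_simps)
  qed
  show "f \<in> D \<and> fmult V f = g" if u: "\<And>n. u n \<in> D" and lims: "u \<longlonglongrightarrow> f" "(\<lambda>n. fmult V (u n)) \<longlonglongrightarrow> g" for u f g
  proof -
    have f: "f \<in> fdom V" "fmult V f = g" using fmult_closed[OF V_measurable DV[OF u] lims] by auto
    have "ev0 f = 0" if s1: "s > 1"
    proof -
      have "cinner (evrep V) (fmult V (u n)) = 0" for n
        using ev0_V[OF s1, of "u n"] u[of n] s1 by (simp add: D_def)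
      moreover have "(\<lambda>n. cinner (evrep V) (fmult V (u n))) \<longlonglongrightarrow> cinner (evrep V) g"
        by (intro tendsto_cinner tendsto_const lims)
      ultimately have "cinner (evrep V) g = 0" by (simp add: LIMSEQ_const_iff)
      then show ?thesis using ev0_V[OF s1, of f] f by (simp add: sobolev_V)
    qed
    then show ?thesis using f by (simp add: D_def sobolev_V)
  qed
  show "B k \<in> D" for k by (rule B_in_D)
  show "cinner (fmult V \<phi>) (fmult V (B k)) = cinner \<phi> k" if "\<phi> \<in> D" for \<phi> k by (rule B_form[OF that])
  show "G \<notin> D" using G_in_V_iff value_at_0_G(2) by (auto simp: D_def)
  show "k_min s = shift {(B h, h) |h. cinner G h = 0} (- of_real l)" by (rule k_min_shift)
  show "\<exists>h. cinner G h = 0 \<and> norm (fmult V (\<phi> - B h)) < e" if "\<phi> \<in> D" "e > 0" for \<phi> e by (rule core[OF that])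
  show "\<exists>C. \<forall>\<phi>\<in>D. \<forall>\<kappa>. (cmod \<kappa>)\<^sup>2 \<le> e * (norm (fmult V \<phi>))\<^sup>2 + C * (norm (\<phi> + \<kappa> *\<^sub>C G))\<^sup>2" if "e > 0" for e
    by (rule coercive[OF that])
  show "closure D = UNIV" by (rule D_dense)
qed

subsection \<open>The extensions as rank one perturbations\<close>

definition \<Omega> :: real where "\<Omega> = omega s * l powr (2 - 1/s)"

lemma \<Omega>_pos: "\<Omega> > 0"
  using omega_pos[OF s] l by (simp add: \<Omega>_def)

lemma k_coeff_eq: "k_coeff s l \<tau> = of_real (\<Omega> * real_of_ereal (1 / \<tau>)) - q"
  by (simp add: k_coeff_def \<Omega>_def q_def)

lemma B_plus_G: "B k + \<kappa> *\<^sub>C G = R k + (\<kappa> - q * cinner G k) *\<^sub>C G"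
  by (simp add: B_def cvec.scale_left_diff_distrib)

text \<open>Substituting F = \<open>R k\<close> replaces the parametrisation by the regular part
  with the one by k. For nonzero \<tau>, solving the relation for \<kappa> gives \<Omega>/\<tau>,
  and passing from B to R subtracts q, which is the coefficient in the statement.\<close>

lemma k_ext_real: "k_ext s l (ereal \<tau>) = Sext (\<tau> / \<Omega>)"
proof (cases "\<tau> = 0")
  case True
  have "{(F + c *\<^sub>C G, op_apply (frac_laplacian (s/2)) F + of_real l *\<^sub>C F) | F c. F \<in> sobolev s \<and> value_at_0 F = 0} = Text 0" (is "?X = _")
  proof -
    have "(f, k) \<in> ?X \<longleftrightarrow> (f, k) \<in> Text 0" for f k
    proof
      assume "(f, k) \<in> ?X"
      then obtain F c where F: "f = F + c *\<^sub>C G" "F \<in> sobolev s" "value_at_0 F = 0" "k = fmult W F"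
        using op_apply_frac_laplacian by auto
      then have "F = R k" "cinner G k = 0" using R_props(3) ev0_eq value_at_0_sobolev by auto
      then show "(f, k) \<in> Text 0" using F(1) unfolding mem_Text by (intro exI[of _ c]) (simp add: B_orth)
    next
      assume "(f, k) \<in> Text 0"
      then obtain c where "f = B k + c *\<^sub>C G" "cinner G k = 0" by (auto simp: mem_Text)
      then have "f = R k + c *\<^sub>C G" "value_at_0 (R k) = 0"
        using B_orth value_at_0_sobolev[OF R_props(1)] ev0_R by auto
      then show "(f, k) \<in> ?X" using R_props(1,2)[of k] op_apply_frac_laplacian[OF R_props(1)[of k]]
        by (auto intro!: exI[of _ "R k"])
    qed
    then show ?thesis by auto
  qed
  then show ?thesis using True by (simp add: k_ext_def Sext_def zero_ereal_def)
next
  case False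
  have co: "k_coeff s l (ereal \<tau>) = of_real (\<Omega> / \<tau>) - q" using False by (simp add: k_coeff_eq one_ereal_def)
  have "{(F + (k_coeff s l (ereal \<tau>) * value_at_0 F) *\<^sub>C G, op_apply (frac_laplacian (s/2)) F + of_real l *\<^sub>C F) | F. F \<in> sobolev s}
     = Text (\<tau> / \<Omega>)" (is "?X = _")
  proof -
    have "(f, k) \<in> ?X \<longleftrightarrow> f = R k + (k_coeff s l (ereal \<tau>) * cinner G k) *\<^sub>C G" for f k
    proof
      assume "(f, k) \<in> ?X"
      then obtain F where F: "f = F + (k_coeff s l (ereal \<tau>) * value_at_0 F) *\<^sub>C G" "F \<in> sobolev s" "k = fmult W F"
        using op_apply_frac_laplacian by auto
      then show "f = R k + (k_coeff s l (ereal \<tau>) * cinner G k) *\<^sub>C G"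
        using R_props(3) ev0_eq value_at_0_sobolev by auto
    next
      assume "f = R k + (k_coeff s l (ereal \<tau>) * cinner G k) *\<^sub>C G"
      then show "(f, k) \<in> ?X"
        using R_props(1,2)[of k] op_apply_frac_laplacian[OF R_props(1)[of k]] value_at_0_sobolev[OF R_props(1)] ev0_R
        by (auto intro!: exI[of _ "R k"])
    qed
    moreover have "(f, k) \<in> Text (\<tau> / \<Omega>) \<longleftrightarrow> f = R k + (k_coeff s l (ereal \<tau>) * cinner G k) *\<^sub>C G" for f k
    proof -
      have "cinner G k = of_real (\<tau> / \<Omega>) * \<kappa> \<longleftrightarrow> \<kappa> = of_real (\<Omega> / \<tau>) * cinner G k" for \<kappa>
        using False \<Omega>_pos by (auto simp: field_simps)
      then show ?thesis unfolding mem_Text B_plus_G co by (simp add: left_diff_distrib)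
    qed
    ultimately show ?thesis by auto
  qed
  then show ?thesis using False by (simp add: k_ext_def Sext_def zero_ereal_def)
qed

lemma k_ext_infinity: "k_ext s l \<infinity> = shift Tinf (- of_real l)" "k_ext s l \<infinity> = friedrichs (k_min s)"
  using friedrichs_S by (simp_all add: k_ext_def)

lemma frac_laplacian_resolvent: "(shift (frac_laplacian (s / 2)) (of_real l))\<inverse> = op_graph R"
proof -
  have "(f, k) \<in> shift (frac_laplacian (s / 2)) (of_real l) \<longleftrightarrow> f = R k" for f k
    using R_props[of k] R_props(3)[of f] by (auto simp: mem_shift mem_frac_laplacian)
  then show ?thesis by (auto simp: op_graph_def)
qed

text \<open>Plancherel and V^2 = |p|^s + l split the form of the shifted Friedrichs operator into
  the kinetic term and l times the squared norm.\<close>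

lemma norm_V_eq:
  assumes "f \<in> D"
  shows "(norm (fmult V f))\<^sup>2 = (norm (op_apply (nabla_pow (s / 2)) f))\<^sup>2 + l * (norm f)\<^sup>2"
proof -
  have f: "f \<in> fdom V" using assms by (simp add: D_def sobolev_V)
  have half: "(\<bar>p\<bar> powr (s / 2))\<^sup>2 = \<bar>p\<bar> powr s" for p :: real
    by (simp add: power2_eq_square flip: powr_add)
  have f2: "f \<in> fdom (\<lambda>p. \<bar>p\<bar> powr (s / 2))"
  proof (rule fdom_bounded(1)[OF V_measurable powr_abs_measurable f])
    show "\<bar>\<bar>p\<bar> powr (s / 2)\<bar> \<le> 1 * \<bar>V p\<bar>" for p
    proof -
      have "\<bar>p\<bar> powr (s / 2) \<le> V p"
        unfolding V_def using l by (intro real_le_rsqrt) (simp add: half W_def)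
      then show ?thesis by simp
    qed
  qed
  have i: "integrable lborel (\<lambda>p. (w p)\<^sup>2 * (cmod (fhat f p))\<^sup>2)" if "f \<in> fdom w" for w
    using that by (simp add: fdom_def square_integrable_def norm_mult power_mult_distrib)
  have "(norm (fmult V f))\<^sup>2 = (LINT p|lborel. (\<bar>p\<bar> powr (s / 2))\<^sup>2 * (cmod (fhat f p))\<^sup>2 + l * (cmod (fhat f p))\<^sup>2)"
    unfolding norm_fmult[OF f] by (intro Bochner_Integration.integral_cong) (auto simp: V_power2 W_def half distrib_right)
  also have "\<dots> = (LINT p|lborel. (\<bar>p\<bar> powr (s / 2))\<^sup>2 * (cmod (fhat f p))\<^sup>2) + (LINT p|lborel. l * (cmod (fhat f p))\<^sup>2)"
    using i[OF f2] i[of "\<lambda>_. 1"] by (intro Bochner_Integration.integral_add integrable_mult_right) (auto simp: fmult_one)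
  also have "\<dots> = (norm (op_apply (nabla_pow (s / 2)) f))\<^sup>2 + l * (norm f)\<^sup>2"
    by (simp only: op_apply_nabla_pow[OF f2] norm_fmult[OF f2] norm_fhat[of f] integral_mult_right_zero)
  finally show ?thesis .
qed

section \<open>The assertions on extensions, spectra, forms and resolvents\<close>

theorem selfadjoint_extensions_k: "{T. selfadjoint T \<and> k_min s \<subseteq> T} = k_ext s l ` {-\<infinity><..}"
proof -
  have "range (\<lambda>\<tau>. Sext (\<tau> / \<Omega>)) = range Sext"
  proof
    show "range Sext \<subseteq> range (\<lambda>\<tau>. Sext (\<tau> / \<Omega>))"
    proof
      fix T assume "T \<in> range Sext"
      then obtain \<gamma> where "T = Sext \<gamma>" by blast
      then have "T = Sext (\<gamma> * \<Omega> / \<Omega>)" using \<Omega>_pos by simp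
      then show "T \<in> range (\<lambda>\<tau>. Sext (\<tau> / \<Omega>))" by blast
    qed
  qed blast
  then show ?thesis
    unfolding selfadjoint_extensions ereal_cases_above image_insert image_image k_ext_real k_ext_infinity(2) by simp
qed

theorem spectral_properties:
  assumes "\<tau> \<in> {-\<infinity><..}"
  shows "semibounded (k_ext s l \<tau>)"
    "inf_spectrum (shift (k_ext s l \<tau>) (of_real l)) \<ge> 0 \<longleftrightarrow> \<tau> \<ge> 0"
    "inf_spectrum (shift (k_ext s l \<tau>) (of_real l)) > 0 \<longleftrightarrow> \<tau> > 0"
    "invertible_op (shift (k_ext s l \<tau>) (of_real l)) \<longleftrightarrow> \<tau> \<noteq> 0"
proof -
  have "semibounded (k_ext s l \<tau>) \<and>
    (inf_spectrum (shift (k_ext s l \<tau>) (of_real l)) \<ge> 0 \<longleftrightarrow> \<tau> \<ge> 0) \<and>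
    (inf_spectrum (shift (k_ext s l \<tau>) (of_real l)) > 0 \<longleftrightarrow> \<tau> > 0) \<and>
    (invertible_op (shift (k_ext s l \<tau>) (of_real l)) \<longleftrightarrow> \<tau> \<noteq> 0)"
  proof (cases "\<tau> = \<infinity>")
    case True
    have "semibounded (shift Tinf (of_real (- l)))" by (rule semibounded_shift[OF semibounded_Tinf])
    then show ?thesis
      unfolding True k_ext_infinity(1) using inf_spectrum_Tinf invertible_Tinf by (simp add: less_imp_le)
  next
    case False
    then obtain t where t: "\<tau> = ereal t" using assms ereal_cases_above by auto
    have "semibounded (shift (Text (t / \<Omega>)) (of_real (- l)))" by (rule semibounded_shift[OF semibounded_Text])
    then show ?thesis
      unfolding t k_ext_real using \<Omega>_pos inf_spectrum_Text_ge[of "t / \<Omega>"] inf_spectrum_Text_gt[of "t / \<Omega>"] invertible_Text_iff[of "t / \<Omega>"]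
      by (simp add: Sext_def zero_le_divide_iff zero_less_divide_iff zero_ereal_def)
  qed
  then show "semibounded (k_ext s l \<tau>)"
    "inf_spectrum (shift (k_ext s l \<tau>) (of_real l)) \<ge> 0 \<longleftrightarrow> \<tau> \<ge> 0"
    "inf_spectrum (shift (k_ext s l \<tau>) (of_real l)) > 0 \<longleftrightarrow> \<tau> > 0"
    "invertible_op (shift (k_ext s l \<tau>) (of_real l)) \<longleftrightarrow> \<tau> \<noteq> 0" by blast+
qed

theorem form_domain_k:
  "is_direct_sum (form_domain (k_ext s l (ereal \<tau>))) (if s < 1 then sobolev (s/2) else sobolev_off_0 (s/2)) (cspan1 G)"
proof -
  have D: "(if s < 1 then sobolev (s/2) else sobolev_off_0 (s/2)) = D"
    using sobolev_off_0_eq s_bounds(3) by (auto simp: D_def)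
  have "D \<inter> cspan1 G = {0}"
  proof (intro equalityI subsetI)
    fix f assume "f \<in> D \<inter> cspan1 G"
    then obtain c where "f = c *\<^sub>C G" "c *\<^sub>C G \<in> D" by (auto simp: cspan1_def)
    then show "f \<in> {0}" using scale_G_in_D[of c] by simp
  next
    fix f :: L2 assume "f \<in> {0}"
    then show "f \<in> D \<inter> cspan1 G" using D_0 by (auto simp: cspan1_def intro!: image_eqI[of _ _ 0])
  qed
  then show ?thesis
    unfolding is_direct_sum_def D k_ext_real form_domain_Sext by (auto simp: cspan1_def)
qed

theorem form_k:
  assumes "F \<in> form_domain (friedrichs (k_min s))"
  shows "form (k_ext s l (ereal \<tau>)) (F + \<kappa> *\<^sub>C G) =
    complex_of_real ((norm (op_apply (nabla_pow (s/2)) F))\<^sup>2 - l * (norm (F + \<kappa> *\<^sub>C G))\<^sup>2 + l * (norm F)\<^sup>2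
      + \<tau> / \<Omega> * (cmod \<kappa>)\<^sup>2)"
proof -
  have F: "F \<in> D" using assms form_domain_friedrichs by blast
  show ?thesis unfolding k_ext_real form_Sext[OF F] norm_V_eq[OF F] by (simp add: algebra_simps)
qed

theorem resolvent_k:
  assumes "\<tau> \<in> {-\<infinity><..} - {0}"
  shows "(shift (k_ext s l \<tau>) (of_real l))\<inverse> =
    op_add ((shift (frac_laplacian (s/2)) (of_real l))\<inverse>) (op_graph (\<lambda>h. (k_coeff s l \<tau> * cinner G h) *\<^sub>C G))"
proof (cases "\<tau> = \<infinity>")
  case True
  \<comment> \<open>Since 1/\<infinity> is 0, the coefficient is -q, which is the Friedrichs
    correction already contained in B.\<close>
  have "B = (\<lambda>h. R h + (k_coeff s l \<tau> * cinner G h) *\<^sub>C G)"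
    using B_plus_G[of _ 0] by (auto simp: True k_coeff_eq)
  then show ?thesis
    unfolding frac_laplacian_resolvent op_add_graph True k_ext_infinity(1) shift_minus_cancel converse_Tinf by metis
next
  case False
  then obtain t where t: "\<tau> = ereal t" using assms ereal_cases_above by auto
  have t0: "t \<noteq> 0" using assms t by (auto simp: zero_ereal_def)
  have "(\<lambda>k. B k + (of_real (1 / (t / \<Omega>)) * cinner G k) *\<^sub>C G) = (\<lambda>h. R h + (k_coeff s l \<tau> * cinner G h) *\<^sub>C G)"
    using t0 by (auto simp: B_plus_G t k_coeff_eq one_ereal_def left_diff_distrib)
  then show ?thesis
    unfolding frac_laplacian_resolvent op_add_graph
    using converse_Text[of "t / \<Omega>"] t0 \<Omega>_pos by (simp add: t k_ext_real)
qed

end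

theorem theorem5p2:
  fixes s l :: real
  assumes s: "s \<in> {1/2<..<1} \<union> {1<..<3/2}" and l: "l > 0"
  shows
   "({T. selfadjoint T \<and> k_min s \<subseteq> T} = k_ext s l ` {-\<infinity><..} \<and>
     k_ext s l \<infinity> = friedrichs (k_min s))
    \<and>
    (\<forall>\<tau>\<in>{-\<infinity><..}.
       semibounded (k_ext s l \<tau>) \<and>
       (inf_spectrum (shift (k_ext s l \<tau>) (of_real l)) \<ge> 0 \<longleftrightarrow> \<tau> \<ge> 0) \<and>
       (inf_spectrum (shift (k_ext s l \<tau>) (of_real l)) > 0 \<longleftrightarrow> \<tau> > 0) \<and>
       (invertible_op (shift (k_ext s l \<tau>) (of_real l)) \<longleftrightarrow> \<tau> \<noteq> 0))
    \<and>
    (\<forall>\<tau>::real.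
       is_direct_sum (form_domain (k_ext s l (ereal \<tau>)))
         (if s < 1 then sobolev (s/2) else sobolev_off_0 (s/2)) (cspan1 (green s l)) \<and>
       (\<forall>F \<in> form_domain (friedrichs (k_min s)). \<forall>\<kappa>::complex.
          form (k_ext s l (ereal \<tau>)) (F + \<kappa> *\<^sub>C green s l) =
          complex_of_real
            ((norm (op_apply (nabla_pow (s/2)) F))\<^sup>2
             - l * (norm (F + \<kappa> *\<^sub>C green s l))\<^sup>2
             + l * (norm F)\<^sup>2
             + \<tau> / (omega s * l powr (2 - 1/s)) * (cmod \<kappa>)\<^sup>2)))
    \<and>
    (\<forall>\<tau>\<in>{-\<infinity><..} - {0}.
       (shift (k_ext s l \<tau>) (of_real l))\<inverse> =
       op_add ((shift (frac_laplacian (s/2)) (of_real l))\<inverse>)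
              (op_graph (\<lambda>h. (k_coeff s l \<tau> * cinner (green s l) h) *\<^sub>C green s l)))"
proof -
  interpret point_perturbation s l by (rule point_perturbation.intro[OF s l])
  show ?thesis
    by (intro conjI ballI allI; (rule selfadjoint_extensions_k k_ext_infinity(2) form_domain_k
      form_k[unfolded \<Omega>_def] resolvent_k spectral_properties; assumption?))
qed

end
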